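(* Let $\alpha>0$, $T>0$, and let $(\sigma^V,j^V)\in\mathrm{CE}(0,T;\Omega_1)$, $V\ge1$, satisfy $$\sup_{V\ge1}\bigl\{\mathrm{Ent}(\sigma_0^V\,|\,\pi)+\mathscr I^V(\sigma^V,j^V)\bigr\}\le C$$ for some constant $C>0$, where $\sigma^V_0=\sigma^V|_{t=0}$. Define $$\rho^V(dt\,dx):=\sum_{v\in\{-1,1\}}\sigma^V_t(dx,v)\,dt,\quad \omega^V(dt\,dx):=V\sum_{v\in\{-1,1\}}v\,\sigma^V_t(dx,v)\,dt,\quad J^V(dt\,dx):=\sum_{v\in\{-1,1\}}\frac vV\,j^{2,V}_t(dx,v)\,dt .$$ Then there exist subsequences $V\to\infty$ (not relabeled) and limits $\bar\rho,\bar\omega,\bar J$ such that (1) $\rho^V\to\bar\rho$ in $C([0,T];\mathcal P(\mathbb T))$, uniformly in time with respect to the narrow topology in space; (2) $\omega^V\to\bar\omega$ narrowly in $\mathcal M([0,T]\times\mathbb T)$; (3) $J^V\to\bar J$ narrowly in $\mathcal M((0,T)\times\mathbb T)$. Moreover, $\bar\rho_t\ll\mathcal L_{\mathbb T}$ for every $t\in[0,T]$, and both $\bar\omega$ and $\bar J$ have densities in time, i.e. $\bar\omega(dt\,dx)=\bar\omega_t(dx)\,dt$ and $\bar J(dt\,dx)=\bar J_t(dx)\,dt$, where $\bar\omega_t,\bar J_t\in\mathcal M(\mathbb T)$ are defined via disintegration.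
   Context: $\mathbb T=\mathbb R/\mathbb Z$, $\mathcal L_{\mathbb T}$ Lebesgue measure, $\Omega_1:=\mathbb T\times\{-1,1\}$, $\iota(x,v):=(x,-v)$, $\pi:=\mathcal L_{\mathbb T}\otimes\mathrm{Unif}_{\{-1,1\}}$. $\mathcal P$, $\mathcal M$: probability measures and finite signed Borel measures; narrow topology = duality with bounded continuous functions. $C^{1,0}(\Omega_1)$: functions that are $C^1$ in $x$ for each $v$. $(\sigma,j)\in\mathrm{CE}(0,T;\Omega_1)$ means: $\sigma\in C([0,T];\mathcal P(\Omega_1))$ (narrowly continuous); $(j_t)_{t\in(0,T)}\subset\mathcal M(\Omega_1;\mathbb R^2)$, $j_t=(j^1_t,j^2_t)$, is a measurable family with $\int_0^T\|j_t\|_{\mathrm{TV}}\,dt<\infty$; and for all $\varphi\in C^{1,0}(\Omega_1)$, $0\le s\le t\le T$: $\int\varphi\,d\sigma_t-\int\varphi\,d\sigma_s=\int_s^t\int_{\Omega_1}[\partial_x\varphi\,dj^1_r+(\varphi\circ\iota-\varphi)\,dj^2_r]\,dr$. For $j^V$, the components are denoted $j^{1,V},j^{2,V}$. $\mathrm{Ent}(\mu\,|\,\nu):=\int(f\log f-f+1)\,d\nu$ if $\mu\ll\nu$ with $f=d\mu/d\nu\ge0$, $+\infty$ otherwise. $\mathscr I^V(\sigma,j):=\int_0^T\mathscr L^V(\sigma_r,j_r)\,dr$ if $(\sigma,j)\in\mathrm{CE}(0,T;\Omega_1)$, $+\infty$ otherwise, with $\mathscr L^V(\sigma,j):=\mathrm{Ent}\bigl(j^2\,|\,\tfrac{V^2}{2\alpha}\sigma\bigr)$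 if $j^1=V\,v\,\sigma$, and $+\infty$ otherwise. The curve associated with $\rho^V$ is $\rho_t^V(dx)=\sum_v\sigma^V_t(dx,v)$, so $\rho^V(dt\,dx)=\rho^V_t(dx)\,dt$. *)

theory Defs
  imports "HOL-Probability.Probability"
begin

section \<open>The torus \<open>\<real>/\<int>\<close> and the phase space\<close>

quotient_type torus = real / "\<lambda>x y::real. x - y \<in> \<int>"
  morphisms rep_torus to_torus
proof (rule equivpI)
  show "reflp (\<lambda>x y::real. x - y \<in> \<int>)"
    by (simp add: reflp_def)
  show "symp (\<lambda>x y::real. x - y \<in> \<int>)"
    unfolding symp_def by (metis Ints_minus minus_diff_eq)
  show "transp (\<lambda>x y::real. x - y \<in> \<int>)"
    unfolding transp_def by (metis Ints_add add.commute diff_add_cancel diff_diff_eq2)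
qed

instantiation torus :: topological_space
begin

definition open_torus :: "torus set \<Rightarrow> bool"
  where "open_torus U \<longleftrightarrow> open (to_torus -` U)"

instance
  by standard (auto simp: open_torus_def vimage_Int vimage_Union intro!: open_Union)

end

lemma to_torus_eq_iff: "to_torus x = to_torus y \<longleftrightarrow> x - y \<in> \<int>"
  using torus.abs_eq_iff by simp

lemma to_torus_surj: "\<exists>x. z = to_torus x"
  by (metis Quotient3_abs_rep Quotient3_torus)

lemma open_to_torus_image:
  assumes "open U"
  shows "open (to_torus ` U)"
proof -
  have "to_torus -` to_torus ` U = (\<Union>k\<in>\<int>. (\<lambda>x. k + x) ` U)"
  proof (intro set_eqI iffI)
    fix x assume "x \<in> to_torus -` to_torus ` U"
    then obtain y where y: "y \<in> U" "x - y \<in> \<int>"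
      by (auto simp: to_torus_eq_iff)
    then show "x \<in> (\<Union>k\<in>\<int>. (\<lambda>x. k + x) ` U)"
      by (intro UN_I[of "x - y"] image_eqI[of _ _ y]) auto
  next
    fix x assume "x \<in> (\<Union>k\<in>\<int>. (\<lambda>x. k + x) ` U)"
    then show "x \<in> to_torus -` to_torus ` U"
      by (auto simp: to_torus_eq_iff image_iff intro!: bexI)
  qed
  moreover have "open (\<Union>k\<in>\<int>. (\<lambda>x. k + x) ` U)"
    using assms by (intro open_UN ballI open_translation) auto
  ultimately show ?thesis
    by (simp add: open_torus_def)
qed

instance torus :: second_countable_topology
proof
  obtain B :: "real set set" where B: "countable B" "topological_basis B"
    using ex_countable_basis by blast
  have "topological_basis ((`) to_torus ` B)"
  proof (rule topological_basisI)
    fix U assume "U \<in> (`) to_torus ` B"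
    then show "open U"
      using B(2) topological_basis_open by (blast intro: open_to_torus_image)
  next
    fix U :: "torus set" and z assume U: "open U" "z \<in> U"
    obtain x where x: "z = to_torus x"
      using to_torus_surj by blast
    have "open (to_torus -` U)" "x \<in> to_torus -` U"
      using U x by (auto simp: open_torus_def)
    then obtain W where "W \<in> B" "x \<in> W" "W \<subseteq> to_torus -` U"
      using B(2) topological_basisE by metis
    then show "\<exists>W\<in>(`) to_torus ` B. z \<in> W \<and> W \<subseteq> U"
      using x by (intro bexI[of _ "to_torus ` W"]) auto
  qed
  then show "\<exists>B :: torus set set. countable B \<and> open = generate_topology B"
    using B(1) by (intro exI[of _ "(`) to_torus ` B"])
      (auto simp: topological_basis_imp_subbasis)
qed

definition torus_lebesgue :: "torus measure"
  where "torus_lebesgue = distr (restrict_space lborel {0..<1}) borel to_torus"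

text \<open>The two velocities \<open>1\<close> and \<open>-1\<close> are encoded by \<^typ>\<open>bool\<close>, which carries the discrete
  topology.\<close>

type_synonym phase = "torus \<times> bool"

definition vel :: "bool \<Rightarrow> real"
  where "vel b = (if b then 1 else -1)"

definition flip :: "phase \<Rightarrow> phase"
  where "flip = (\<lambda>(x, b). (x, \<not> b))"

definition ref_measure :: "phase measure"
  where "ref_measure = torus_lebesgue \<Otimes>\<^sub>M uniform_count_measure (UNIV :: bool set)"

text \<open>Functions on the phase space that are \<open>C\<^sup>1\<close> in the position, and their derivative in the
  position. The derivative does not depend on the representative, by periodicity.\<close>

definition C10 :: "(phase \<Rightarrow> real) set"
  where "C10 = {\<phi>. \<forall>b. (\<lambda>y. \<phi> (to_torus y, b)) C1_differentiable_on UNIV}"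

definition dx :: "(phase \<Rightarrow> real) \<Rightarrow> phase \<Rightarrow> real"
  where "dx \<phi> = (\<lambda>(x, b). deriv (\<lambda>y. \<phi> (to_torus y, b)) (rep_torus x))"


section \<open>Signed and vector measures\<close>

text \<open>Finite signed (or vector valued) measures are countably additive set functions on the
  sigma-algebra of \<open>M\<close>; their values outside \<^term>\<open>sets M\<close> are irrelevant.\<close>

definition vector_measure :: "'a measure \<Rightarrow> ('a set \<Rightarrow> 'b::real_normed_vector) \<Rightarrow> bool"
  where "vector_measure M \<mu> \<longleftrightarrow> \<mu> {} = 0 \<and>
    (\<forall>A :: nat \<Rightarrow> 'a set. range A \<subseteq> sets M \<longrightarrow> disjoint_family A \<longrightarrow>
      (\<lambda>i. \<mu> (A i)) sums \<mu> (\<Union>i. A i))"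

definition tv_norm :: "'a measure \<Rightarrow> ('a set \<Rightarrow> 'b::real_normed_vector) \<Rightarrow> ennreal"
  where "tv_norm M \<mu> =
    (SUP P \<in> {P. finite P \<and> P \<subseteq> sets M \<and> disjoint P}. \<Sum>A\<in>P. ennreal (norm (\<mu> A)))"

text \<open>The positive and negative variation (Jordan decomposition) of a signed measure, and the
  integral against it. Since \<^const>\<open>ennreal\<close> maps negative reals to \<open>0\<close>, the supremum below is the
  usual \<open>sup {\<mu> A | A \<subseteq> E}\<close>, which is nonnegative because of \<open>A = {}\<close>.\<close>

definition pos_variation :: "'a measure \<Rightarrow> ('a set \<Rightarrow> real) \<Rightarrow> 'a measure"
  where "pos_variation M \<mu> =
    measure_of (space M) (sets M) (\<lambda>E. SUP A \<in> {A \<in> sets M. A \<subseteq> E}. ennreal (\<mu> A))"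

definition neg_variation :: "'a measure \<Rightarrow> ('a set \<Rightarrow> real) \<Rightarrow> 'a measure"
  where "neg_variation M \<mu> = pos_variation M (\<lambda>A. - \<mu> A)"

definition signed_integral :: "'a measure \<Rightarrow> ('a set \<Rightarrow> real) \<Rightarrow> ('a \<Rightarrow> real) \<Rightarrow> real"
  where "signed_integral M \<mu> f =
    (LINT x|pos_variation M \<mu>. f x) - (LINT x|neg_variation M \<mu>. f x)"

text \<open>Measurable families \<open>(\<mu>\<^sub>t)\<close>, \<open>t \<in> I\<close>, of measures with time-integrable total variation, and
  the measure \<open>\<mu>\<^sub>t(dx) dt\<close> on \<open>I \<times> X\<close>.\<close>

definition integrable_family ::
    "real set \<Rightarrow> (real \<Rightarrow> 'a::topological_space set \<Rightarrow> 'b::real_normed_vector) \<Rightarrow> bool"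
  where "integrable_family I \<mu> \<longleftrightarrow>
    (\<forall>t\<in>I. vector_measure borel (\<mu> t)) \<and>
    (\<forall>A\<in>sets borel. (\<lambda>t. \<mu> t A) \<in> borel_measurable (restrict_space borel I)) \<and>
    (\<integral>\<^sup>+t\<in>I. tv_norm borel (\<mu> t) \<partial>lborel) < \<infinity>"

definition time_integral ::
    "real set \<Rightarrow> (real \<Rightarrow> 'a set \<Rightarrow> real) \<Rightarrow> (real \<times> 'a) set \<Rightarrow> real"
  where "time_integral I \<mu> A = (LINT t:I|lborel. \<mu> t {x. (t, x) \<in> A})"

text \<open>Measures on a subset \<open>S\<close> of a topological space live on its Borel sigma-algebra
  \<^term>\<open>restrict_space borel S\<close>; narrow convergence is tested with bounded continuous functions
  on \<open>S\<close>.\<close>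

definition signed_narrow_conv ::
    "'a::topological_space set \<Rightarrow> (nat \<Rightarrow> 'a set \<Rightarrow> real) \<Rightarrow> ('a set \<Rightarrow> real) \<Rightarrow> bool"
  where "signed_narrow_conv S \<mu> \<nu> \<longleftrightarrow>
    (\<forall>\<phi>. continuous_on S \<phi> \<longrightarrow> bounded (\<phi> ` S) \<longrightarrow>
      (\<lambda>n. signed_integral (restrict_space borel S) (\<mu> n) \<phi>)
        \<longlonglongrightarrow> signed_integral (restrict_space borel S) \<nu> \<phi>)"


section \<open>Narrowly continuous curves of probability measures\<close>

definition narrow_curve :: "real \<Rightarrow> (real \<Rightarrow> 'a::topological_space measure) \<Rightarrow> bool"
  where "narrow_curve T \<sigma> \<longleftrightarrow>
    (\<forall>t\<in>{0..T}. prob_space (\<sigma> t) \<and> sets (\<sigma> t) = sets borel) \<and>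
    (\<forall>\<phi> :: 'a \<Rightarrow> real. continuous_on UNIV \<phi> \<longrightarrow> bounded (range \<phi>) \<longrightarrow>
      continuous_on {0..T} (\<lambda>t. LINT x|\<sigma> t. \<phi> x))"

definition uniform_narrow_conv ::
    "real \<Rightarrow> (nat \<Rightarrow> real \<Rightarrow> 'a::topological_space measure) \<Rightarrow> (real \<Rightarrow> 'a measure) \<Rightarrow> bool"
  where "uniform_narrow_conv T \<rho> \<rho>' \<longleftrightarrow>
    (\<forall>\<phi> :: 'a \<Rightarrow> real. continuous_on UNIV \<phi> \<longrightarrow> bounded (range \<phi>) \<longrightarrow>
      uniform_limit {0..T} (\<lambda>n t. LINT x|\<rho> n t. \<phi> x) (\<lambda>t. LINT x|\<rho>' t. \<phi> x) sequentially)"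


section \<open>Continuity equation, entropy and action functional\<close>

definition flux1 :: "('a set \<Rightarrow> real \<times> real) \<Rightarrow> 'a set \<Rightarrow> real"
  where "flux1 j A = fst (j A)"

definition flux2 :: "('a set \<Rightarrow> real \<times> real) \<Rightarrow> 'a set \<Rightarrow> real"
  where "flux2 j A = snd (j A)"

definition CE :: "real \<Rightarrow> (real \<Rightarrow> phase measure) \<Rightarrow> (real \<Rightarrow> phase set \<Rightarrow> real \<times> real) \<Rightarrow> bool"
  where "CE T \<sigma> j \<longleftrightarrow>
    narrow_curve T \<sigma> \<and>
    integrable_family {0<..<T} j \<and>
    (\<forall>\<phi>\<in>C10. \<forall>s t. 0 \<le> s \<longrightarrow> s \<le> t \<longrightarrow> t \<le> T \<longrightarrow>
      (LINT p|\<sigma> t. \<phi> p) - (LINT p|\<sigma> s. \<phi> p) =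
      (LINT r:{s<..<t}|lborel.
        signed_integral borel (flux1 (j r)) (dx \<phi>) +
        signed_integral borel (flux2 (j r)) (\<lambda>p. \<phi> (flip p) - \<phi> p)))"

text \<open>\<open>f = d\<mu>/d\<nu>\<close> for a finite signed measure \<open>\<mu>\<close> and a finite measure \<open>\<nu>\<close>; by Radon-Nikodym
  some such \<open>f\<close> exists iff \<open>\<mu> \<lless> \<nu>\<close>, and it is unique up to \<open>\<nu>\<close>-null sets.\<close>

definition is_density :: "('a set \<Rightarrow> real) \<Rightarrow> 'a measure \<Rightarrow> ('a \<Rightarrow> real) \<Rightarrow> bool"
  where "is_density \<mu> \<nu> f \<longleftrightarrow>
    integrable \<nu> f \<and> (\<forall>A\<in>sets \<nu>. \<mu> A = (LINT x:A|\<nu>. f x))"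

text \<open>Note \<open>0 * ln 0 = 0\<close>.\<close>

definition Ent :: "('a set \<Rightarrow> real) \<Rightarrow> 'a measure \<Rightarrow> ennreal"
  where "Ent \<mu> \<nu> =
    (if \<exists>f. is_density \<mu> \<nu> f \<and> (\<forall>x. 0 \<le> f x)
     then let f = SOME f. is_density \<mu> \<nu> f \<and> (\<forall>x. 0 \<le> f x)
          in \<integral>\<^sup>+x. ennreal (f x * ln (f x) - f x + 1) \<partial>\<nu>
     else \<infinity>)"

definition lagrangian :: "real \<Rightarrow> real \<Rightarrow> phase measure \<Rightarrow> (phase set \<Rightarrow> real \<times> real) \<Rightarrow> ennreal"
  where "lagrangian \<alpha> V \<sigma> j =
    (if \<forall>A\<in>sets borel. flux1 j A = V * (LINT p:A|\<sigma>. vel (snd p))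
     then Ent (flux2 j) (scale_measure (ennreal (V\<^sup>2 / (2 * \<alpha>))) \<sigma>)
     else \<infinity>)"

definition action ::
    "real \<Rightarrow> real \<Rightarrow> real \<Rightarrow> (real \<Rightarrow> phase measure) \<Rightarrow> (real \<Rightarrow> phase set \<Rightarrow> real \<times> real) \<Rightarrow> ennreal"
  where "action \<alpha> T V \<sigma> j =
    (if CE T \<sigma> j then \<integral>\<^sup>+r\<in>{0<..<T}. lagrangian \<alpha> V (\<sigma> r) (j r) \<partial>lborel else \<infinity>)"


section \<open>Position marginal, momentum and flux\<close>

text \<open>The sum over the velocities of \<open>\<sigma>(dx, v)\<close>.\<close>

definition position_marginal :: "phase measure \<Rightarrow> torus measure"
  where "position_marginal \<sigma> = distr \<sigma> borel fst"

definition momentum :: "real \<Rightarrow> phase measure \<Rightarrow> torus set \<Rightarrow> real"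
  where "momentum V \<sigma> B = V * (\<Sum>b\<in>UNIV. vel b * measure \<sigma> (B \<times> {b}))"

definition net_flux :: "real \<Rightarrow> (phase set \<Rightarrow> real \<times> real) \<Rightarrow> torus set \<Rightarrow> real"
  where "net_flux V j B = (\<Sum>b\<in>UNIV. vel b / V * flux2 j (B \<times> {b}))"

end

(* The curves are mollified by convolution in position with a nonnegative trigonometric kernel of
   finite rank and a small multiple of the reference measure is added. The entropy of the mollified
   curve is then a smooth function of finitely many integrals against sigma_t, so its increments are
   controlled by the continuity equation tested with trigonometric functions. Fenchel duality for the
   Lagrangian, with half the velocity difference of the mollified logarithmic density as test function,
   gives a bound on the entropy at all times and on the time integral of a Hellinger type velocity
   dissipation, uniformly in V. Since it only uses test functions, it does not require the Lagrangian
   to be measurable in time. After removing the mollification, the entropy bound controls rho_t(A) by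
   the Lebesgue measure of A, the dissipation bound controls the momentum V (sigma_t(A,1) - sigma_t(A,-1)),
   and duality with test functions of size s/V controls J - omega/(2 alpha). The space-time measures are
   thus uniformly absolutely continuous in the limit, hence compact for setwise convergence with limits
   having a density, and densities disintegrate in time. Uniform convergence of rho follows from Hoelder-1/2
   bounds in time, obtained from the momentum estimate, and convergence of time averages. *)

theory Submission
  imports Defs
begin

text \<open>The jump rate k = V^2/(2 \<alpha>) blows up, so an error term survives the limit only if
  it is of order 1/k. This fixes the added mass: with \<open>\<delta>\<close> = 1/V^2 its cost in
  the entropy balance is 2 \<open>\<delta>\<close> k = 1/\<alpha> per unit time. The factor one half
  in the test function makes exp((ln f(-v) - ln f(v))/2) f(v) the geometric mean of both densities;
  the dual functional then becomes mass minus a squared Hellinger distance, and k times the latter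
  has a bounded time integral. Since V (a - b) = V (sqrt a - sqrt b)(sqrt a + sqrt b), a rate of
  order V^2 is exactly what the momentum, which carries a factor V, requires. Transport is of size V
  and has no sign: it must vanish identically, which is why the mollifier has to commute with
  translations. For J the size s/V is forced as well: it turns the linear part of k (exp - 1) into
  momentum/(2 \<alpha>) and the quadratic part into s^2/(2 \<alpha>) rho, leaving a bound C/s that
  can be made small, but only once V >= s. Smallness for J is therefore available along tails of the
  sequence.\<close>

instance bool :: second_countable_topology
proof
  have "finite (UNIV :: bool set set)" by simp
  moreover have "(open :: bool set \<Rightarrow> bool) = generate_topology UNIV"
    by (intro ext iffI) (auto intro: generate_topology.Basis discrete_topology_class.open_discrete)
  ultimately show "\<exists>B :: bool set set. countable B \<and> open = generate_topology B"
    by (intro exI[of _ UNIV]) (auto simp: uncountable_infinite countable_finite)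
qed

section \<open>Signed measures\<close>

lemma vector_measure_empty: "vector_measure M \<mu> \<Longrightarrow> \<mu> {} = 0"
  by (simp add: vector_measure_def)

lemma vector_measure_sums:
  "vector_measure M \<mu> \<Longrightarrow> range A \<subseteq> sets M \<Longrightarrow> disjoint_family A \<Longrightarrow> (\<lambda>i. \<mu> (A i)) sums \<mu> (\<Union>i. A i)"
  by (simp add: vector_measure_def)

lemma vector_measure_Un:
  assumes "vector_measure M \<mu>" "A \<in> sets M" "B \<in> sets M" "A \<inter> B = {}"
  shows "\<mu> (A \<union> B) = \<mu> A + \<mu> B"
proof -
  have "(\<lambda>i. \<mu> (binaryset A B i)) sums \<mu> (\<Union>i. binaryset A B i)"
    using assms by (intro vector_measure_sums)
      (auto simp: range_binaryset_eq disjoint_family_on_def binaryset_def split: if_splits)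
  moreover have "(\<lambda>i. \<mu> (binaryset A B i)) sums (\<mu> A + \<mu> B)"
    using assms(1) by (intro binaryset_sums) (simp add: vector_measure_empty)
  ultimately show ?thesis
    by (simp add: UN_binaryset_eq sums_unique2)
qed

lemma vector_measure_Diff:
  assumes "vector_measure M \<mu>" "A \<in> sets M" "B \<in> sets M" "A \<subseteq> B"
  shows "\<mu> (B - A) = \<mu> B - \<mu> A"
  using vector_measure_Un[of M \<mu> A "B - A"] assms
  by (simp add: Un_absorb1 algebra_simps)

lemma vector_measure_minus: "vector_measure M \<mu> \<Longrightarrow> vector_measure M (\<lambda>A. - \<mu> A)"
  by (auto simp: vector_measure_def intro: sums_minus)

lemma vector_measure_add:
  "vector_measure M \<mu> \<Longrightarrow> vector_measure M \<nu> \<Longrightarrow> vector_measure M (\<lambda>A. \<mu> A + \<nu> A)"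
  by (auto simp: vector_measure_def intro: sums_add)

lemma vector_measure_cmult:
  fixes \<mu> :: "'a set \<Rightarrow> real"
  shows "vector_measure M \<mu> \<Longrightarrow> vector_measure M (\<lambda>A. c * \<mu> A)"
  by (auto simp: vector_measure_def intro: sums_mult)

lemma vector_measure_bounded_linear:
  "bounded_linear f \<Longrightarrow> vector_measure M \<mu> \<Longrightarrow> vector_measure M (\<lambda>A. f (\<mu> A))"
  by (auto simp: vector_measure_def linear_simps intro: bounded_linear.sums)

lemma vector_measure_measure:
  assumes "finite_measure P" "sets P = sets M"
  shows "vector_measure M (measure P)"
  using assms finite_measure.finite_measure_UNION[of P] by (auto simp: vector_measure_def)

lemma vector_measure_Int:
  assumes "vector_measure M \<mu>" "Y \<in> sets M"
  shows "vector_measure M (\<lambda>A. \<mu> (A \<inter> Y))"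
  unfolding vector_measure_def
proof (intro conjI allI impI)
  show "\<mu> ({} \<inter> Y) = 0" using assms by (simp add: vector_measure_empty)
next
  fix A :: "nat \<Rightarrow> 'a set" assume A: "range A \<subseteq> sets M" "disjoint_family A"
  then have "(\<lambda>i. \<mu> (A i \<inter> Y)) sums \<mu> (\<Union>i. A i \<inter> Y)"
    using assms by (intro vector_measure_sums) (auto simp: disjoint_family_on_def)
  then show "(\<lambda>i. \<mu> (A i \<inter> Y)) sums \<mu> ((\<Union>i. A i) \<inter> Y)" by simp
qed

section \<open>Hahn and Jordan decompositions\<close>

lemma nonneg_vector_measure_obtain:
  fixes \<mu> :: "'a set \<Rightarrow> real"
  assumes vm: "vector_measure M \<mu>" and pos: "\<And>A. A \<in> sets M \<Longrightarrow> 0 \<le> \<mu> A"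
  obtains P where "finite_measure P" "sets P = sets M" "\<And>A. A \<in> sets M \<Longrightarrow> measure P A = \<mu> A"
proof -
  define P where "P = measure_of (space M) (sets M) (\<lambda>A. ennreal (\<mu> A))"
  have sets: "sets P = sets M" by (simp add: P_def)
  have "countably_additive (sets M) (\<lambda>A. ennreal (\<mu> A))"
    unfolding countably_additive_def
  proof (intro allI impI)
    fix A :: "nat \<Rightarrow> 'a set" assume A: "range A \<subseteq> sets M" "disjoint_family A"
    show "(\<Sum>i. ennreal (\<mu> (A i))) = ennreal (\<mu> (\<Union>(range A)))"
      using A pos vector_measure_sums[OF vm A] by (intro suminf_ennreal_eq) auto
  qed
  then have em: "emeasure P A = ennreal (\<mu> A)" if "A \<in> sets M" for A
    using that unfolding P_def
    by (intro emeasure_measure_of_sigma) (auto simp: positive_def vector_measure_empty[OF vm] sets.sigma_algebra_axioms)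
  show ?thesis
  proof
    show "sets P = sets M" by (fact sets)
    show "finite_measure P"
      using em[of "space M"] by (intro finite_measureI) (simp add: sets_eq_imp_space_eq[OF sets])
    show "measure P A = \<mu> A" if "A \<in> sets M" for A
      using em[OF that] pos[OF that] by (simp add: measure_def)
  qed
qed

text \<open>Greedy exhaustion: remove from \<open>D\<close> again and again a subset whose measure
  is at most half of the lowest possible value. The removed sets are disjoint, so their measures are
  summable and tend to 0; a negative set left over at the end would have kept them away from
  0.\<close>

lemma vector_measure_positive_part:
  fixes \<mu> :: "'a set \<Rightarrow> real"
  assumes vm: "vector_measure M \<mu>" and D: "D \<in> sets M"
  obtains A where "A \<in> sets M" "A \<subseteq> D" "\<mu> D \<le> \<mu> A" "\<And>E. E \<in> sets M \<Longrightarrow> E \<subseteq> A \<Longrightarrow> 0 \<le> \<mu> E"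
proof -
  \<comment> \<open>The cap -1 is there because the measures of subsets of \<open>X\<close> are not
    yet known to be bounded below.\<close>
  define good where "good X B \<longleftrightarrow> B \<in> sets M \<and> B \<subseteq> X \<and> \<mu> B \<le> 0 \<and>
    (\<forall>E\<in>sets M. E \<subseteq> X \<longrightarrow> \<mu> E < 0 \<longrightarrow> \<mu> B \<le> max (-1) (\<mu> E / 2))" for X B
  have ex: "\<exists>B. good X B" if X: "X \<in> sets M" for X
  proof (cases "\<exists>B\<in>sets M. B \<subseteq> X \<and> \<mu> B \<le> -1")
    case True
    then obtain B where "B \<in> sets M" "B \<subseteq> X" "\<mu> B \<le> -1" by blast
    then show ?thesis by (intro exI[of _ B]) (auto simp: good_def)
  next
    case False
    define S where "S = \<mu> ` {E\<in>sets M. E \<subseteq> X}"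
    have bb: "bdd_below S" using False by (intro bdd_belowI[of _ "-1"]) (force simp: S_def)
    have ne: "S \<noteq> {}" unfolding S_def by blast
    have "0 \<in> S" unfolding S_def using vector_measure_empty[OF vm] by (force intro!: image_eqI[of _ _ "{}"])
    then have i0: "Inf S \<le> 0" using bb by (rule cInf_lower)
    show ?thesis
    proof (cases "Inf S = 0")
      case True
      then have "\<mu> E \<ge> 0" if "E \<in> sets M" "E \<subseteq> X" for E
        using cInf_lower[OF _ bb, of "\<mu> E"] that by (auto simp: S_def)
      then show ?thesis using vector_measure_empty[OF vm] by (intro exI[of _ "{}"]) (force simp: good_def)
    next
      case False
      then have "Inf S < Inf S / 2" using i0 by simp
      then obtain y where "y \<in> S" "y < Inf S / 2" using cInf_lessD[OF ne] by blast
      then obtain B where B: "B \<in> sets M" "B \<subseteq> X" "\<mu> B < Inf S / 2" by (auto simp: S_def)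
      have "\<mu> B \<le> \<mu> E / 2" if "E \<in> sets M" "E \<subseteq> X" for E
        using cInf_lower[OF _ bb, of "\<mu> E"] that B by (auto simp: S_def)
      then show ?thesis using B i0 by (intro exI[of _ B]) (auto simp: good_def le_max_iff_disj)
    qed
  qed
  define b where "b X = (SOME B. good X B)" for X
  have b: "good X (b X)" if "X \<in> sets M" for X
    unfolding b_def using ex[OF that] by (rule someI_ex)
  define X where "X = rec_nat D (\<lambda>_ Y. Y - b Y)"
  have X0: "X 0 = D" and XS: "X (Suc n) = X n - b (X n)" for n by (simp_all add: X_def)
  have XM: "X n \<in> sets M" for n
  proof (induction n)
    case (Suc n) then show ?case using b[OF Suc] by (auto simp: XS good_def)
  qed (simp add: X0 D)
  define B where "B n = b (X n)" for n
  have B: "good (X n) (B n)" for n using b[OF XM] by (simp add: B_def)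
  have BM: "B n \<in> sets M" for n using B[of n] by (simp add: good_def)
  have anti: "X n \<subseteq> X m" if "m \<le> n" for m n
    using that by (induction rule: dec_induct) (auto simp: XS)
  have "B m \<inter> B n = {}" if "m < n" for m n
    using anti[of "Suc m" n] that B[of n] by (auto simp: XS B_def good_def)
  then have disj: "disjoint_family B"
    unfolding disjoint_family_on_def by (metis Int_commute linorder_neqE_nat)
  have sm: "(\<lambda>i. \<mu> (B i)) sums \<mu> (\<Union>i. B i)"
    using BM disj by (intro vector_measure_sums[OF vm]) auto
  define A where "A = D - (\<Union>i. B i)"
  have AX: "A \<subseteq> X n" for n
    by (induction n) (auto simp: A_def X0 XS B_def)
  have BD: "(\<Union>i. B i) \<subseteq> D" using B anti[of 0] by (force simp: good_def X0)
  have UM: "(\<Union>i. B i) \<in> sets M" using BM by auto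
  show ?thesis
  proof
    show "A \<in> sets M" "A \<subseteq> D" using D UM by (auto simp: A_def)
    have "\<mu> (\<Union>i. B i) \<le> 0"
      using sm B by (intro sums_le[OF _ sm sums_zero]) (auto simp: good_def)
    then show "\<mu> D \<le> \<mu> A"
      unfolding A_def using vector_measure_Diff[OF vm UM D BD] by simp
    fix E assume E: "E \<in> sets M" "E \<subseteq> A"
    show "0 \<le> \<mu> E"
    proof (rule ccontr)
      assume neg: "\<not> 0 \<le> \<mu> E"
      have "\<mu> (B n) \<le> max (-1) (\<mu> E / 2)" for n
        using B[of n] E neg AX[of n] by (auto simp: good_def)
      moreover have "(\<lambda>i. \<mu> (B i)) \<longlonglongrightarrow> 0"
        using sm by (intro summable_LIMSEQ_zero) (auto simp: sums_iff)
      ultimately have "0 \<le> max (-1) (\<mu> E / 2)"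
        by (intro LIMSEQ_le_const2) auto
      then show False using neg by auto
    qed
  qed
qed

text \<open>A countable union of positive sets is positive, so the supremum of \<open>\<mu>\<close>
  over positive sets is attained by the union of a maximizing sequence. A set outside
  \<open>Y\<close> with positive measure would contain a positive set of positive measure by
  \<open>vector_measure_positive_part\<close>, and adding that to \<open>Y\<close> would exceed the
  maximum.\<close>

theorem Hahn_decomposition_vector_measure:
  fixes \<mu> :: "'a set \<Rightarrow> real"
  assumes vm: "vector_measure M \<mu>"
  obtains Y where "Y \<in> sets M" "\<And>E. E \<in> sets M \<Longrightarrow> E \<subseteq> Y \<Longrightarrow> 0 \<le> \<mu> E"
    "\<And>E. E \<in> sets M \<Longrightarrow> E \<inter> Y = {} \<Longrightarrow> \<mu> E \<le> 0"
proof -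
  define \<P> where "\<P> = {A\<in>sets M. \<forall>E\<in>sets M. E \<subseteq> A \<longrightarrow> 0 \<le> \<mu> E}"
  have mono: "\<mu> A \<le> \<mu> A'" if "A' \<in> \<P>" "A \<in> sets M" "A \<subseteq> A'" for A A'
  proof -
    have "0 \<le> \<mu> (A' - A)" using that by (auto simp: \<P>_def)
    then show ?thesis using vector_measure_Diff[OF vm, of A A'] that by (auto simp: \<P>_def)
  qed
  have UNP: "(\<Union>i. A i) \<in> \<P>" if rA: "range A \<subseteq> \<P>" for A :: "nat \<Rightarrow> 'a set"
  proof -
    have "0 \<le> \<mu> E" if E: "E \<in> sets M" "E \<subseteq> (\<Union>i. A i)" for E
    proof -
      have A: "A i \<in> sets M" for i using \<open>range A \<subseteq> \<P>\<close> by (auto simp: \<P>_def)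
      have "(\<Union>i. E \<inter> disjointed A i) = E \<inter> (\<Union>i. A i)"
        by (simp only: Int_UN_distrib[symmetric] UN_disjointed_eq)
      then have U: "(\<Union>i. E \<inter> disjointed A i) = E" using E by (simp add: Int_absorb2)
      have "E \<inter> disjointed A i \<in> sets M" for i
        using A E sets.range_disjointed_sets[of A M] by (intro sets.Int) auto
      then have s: "(\<lambda>i. \<mu> (E \<inter> disjointed A i)) sums \<mu> (\<Union>i. E \<inter> disjointed A i)"
      proof (intro vector_measure_sums[OF vm])
        show "disjoint_family (\<lambda>i. E \<inter> disjointed A i)"
          using disjoint_family_disjointed[of A] unfolding disjoint_family_on_def by blast
      qed (simp add: image_subset_iff)
      have nn: "0 \<le> \<mu> (E \<inter> disjointed A i)" for i
      proof -
        have "A i \<in> \<P>" using rA by auto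
        moreover have "disjointed A i \<in> sets M" using sets.range_disjointed_sets[of A M] A by auto
        moreover have "E \<inter> disjointed A i \<subseteq> A i" using disjointed_subset[of A i] by blast
        moreover have "E \<inter> disjointed A i \<in> sets M" using calculation E by (intro sets.Int)
        ultimately show ?thesis unfolding \<P>_def by blast
      qed
      show ?thesis using sums_le[OF nn sums_zero s] by (simp only: U)
    qed
    moreover have "(\<Union>i. A i) \<in> sets M" using rA by (intro sets.countable_UN) (auto simp: \<P>_def)
    ultimately show ?thesis unfolding \<P>_def by blast
  qed
  have ne: "{} \<in> \<P>" using vector_measure_empty[OF vm] by (simp add: \<P>_def)
  have "\<exists>Y\<in>\<P>. \<forall>A\<in>\<P>. \<mu> A \<le> \<mu> Y"
  proof -
    \<comment> \<open>Taken in \<open>ereal\<close>, as boundedness only follows once the supremum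
      is seen to be attained.\<close>
    define s where "s = (SUP A\<in>\<P>. ereal (\<mu> A))"
    obtain f :: "nat \<Rightarrow> ereal" where f: "range f \<subseteq> (\<lambda>A. ereal (\<mu> A)) ` \<P>" "s = (SUP i. f i)"
      using Sup_countable_SUP[of "(\<lambda>A. ereal (\<mu> A)) ` \<P>"] ne unfolding s_def by (metis empty_iff image_is_empty)
    have "\<forall>i. \<exists>A. A \<in> \<P> \<and> f i = ereal (\<mu> A)"
    proof
      fix i
      have "f i \<in> (\<lambda>A. ereal (\<mu> A)) ` \<P>" using f(1) by (rule subsetD) simp
      then show "\<exists>A. A \<in> \<P> \<and> f i = ereal (\<mu> A)" by blast
    qed
    then obtain A where A: "\<And>i. A i \<in> \<P>" "\<And>i. f i = ereal (\<mu> (A i))" by metis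
    have Y: "(\<Union>i. A i) \<in> \<P>" using A by (intro UNP) auto
    have "s \<le> ereal (\<mu> (\<Union>i. A i))"
      unfolding f(2)
    proof (rule SUP_least)
      fix i
      have "A i \<in> sets M" using A(1)[of i] by (simp add: \<P>_def)
      then show "f i \<le> ereal (\<mu> (\<Union>i. A i))"
        unfolding A(2) by (simp add: mono[OF Y] UN_upper)
    qed
    moreover have "ereal (\<mu> B) \<le> s" if "B \<in> \<P>" for B
      unfolding s_def using that by (rule SUP_upper)
    ultimately have "\<mu> B \<le> \<mu> (\<Union>i. A i)" if "B \<in> \<P>" for B
      using order_trans[of "ereal (\<mu> B)" s "ereal (\<mu> (\<Union>i. A i))"] that by simp
    then show ?thesis using Y by blast
  qed
  then obtain Y where Y: "Y \<in> \<P>" and max: "\<And>A. A \<in> \<P> \<Longrightarrow> \<mu> A \<le> \<mu> Y" by blast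
  show ?thesis
  proof
    show "Y \<in> sets M" "\<And>E. E \<in> sets M \<Longrightarrow> E \<subseteq> Y \<Longrightarrow> 0 \<le> \<mu> E" using Y by (auto simp: \<P>_def)
    fix D assume D: "D \<in> sets M" "D \<inter> Y = {}"
    show "\<mu> D \<le> 0"
    proof (rule ccontr)
      assume "\<not> \<mu> D \<le> 0"
      obtain A where A: "A \<in> sets M" "A \<subseteq> D" "\<mu> D \<le> \<mu> A" "\<And>E. E \<in> sets M \<Longrightarrow> E \<subseteq> A \<Longrightarrow> 0 \<le> \<mu> E"
        using vector_measure_positive_part[OF vm D(1)] by blast
      have AP: "A \<in> \<P>" using A by (auto simp: \<P>_def)
      have "(\<Union>i::nat. if i = 0 then Y else A) = Y \<union> A" by (auto split: if_splits)
      moreover have "(\<Union>i::nat. if i = 0 then Y else A) \<in> \<P>" using AP Y by (intro UNP) auto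
      ultimately have "\<mu> (Y \<union> A) \<le> \<mu> Y" using max by metis
      moreover have "\<mu> (Y \<union> A) = \<mu> Y + \<mu> A"
        using A D Y by (intro vector_measure_Un[OF vm]) (auto simp: \<P>_def)
      ultimately show False using A \<open>\<not> \<mu> D \<le> 0\<close> by simp
    qed
  qed
qed

text \<open>The last two conclusions are what the compactness argument uses: on \<open>A\<close>
  each part takes, up to sign, a value of \<open>\<mu>\<close> on a subset of \<open>A\<close>, so
  any bound of \<open>\<mu>\<close> on all small sets passes to both parts. The bound by
  \<open>tv_norm\<close> serves for integrals of bounded functions.\<close>

lemma Jordan_decomposition_vector_measure:
  fixes \<mu> :: "'a set \<Rightarrow> real"
  assumes vm: "vector_measure M \<mu>"
  obtains P N where "finite_measure P" "finite_measure N" "sets P = sets M" "sets N = sets M"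
    "\<And>A. A \<in> sets M \<Longrightarrow> \<mu> A = measure P A - measure N A"
    "ennreal (measure P (space M) + measure N (space M)) \<le> tv_norm M \<mu>"
    "\<And>A. A \<in> sets M \<Longrightarrow> \<exists>B\<in>sets M. B \<subseteq> A \<and> measure P A = \<mu> B"
    "\<And>A. A \<in> sets M \<Longrightarrow> \<exists>B\<in>sets M. B \<subseteq> A \<and> measure N A = - \<mu> B"
proof -
  obtain Y where Y: "Y \<in> sets M" "\<And>E. E \<in> sets M \<Longrightarrow> E \<subseteq> Y \<Longrightarrow> 0 \<le> \<mu> E"
    "\<And>E. E \<in> sets M \<Longrightarrow> E \<inter> Y = {} \<Longrightarrow> \<mu> E \<le> 0"
    using Hahn_decomposition_vector_measure[OF vm] by blast
  have C: "space M - Y \<in> sets M" using Y(1) by auto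
  obtain P where P: "finite_measure P" "sets P = sets M" "\<And>A. A \<in> sets M \<Longrightarrow> measure P A = \<mu> (A \<inter> Y)"
    by (rule nonneg_vector_measure_obtain[OF vector_measure_Int[OF vm Y(1)]]) (use Y in auto)
  obtain N where N: "finite_measure N" "sets N = sets M"
    "\<And>A. A \<in> sets M \<Longrightarrow> measure N A = - \<mu> (A \<inter> (space M - Y))"
  proof (rule nonneg_vector_measure_obtain[OF vector_measure_minus[OF vector_measure_Int[OF vm C]]])
    show "0 \<le> - \<mu> (A \<inter> (space M - Y))" if "A \<in> sets M" for A
      using Y(3)[of "A \<inter> (space M - Y)"] that C by auto
  qed auto
  show ?thesis
  proof (rule that[OF P(1) N(1) P(2) N(2)])
    fix A assume A: "A \<in> sets M"
    have "A = A \<inter> Y \<union> A \<inter> (space M - Y)" using sets.sets_into_space[OF A] by auto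
    then have "\<mu> A = \<mu> (A \<inter> Y) + \<mu> (A \<inter> (space M - Y))"
      using vector_measure_Un[OF vm, of "A \<inter> Y" "A \<inter> (space M - Y)"] A Y(1) C by auto
    then show "\<mu> A = measure P A - measure N A" using P(3)[OF A] N(3)[OF A] by simp
    show "\<exists>B\<in>sets M. B \<subseteq> A \<and> measure P A = \<mu> B"
      using A Y(1) P(3)[OF A] by (intro bexI[of _ "A \<inter> Y"]) auto
    show "\<exists>B\<in>sets M. B \<subseteq> A \<and> measure N A = - \<mu> B"
      using A C N(3)[OF A] by (intro bexI[of _ "A \<inter> (space M - Y)"]) auto
  next
    have PS: "measure P (space M) = norm (\<mu> Y)"
      using P(3)[of "space M"] Y(1) Y(2)[of Y] sets.sets_into_space[OF Y(1)] by (simp add: Int_absorb1)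
    have NS: "measure N (space M) = norm (\<mu> (space M - Y))"
      using N(3)[of "space M"] Y(3)[OF C] by (simp add: Int_absorb1 Diff_Int_distrib2)
    show "ennreal (measure P (space M) + measure N (space M)) \<le> tv_norm M \<mu>"
    \<comment> \<open>The two blocks of the partition coincide only when the space is empty, and the
      sum over them would then have one term.\<close>
    proof (cases "Y = space M - Y")
      case True
      then have "Y = {}" by auto
      then show ?thesis unfolding PS NS using True vector_measure_empty[OF vm] by simp
    next
      case False
      have "ennreal (measure P (space M) + measure N (space M)) = (\<Sum>A\<in>{Y, space M - Y}. ennreal (norm (\<mu> A)))"
        unfolding PS NS using False by simp
      also have "\<dots> \<le> tv_norm M \<mu>"
        unfolding tv_norm_def using Y(1) C by (intro SUP_upper) (auto simp: disjoint_def)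
      finally show ?thesis .
    qed
  qed
qed

section \<open>Integration against a difference of measures\<close>

lemma integrable_bounded:
  fixes f :: "'a \<Rightarrow> real"
  assumes "finite_measure P" "f \<in> borel_measurable P" "\<And>x. x \<in> space P \<Longrightarrow> \<bar>f x\<bar> \<le> B"
  shows "integrable P f"
proof -
  interpret finite_measure P by fact
  show ?thesis using assms by (intro integrable_const_bound[of _ B]) auto
qed

text \<open>Evaluates the supremum that defines \<open>pos_variation\<close> for a pair of measures
  that may overlap: replacing \<open>A\<close> by \<open>A \<inter> Y\<close> discards a nonpositive
  amount, enlarging it to \<open>E \<inter> Y\<close> adds a nonnegative one.\<close>

lemma Jordan_SUP:
  assumes "finite_measure P" "finite_measure N" and sP: "sets P = sets M" and sN: "sets N = sets M"
    and E: "E \<in> sets M" and Y: "Y \<in> sets M"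
    and YP: "\<And>X. X \<in> sets M \<Longrightarrow> X \<subseteq> Y \<Longrightarrow> measure N X \<le> measure P X"
    and YN: "\<And>X. X \<in> sets M \<Longrightarrow> X \<inter> Y = {} \<Longrightarrow> measure P X \<le> measure N X"
  shows "(SUP A\<in>{A\<in>sets M. A \<subseteq> E}. ennreal (measure P A - measure N A)) = ennreal (measure P (E \<inter> Y) - measure N (E \<inter> Y))"
proof (rule antisym)
  interpret P: finite_measure P by fact
  interpret N: finite_measure N by fact
  show "(SUP A\<in>{A\<in>sets M. A \<subseteq> E}. ennreal (measure P A - measure N A)) \<le> ennreal (measure P (E \<inter> Y) - measure N (E \<inter> Y))"
  proof (intro SUP_least ennreal_leI, safe)
    fix A assume A: "A \<in> sets M" "A \<subseteq> E"
    have e1: "measure P A = measure P (A \<inter> Y) + measure P (A - Y)" "measure N A = measure N (A \<inter> Y) + measure N (A - Y)"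
      using A Y sP sN by (auto intro!: P.finite_measure_Union'[where A="A \<inter> Y" and B="A - Y", symmetric, THEN trans, symmetric]
          simp: P.finite_measure_Diff' N.finite_measure_Diff')
    have *: "E \<inter> Y \<inter> A = A \<inter> Y" using A by auto
    have e2: "measure P (E \<inter> Y) = measure P (A \<inter> Y) + measure P (E \<inter> Y - A)"
      "measure N (E \<inter> Y) = measure N (A \<inter> Y) + measure N (E \<inter> Y - A)"
      using A Y E sP sN P.finite_measure_Diff'[of "E \<inter> Y" A] N.finite_measure_Diff'[of "E \<inter> Y" A]
        by (auto simp: *)
    show "measure P A - measure N A \<le> measure P (E \<inter> Y) - measure N (E \<inter> Y)"
      proof -
      have "measure P (A - Y) \<le> measure N (A - Y)" using A Y by (intro YN) auto
      moreover have "measure N (E \<inter> Y - A) \<le> measure P (E \<inter> Y - A)" using A Y E by (intro YP) auto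
      ultimately show ?thesis using e1 e2 by linarith
    qed
  qed
  show "ennreal (measure P (E \<inter> Y) - measure N (E \<inter> Y)) \<le> (SUP A\<in>{A\<in>sets M. A \<subseteq> E}. ennreal (measure P A - measure N A))"
    using E Y by (intro SUP_upper) auto
qed

text \<open>\<open>signed_integral\<close> is defined through suprema; this makes it computable from
  any representation of \<open>\<mu>\<close> as a difference of finite measures. With the Jordan
  parts \<open>P'\<close> and \<open>N'\<close> the two representations are compared after adding
  the negative parts crosswise.\<close>

theorem signed_integral_eq:
  assumes fP: "finite_measure P" and fN: "finite_measure N" and sP: "sets P = sets M" and sN: "sets N = sets M"
    and eq: "\<And>A. A \<in> sets M \<Longrightarrow> \<mu> A = measure P A - measure N A"
    and f: "f \<in> borel_measurable M" and bd: "\<And>x. x \<in> space M \<Longrightarrow> \<bar>f x\<bar> \<le> B"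
  shows "signed_integral M \<mu> f = (LINT x|P. f x) - (LINT x|N. f x)"
proof -
  interpret P: finite_measure P by fact
  interpret N: finite_measure N by fact
  have spP: "space P = space M" and spN: "space N = space M"
    using sP sN sets_eq_imp_space_eq by blast+
  obtain Y where Y: "Y \<in> sets P" "\<And>X. X \<in> sets P \<Longrightarrow> X \<subseteq> Y \<Longrightarrow> emeasure N X \<le> emeasure P X"
    "\<And>X. X \<in> sets P \<Longrightarrow> X \<inter> Y = {} \<Longrightarrow> emeasure P X \<le> emeasure N X"
    using finite_unsigned_Hahn_decomposition[OF fP fN] sP sN by auto
  have YM: "Y \<in> sets M" using Y sP by simp
  have YP: "measure N X \<le> measure P X" if "X \<in> sets M" "X \<subseteq> Y" for X
    using Y(2)[of X] that sP by (simp add: P.emeasure_eq_measure N.emeasure_eq_measure)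
  have YN: "measure P X \<le> measure N X" if "X \<in> sets M" "X \<inter> Y = {}" for X
    using Y(3)[of X] that sP by (simp add: P.emeasure_eq_measure N.emeasure_eq_measure)
  define Z where "Z = space M - Y"
  have ZM: "Z \<in> sets M" using YM by (auto simp: Z_def)
  have vm: "vector_measure M \<mu>"
  proof -
    have "vector_measure M (\<lambda>A. measure P A + - measure N A)"
      using vector_measure_measure[OF fP sP] vector_measure_measure[OF fN sN]
      by (intro vector_measure_add vector_measure_minus)
    then show ?thesis unfolding vector_measure_def
      using eq by (simp add: image_subset_iff)
  qed
  obtain P' where P': "finite_measure P'" "sets P' = sets M" "\<And>A. A \<in> sets M \<Longrightarrow> measure P' A = \<mu> (A \<inter> Y)"
  proof (rule nonneg_vector_measure_obtain[OF vector_measure_Int[OF vm YM]])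
    show "0 \<le> \<mu> (A \<inter> Y)" if "A \<in> sets M" for A
      using YP[of "A \<inter> Y"] eq[of "A \<inter> Y"] that YM by auto
  qed auto
  obtain N' where N': "finite_measure N'" "sets N' = sets M" "\<And>A. A \<in> sets M \<Longrightarrow> measure N' A = - \<mu> (A \<inter> Z)"
  proof (rule nonneg_vector_measure_obtain[OF vector_measure_minus[OF vector_measure_Int[OF vm ZM]]])
    show "0 \<le> - \<mu> (A \<inter> Z)" if "A \<in> sets M" for A
      using YN[of "A \<inter> Z"] eq[of "A \<inter> Z"] that ZM by (auto simp: Z_def)
  qed auto
  interpret P': finite_measure P' by fact
  interpret N': finite_measure N' by fact
  have spP': "space P' = space M" and spN': "space N' = space M"
    using P' N' sets_eq_imp_space_eq by blast+
  have pv: "pos_variation M \<mu> = P'"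
  proof -
    have "P' = measure_of (space P') (sets P') (emeasure P')" by (simp add: measure_of_of_measure)
    also have "\<dots> = pos_variation M \<mu>"
      unfolding pos_variation_def spP' P'(2)
    proof (rule measure_of_eq)
      fix E assume "E \<in> sigma_sets (space M) (sets M)"
      then have E: "E \<in> sets M" by (simp add: sets.sigma_sets_eq)
      have "emeasure P' E = ennreal (measure P (E \<inter> Y) - measure N (E \<inter> Y))"
        using P'(3)[OF E] eq[of "E \<inter> Y"] E YM by (simp add: P'.emeasure_eq_measure)
      also have "\<dots> = (SUP A\<in>{A\<in>sets M. A \<subseteq> E}. ennreal (measure P A - measure N A))"
        by (rule Jordan_SUP[OF fP fN sP sN E YM, symmetric]) (use YP YN in auto)
      also have "\<dots> = (SUP A\<in>{A\<in>sets M. A \<subseteq> E}. ennreal (\<mu> A))"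
        using eq by (intro SUP_cong) auto
      finally show "emeasure P' E = (SUP A\<in>{A\<in>sets M. A \<subseteq> E}. ennreal (\<mu> A))" .
    qed (simp add: sets.space_closed)
    finally show ?thesis by simp
  qed
  have nv: "neg_variation M \<mu> = N'"
  proof -
    have "N' = measure_of (space N') (sets N') (emeasure N')" by (simp add: measure_of_of_measure)
    also have "\<dots> = neg_variation M \<mu>"
      unfolding neg_variation_def pos_variation_def spN' N'(2)
    proof (rule measure_of_eq)
      fix E assume "E \<in> sigma_sets (space M) (sets M)"
      then have E: "E \<in> sets M" by (simp add: sets.sigma_sets_eq)
      have "emeasure N' E = ennreal (measure N (E \<inter> Z) - measure P (E \<inter> Z))"
        using N'(3)[OF E] eq[of "E \<inter> Z"] E ZM by (simp add: N'.emeasure_eq_measure)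
      also have "\<dots> = (SUP A\<in>{A\<in>sets M. A \<subseteq> E}. ennreal (measure N A - measure P A))"
      proof (rule Jordan_SUP[OF fN fP sN sP E ZM, symmetric])
        show "measure P X \<le> measure N X" if "X \<in> sets M" "X \<subseteq> Z" for X
          using that by (intro YN) (auto simp: Z_def)
        show "measure N X \<le> measure P X" if "X \<in> sets M" "X \<inter> Z = {}" for X
          using that sets.sets_into_space[OF that(1)] by (intro YP) (auto simp: Z_def)
      qed
      also have "\<dots> = (SUP A\<in>{A\<in>sets M. A \<subseteq> E}. ennreal (- \<mu> A))"
        using eq by (intro SUP_cong) auto
      finally show "emeasure N' E = (SUP A\<in>{A\<in>sets M. A \<subseteq> E}. ennreal (- \<mu> A))" .
    qed (simp add: sets.space_closed)
    finally show ?thesis by simp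
  qed
  text \<open>The measures \<open>P + N'\<close> and \<open>N + P'\<close> coincide.\<close>
  have eq': "measure P A + measure N' A = measure N A + measure P' A" if A: "A \<in> sets M" for A
  proof -
    have "A = A \<inter> Y \<union> A \<inter> Z" using sets.sets_into_space[OF A] by (auto simp: Z_def)
    then have "\<mu> A = \<mu> (A \<inter> Y) + \<mu> (A \<inter> Z)"
      using vector_measure_Un[OF vm, of "A \<inter> Y" "A \<inter> Z"] A YM ZM by (auto simp: Z_def)
    then show ?thesis using P'(3)[OF A] N'(3)[OF A] eq[OF A] by simp
  qed
  have int: "integrable Q f" if "finite_measure Q" "sets Q = sets M" for Q :: "'a measure"
    using that f bd sets_eq_imp_space_eq[OF that(2)]
    by (intro integrable_bounded[of _ _ B]) (auto simp: measurable_cong_sets[OF that(2) refl])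
  have main: "(LINT x|P. f x) + (LINT x|N'. f x) = (LINT x|N. f x) + (LINT x|P'. f x)"
  proof -
    define S where "S = sup_measure P N'"
    have "(LINT x|P. g x) + (LINT x|N'. g x) = (LINT x|N. g x) + (LINT x|P'. g x)"
      if g: "g \<in> borel_measurable M" "\<And>x. 0 \<le> g x" "\<And>x. x \<in> space M \<Longrightarrow> g x \<le> B" for g
    proof -
      have gint: "integrable Q g" if "finite_measure Q" "sets Q = sets M" for Q :: "'a measure"
        using that g sets_eq_imp_space_eq[OF that(2)]
        by (intro integrable_bounded[of _ _ B]) (auto simp: measurable_cong_sets[OF that(2) refl])
      \<comment> \<open>The identity of set functions is lifted to nonnegative functions by the
        standard induction, for all four measures at once.\<close>
      have nn: "(\<integral>\<^sup>+x. u x \<partial>P) + (\<integral>\<^sup>+x. u x \<partial>N') = (\<integral>\<^sup>+x. u x \<partial>N) + (\<integral>\<^sup>+x. u x \<partial>P')"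
        if "u \<in> borel_measurable M" for u :: "'a \<Rightarrow> ennreal"
        using that
      proof (induction u rule: borel_measurable_induct)
        case (cong f g)
        have "integral\<^sup>N Q f = integral\<^sup>N Q g" if "sets Q = sets M" for Q :: "'a measure"
          using cong sets_eq_imp_space_eq[OF that] by (intro nn_integral_cong) auto
        then show ?case using cong sP sN P' N' by metis
      next
        case (set A)
        then show ?case using sP sN P'(2) N'(2) eq'[of A]
          by (simp add: P.emeasure_eq_measure N.emeasure_eq_measure P'.emeasure_eq_measure
              N'.emeasure_eq_measure flip: ennreal_plus)
      next
        case (mult u c)
        have "(\<integral>\<^sup>+x. c * u x \<partial>Q) = c * (\<integral>\<^sup>+x. u x \<partial>Q)" if "sets Q = sets M" for Q :: "'a measure"
          using mult that by (intro nn_integral_cmult) (simp add: measurable_cong_sets[OF that refl])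
        then show ?case using mult sP sN P'(2) N'(2) by (simp add: distrib_left[symmetric])
      next
        case (add u v)
        have "(\<integral>\<^sup>+x. v x + u x \<partial>Q) = (\<integral>\<^sup>+x. v x \<partial>Q) + (\<integral>\<^sup>+x. u x \<partial>Q)" if "sets Q = sets M" for Q :: "'a measure"
          using add that by (intro nn_integral_add) (simp_all add: measurable_cong_sets[OF that refl])
        then show ?case using add sP sN P'(2) N'(2) by (simp add: ac_simps)
      next
        case (seq U)
        have *: "integral\<^sup>N Q (\<Squnion> (range U)) = (SUP i. \<integral>\<^sup>+x. U i x \<partial>Q)" if "sets Q = sets M" for Q :: "'a measure"
        proof -
          have "integral\<^sup>N Q (\<Squnion> (range U)) = (\<integral>\<^sup>+x. (SUP i. U i x) \<partial>Q)"
            by (intro nn_integral_cong) (simp add: image_image)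
          also have "\<dots> = (SUP i. \<integral>\<^sup>+x. U i x \<partial>Q)"
            using seq that by (intro nn_integral_monotone_convergence_SUP) (simp_all add: measurable_cong_sets[OF that refl])
          finally show ?thesis .
        qed
        have inc: "incseq (\<lambda>i. \<integral>\<^sup>+x. U i x \<partial>Q)" for Q :: "'a measure"
          using seq by (auto simp: incseq_def le_fun_def intro!: nn_integral_mono)
        show ?case
          unfolding *[OF sP] *[OF sN] *[OF P'(2)] *[OF N'(2)] ennreal_SUP_add[OF inc inc, symmetric]
          by (simp only: seq)
      qed
      have "(\<integral>\<^sup>+x. ennreal (g x) \<partial>Q) = ennreal (LINT x|Q. g x)" if "finite_measure Q" "sets Q = sets M" for Q :: "'a measure"
        using gint[OF that] g by (intro nn_integral_eq_integral) auto
      with nn[of "\<lambda>x. ennreal (g x)"] g fP fN sP sN P' N'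
      have "ennreal (LINT x|P. g x) + ennreal (LINT x|N'. g x) = ennreal (LINT x|N. g x) + ennreal (LINT x|P'. g x)"
        by simp
      then show ?thesis
        using g by (simp add: integral_nonneg_AE flip: ennreal_plus)
    qed
    from this[of "\<lambda>x. max 0 (f x)"] this[of "\<lambda>x. max 0 (- f x)"]
    have *: "(LINT x|P. max 0 (f x)) + (LINT x|N'. max 0 (f x)) = (LINT x|N. max 0 (f x)) + (LINT x|P'. max 0 (f x))"
      "(LINT x|P. max 0 (- f x)) + (LINT x|N'. max 0 (- f x)) = (LINT x|N. max 0 (- f x)) + (LINT x|P'. max 0 (- f x))"
      if "0 \<le> B" using f bd that by (force simp: abs_le_iff)+
    have sp: "(LINT x|Q. f x) = (LINT x|Q. max 0 (f x)) - (LINT x|Q. max 0 (- f x))"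
      if "finite_measure Q" "sets Q = sets M" for Q :: "'a measure"
    proof -
      have "(LINT x|Q. max 0 (f x)) - (LINT x|Q. max 0 (- f x)) = (LINT x|Q. max 0 (f x) - max 0 (- f x))"
        using int[OF that] by (intro Bochner_Integration.integral_diff[symmetric]) auto
      also have "\<dots> = (LINT x|Q. f x)" by (intro Bochner_Integration.integral_cong) auto
      finally show ?thesis by simp
    qed
    show ?thesis
    \<comment> \<open>A negative bound \<open>B\<close> is consistent only with an empty
      space.\<close>
    proof (cases "space M = {}")
      case True
      then show ?thesis
        by (simp add: Bochner_Integration.integral_empty spP spN spP' spN')
    next
      case False
      then have "0 \<le> B" using bd by fastforce
      then show ?thesis using * sp[OF fP sP] sp[OF fN sN] sp[OF P'(1,2)] sp[OF N'(1,2)] by linarith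
    qed
  qed
  then show ?thesis by (simp add: signed_integral_def pv nv)
qed

section \<open>Setwise compactness of uniformly absolutely continuous measures\<close>

lemma L1_approx_finite_Union:
  fixes F :: "('a \<Rightarrow> real) set"
  assumes fin: "finite_measure M"
    and Fm: "\<And>f. f \<in> F \<Longrightarrow> f \<in> borel_measurable M" and F01: "\<And>f x. f \<in> F \<Longrightarrow> 0 \<le> f x \<and> f x \<le> 1"
    and zero: "(\<lambda>x. 0) \<in> F"
    and max: "\<And>f g. f \<in> F \<Longrightarrow> g \<in> F \<Longrightarrow> (\<lambda>x. max (f x) (g x)) \<in> F"
    and A: "\<And>i::nat. A i \<in> sets M"
    and ap: "\<And>i e. e > 0 \<Longrightarrow> \<exists>f\<in>F. (LINT x|M. \<bar>indicator (A i) x - f x\<bar>) < e"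
    and e: "e > 0"
  shows "\<exists>f\<in>F. (LINT x|M. \<bar>indicator (\<Union>i<n. A i) x - f x\<bar>) < e"
  using e
proof (induction n arbitrary: e)
  case 0
  then show ?case by (intro bexI[OF _ zero]) simp
next
  case (Suc n)
  interpret finite_measure M by fact
  have "e / 2 > 0" using Suc.prems by simp
  then obtain f g where f: "f \<in> F" "(LINT x|M. \<bar>indicator (\<Union>i<n. A i) x - f x\<bar>) < e / 2"
    and g: "g \<in> F" "(LINT x|M. \<bar>indicator (A n) x - g x\<bar>) < e / 2"
    using Suc.IH ap by metis
  have i: "integrable M (\<lambda>x. \<bar>indicator B x - h x\<bar>)" if "h \<in> F" "B \<in> sets M" for h B
  proof (rule integrable_bounded[OF fin, of _ 1])
    show "\<bar>\<bar>indicator B x - h x\<bar>\<bar> \<le> 1" for x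
      using F01[OF that(1), of x] by (auto simp: indicator_def)
  qed (use that Fm[OF that(1)] in auto)
  have U: "(\<Union>i<n. A i) \<in> sets M" "(\<Union>i<Suc n. A i) \<in> sets M" using A by auto
  have "(LINT x|M. \<bar>indicator (\<Union>i<Suc n. A i) x - max (f x) (g x)\<bar>)
      \<le> (LINT x|M. \<bar>indicator (\<Union>i<n. A i) x - f x\<bar> + \<bar>indicator (A n) x - g x\<bar>)"
  proof (intro integral_mono i Bochner_Integration.integrable_add max f g U A)
    fix x
    have "0 \<le> f x" "f x \<le> 1" "0 \<le> g x" "g x \<le> 1" using F01 f g by auto
    moreover have "(\<Union>i<Suc n. A i) = A n \<union> (\<Union>i<n. A i)" by (auto simp: lessThan_Suc)
    ultimately show "\<bar>indicator (\<Union>i<Suc n. A i) x - max (f x) (g x)\<bar> \<le> \<bar>indicator (\<Union>i<n. A i) x - f x\<bar> + \<bar>indicator (A n) x - g x\<bar>"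
      by (simp add: indicator_def)
  qed
  also have "\<dots> = (LINT x|M. \<bar>indicator (\<Union>i<n. A i) x - f x\<bar>) + (LINT x|M. \<bar>indicator (A n) x - g x\<bar>)"
    by (rule Bochner_Integration.integral_add[OF i[OF f(1) U(1)] i[OF g(1) A]])
  also have "\<dots> < e" using f(2) g(2) by linarith
  finally show ?case using max[OF f(1) g(1)] by (rule bexI)
qed

text \<open>The sets whose indicators are L1 limits of functions from \<open>F\<close> form a
  sigma-algebra: complements come from \<open>1 - f\<close>, finite unions from \<open>max\<close>,
  countable ones from continuity of the measure. It is applied to indicators of a countable algebra
  and to continuous functions on the torus.\<close>

lemma L1_approx:
  fixes F :: "('a \<Rightarrow> real) set"
  assumes fin: "finite_measure M"
    and gen: "sets M = sigma_sets (space M) G" "G \<subseteq> Pow (space M)"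
    and Fm: "\<And>f. f \<in> F \<Longrightarrow> f \<in> borel_measurable M" and F01: "\<And>f x. f \<in> F \<Longrightarrow> 0 \<le> f x \<and> f x \<le> 1"
    and zero: "(\<lambda>x. 0) \<in> F"
    and compl: "\<And>f. f \<in> F \<Longrightarrow> \<exists>g\<in>F. \<forall>x\<in>space M. g x = 1 - f x"
    and max: "\<And>f g. f \<in> F \<Longrightarrow> g \<in> F \<Longrightarrow> (\<lambda>x. max (f x) (g x)) \<in> F"
    and G: "\<And>A e. A \<in> G \<Longrightarrow> e > 0 \<Longrightarrow> \<exists>f\<in>F. (LINT x|M. \<bar>indicator A x - f x\<bar>) < e"
    and A: "A \<in> sets M" and e: "e > 0"
  shows "\<exists>f\<in>F. (LINT x|M. \<bar>indicator A x - f x\<bar>) < e"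
proof -
  interpret finite_measure M by fact
  have "A \<in> sigma_sets (space M) G" using A gen by simp
  then show ?thesis using e
  proof (induction A arbitrary: e)
    case (Basic a) then show ?case using G by blast
  next
    case Empty then show ?case by (intro bexI[OF _ zero]) simp
  next
    case (Compl a)
    then obtain f where f: "f \<in> F" "(LINT x|M. \<bar>indicator a x - f x\<bar>) < e" by blast
    then obtain g where g: "g \<in> F" "\<forall>x\<in>space M. g x = 1 - f x" using compl by blast
    have "(LINT x|M. \<bar>indicator (space M - a) x - g x\<bar>) = (LINT x|M. \<bar>indicator a x - f x\<bar>)"
      using g by (intro Bochner_Integration.integral_cong) (auto simp: indicator_def)
    then show ?case using f(2) g(1) by (intro bexI[of _ g]) simp_all
  next
    case (Union a)
    have a: "a i \<in> sets M" for i using Union.hyps gen by auto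
    define U where "U = (\<Union>i. a i)"
    have UM: "U \<in> sets M" using a by (auto simp: U_def)
    have Vn: "(\<Union>i<n. a i) \<in> sets M" for n using a by auto
    \<comment> \<open>Continuity from below reduces the countable union to a finite one, which
      \<open>L1_approx_finite_Union\<close> handles.\<close>
    have "(\<lambda>n. measure M (\<Union>i<n. a i)) \<longlonglongrightarrow> measure M (\<Union>n. \<Union>i<n. a i)"
      using Vn by (intro finite_Lim_measure_incseq) (force simp: incseq_def)+
    moreover have "(\<Union>n. \<Union>i<n. a i) = U" by (auto simp: U_def)
    ultimately have "(\<lambda>n. measure M (\<Union>i<n. a i)) \<longlonglongrightarrow> measure M U" by simp
    moreover have "e / 2 > 0" using Union.prems by simp
    ultimately obtain n where n: "\<bar>measure M (\<Union>i<n. a i) - measure M U\<bar> < e / 2"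
      by (metis LIMSEQ_D le_refl real_norm_def)
    define V where "V = (\<Union>i<n. a i)"
    have VU: "V \<in> sets M" "V \<subseteq> U" using Vn by (auto simp: V_def U_def)
    have mV: "measure M (U - V) < e / 2"
      using n finite_measure_Diff[OF UM VU] unfolding V_def by linarith
    obtain f where f: "f \<in> F" "(LINT x|M. \<bar>indicator V x - f x\<bar>) < e / 2"
    proof -
      have "\<exists>f\<in>F. (LINT x|M. \<bar>indicator (\<Union>i<n. a i) x - f x\<bar>) < e / 2"
        by (rule L1_approx_finite_Union[where F=F])
          (fact fin Fm F01 zero max a Union.IH \<open>e / 2 > 0\<close>)+
      then show ?thesis using that unfolding V_def by blast
    qed
    have i: "integrable M (\<lambda>x. \<bar>indicator B x - f x\<bar>)" if "B \<in> sets M" for B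
    proof (rule integrable_bounded[OF fin, of _ 1])
      show "\<bar>\<bar>indicator B x - f x\<bar>\<bar> \<le> 1" for x
        using F01[OF f(1), of x] by (auto simp: indicator_def)
    qed (use that Fm[OF f(1)] in auto)
    have iUV: "integrable M (indicator (U - V) :: 'a \<Rightarrow> real)"
      using UM VU by (intro integrable_real_indicator) (auto simp: less_top[symmetric])
    have "(LINT x|M. \<bar>indicator U x - f x\<bar>) \<le> (LINT x|M. indicator (U - V) x + \<bar>indicator V x - f x\<bar>)"
      using VU by (intro integral_mono i Bochner_Integration.integrable_add UM iUV) (auto simp: indicator_def)
    also have "\<dots> = measure M (U - V) + (LINT x|M. \<bar>indicator V x - f x\<bar>)"
      using i[OF VU(1)] iUV UM VU sets.sets_into_space[OF UM] by (simp add: Int_absorb1 Diff_subset_conv le_supI2)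
    also have "\<dots> < e" using mV f(2) by simp
    finally show ?case using f(1) by (auto simp: U_def)
  qed
qed

text \<open>Countability serves the diagonal argument, closure under complement and union serves
  \<open>L1_approx\<close>. Each stage adds only complements and pairwise unions, so all stages stay
  countable.\<close>

lemma countable_algebra_obtain:
  fixes G :: "'a set set"
  assumes "countable G" "G \<subseteq> Pow \<Omega>"
  obtains \<A> where "countable \<A>" "G \<subseteq> \<A>" "{} \<in> \<A>" "\<A> \<subseteq> sigma_sets \<Omega> G"
    "\<And>A. A \<in> \<A> \<Longrightarrow> \<Omega> - A \<in> \<A>" "\<And>A B. A \<in> \<A> \<Longrightarrow> B \<in> \<A> \<Longrightarrow> A \<union> B \<in> \<A>"
proof -
  define step where "step \<B> = \<B> \<union> (\<lambda>A. \<Omega> - A) ` \<B> \<union> (\<lambda>(A, B). A \<union> B) ` (\<B> \<times> \<B>)" for \<B> :: "'a set set"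
  define \<S> where "\<S> n = (step ^^ n) (insert {} G)" for n
  have S0: "\<S> 0 = insert {} G" and SS: "\<S> (Suc n) = step (\<S> n)" for n by (simp_all add: \<S>_def)
  have c: "countable (\<S> n)" for n
    by (induction n) (use assms in \<open>auto simp: S0 SS step_def\<close>)
  have mono: "\<S> m \<subseteq> \<S> n" if "m \<le> n" for m n
    using that by (induction rule: dec_induct) (auto simp: SS step_def)
  have sub: "\<S> n \<subseteq> sigma_sets \<Omega> G" for n
  proof (induction n)
    case 0 then show ?case by (auto simp: S0 intro: sigma_sets.intros)
  next
    case (Suc n)
    then show ?case using assms(2)
      by (auto simp: SS step_def intro: sigma_sets.Compl) (intro sigma_sets_Un, auto)
  qed
  show ?thesis
  proof (rule that[of "\<Union>n. \<S> n"])
    show "G \<subseteq> (\<Union>n. \<S> n)" "{} \<in> (\<Union>n. \<S> n)" using S0 by blast+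
    show "(\<Union>n. \<S> n) \<subseteq> sigma_sets \<Omega> G" using sub by blast
    show "countable (\<Union>n. \<S> n)" using c by auto
    show "\<Omega> - A \<in> (\<Union>n. \<S> n)" if A: "A \<in> (\<Union>n. \<S> n)" for A
    proof -
      obtain n where "A \<in> \<S> n" using A by blast
      then have "\<Omega> - A \<in> \<S> (Suc n)" by (auto simp: SS step_def)
      then show ?thesis by blast
    qed
    show "A \<union> B \<in> (\<Union>n. \<S> n)" if AB: "A \<in> (\<Union>n. \<S> n)" "B \<in> (\<Union>n. \<S> n)" for A B
    proof -
      obtain m n where "A \<in> \<S> m" "B \<in> \<S> n" using AB by blast
      then have "A \<in> \<S> (max m n)" "B \<in> \<S> (max m n)" using mono[of m "max m n"] mono[of n "max m n"] by auto
      then have "A \<union> B \<in> \<S> (Suc (max m n))" by (auto simp: SS step_def)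
      then show ?thesis by blast
    qed
  qed
qed

section \<open>Diagonal extraction and setwise limits\<close>

lemma diagonal_subsequence_convergent:
  fixes u :: "nat \<Rightarrow> nat \<Rightarrow> real"
  assumes bd: "\<And>i n. \<bar>u i n\<bar> \<le> K i"
  obtains k :: "nat \<Rightarrow> nat" where "strict_mono k" "\<And>i. convergent (\<lambda>n. u i (k n))"
proof -
  interpret subseqs "\<lambda>i s. convergent (\<lambda>n. u i (s n))"
  proof
    fix i :: nat and s :: "nat \<Rightarrow> nat"
    have "bounded (range (\<lambda>n. u i (s n)))" using bd by (intro boundedI[of _ "K i"]) auto
    then obtain l r where "strict_mono r" "((\<lambda>n. u i (s n)) \<circ> r) \<longlonglongrightarrow> l"
      using bounded_imp_convergent_subsequence by blast
    then show "\<exists>r. strict_mono r \<and> convergent (\<lambda>n. u i ((s \<circ> r) n))"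
      by (auto simp: convergent_def o_def)
  qed
  show ?thesis
  proof
    show "strict_mono diagseq" by (rule subseq_diagseq)
    fix i
    have "convergent (\<lambda>n. u i ((diagseq \<circ> ((+) (Suc i))) n))"
    proof (rule diagseq_holds)
      fix r s :: "nat \<Rightarrow> nat" and n assume "strict_mono r" "convergent (\<lambda>m. u n (s m))"
      then show "convergent (\<lambda>m. u n ((s \<circ> r) m))"
        using convergent_subseq_convergent[of "\<lambda>m. u n (s m)" r] by (simp add: o_def)
    qed
    then obtain l where "(\<lambda>n. u i (diagseq (n + Suc i))) \<longlonglongrightarrow> l"
      by (auto simp: convergent_def o_def add.commute)
    then have "(\<lambda>n. u i (diagseq n)) \<longlonglongrightarrow> l" by (rule LIMSEQ_offset)
    then show "convergent (\<lambda>n. u i (diagseq n))" by (auto simp: convergent_def)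
  qed
qed

lemma real_density_obtain:
  assumes "finite_measure L" "finite_measure P" and sets: "sets P = sets L" and ac: "absolutely_continuous L P"
  obtains g :: "'a \<Rightarrow> real" where "integrable L g" "\<And>x. 0 \<le> g x" "density L (\<lambda>x. ennreal (g x)) = P"
proof -
  interpret L: finite_measure L by fact
  interpret P: finite_measure P by fact
  obtain g where g: "g \<in> borel_measurable L" "AE x in L. RN_deriv L P x = ennreal (g x)" "\<And>x. 0 \<le> g x"
    using L.real_RN_deriv[OF assms(2) ac sets] by blast
  have d: "density L (\<lambda>x. ennreal (g x)) = P"
  proof -
    have "density L (\<lambda>x. ennreal (g x)) = density L (RN_deriv L P)"
      using g by (intro density_cong) auto
    then show ?thesis using L.density_RN_deriv[OF ac sets] by simp
  qed
  have "(\<integral>\<^sup>+x. ennreal (g x) \<partial>L) = emeasure P (space P)"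
    unfolding d[symmetric] using g by (simp add: emeasure_density cong: nn_integral_cong)
  then have "integrable L g"
    using g P.emeasure_finite[of "space P"] by (intro integrableI_nonneg) (auto simp: less_top[symmetric])
  then show ?thesis using that g d by blast
qed

text \<open>Sequential part of the Dunford-Pettis theorem, for measures rather than densities. The
  diagonal sequence converges on a countable generating algebra; equi-absolute continuity carries
  convergence to all measurable sets and makes the limit countably additive and absolutely
  continuous, so that Radon-Nikodym applies. The bound on small sets is asked only for large
  \<open>n\<close> because the flux satisfies it only for large \<open>V\<close>.\<close>

lemma setwise_compactness_nonneg:
  fixes \<nu> :: "nat \<Rightarrow> 'a measure"
  assumes fin: "finite_measure L" and G: "countable G" "G \<subseteq> Pow (space L)" "sets L = sigma_sets (space L) G"
    and f\<nu>: "\<And>n. finite_measure (\<nu> n)" and s\<nu>: "\<And>n. sets (\<nu> n) = sets L"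
    and K: "\<And>n. measure (\<nu> n) (space L) \<le> K"
    and equi: "\<And>e. e > 0 \<Longrightarrow> \<exists>d>0. \<exists>N. \<forall>n\<ge>N. \<forall>A\<in>sets L. measure L A < d \<longrightarrow> measure (\<nu> n) A \<le> e"
  obtains k :: "nat \<Rightarrow> nat" and g :: "'a \<Rightarrow> real" where "strict_mono k" "integrable L g" "\<And>x. 0 \<le> g x"
    "\<And>A. A \<in> sets L \<Longrightarrow> (\<lambda>n. measure (\<nu> (k n)) A) \<longlonglongrightarrow> measure (density L (\<lambda>x. ennreal (g x))) A"
proof -
  interpret L: finite_measure L by fact
  have sp: "space (\<nu> n) = space L" for n using s\<nu> sets_eq_imp_space_eq by blast
  obtain \<A> where \<A>: "countable \<A>" "G \<subseteq> \<A>" "{} \<in> \<A>" "\<A> \<subseteq> sigma_sets (space L) G"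
    "\<And>A. A \<in> \<A> \<Longrightarrow> space L - A \<in> \<A>" "\<And>A B. A \<in> \<A> \<Longrightarrow> B \<in> \<A> \<Longrightarrow> A \<union> B \<in> \<A>"
    using countable_algebra_obtain[OF G(1,2)] by blast
  have \<A>L: "A \<in> sets L" if "A \<in> \<A>" for A using that \<A>(4) G(3) by auto
  define a where "a = from_nat_into \<A>"
  have a: "range a = \<A>" unfolding a_def using \<A>(1,3) by (intro range_from_nat_into) auto
  have bd: "\<bar>measure (\<nu> n) A\<bar> \<le> K" for n A
    using finite_measure.bounded_measure[OF f\<nu>, of n A] K[of n] by (simp add: sp)
  obtain k where k: "strict_mono k" "\<And>i. convergent (\<lambda>n. measure (\<nu> (k n)) (a i))"
    using diagonal_subsequence_convergent[of "\<lambda>i n. measure (\<nu> n) (a i)" "\<lambda>_. K"] bd by blast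
  have conv\<A>: "convergent (\<lambda>n. measure (\<nu> (k n)) A)" if "A \<in> \<A>" for A
    using k(2) that a by (metis imageE)
  have equik: "\<exists>d>0. \<exists>N. \<forall>n\<ge>N. \<forall>A\<in>sets L. measure L A < d \<longrightarrow> measure (\<nu> (k n)) A \<le> e" if e: "e > 0" for e
  proof -
    obtain d N where "d > 0" "\<forall>n\<ge>N. \<forall>A\<in>sets L. measure L A < d \<longrightarrow> measure (\<nu> n) A \<le> e"
      using equi[OF e] by blast
    then show ?thesis using seq_suble[OF k(1)] order_trans by (intro exI[of _ d]) blast
  qed
  \<comment> \<open>The algebra is dense for the pseudometric given by the measure of symmetric
    differences.\<close>
  have approx: "\<exists>B\<in>\<A>. measure L (A - B) < d \<and> measure L (B - A) < d" if A: "A \<in> sets L" and "d > 0" for A d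
  proof -
    define F where "F = (\<lambda>B. indicator B :: 'a \<Rightarrow> real) ` \<A>"
    have "\<exists>f\<in>F. (LINT x|L. \<bar>indicator A x - f x\<bar>) < d"
    proof (rule L1_approx[OF fin G(3,2) _ _ _ _ _ _ A \<open>d > 0\<close>])
      show "f \<in> borel_measurable L" "0 \<le> f x \<and> f x \<le> 1" if "f \<in> F" for f x
        using that \<A>L by (auto simp: F_def indicator_def)
      show "(\<lambda>x. 0) \<in> F" using \<A>(3) by (force simp: F_def)
      show "\<exists>g\<in>F. \<forall>x\<in>space L. g x = 1 - f x" if f: "f \<in> F" for f
      proof -
        obtain B where "B \<in> \<A>" "f = indicator B" using f by (auto simp: F_def)
        then show ?thesis using \<A>(5)[of B]
          by (intro bexI[of _ "indicator (space L - B)"]) (auto simp: F_def indicator_def)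
      qed
      show "(\<lambda>x. max (f x) (g x)) \<in> F" if fg: "f \<in> F" "g \<in> F" for f g
      proof -
        obtain B C where "B \<in> \<A>" "f = indicator B" "C \<in> \<A>" "g = indicator C" using fg by (auto simp: F_def)
        moreover have "(\<lambda>x. max (indicator B x) (indicator C x) :: real) = indicator (B \<union> C)"
          by (auto simp: indicator_def fun_eq_iff)
        ultimately show ?thesis using \<A>(6)[of B C] by (simp add: F_def)
      qed
      show "\<exists>f\<in>F. (LINT x|L. \<bar>indicator A x - f x\<bar>) < e" if "A \<in> G" "e > 0" for A e
        using that \<A>(2) by (intro bexI[of _ "indicator A"]) (auto simp: F_def)
    qed
    then obtain B where B: "B \<in> \<A>" "(LINT x|L. \<bar>indicator A x - indicator B x\<bar>) < d" by (auto simp: F_def)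
    have D: "A - B \<union> (B - A) \<in> sets L" using A \<A>L[OF B(1)] by auto
    have "(LINT x|L. \<bar>indicator A x - indicator B x\<bar>) = (LINT x|L. indicator (A - B \<union> (B - A)) x :: real)"
      by (intro Bochner_Integration.integral_cong) (auto simp: indicator_def)
    also have "\<dots> = measure L (A - B \<union> (B - A))"
      using Int_absorb2[OF sets.sets_into_space[OF D]] by simp
    finally have "measure L (A - B \<union> (B - A)) < d" using B(2) by simp
    moreover have "measure L (A - B) \<le> measure L (A - B \<union> (B - A))" "measure L (B - A) \<le> measure L (A - B \<union> (B - A))"
      using D by (auto intro!: L.finite_measure_mono)
    ultimately show ?thesis using B(1) by (intro bexI[of _ B] conjI) linarith+
  qed
  have conv: "convergent (\<lambda>n. measure (\<nu> (k n)) A)" if A: "A \<in> sets L" for A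
  proof (rule Cauchy_convergent, rule metric_CauchyI)
    fix e :: real assume "e > 0"
    then have "e / 8 > 0" by simp
    then obtain d N where d: "d > 0" and N: "\<And>n B. n \<ge> N \<Longrightarrow> B \<in> sets L \<Longrightarrow> measure L B < d \<Longrightarrow> measure (\<nu> (k n)) B \<le> e / 8"
      using equik by blast
    obtain B where B: "B \<in> \<A>" "measure L (A - B) < d" "measure L (B - A) < d" using approx[OF A d] by blast
    have BL: "B \<in> sets L" using \<A>L B by simp
    have cl: "\<bar>measure (\<nu> (k n)) A - measure (\<nu> (k n)) B\<bar> \<le> e / 4" if "n \<ge> N" for n
    proof -
      interpret n: finite_measure "\<nu> (k n)" by (rule f\<nu>)
      have "measure (\<nu> (k n)) (A - B) \<le> e / 8" "measure (\<nu> (k n)) (B - A) \<le> e / 8"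
        using A BL B that by (blast intro: N)+
      moreover have "measure (\<nu> (k n)) (A - B) = measure (\<nu> (k n)) A - measure (\<nu> (k n)) (A \<inter> B)"
        "measure (\<nu> (k n)) (B - A) = measure (\<nu> (k n)) B - measure (\<nu> (k n)) (A \<inter> B)"
        using A BL n.finite_measure_Diff'[of A B] n.finite_measure_Diff'[of B A] by (auto simp: s\<nu> Int_commute)
      ultimately show ?thesis using measure_nonneg[of "\<nu> (k n)" "A - B"] measure_nonneg[of "\<nu> (k n)" "B - A"] \<open>e > 0\<close>
        unfolding abs_le_iff by linarith
    qed
    have "Cauchy (\<lambda>n. measure (\<nu> (k n)) B)" using conv\<A>[OF B(1)] by (rule convergent_Cauchy)
    then obtain N' where N': "\<And>m n. m \<ge> N' \<Longrightarrow> n \<ge> N' \<Longrightarrow> \<bar>measure (\<nu> (k m)) B - measure (\<nu> (k n)) B\<bar> < e / 4"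
      using \<open>e > 0\<close> unfolding Cauchy_def dist_real_def by (metis divide_pos_pos zero_less_numeral)
    have "\<bar>measure (\<nu> (k m)) A - measure (\<nu> (k n)) A\<bar> < e" if "m \<ge> max N N'" "n \<ge> max N N'" for m n
      using cl[of m] cl[of n] N'[of m n] that \<open>e > 0\<close> unfolding max.bounded_iff abs_le_iff abs_less_iff by linarith
    then show "\<exists>M. \<forall>m\<ge>M. \<forall>n\<ge>M. dist (measure (\<nu> (k m)) A) (measure (\<nu> (k n)) A) < e"
      unfolding dist_real_def by blast
  qed
  define l where "l A = lim (\<lambda>n. measure (\<nu> (k n)) A)" for A
  have l: "(\<lambda>n. measure (\<nu> (k n)) A) \<longlonglongrightarrow> l A" if "A \<in> sets L" for A
    using conv[OF that] by (simp add: l_def convergent_LIMSEQ_iff)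
  have lnn: "0 \<le> l A" if "A \<in> sets L" for A
    using l[OF that] by (rule LIMSEQ_le_const) auto
  have lequi: "\<exists>d>0. \<forall>A\<in>sets L. measure L A < d \<longrightarrow> l A \<le> e" if e: "e > 0" for e
  proof -
    obtain d N where d: "d > 0" and N: "\<And>n B. n \<ge> N \<Longrightarrow> B \<in> sets L \<Longrightarrow> measure L B < d \<Longrightarrow> measure (\<nu> (k n)) B \<le> e"
      using equik[OF e] by blast
    have "l A \<le> e" if "A \<in> sets L" "measure L A < d" for A
      using l[OF that(1)] by (rule LIMSEQ_le_const2) (use N that in blast)
    then show ?thesis using d by blast
  qed
  have lUn: "l (A \<union> B) = l A + l B" if "A \<in> sets L" "B \<in> sets L" "A \<inter> B = {}" for A B
  proof (rule LIMSEQ_unique)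
    show "(\<lambda>n. measure (\<nu> (k n)) (A \<union> B)) \<longlonglongrightarrow> l (A \<union> B)" using that by (intro l) auto
    have "measure (\<nu> (k n)) (A \<union> B) = measure (\<nu> (k n)) A + measure (\<nu> (k n)) B" for n
      using that by (intro finite_measure.finite_measure_Union f\<nu>) (auto simp: s\<nu>)
    then show "(\<lambda>n. measure (\<nu> (k n)) (A \<union> B)) \<longlonglongrightarrow> l A + l B"
      using tendsto_add[OF l[OF that(1)] l[OF that(2)]] by simp
  qed
  have l0: "l {} = 0" using l[of "{}"] by (simp add: LIMSEQ_const_iff)
  have vm: "vector_measure L l"
    unfolding vector_measure_def
  proof (intro conjI allI impI)
    fix A :: "nat \<Rightarrow> 'a set" assume A: "range A \<subseteq> sets L" "disjoint_family A"
    define U where "U = (\<Union>i. A i)"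
    have UL: "U \<in> sets L" and Un: "(\<Union>i<n. A i) \<in> sets L" for n using A by (auto simp: U_def)
    have s: "l (\<Union>i<n. A i) = (\<Sum>i<n. l (A i))" for n
    proof (induction n)
      case (Suc n)
      have "A i \<inter> A n = {}" if "i < n" for i
        by (rule disjoint_family_onD[OF A(2)]) (use that in auto)
      then have "(\<Union>i<n. A i) \<inter> A n = {}" by blast
      then have "l ((\<Union>i<n. A i) \<union> A n) = l (\<Union>i<n. A i) + l (A n)" using A Un by (intro lUn) auto
      then show ?case using Suc by (simp add: lessThan_Suc Un_commute)
    qed (simp add: l0)
    \<comment> \<open>Remainders of a disjoint union have vanishing \<open>L\<close>-measure; by
      \<open>lequi\<close> their limit masses vanish too, which is countable additivity.\<close>
    have lim: "(\<lambda>n. measure L (U - (\<Union>i<n. A i))) \<longlonglongrightarrow> 0"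
    proof -
      have "(\<lambda>n. measure L (\<Union>i<n. A i)) \<longlonglongrightarrow> measure L (\<Union>n. \<Union>i<n. A i)"
        using Un by (intro L.finite_Lim_measure_incseq) (force simp: incseq_def)+
      moreover have "(\<Union>n. \<Union>i<n. A i) = U" by (auto simp: U_def)
      ultimately have "(\<lambda>n. measure L U - measure L (\<Union>i<n. A i)) \<longlonglongrightarrow> measure L U - measure L U"
        by (intro tendsto_diff) auto
      moreover have "measure L (U - (\<Union>i<n. A i)) = measure L U - measure L (\<Union>i<n. A i)" for n
        using UL Un by (intro L.finite_measure_Diff) (auto simp: U_def)
      ultimately show ?thesis by simp
    qed
    show "(\<lambda>i. l (A i)) sums l (\<Union>i. A i)"
      unfolding sums_def U_def[symmetric]
    proof (rule LIMSEQ_I)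
      fix e :: real assume "e > 0"
      then have "e / 2 > 0" by simp
      then obtain d where d: "d > 0" "\<And>A. A \<in> sets L \<Longrightarrow> measure L A < d \<Longrightarrow> l A \<le> e / 2" using lequi by blast
      obtain N where N: "\<And>n. n \<ge> N \<Longrightarrow> measure L (U - (\<Union>i<n. A i)) < d"
        using LIMSEQ_D[OF lim d(1)] by auto
      have "norm ((\<Sum>i<n. l (A i)) - l U) < e" if "n \<ge> N" for n
      proof -
        have "U - (\<Union>i<n. A i) \<in> sets L" using UL Un by auto
        moreover have "U = (\<Union>i<n. A i) \<union> (U - (\<Union>i<n. A i))" by (auto simp: U_def)
        ultimately have "l U = l (\<Union>i<n. A i) + l (U - (\<Union>i<n. A i))" "l (U - (\<Union>i<n. A i)) \<le> e / 2" "0 \<le> l (U - (\<Union>i<n. A i))"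
          using lUn[of "\<Union>i<n. A i" "U - (\<Union>i<n. A i)"] Un N[OF that] d(2) lnn by auto
        then show ?thesis using \<open>e > 0\<close> by (simp add: s)
      qed
      then show "\<exists>no. \<forall>n\<ge>no. norm ((\<Sum>i<n. l (A i)) - l U) < e" by blast
    qed
  qed (rule l0)
  obtain P where P: "finite_measure P" "sets P = sets L" "\<And>A. A \<in> sets L \<Longrightarrow> measure P A = l A"
    using nonneg_vector_measure_obtain[OF vm lnn] by blast
  have ac: "absolutely_continuous L P"
    unfolding absolutely_continuous_def
  proof
    fix A assume A: "A \<in> null_sets L"
    then have AL: "A \<in> sets L" "measure L A = 0" by (auto simp: measure_def)
    have "l A \<le> 0"
    proof (rule field_le_epsilon)
      fix e :: real assume "e > 0"
      then show "l A \<le> 0 + e" using lequi[of e] AL by auto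
    qed
    then have "measure P A = 0" using lnn[OF AL(1)] P(3)[OF AL(1)] by simp
    then show "A \<in> null_sets P"
      using AL P(2) finite_measure.emeasure_eq_measure[OF P(1), of A] by (intro null_setsI) auto
  qed
  obtain g :: "'a \<Rightarrow> real" where g: "integrable L g" "\<And>x. 0 \<le> g x" "density L (\<lambda>x. ennreal (g x)) = P"
    using real_density_obtain[OF fin P(1,2) ac] by blast
  show ?thesis
    by (rule that[OF k(1) g(1,2)]) (use l P g in auto)
qed

text \<open>The point is the order of quantifiers: the level sets \<open>C i\<close> depend on
  \<open>\<psi>\<close> and \<open>d\<close> alone, so one simple function serves every finite
  measure at once, in particular every member of a sequence or of a family in time.\<close>

lemma bounded_simple_approx:
  fixes \<psi> :: "'a \<Rightarrow> real"
  assumes \<psi>: "\<psi> \<in> borel_measurable M" "\<And>x. x \<in> space M \<Longrightarrow> \<bar>\<psi> x\<bar> \<le> B" and d: "d > 0"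
  obtains J :: "int set" and C :: "int \<Rightarrow> 'a set" where "finite J" "\<And>i. C i \<in> sets M"
    "\<And>Q. finite_measure Q \<Longrightarrow> sets Q = sets M \<Longrightarrow>
      \<bar>(LINT x|Q. \<psi> x) - (\<Sum>i\<in>J. d * of_int i * measure Q (C i))\<bar> \<le> d * measure Q (space M)"
proof -
  \<comment> \<open>Rounding down to the grid of step \<open>d\<close>; boundedness of
    \<open>\<psi>\<close> leaves finitely many values.\<close>
  define s where "s x = d * of_int \<lfloor>\<psi> x / d\<rfloor>" for x
  define J where "J = {\<lfloor>- B / d\<rfloor>..\<lfloor>B / d\<rfloor>}"
  define C where "C i = {x\<in>space M. \<lfloor>\<psi> x / d\<rfloor> = i}" for i
  have C: "C i \<in> sets M" for i
  proof -
    have "C i = {x\<in>space M. of_int i \<le> \<psi> x / d \<and> \<psi> x / d < of_int i + 1}"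
      by (auto simp: C_def floor_eq_iff)
    also have "\<dots> \<in> sets M" using \<psi>(1) by measurable
    finally show ?thesis .
  qed
  have s: "\<bar>\<psi> x - s x\<bar> \<le> d" for x
  proof -
    have "of_int \<lfloor>\<psi> x / d\<rfloor> \<le> \<psi> x / d" "\<psi> x / d < of_int \<lfloor>\<psi> x / d\<rfloor> + 1" by linarith+
    then have "s x \<le> d * (\<psi> x / d)" "d * (\<psi> x / d) < d * (of_int \<lfloor>\<psi> x / d\<rfloor> + 1)"
      unfolding s_def using d by (blast intro: mult_left_mono mult_strict_left_mono less_imp_le)+
    then have "s x \<le> \<psi> x" "\<psi> x < s x + d" using d by (simp_all add: s_def algebra_simps)
    then show ?thesis by simp
  qed
  have sum: "s x = (\<Sum>i\<in>J. d * of_int i * indicator (C i) x)" if "x \<in> space M" for x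
  proof -
    have "\<lfloor>\<psi> x / d\<rfloor> \<in> J"
      using \<psi>(2)[OF that] d unfolding J_def abs_le_iff
      by (auto intro!: floor_mono divide_right_mono simp del: divide_minus_left)
    moreover have "(\<Sum>i\<in>J. d * of_int i * indicator (C i) x) = (\<Sum>i\<in>J. if i = \<lfloor>\<psi> x / d\<rfloor> then d * of_int i else 0)"
      using that by (intro sum.cong) (auto simp: C_def indicator_def)
    ultimately show ?thesis by (simp add: s_def J_def)
  qed
  show ?thesis
  proof (rule that[of J C])
    show "finite J" by (simp add: J_def)
    show "C i \<in> sets M" for i by (rule C)
    fix Q assume Q: "finite_measure Q" "sets Q = sets M"
    interpret Q: finite_measure Q by fact
    have spQ: "space Q = space M" using Q sets_eq_imp_space_eq by blast
    have ii: "integrable Q (indicator (C i) :: 'a \<Rightarrow> real)" for i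
      using C Q by (intro integrable_real_indicator) (auto simp: less_top[symmetric])
    have CQ: "C i \<inter> space Q = C i" for i by (auto simp: C_def spQ)
    have "(LINT x|Q. s x) = (LINT x|Q. (\<Sum>i\<in>J. d * of_int i * indicator (C i) x))"
      using sum by (intro Bochner_Integration.integral_cong) (auto simp: spQ)
    also have "\<dots> = (\<Sum>i\<in>J. d * of_int i * measure Q (C i))"
      using ii by (simp add: CQ)
    finally have 1: "(LINT x|Q. s x) = (\<Sum>i\<in>J. d * of_int i * measure Q (C i))" .
    have "integrable Q (\<lambda>x. (\<Sum>i\<in>J. d * of_int i * indicator (C i) x))"
      using ii by (intro Bochner_Integration.integrable_sum integrable_mult_right)
    then have int_s: "integrable Q s" using sum by (subst Bochner_Integration.integrable_cong) (auto simp: spQ)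
    have i\<psi>: "integrable Q \<psi>" using \<psi> Q by (intro integrable_bounded[of _ _ B]) (auto simp: spQ measurable_cong_sets[OF Q(2) refl])
    have "\<bar>(LINT x|Q. \<psi> x) - (LINT x|Q. s x)\<bar> = \<bar>LINT x|Q. \<psi> x - s x\<bar>" using int_s i\<psi> by simp
    also have "\<dots> \<le> (LINT x|Q. \<bar>\<psi> x - s x\<bar>)" by (rule integral_abs_bound)
    also have "\<dots> \<le> (LINT x|Q. d)" using int_s i\<psi> s by (intro integral_mono) auto
    finally show "\<bar>(LINT x|Q. \<psi> x) - (\<Sum>i\<in>J. d * of_int i * measure Q (C i))\<bar> \<le> d * measure Q (space M)"
      by (simp add: spQ mult.commute 1)
  qed
qed

text \<open>One simple function approximates \<open>\<psi>\<close> for all measures with error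
  \<open>d\<close> times the total mass; the total masses converge, hence are eventually below
  \<open>K\<close>.\<close>

lemma setwise_convergence_bounded_integral:
  fixes \<psi> :: "'a \<Rightarrow> real"
  assumes fP: "finite_measure P" and fn: "\<And>n. finite_measure (Pn n)" and sn: "\<And>n. sets (Pn n) = sets P"
    and conv: "\<And>A. A \<in> sets P \<Longrightarrow> (\<lambda>n. measure (Pn n) A) \<longlonglongrightarrow> measure P A"
    and \<psi>: "\<psi> \<in> borel_measurable P" "\<And>x. x \<in> space P \<Longrightarrow> \<bar>\<psi> x\<bar> \<le> B"
  shows "(\<lambda>n. LINT x|Pn n. \<psi> x) \<longlonglongrightarrow> (LINT x|P. \<psi> x)"
proof (rule LIMSEQ_I)
  fix e :: real assume e: "e > 0"
  define K where "K = measure P (space P) + 1"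
  have K0: "K > 0" by (simp add: K_def add_nonneg_pos)
  have cK: "(\<lambda>n. measure (Pn n) (space P)) \<longlonglongrightarrow> measure P (space P)" by (intro conv) auto
  define d where "d = e / (4 * K)"
  have d: "d > 0" using e K0 by (simp add: d_def)
  obtain J C where J: "finite J" and C: "\<And>i. C i \<in> sets P"
    and err: "\<And>Q. finite_measure Q \<Longrightarrow> sets Q = sets P \<Longrightarrow>
      \<bar>(LINT x|Q. \<psi> x) - (\<Sum>i\<in>J. d * of_int i * measure Q (C i))\<bar> \<le> d * measure Q (space P)"
    using bounded_simple_approx[OF \<psi> d] by blast
  define S where "S Q = (\<Sum>i\<in>J. d * of_int i * measure Q (C i))" for Q
  have lS: "(\<lambda>n. S (Pn n)) \<longlonglongrightarrow> S P"
    unfolding S_def by (intro tendsto_intros conv C)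
  have e2: "e / 2 > 0" using e by simp
  from LIMSEQ_D[OF lS e2] obtain N1 where N1: "\<And>n. n \<ge> N1 \<Longrightarrow> \<bar>S (Pn n) - S P\<bar> < e / 2"
    unfolding real_norm_def by blast
  from LIMSEQ_D[OF cK zero_less_one]
  obtain N2 where N2: "\<And>n. n \<ge> N2 \<Longrightarrow> \<bar>measure (Pn n) (space P) - measure P (space P)\<bar> < 1"
    unfolding real_norm_def by blast
  have "norm ((LINT x|Pn n. \<psi> x) - (LINT x|P. \<psi> x)) < e" if "n \<ge> max N1 N2" for n
  proof -
    have "measure (Pn n) (space P) \<le> K" "measure P (space P) \<le> K"
      using N2[of n] that unfolding K_def by linarith+
    then have "d * measure (Pn n) (space P) \<le> d * K" "d * measure P (space P) \<le> d * K"
      using d by (auto intro: mult_left_mono)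
    moreover have "d * K = e / 4" using K0 by (simp add: d_def)
    moreover have "\<bar>S (Pn n) - S P\<bar> < e / 2" using N1 that by simp
    ultimately show ?thesis using err[OF fn sn, of n] err[OF fP refl] unfolding S_def[symmetric] real_norm_def
      by linarith
  qed
  then show "\<exists>no. \<forall>n\<ge>no. norm ((LINT x|Pn n. \<psi> x) - (LINT x|P. \<psi> x)) < e" by blast
qed

text \<open>Positive and negative parts are extracted one after the other. They inherit the bound
  and the equi-absolute continuity from \<open>\<nu>\<close> because each of their values is, up to
  sign, a value of \<open>\<nu>\<close> on a subset.\<close>

theorem setwise_compactness_signed:
  fixes \<nu> :: "nat \<Rightarrow> 'a set \<Rightarrow> real"
  assumes fin: "finite_measure L" and G: "countable G" "G \<subseteq> Pow (space L)" "sets L = sigma_sets (space L) G"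
    and vm: "\<And>n. vector_measure L (\<nu> n)"
    and K: "\<And>n A. A \<in> sets L \<Longrightarrow> \<bar>\<nu> n A\<bar> \<le> K"
    and equi: "\<And>e. e > 0 \<Longrightarrow> \<exists>d>0. \<exists>N. \<forall>n\<ge>N. \<forall>A\<in>sets L. measure L A < d \<longrightarrow> \<bar>\<nu> n A\<bar> \<le> e"
  obtains k :: "nat \<Rightarrow> nat" and g :: "'a \<Rightarrow> real" where "strict_mono k" "integrable L g"
    "\<And>\<psi> B. \<psi> \<in> borel_measurable L \<Longrightarrow> (\<And>x. x \<in> space L \<Longrightarrow> \<bar>\<psi> x\<bar> \<le> B) \<Longrightarrow>
      (\<lambda>n. signed_integral L (\<nu> (k n)) \<psi>) \<longlonglongrightarrow> (LINT x|L. \<psi> x * g x)"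
proof -
  define Q where "Q P N n \<longleftrightarrow> finite_measure P \<and> finite_measure N \<and> sets P = sets L \<and> sets N = sets L \<and>
    (\<forall>A\<in>sets L. \<nu> n A = measure P A - measure N A) \<and>
    (\<forall>A\<in>sets L. \<exists>B\<in>sets L. B \<subseteq> A \<and> measure P A = \<nu> n B) \<and>
    (\<forall>A\<in>sets L. \<exists>B\<in>sets L. B \<subseteq> A \<and> measure N A = - \<nu> n B)" for P N n
  have "\<forall>n. \<exists>PN. Q (fst PN) (snd PN) n"
  proof
    fix n
    obtain P N where "finite_measure P" "finite_measure N" "sets P = sets L" "sets N = sets L"
      "\<And>A. A \<in> sets L \<Longrightarrow> \<nu> n A = measure P A - measure N A"
      "\<And>A. A \<in> sets L \<Longrightarrow> \<exists>B\<in>sets L. B \<subseteq> A \<and> measure P A = \<nu> n B"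
      "\<And>A. A \<in> sets L \<Longrightarrow> \<exists>B\<in>sets L. B \<subseteq> A \<and> measure N A = - \<nu> n B"
      by (rule Jordan_decomposition_vector_measure[OF vm[of n]]) (rule that)
    then have "Q P N n" unfolding Q_def by (intro conjI ballI)
    then show "\<exists>PN. Q (fst PN) (snd PN) n" by (intro exI[of _ "(P, N)"]) simp
  qed
  from choice[OF this] obtain PN where PN: "\<And>n. Q (fst (PN n)) (snd (PN n)) n" by blast
  define P where "P n = fst (PN n)" for n
  define N where "N n = snd (PN n)" for n
  have Q: "Q (P n) (N n) n" for n using PN by (simp add: P_def N_def)
  have f: "finite_measure (P n)" "finite_measure (N n)"
    and s: "sets (P n) = sets L" "sets (N n) = sets L" for n
    using Q[of n] unfolding Q_def by simp_all
  have eq: "\<nu> n A = measure (P n) A - measure (N n) A"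
    and BP: "\<exists>B\<in>sets L. B \<subseteq> A \<and> measure (P n) A = \<nu> n B"
    and BN: "\<exists>B\<in>sets L. B \<subseteq> A \<and> measure (N n) A = - \<nu> n B" if A: "A \<in> sets L" for n A
    using Q[of n] unfolding Q_def by (blast intro: A)+
  have le: "measure (P n) A \<le> e" "measure (N n) A \<le> e"
    if A: "A \<in> sets L" "\<And>B. B \<in> sets L \<Longrightarrow> B \<subseteq> A \<Longrightarrow> \<bar>\<nu> n B\<bar> \<le> e" for n A e
  proof -
    obtain B B' where "B \<in> sets L" "B \<subseteq> A" "measure (P n) A = \<nu> n B"
      "B' \<in> sets L" "B' \<subseteq> A" "measure (N n) A = - \<nu> n B'"
      using BP[OF A(1), of n] BN[OF A(1), of n] by (elim bexE conjE) (rule that)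
    then show "measure (P n) A \<le> e" "measure (N n) A \<le> e"
      using A(2)[of B] A(2)[of B'] by (simp_all add: abs_le_iff)
  qed
  have bd: "measure (P n) A \<le> K" "measure (N n) A \<le> K" if "A \<in> sets L" for n A
    using le[OF that, of n K] K by simp_all
  have bdS: "measure (P n) (space L) \<le> K" "measure (N n) (space L) \<le> K" for n
    using bd[OF sets.top] by simp_all
  have eqP: "\<exists>d>0. \<exists>M. \<forall>n\<ge>M. \<forall>A\<in>sets L. measure L A < d \<longrightarrow> measure (P n) A \<le> e \<and> measure (N n) A \<le> e"
    if e: "e > 0" for e
  proof -
    obtain d M where d: "d > 0" and M: "\<And>n A. n \<ge> M \<Longrightarrow> A \<in> sets L \<Longrightarrow> measure L A < d \<Longrightarrow> \<bar>\<nu> n A\<bar> \<le> e"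
      using equi[OF e] by blast
    have "measure (P n) A \<le> e \<and> measure (N n) A \<le> e" if "n \<ge> M" "A \<in> sets L" "measure L A < d" for n A
    proof -
      have *: "\<bar>\<nu> n B\<bar> \<le> e" if "B \<in> sets L" "B \<subseteq> A" for B
        using finite_measure.finite_measure_mono[OF fin that(2) \<open>A \<in> sets L\<close>] \<open>measure L A < d\<close> \<open>n \<ge> M\<close> that
        by (intro M) auto
      show ?thesis using le[OF that(2), of n e] * by simp
    qed
    then show ?thesis using d by blast
  qed
  obtain k1 g1 where 1: "strict_mono (k1 :: nat \<Rightarrow> nat)" "integrable L g1" "\<And>x. 0 \<le> (g1 x :: real)"
    "\<And>A. A \<in> sets L \<Longrightarrow> (\<lambda>n. measure (P (k1 n)) A) \<longlonglongrightarrow> measure (density L (\<lambda>x. ennreal (g1 x))) A"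
  proof (rule setwise_compactness_nonneg[OF fin G f(1) s(1) bdS(1)])
    show "\<exists>d>0. \<exists>M. \<forall>n\<ge>M. \<forall>A\<in>sets L. measure L A < d \<longrightarrow> measure (P n) A \<le> e" if "e > 0" for e
      using eqP[OF that] by blast
  qed (rule that)
  obtain k2 g2 where 2: "strict_mono (k2 :: nat \<Rightarrow> nat)" "integrable L g2" "\<And>x. 0 \<le> (g2 x :: real)"
    "\<And>A. A \<in> sets L \<Longrightarrow> (\<lambda>n. measure (N (k1 (k2 n))) A) \<longlonglongrightarrow> measure (density L (\<lambda>x. ennreal (g2 x))) A"
  proof (rule setwise_compactness_nonneg[OF fin G, of "\<lambda>n. N (k1 n)", OF f(2) s(2) bdS(2)])
    show "\<exists>d>0. \<exists>M. \<forall>n\<ge>M. \<forall>A\<in>sets L. measure L A < d \<longrightarrow> measure (N (k1 n)) A \<le> e" if e: "e > 0" for e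
    proof -
      obtain d M where d: "d > 0" and M: "\<And>n A. n \<ge> M \<Longrightarrow> A \<in> sets L \<Longrightarrow> measure L A < d \<Longrightarrow> measure (N n) A \<le> e"
        using eqP[OF e] by blast
      have "measure (N (k1 n)) A \<le> e" if "n \<ge> M" "A \<in> sets L" "measure L A < d" for n A
        using seq_suble[OF 1(1), of n] that by (intro M) auto
      then show ?thesis using d by blast
    qed
  qed (rule that)
  show ?thesis
  proof (rule that[of "k1 \<circ> k2" "\<lambda>x. g1 x - g2 x"])
    show "strict_mono (k1 \<circ> k2)" using 1(1) 2(1) by (rule strict_mono_o)
    show "integrable L (\<lambda>x. g1 x - g2 x)" using 1(2) 2(2) by simp
    fix \<psi> :: "'a \<Rightarrow> real" and B assume \<psi>: "\<psi> \<in> borel_measurable L" "\<And>x. x \<in> space L \<Longrightarrow> \<bar>\<psi> x\<bar> \<le> B"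
    have fd: "finite_measure (density L (\<lambda>x. ennreal (g x)))" if "integrable L g" "\<And>x. 0 \<le> g x" for g
      using that by (intro finite_measureI)
        (simp add: emeasure_density nn_integral_eq_integral cong: nn_integral_cong)
    have lim: "(\<lambda>n. LINT x|Q n. \<psi> x) \<longlonglongrightarrow> (LINT x|L. \<psi> x * g x)"
      if "\<And>n. finite_measure (Q n)" "\<And>n. sets (Q n) = sets L" "integrable L g" "\<And>x. 0 \<le> g x"
        "\<And>A. A \<in> sets L \<Longrightarrow> (\<lambda>n. measure (Q n) A) \<longlonglongrightarrow> measure (density L (\<lambda>x. ennreal (g x))) A"
      for Q :: "nat \<Rightarrow> 'a measure" and g
    proof -
      have "(\<lambda>n. LINT x|Q n. \<psi> x) \<longlonglongrightarrow> (LINT x|density L (\<lambda>x. ennreal (g x)). \<psi> x)"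
        using that \<psi> fd by (intro setwise_convergence_bounded_integral[of _ _ _ B]) auto
      also have "(LINT x|density L (\<lambda>x. ennreal (g x)). \<psi> x) = (LINT x|L. g x * \<psi> x)"
        using that \<psi> by (intro integral_real_density) auto
      finally show ?thesis by (simp add: mult.commute)
    qed
    have lim1: "(\<lambda>n. LINT x|P (k1 (k2 n)). \<psi> x) \<longlonglongrightarrow> (LINT x|L. \<psi> x * g1 x)"
      using LIMSEQ_subseq_LIMSEQ[OF lim[of "\<lambda>n. P (k1 n)" g1] 2(1)] f s 1 by (simp add: o_def)
    have lim2: "(\<lambda>n. LINT x|N (k1 (k2 n)). \<psi> x) \<longlonglongrightarrow> (LINT x|L. \<psi> x * g2 x)"
      using f s 2 by (intro lim) auto
    have int: "integrable L (\<lambda>x. \<psi> x * g x)" if "integrable L g" for g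
    proof (rule Bochner_Integration.integrable_bound[where f="\<lambda>x. B * g x"])
      show "AE x in L. norm (\<psi> x * g x) \<le> norm (B * g x)"
      proof (rule AE_I2)
        fix x assume "x \<in> space L"
        then have "\<bar>\<psi> x\<bar> \<le> \<bar>B\<bar>" using \<psi>(2)[of x] by linarith
        then show "norm (\<psi> x * g x) \<le> norm (B * g x)" by (simp add: abs_mult mult_right_mono)
      qed
    qed (use that \<psi> in auto)
    have "(LINT x|L. \<psi> x * (g1 x - g2 x)) = (LINT x|L. \<psi> x * g1 x) - (LINT x|L. \<psi> x * g2 x)"
      using int[OF 1(2)] int[OF 2(2)] by (simp add: right_diff_distrib)
    moreover have "signed_integral L (\<nu> n) \<psi> = (LINT x|P n. \<psi> x) - (LINT x|N n. \<psi> x)" for n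
      using f s eq \<psi> by (intro signed_integral_eq[where B=B]) auto
    ultimately show "(\<lambda>n. signed_integral L (\<nu> ((k1 \<circ> k2) n)) \<psi>) \<longlonglongrightarrow> (LINT x|L. \<psi> x * (g1 x - g2 x))"
      using tendsto_diff[OF lim1 lim2] by simp
  qed
qed

section \<open>The torus\<close>

lemma to_torus_rep [simp]: "to_torus (rep_torus z) = z"
  by (rule Quotient3_abs_rep[OF Quotient3_torus])

lemma rep_to_torus: "rep_torus (to_torus x) - x \<in> \<int>"
  using to_torus_eq_iff[of "rep_torus (to_torus x)" x] by simp

lemma continuous_on_torus_iff:
  fixes g :: "torus \<Rightarrow> 'b::topological_space"
  shows "continuous_on UNIV g \<longleftrightarrow> continuous_on UNIV (\<lambda>x. g (to_torus x))"
proof -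
  have "to_torus -` (g -` B) = (\<lambda>x. g (to_torus x)) -` B" for B by auto
  then show ?thesis by (simp add: continuous_on_open_vimage open_torus_def)
qed

lemma continuous_to_torus: "continuous_on UNIV to_torus"
  by (simp add: continuous_on_open_vimage open_torus_def)

lemma measurable_to_torus [measurable]: "to_torus \<in> borel_measurable borel"
  by (rule borel_measurable_continuous_onI[OF continuous_to_torus])

lemma compact_torus: "compact (UNIV :: torus set)"
proof -
  have "z \<in> to_torus ` {0..1}" for z
  proof -
    have "to_torus (frac (rep_torus z)) = to_torus (rep_torus z)"
      by (simp only: to_torus_eq_iff frac_def) (simp add: Ints_minus)
    then show ?thesis using frac_ge_0[of "rep_torus z"] frac_lt_1[of "rep_torus z"]
      by (intro image_eqI[of _ _ "frac (rep_torus z)"]) auto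
  qed
  then have "(UNIV :: torus set) = to_torus ` {0..1}" by blast
  moreover have "compact (to_torus ` {0..1})"
    by (intro compact_continuous_image continuous_on_subset[OF continuous_to_torus]) auto
  ultimately show ?thesis by simp
qed

lemma bounded_continuous_torus:
  fixes \<phi> :: "torus \<Rightarrow> real"
  assumes "continuous_on UNIV \<phi>"
  obtains B where "0 < B" "\<And>z. \<bar>\<phi> z\<bar> \<le> B"
proof -
  have "compact (range \<phi>)" using assms compact_torus by (rule compact_continuous_image)
  then have "bounded (range \<phi>)" by (rule compact_imp_bounded)
  then obtain B where "0 < B" "\<And>z. norm (\<phi> z) \<le> B" by (auto simp: bounded_pos)
  then show ?thesis using that by auto
qed

lemma space_torus_lebesgue [simp]: "space torus_lebesgue = UNIV"
  and sets_torus_lebesgue [simp, measurable_cong]: "sets torus_lebesgue = sets borel"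
  by (simp_all add: torus_lebesgue_def)

lemma prob_space_torus_lebesgue: "prob_space torus_lebesgue"
proof -
  have "emeasure (restrict_space lborel {0..<1::real}) (space (restrict_space lborel {0..<1})) = 1"
    by (simp add: emeasure_restrict_space space_restrict_space)
  then have "prob_space (restrict_space lborel {0..<1::real})" by (rule prob_spaceI)
  then show ?thesis unfolding torus_lebesgue_def
    by (rule prob_space.prob_space_distr) (simp add: measurable_restrict_space1)
qed

interpretation torus: prob_space torus_lebesgue
  by (rule prob_space_torus_lebesgue)

lemma integral_torus_lebesgue:
  fixes g :: "torus \<Rightarrow> real"
  assumes [measurable]: "g \<in> borel_measurable borel"
  shows "(LINT z|torus_lebesgue. g z) = (LINT x|lborel. indicator {0..<1} x * g (to_torus x))"
proof -
  have "(LINT z|torus_lebesgue. g z) = (LINT x|restrict_space lborel {0..<1}. g (to_torus x))"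
    unfolding torus_lebesgue_def
  proof (rule integral_distr)
    show "to_torus \<in> measurable (restrict_space lborel {0..<1}) borel"
      by (simp add: measurable_restrict_space1)
  qed (rule assms)
  then show ?thesis by (simp add: integral_restrict_space)
qed

text \<open>A relation between functions on the torus, stated through the periodic lift, so that
  real derivative rules apply directly and the derivative is again a function on the torus.\<close>

definition torus_deriv :: "(torus \<Rightarrow> real) \<Rightarrow> (torus \<Rightarrow> real) \<Rightarrow> bool"
  where "torus_deriv F G \<longleftrightarrow> (\<forall>x. ((\<lambda>x. F (to_torus x)) has_real_derivative G (to_torus x)) (at x))"

text \<open>Periodicity cancels the boundary terms of the fundamental theorem of calculus.
  Integrations by parts on the torus are cast in this form below.\<close>

lemma integral_torus_deriv_eq_0:
  assumes F: "torus_deriv F G" and G: "continuous_on UNIV G"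
  shows "(LINT z|torus_lebesgue. G z) = 0"
proof -
  have Gm [measurable]: "G \<in> borel_measurable borel" by (rule borel_measurable_continuous_onI[OF G])
  have "(LINT z|torus_lebesgue. G z) = (LINT x|lborel. indicator {0..<1} x * G (to_torus x))"
    by (rule integral_torus_lebesgue) simp
  also have "\<dots> = (LINT x|lborel. indicator {0..1} x *\<^sub>R G (to_torus x))"
    using AE_lborel_singleton[of "1::real"]
    by (intro Bochner_Integration.integral_cong_AE) (auto simp: indicator_def)
  also have "\<dots> = F (to_torus 1) - F (to_torus 0)"
  proof (rule integral_FTC_atLeastAtMost)
    show "((\<lambda>x. F (to_torus x)) has_vector_derivative G (to_torus x)) (at x within {0..1})" for x
      by (rule has_vector_derivative_at_within)
        (use F in \<open>simp add: torus_deriv_def has_real_derivative_iff_has_vector_derivative\<close>)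
    show "continuous_on {0..1} (\<lambda>x. G (to_torus x))"
      using G unfolding continuous_on_torus_iff by (rule continuous_on_subset) simp
  qed simp
  also have "to_torus 1 = to_torus 0" by (simp add: to_torus_eq_iff)
  finally show ?thesis by simp
qed

section \<open>Trigonometric functions and the de la Vallee Poussin kernel on the torus\<close>

definition tcos :: "torus \<Rightarrow> real" where "tcos z = cos (2 * pi * rep_torus z)"
definition tsin :: "torus \<Rightarrow> real" where "tsin z = sin (2 * pi * rep_torus z)"

lemma tcos_to_torus [simp]: "tcos (to_torus x) = cos (2 * pi * x)"
  and tsin_to_torus [simp]: "tsin (to_torus x) = sin (2 * pi * x)"
proof -
  obtain n where n: "rep_torus (to_torus x) - x = of_int n"
    using rep_to_torus[of x] by (auto elim: Ints_cases)
  then have "2 * pi * rep_torus (to_torus x) = 2 * pi * x + 2 * pi * of_int n"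
    by (simp add: algebra_simps)
  then show "tcos (to_torus x) = cos (2 * pi * x)" "tsin (to_torus x) = sin (2 * pi * x)"
    unfolding tcos_def tsin_def by (simp_all add: cos_add sin_add)
qed

lemma continuous_tcos [continuous_intros]: "continuous_on UNIV tcos"
  and continuous_tsin [continuous_intros]: "continuous_on UNIV tsin"
  by (simp_all add: continuous_on_torus_iff continuous_intros)

lemma measurable_tcos [measurable]: "tcos \<in> borel_measurable borel"
  and measurable_tsin [measurable]: "tsin \<in> borel_measurable borel"
  by (simp_all add: borel_measurable_continuous_onI continuous_intros)

lemma tcos_bound: "\<bar>tcos z\<bar> \<le> 1" and tsin_bound: "\<bar>tsin z\<bar> \<le> 1"
  by (simp_all add: tcos_def tsin_def)

text \<open>Cosine and sine of \<open>2 * pi * (z - w)\<close>, expanded by the addition theorems,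
  which displays them as sums of products of functions of \<open>z\<close> and of
  \<open>w\<close>.\<close>

definition cosdiff :: "torus \<Rightarrow> torus \<Rightarrow> real" where "cosdiff z w = tcos z * tcos w + tsin z * tsin w"
definition sindiff :: "torus \<Rightarrow> torus \<Rightarrow> real" where "sindiff z w = tsin z * tcos w - tcos z * tsin w"

lemma cosdiff_eq: "cosdiff z w = cos (2 * pi * (rep_torus z - rep_torus w))"
  unfolding cosdiff_def tcos_def tsin_def by (simp add: right_diff_distrib cos_diff)

lemma sindiff_eq: "sindiff z w = sin (2 * pi * (rep_torus z - rep_torus w))"
  unfolding sindiff_def tcos_def tsin_def by (simp add: right_diff_distrib sin_diff)

lemma cosdiff_bounds: "- 1 \<le> cosdiff z w" "cosdiff z w \<le> 1"
  by (simp_all add: cosdiff_eq)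

lemma cosdiff_commute: "cosdiff z w = cosdiff w z"
  by (simp add: cosdiff_def mult.commute)

lemma sindiff_commute: "sindiff z w = - sindiff w z"
  by (simp add: sindiff_def mult.commute)

lemma sindiff_squared: "sindiff z w ^ 2 = (1 - cosdiff z w) * (1 + cosdiff z w)"
proof -
  have "sindiff z w ^ 2 = 1 - cosdiff z w ^ 2"
    unfolding sindiff_eq cosdiff_eq by (rule sin_squared_eq)
  then show ?thesis by (simp add: power2_eq_square algebra_simps)
qed

text \<open>\<open>1 - cosdiff\<close> is half the squared chordal distance and plays the role of a
  metric below.\<close>

lemma cosdiff_eq_1D: assumes "cosdiff z w = 1" shows "z = w"
proof -
  obtain n :: int where "2 * pi * (rep_torus z - rep_torus w) = of_int n * 2 * pi"
    using assms unfolding cosdiff_eq cos_one_2pi_int by blast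
  then have "rep_torus z - rep_torus w = of_int n" by simp
  then have "to_torus (rep_torus z) = to_torus (rep_torus w)" unfolding to_torus_eq_iff by simp
  then show ?thesis by simp
qed

lemma continuous_cosdiff: "continuous_on UNIV (\<lambda>z. cosdiff z w)" "continuous_on UNIV (\<lambda>z. sindiff z w)"
  unfolding cosdiff_def sindiff_def by (intro continuous_intros)+

lemma torus_deriv_cosdiff:
  "torus_deriv (\<lambda>z. cosdiff z w) (\<lambda>z. - 2 * pi * sindiff z w)"
  "torus_deriv (\<lambda>z. sindiff z w) (\<lambda>z. 2 * pi * cosdiff z w)"
  unfolding torus_deriv_def cosdiff_def sindiff_def
  by (auto intro!: derivative_eq_intros simp: algebra_simps)

text \<open>The index \<open>(i, j)\<close> holds the degree and the power of the cosine, as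
  produced by two nested binomial expansions.\<close>

definition tmon :: "nat \<times> nat \<Rightarrow> torus \<Rightarrow> real"
  where "tmon p z = tcos z ^ snd p * tsin z ^ (fst p - snd p)"

text \<open>An exponent \<open>0 - 1\<close> truncates to 0, which is harmless since its coefficient
  \<open>real 0\<close> vanishes.\<close>

definition dtmon :: "nat \<times> nat \<Rightarrow> torus \<Rightarrow> real"
  where "dtmon p z = 2 * pi * (tcos z ^ snd p * (real (fst p - snd p) * tsin z ^ (fst p - snd p - 1) * tcos z)
    - real (snd p) * tcos z ^ (snd p - 1) * tsin z * tsin z ^ (fst p - snd p))"

lemma continuous_tmon: "continuous_on UNIV (tmon p)" and continuous_dtmon: "continuous_on UNIV (dtmon p)"
  unfolding tmon_def dtmon_def by (intro continuous_intros)+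

lemma measurable_tmon [measurable]: "tmon p \<in> borel_measurable borel"
  and measurable_dtmon [measurable]: "dtmon p \<in> borel_measurable borel"
  by (simp_all add: borel_measurable_continuous_onI continuous_tmon continuous_dtmon)

lemma tmon_bound: "\<bar>tmon p z\<bar> \<le> 1"
  unfolding tmon_def abs_mult power_abs
  by (intro mult_le_one power_le_one tcos_bound tsin_bound) auto

lemma torus_deriv_tmon: "torus_deriv (tmon p) (dtmon p)"
  unfolding torus_deriv_def tmon_def dtmon_def
  by (auto intro!: derivative_eq_intros simp: algebra_simps)

definition tker_norm :: "nat \<Rightarrow> real" where "tker_norm n = (LINT z|torus_lebesgue. (1 + tcos z) ^ n)"
text \<open>The de la Vallee Poussin kernel, proportional to the 2n-th power of
  \<open>cos (pi * (z - w))\<close>. It is nonnegative, symmetric, translation invariant and a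
  trigonometric polynomial.\<close>

definition tker :: "nat \<Rightarrow> torus \<Rightarrow> torus \<Rightarrow> real" where "tker n z w = (1 + cosdiff z w) ^ n / tker_norm n"
definition tidx :: "nat \<Rightarrow> (nat \<times> nat) set" where "tidx n = Sigma {..n} (\<lambda>i. {..i})"
definition tcoef :: "nat \<Rightarrow> nat \<times> nat \<Rightarrow> real"
  where "tcoef n p = real (n choose fst p) * real (fst p choose snd p) / tker_norm n"

lemma finite_tidx [simp]: "finite (tidx n)" by (simp add: tidx_def)

lemma tker_norm_pos: "0 < tker_norm n"
proof -
  \<comment> \<open>On \<open>{0..<1/8}\<close> the cosine is nonnegative, so the integrand is at
    least 1 there.\<close>
  have "1 / 8 = (LINT x|lborel. indicator {0..<1/8::real} x :: real)" by simp
  also have "\<dots> \<le> (LINT x|lborel. indicator {0..<1} x * (1 + tcos (to_torus x)) ^ n)"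
  proof (rule integral_mono)
    show "integrable lborel (indicator {0..<1/8::real} :: real \<Rightarrow> real)" by simp
    show "integrable lborel (\<lambda>x. indicator {0..<1::real} x * (1 + tcos (to_torus x)) ^ n)"
    proof (rule Bochner_Integration.integrable_bound[where f="\<lambda>x. 2 ^ n * indicator {0..<1::real} x :: real"])
      show "AE x in lborel. norm (indicator {0..<1::real} x * (1 + tcos (to_torus x)) ^ n) \<le> norm (2 ^ n * indicator {0..<1::real} x :: real)"
      proof (rule AE_I2)
        fix x :: real
        have "(1 + cos (2 * pi * x)) ^ n \<le> 2 ^ n"
        proof (rule power_mono)
          show "1 + cos (2 * pi * x) \<le> 2" "0 \<le> 1 + cos (2 * pi * x)"
            using cos_le_one[of "2 * pi * x"] cos_ge_minus_one[of "2 * pi * x"] by linarith+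
        qed
        moreover have "0 \<le> (1 + cos (2 * pi * x)) ^ n"
          using cos_ge_minus_one[of "2 * pi * x"] by (intro zero_le_power) linarith
        ultimately show "norm (indicator {0..<1::real} x * (1 + tcos (to_torus x)) ^ n) \<le> norm (2 ^ n * indicator {0..<1::real} x :: real)"
          by (simp add: indicator_def)
      qed
    qed simp_all
    fix x :: real
    show "indicator {0..<1/8} x \<le> indicator {0..<1} x * (1 + tcos (to_torus x)) ^ n"
    proof (cases "x \<in> {0..<1/8}")
      case True
      then have "2 * pi * 0 \<le> 2 * pi * x" "2 * pi * x \<le> 2 * pi * (1 / 8)"
        by (intro mult_left_mono; simp)+
      then have "0 \<le> cos (2 * pi * x)" using pi_gt_zero by (intro cos_ge_zero) linarith+
      then have "1 \<le> (1 + cos (2 * pi * x)) ^ n" by (intro one_le_power) simp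
      then show ?thesis using True by simp
    next
      case False
      have "0 \<le> (1 + cos (2 * pi * x)) ^ n"
        using cos_ge_minus_one[of "2 * pi * x"] by (intro zero_le_power) linarith
      moreover have "indicator {0..<1/8} x = (0::real)" by (rule indicator_simps(2)[OF False])
      ultimately show ?thesis by (simp add: zero_le_mult_iff)
    qed
  qed
  also have "\<dots> = tker_norm n" unfolding tker_norm_def by (intro integral_torus_lebesgue[symmetric]) simp
  finally show ?thesis by simp
qed

text \<open>Finite rank: the convolution of a measure with the kernel is determined by finitely many
  moments. This reduces Fubini and differentiation in time to finite sums.\<close>

lemma tker_expand: "tker n z w = (\<Sum>p\<in>tidx n. tcoef n p * tmon p z * tmon p w)"
proof -
  have "(1 + cosdiff z w) ^ n = (\<Sum>i\<le>n. real (n choose i) * cosdiff z w ^ i)"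
    using binomial_ring[of "cosdiff z w" 1 n] by (simp add: add.commute)
  also have "\<dots> = (\<Sum>i\<le>n. \<Sum>j\<le>i. real (n choose i) * real (i choose j) * tmon (i, j) z * tmon (i, j) w)"
    unfolding cosdiff_def binomial_ring tmon_def
    by (simp add: sum_distrib_left power_mult_distrib mult_ac)
  also have "\<dots> = (\<Sum>p\<in>tidx n. real (n choose fst p) * real (fst p choose snd p) * tmon p z * tmon p w)"
    unfolding tidx_def by (subst sum.Sigma) (auto simp: case_prod_beta)
  finally show ?thesis unfolding tker_def tcoef_def by (simp add: sum_divide_distrib)
qed

lemma tker_nonneg: "0 \<le> tker n z w"
  unfolding tker_def using cosdiff_bounds(1)[of z w] tker_norm_pos[of n]
  by (intro divide_nonneg_pos zero_le_power) auto

lemma continuous_tker: "continuous_on UNIV (\<lambda>z. tker n z w)"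
  unfolding tker_def using tker_norm_pos[of n] by (intro continuous_intros continuous_cosdiff) auto

lemma measurable_tker [measurable]: "(\<lambda>z. tker n z w) \<in> borel_measurable borel"
  by (rule borel_measurable_continuous_onI[OF continuous_tker])

lemma torus_integrable_continuous:
  fixes g :: "torus \<Rightarrow> real"
  assumes "continuous_on UNIV g"
  shows "integrable torus_lebesgue g"
proof -
  obtain B where "\<And>z. \<bar>g z\<bar> \<le> B" using bounded_continuous_torus[OF assms] by blast
  then show ?thesis using borel_measurable_continuous_onI[OF assms]
    by (intro integrable_bounded[of _ _ B] torus.finite_measure_axioms) auto
qed

lemma tker_deriv_sum:
  "(\<Sum>p\<in>tidx n. tcoef n p * dtmon p z * tmon p w) = - (2 * pi * real n * (1 + cosdiff z w) ^ (n - 1) * sindiff z w / tker_norm n)"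
proof -
  obtain x where x: "z = to_torus x" using to_torus_surj by blast
  have "((\<lambda>x. tker n (to_torus x) w) has_real_derivative (\<Sum>p\<in>tidx n. tcoef n p * dtmon p z * tmon p w)) (at x)"
    unfolding tker_expand x using torus_deriv_tmon unfolding torus_deriv_def
    by (auto intro!: derivative_eq_intros simp: mult.commute[of "tcoef _ _"])
  moreover have "((\<lambda>x. tker n (to_torus x) w) has_real_derivative - (2 * pi * real n * (1 + cosdiff z w) ^ (n - 1) * sindiff z w / tker_norm n)) (at x)"
  proof -
    have "((\<lambda>x. cosdiff (to_torus x) w) has_real_derivative - 2 * pi * sindiff z w) (at x)"
      using torus_deriv_cosdiff(1)[of w] unfolding torus_deriv_def x by blast
    then show ?thesis
      unfolding tker_def x using tker_norm_pos[of n] by (auto intro!: derivative_eq_intros)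
  qed
  ultimately show ?thesis by (rule DERIV_unique)
qed

text \<open>The kernel is a function of \<open>z - w\<close>, so its two partial derivatives are
  opposite. Translation invariance enters in this infinitesimal form.\<close>

lemma tker_deriv_antisym:
  "(\<Sum>p\<in>tidx n. tcoef n p * tmon p z * dtmon p w) = - (\<Sum>p\<in>tidx n. tcoef n p * dtmon p z * tmon p w)"
proof -
  have "(\<Sum>p\<in>tidx n. tcoef n p * tmon p z * dtmon p w) = (\<Sum>p\<in>tidx n. tcoef n p * dtmon p w * tmon p z)"
    by (simp add: mult_ac)
  then show ?thesis
    unfolding tker_deriv_sum by (simp add: cosdiff_commute[of w z] sindiff_commute[of w z])
qed

text \<open>Differentiating in \<open>w\<close> and moving the derivative to \<open>z\<close> by
  antisymmetry leaves the integral of a derivative, which is 0. The integral is thus constant in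
  \<open>w\<close>, and at the origin it is 1 by the choice of \<open>tker_norm\<close>.\<close>

lemma integral_tker: "(LINT z|torus_lebesgue. tker n z w) = 1"
proof -
  define G where "G w = (LINT z|torus_lebesgue. tker n z w)" for w
  define I where "I p = (LINT z|torus_lebesgue. tmon p z)" for p
  have it: "integrable torus_lebesgue (tmon p)" for p
    by (rule torus_integrable_continuous[OF continuous_tmon])
  have G: "G w = (\<Sum>p\<in>tidx n. tcoef n p * I p * tmon p w)" for w
    unfolding G_def tker_expand I_def using it by (subst Bochner_Integration.integral_sum) auto
  have "(\<Sum>p\<in>tidx n. tcoef n p * I p * dtmon p w) = 0" for w
  proof -
    have "(\<Sum>p\<in>tidx n. tcoef n p * I p * dtmon p w) = (LINT z|torus_lebesgue. (\<Sum>p\<in>tidx n. tcoef n p * tmon p z * dtmon p w))"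
      unfolding I_def using it by (subst Bochner_Integration.integral_sum) auto
    also have "\<dots> = - (LINT z|torus_lebesgue. (\<Sum>p\<in>tidx n. tcoef n p * dtmon p z * tmon p w))"
      unfolding tker_deriv_antisym by simp
    also have "(LINT z|torus_lebesgue. (\<Sum>p\<in>tidx n. tcoef n p * dtmon p z * tmon p w)) = 0"
    proof (rule integral_torus_deriv_eq_0)
      show "torus_deriv (\<lambda>z. tker n z w) (\<lambda>z. \<Sum>p\<in>tidx n. tcoef n p * dtmon p z * tmon p w)"
        unfolding tker_expand using torus_deriv_tmon unfolding torus_deriv_def
        by (auto intro!: derivative_eq_intros simp: mult.commute[of "tcoef _ _"])
      show "continuous_on UNIV (\<lambda>z. \<Sum>p\<in>tidx n. tcoef n p * dtmon p z * tmon p w)"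
        by (intro continuous_intros continuous_dtmon)
    qed
    finally show ?thesis by simp
  qed
  moreover have "((\<lambda>y. G (to_torus y)) has_real_derivative (\<Sum>p\<in>tidx n. tcoef n p * I p * dtmon p (to_torus y))) (at y)" for y
    unfolding G by (intro DERIV_sum DERIV_cmult) (use torus_deriv_tmon in \<open>simp add: torus_deriv_def\<close>)
  ultimately have "((\<lambda>y. G (to_torus y)) has_real_derivative 0) (at y)" for y by simp
  then have const: "G (to_torus x) = G (to_torus y)" for x y
    by (intro DERIV_isconst_all[of "\<lambda>y. G (to_torus y)"] allI)
  have "G (to_torus 0) = 1"
    using tker_norm_pos[of n] unfolding G_def tker_def cosdiff_def tker_norm_def by simp
  moreover obtain y where "w = to_torus y" using to_torus_surj by blast
  ultimately show ?thesis using const[of y 0] by (simp add: G_def)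
qed

text \<open>The derivative of \<open>sindiff\<close> times \<open>(1 + cosdiff) ^ n\<close>
  integrates to 0. This is an exact identity: under the kernel, the mean of \<open>cosdiff\<close>
  equals \<open>n\<close> times the mean of \<open>1 - cosdiff\<close>, and the former is at most 1.
  The asymptotics of \<open>tker_norm\<close> does not enter.\<close>

lemma tker_concentration:
  assumes n: "n \<ge> 1"
  shows "(LINT z|torus_lebesgue. tker n z w * (1 - cosdiff z w)) \<le> 1 / real n"
proof -
  define F where "F z = sindiff z w * (1 + cosdiff z w) ^ n" for z
  define G where "G z = 2 * pi * tker_norm n * (cosdiff z w * tker n z w - real n * (tker n z w * (1 - cosdiff z w)))" for z
  have "torus_deriv F G"
    unfolding torus_deriv_def
  proof
    fix x
    define z where "z = to_torus x"
    have d: "((\<lambda>x. cosdiff (to_torus x) w) has_real_derivative - 2 * pi * sindiff z w) (at x)"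
      "((\<lambda>x. sindiff (to_torus x) w) has_real_derivative 2 * pi * cosdiff z w) (at x)"
      using torus_deriv_cosdiff[of w] unfolding torus_deriv_def z_def by blast+
    have e: "sindiff z w * (real n * (1 + cosdiff z w) ^ (n - 1) * (- 2 * pi * sindiff z w))
        = - (2 * pi * real n * (1 - cosdiff z w) * (1 + cosdiff z w) ^ n)"
    proof -
      have "sindiff z w * (real n * (1 + cosdiff z w) ^ (n - 1) * (- 2 * pi * sindiff z w))
        = - (2 * pi * real n * (sindiff z w ^ 2 * (1 + cosdiff z w) ^ (n - 1)))"
        by (simp add: power2_eq_square)
      also have "sindiff z w ^ 2 * (1 + cosdiff z w) ^ (n - 1) = (1 - cosdiff z w) * (1 + cosdiff z w) ^ n"
        unfolding sindiff_squared using n by (cases n) auto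
      finally show ?thesis by simp
    qed
    have "((\<lambda>x. F (to_torus x)) has_real_derivative
        2 * pi * cosdiff z w * (1 + cosdiff z w) ^ n + sindiff z w * (real n * (1 + cosdiff z w) ^ (n - 1) * (- 2 * pi * sindiff z w))) (at x)"
      unfolding F_def by (auto intro!: derivative_eq_intros d simp: z_def[symmetric])
    also have "2 * pi * cosdiff z w * (1 + cosdiff z w) ^ n + sindiff z w * (real n * (1 + cosdiff z w) ^ (n - 1) * (- 2 * pi * sindiff z w)) = G z"
      unfolding e G_def tker_def using tker_norm_pos[of n] by (simp add: field_simps)
    finally show "((\<lambda>x. F (to_torus x)) has_real_derivative G (to_torus x)) (at x)" by (simp add: z_def)
  qed
  moreover have "continuous_on UNIV G"
    unfolding G_def by (intro continuous_intros continuous_cosdiff continuous_tker)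
  ultimately have "(LINT z|torus_lebesgue. G z) = 0" by (rule integral_torus_deriv_eq_0)
  moreover have i: "integrable torus_lebesgue (\<lambda>z. cosdiff z w * tker n z w)"
    "integrable torus_lebesgue (\<lambda>z. tker n z w * (1 - cosdiff z w))" "integrable torus_lebesgue (\<lambda>z. tker n z w)"
    by (intro torus_integrable_continuous continuous_intros continuous_cosdiff continuous_tker)+
  ultimately have "(LINT z|torus_lebesgue. cosdiff z w * tker n z w) = real n * (LINT z|torus_lebesgue. tker n z w * (1 - cosdiff z w))"
    unfolding G_def using tker_norm_pos[of n] by simp
  moreover have "(LINT z|torus_lebesgue. cosdiff z w * tker n z w) \<le> (LINT z|torus_lebesgue. tker n z w)"
  proof (rule integral_mono[OF i(1,3)])
    show "cosdiff z w * tker n z w \<le> tker n z w" for z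
      using mult_right_mono[OF cosdiff_bounds(2) tker_nonneg] by simp
  qed
  ultimately show ?thesis using n by (simp add: integral_tker field_simps)
qed

text \<open>A modulus of continuity linear in \<open>1 - cosdiff\<close>, the quantity that
  \<open>tker_concentration\<close> controls. On the compact set where \<open>\<phi>\<close> varies
  by at least \<open>e\<close>, \<open>1 - cosdiff\<close> has a positive minimum
  \<open>d\<close>.\<close>

lemma continuous_torus_modulus:
  fixes \<phi> :: "torus \<Rightarrow> real"
  assumes \<phi>: "continuous_on UNIV \<phi>" and e: "e > 0"
  obtains M where "0 \<le> M" "\<And>z w. \<bar>\<phi> z - \<phi> w\<bar> \<le> e + M * (1 - cosdiff z w)"
proof -
  obtain B where B: "0 < B" "\<And>z. \<bar>\<phi> z\<bar> \<le> B" using bounded_continuous_torus[OF \<phi>] by blast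
  define S where "S = {p :: torus \<times> torus. e \<le> \<bar>\<phi> (fst p) - \<phi> (snd p)\<bar>}"
  have c: "continuous_on UNIV (\<lambda>p :: torus \<times> torus. g (fst p))" "continuous_on UNIV (\<lambda>p :: torus \<times> torus. g (snd p))"
    if "continuous_on UNIV g" for g :: "torus \<Rightarrow> real"
    by (intro continuous_on_compose2[OF that] continuous_intros; simp)+
  have "closed S" unfolding S_def
    by (intro closed_Collect_le continuous_on_rabs continuous_on_diff continuous_on_const c[OF \<phi>])
  moreover have "compact (UNIV :: (torus \<times> torus) set)"
    using compact_Times[OF compact_torus compact_torus] by simp
  ultimately have S: "compact S" using compact_Int_closed[of UNIV S] by simp
  show ?thesis
  proof (cases "S = {}")
    case True
    have "\<bar>\<phi> z - \<phi> w\<bar> \<le> e + 0 * (1 - cosdiff z w)" for z w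
    proof -
      have "(z, w) \<notin> S" using True by simp
      then show ?thesis by (simp add: S_def)
    qed
    then show ?thesis by (intro that[of 0]) simp_all
  next
    case False
    have "continuous_on S (\<lambda>p. 1 - cosdiff (fst p) (snd p))"
    proof (rule continuous_on_subset[OF _ subset_UNIV])
      show "continuous_on UNIV (\<lambda>p :: torus \<times> torus. 1 - cosdiff (fst p) (snd p))"
        unfolding cosdiff_def
        by (intro continuous_on_diff continuous_on_add continuous_on_mult continuous_on_const
            c[OF continuous_tcos] c[OF continuous_tsin])
    qed
    from continuous_attains_inf[OF S False this] obtain p where p: "p \<in> S"
      "\<And>q. q \<in> S \<Longrightarrow> 1 - cosdiff (fst p) (snd p) \<le> 1 - cosdiff (fst q) (snd q)" by blast
    define d where "d = 1 - cosdiff (fst p) (snd p)"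
    have "fst p \<noteq> snd p" using p(1) e by (auto simp: S_def)
    then have d: "d > 0" using cosdiff_eq_1D[of "fst p" "snd p"] cosdiff_bounds[of "fst p" "snd p"] by (force simp: d_def)
    show ?thesis
    \<comment> \<open>On \<open>S\<close> the second term is then at least \<open>2 * B\<close>, the
      largest possible oscillation.\<close>
    proof (rule that[of "2 * B / d"])
      show "0 \<le> 2 * B / d" using B d by simp
      fix z w
      show "\<bar>\<phi> z - \<phi> w\<bar> \<le> e + 2 * B / d * (1 - cosdiff z w)"
      proof (cases "(z, w) \<in> S")
        case True
        then have "d \<le> 1 - cosdiff z w" using p(2)[of "(z, w)"] by (simp add: d_def)
        then have "2 * B / d * d \<le> 2 * B / d * (1 - cosdiff z w)" using B d by (intro mult_left_mono) auto
        then have "2 * B \<le> 2 * B / d * (1 - cosdiff z w)" using d by simp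
        then show ?thesis using B(2)[of z] B(2)[of w] e by linarith
      next
        case False
        then have "\<bar>\<phi> z - \<phi> w\<bar> < e" by (simp add: S_def)
        moreover have "0 \<le> 2 * B / d * (1 - cosdiff z w)"
          using B d cosdiff_bounds[of z w] by (intro mult_nonneg_nonneg) auto
        ultimately show ?thesis by linarith
      qed
    qed
  qed
qed

text \<open>A Korovkin-type argument: integrate the modulus against the kernel. Uniformity in
  \<open>w\<close> allows its use under integrals against arbitrary probability measures, and makes
  trigonometric polynomials dense in the continuous functions.\<close>

theorem tker_uniform_approximation:
  fixes \<phi> :: "torus \<Rightarrow> real"
  assumes \<phi>: "continuous_on UNIV \<phi>" and e: "e > 0"
  shows "\<exists>N. \<forall>n\<ge>N. \<forall>w. \<bar>(LINT z|torus_lebesgue. tker n z w * \<phi> z) - \<phi> w\<bar> \<le> e"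
proof -
  have "e / 2 > 0" using e by simp
  then obtain M where M: "0 \<le> M" "\<And>z w. \<bar>\<phi> z - \<phi> w\<bar> \<le> e / 2 + M * (1 - cosdiff z w)"
    using continuous_torus_modulus[OF \<phi>] by blast
  obtain N :: nat where N: "real N \<ge> 2 * M / e" using real_arch_simple by blast
  have "\<bar>(LINT z|torus_lebesgue. tker n z w * \<phi> z) - \<phi> w\<bar> \<le> e" if n: "n \<ge> Suc N" for n w
  proof -
    have i: "integrable torus_lebesgue (\<lambda>z. tker n z w * \<phi> z)" "integrable torus_lebesgue (\<lambda>z. tker n z w)"
      "integrable torus_lebesgue (\<lambda>z. tker n z w * (1 - cosdiff z w))"
      by (intro torus_integrable_continuous continuous_intros \<phi> continuous_cosdiff continuous_tker)+
    have "(LINT z|torus_lebesgue. tker n z w * \<phi> z) - \<phi> w = (LINT z|torus_lebesgue. tker n z w * \<phi> z - tker n z w * \<phi> w)"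
      using i by (simp add: integral_tker)
    also have "\<bar>\<dots>\<bar> \<le> (LINT z|torus_lebesgue. \<bar>tker n z w * \<phi> z - tker n z w * \<phi> w\<bar>)"
      by (rule integral_abs_bound)
    also have "\<dots> \<le> (LINT z|torus_lebesgue. e / 2 * tker n z w + M * (tker n z w * (1 - cosdiff z w)))"
    proof (rule integral_mono)
      fix z
      have "\<bar>tker n z w * \<phi> z - tker n z w * \<phi> w\<bar> = tker n z w * \<bar>\<phi> z - \<phi> w\<bar>"
        using tker_nonneg[of n z w] by (simp add: right_diff_distrib[symmetric] abs_mult)
      also have "\<dots> \<le> tker n z w * (e / 2 + M * (1 - cosdiff z w))"
        by (rule mult_left_mono[OF M(2) tker_nonneg])
      finally show "\<bar>tker n z w * \<phi> z - tker n z w * \<phi> w\<bar> \<le> e / 2 * tker n z w + M * (tker n z w * (1 - cosdiff z w))"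
        by (simp add: algebra_simps)
    qed (use i in auto)
    also have "\<dots> = e / 2 + M * (LINT z|torus_lebesgue. tker n z w * (1 - cosdiff z w))"
      using i by (simp add: integral_tker)
    also have "\<dots> \<le> e / 2 + M * (1 / real n)"
      using n M(1) by (intro add_left_mono mult_left_mono tker_concentration) auto
    also have "M * (1 / real n) \<le> e / 2"
    proof -
      have "2 * M / e \<le> real n" using N n by linarith
      then show ?thesis using e n by (simp add: field_simps)
    qed
    finally show ?thesis by simp
  qed
  then show ?thesis by blast
qed

text \<open>The torus is embedded in the plane by cosine and sine, and \<open>\<phi>\<close> is the
  distance to the image of the complement. Truncated multiples of \<open>\<phi>\<close> then
  approximate the indicator of \<open>U\<close> by continuous functions.\<close>

lemma open_torus_eq_positive_set:
  fixes U :: "torus set"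
  assumes U: "open U"
  obtains \<phi> :: "torus \<Rightarrow> real" where "continuous_on UNIV \<phi>" "\<And>z. 0 \<le> \<phi> z" "U = {z. 0 < \<phi> z}"
\<comment> \<open>\<open>infdist\<close> to the empty set is 0 by convention, so the full torus is
  treated separately.\<close>
proof (cases "U = UNIV")
  case True
  then show ?thesis using that[of "\<lambda>_. 1"] by simp
next
  case False
  define E where "E z = (tcos z, tsin z)" for z
  have E: "continuous_on UNIV E" unfolding E_def by (intro continuous_intros)
  have inj: "z = w" if "E z = E w" for z w
  proof (rule cosdiff_eq_1D)
    have "cosdiff z w = tcos w ^ 2 + tsin w ^ 2" using that by (simp add: E_def cosdiff_def power2_eq_square)
    then show "cosdiff z w = 1" by (simp add: tcos_def tsin_def)
  qed
  define C where "C = E ` (- U)"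
  have "compact (- U)" using compact_torus closed_Compl[OF U] compact_Int_closed[of UNIV "- U"] by simp
  then have "compact C" unfolding C_def by (intro compact_continuous_image continuous_on_subset[OF E]) auto
  then have C: "closed C" "C \<noteq> {}" using False by (auto simp: C_def compact_imp_closed)
  show ?thesis
  proof (rule that[of "\<lambda>z. infdist (E z) C"])
    show "continuous_on UNIV (\<lambda>z. infdist (E z) C)" by (intro continuous_on_infdist E)
    show "0 \<le> infdist (E z) C" for z by (rule infdist_nonneg)
    have "z \<in> U \<longleftrightarrow> E z \<notin> C" for z using inj by (auto simp: C_def)
    moreover have "E z \<in> C \<longleftrightarrow> infdist (E z) C = 0" for z using C by (rule in_closed_iff_infdist_zero)
    ultimately show "U = {z. 0 < infdist (E z) C}"
      using infdist_nonneg by (auto simp: less_le)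
  qed
qed

section \<open>Measurable families of signed measures\<close>

lemma sum_norm_le_tv_norm:
  "A \<in> sets M \<Longrightarrow> B \<in> sets M \<Longrightarrow> A \<inter> B = {} \<Longrightarrow> ennreal (norm (\<mu> A) + norm (\<mu> B)) \<le> tv_norm M \<mu>" if "\<mu> {} = 0"
\<comment> \<open>Disjoint and equal means empty; the sum over \<open>{A, B}\<close> would have a
  single term.\<close>
proof (cases "A = B")
  case True
  assume "A \<in> sets M" "A \<inter> B = {}"
  then show ?thesis using True that by simp
next
  case False
  assume *: "A \<in> sets M" "B \<in> sets M" "A \<inter> B = {}"
  have "ennreal (norm (\<mu> A) + norm (\<mu> B)) = (\<Sum>A\<in>{A, B}. ennreal (norm (\<mu> A)))"
    using False by simp
  also have "\<dots> \<le> tv_norm M \<mu>"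
    unfolding tv_norm_def using * by (intro SUP_upper) (auto simp: disjoint_def)
  finally show ?thesis .
qed

lemma tv_norm_mono:
  assumes "\<And>A. A \<in> sets M \<Longrightarrow> norm (\<mu> A) \<le> norm (\<nu> A)"
  shows "tv_norm M \<mu> \<le> tv_norm M \<nu>"
  unfolding tv_norm_def
proof (rule SUP_mono)
  fix P assume "P \<in> {P. finite P \<and> P \<subseteq> sets M \<and> disjoint P}"
  moreover from this have "(\<Sum>A\<in>P. ennreal (norm (\<mu> A))) \<le> (\<Sum>A\<in>P. ennreal (norm (\<nu> A)))"
    using assms by (intro sum_mono ennreal_leI) auto
  ultimately show "\<exists>Q\<in>{P. finite P \<and> P \<subseteq> sets M \<and> disjoint P}. (\<Sum>A\<in>P. ennreal (norm (\<mu> A))) \<le> (\<Sum>A\<in>Q. ennreal (norm (\<nu> A)))"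
    by blast
qed

text \<open>The dominating function \<open>h\<close> need not be measurable, so that its integral is a lower integral.\<close>

lemma set_integrable_dominated:
  fixes g :: "real \<Rightarrow> real" and h :: "real \<Rightarrow> ennreal"
  assumes I: "I \<in> sets borel" and g: "g \<in> borel_measurable (restrict_space borel I)"
    and h: "(\<integral>\<^sup>+t\<in>I. h t \<partial>lborel) < \<infinity>"
    and le: "\<And>t. t \<in> I \<Longrightarrow> ennreal \<bar>g t\<bar> \<le> ennreal c * h t"
  shows "set_integrable lborel I g"
proof -
  \<comment> \<open>\<open>C\<close> is positive while \<open>c\<close> may not be. Below,
    \<open>g\<close> is divided by \<open>C\<close> instead of multiplying \<open>h\<close>, because
    constants are pulled out only of integrals of measurable functions.\<close>
  define C where "C = max c 1"
  have C: "C > 0" "c \<le> C" by (simp_all add: C_def)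
  have gm [measurable]: "(\<lambda>t. indicator I t * g t) \<in> borel_measurable borel"
    using g I by (simp add: borel_measurable_restrict_space_iff mult.commute)
  have "(\<integral>\<^sup>+t. ennreal \<bar>indicator I t * g t\<bar> \<partial>lborel) = (\<integral>\<^sup>+t. ennreal C * ennreal (\<bar>indicator I t * g t\<bar> / C) \<partial>lborel)"
    using C by (intro nn_integral_cong) (simp add: ennreal_mult[symmetric])
  also have "\<dots> = ennreal C * (\<integral>\<^sup>+t. ennreal (\<bar>indicator I t * g t\<bar> / C) \<partial>lborel)"
    by (rule nn_integral_cmult) measurable
  also have "(\<integral>\<^sup>+t. ennreal (\<bar>indicator I t * g t\<bar> / C) \<partial>lborel) \<le> (\<integral>\<^sup>+t\<in>I. h t \<partial>lborel)"
  proof (rule nn_integral_mono)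
    fix t
    show "ennreal (\<bar>indicator I t * g t\<bar> / C) \<le> h t * indicator I t"
    proof (cases "t \<in> I")
      case True
      have "ennreal \<bar>g t\<bar> \<le> ennreal C * h t"
        using le[OF True] C by (meson ennreal_leI mult_right_mono order_trans zero_le)
      then have "ennreal \<bar>g t\<bar> * ennreal (1 / C) \<le> ennreal C * h t * ennreal (1 / C)"
        by (intro mult_right_mono) auto
      also have "\<dots> = h t * (ennreal C * ennreal (1 / C))" by (simp add: mult_ac)
      also have "ennreal C * ennreal (1 / C) = 1" using C by (simp add: ennreal_mult[symmetric])
      finally show ?thesis using True C by (simp add: ennreal_mult[symmetric])
    qed simp
  qed
  finally have "(\<integral>\<^sup>+t. ennreal \<bar>indicator I t * g t\<bar> \<partial>lborel) \<le> ennreal C * (\<integral>\<^sup>+t\<in>I. h t \<partial>lborel)"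
    by (simp add: mult_left_mono)
  also have "\<dots> < \<infinity>" using h by (simp add: ennreal_mult_less_top)
  finally have "integrable lborel (\<lambda>t. indicator I t * g t)" by (intro integrableI_bounded) auto
  then show ?thesis by (simp add: set_integrable_def)
qed

text \<open>Dynkin's theorem on the rectangles, which generate the Borel sets of the product by
  second countability; complements and disjoint unions pass through because each
  \<open>\<mu> t\<close> is countably additive.\<close>

lemma measurable_section_family:
  fixes \<mu> :: "real \<Rightarrow> 'a::second_countable_topology set \<Rightarrow> real"
  assumes I: "I \<in> sets borel" and vm: "\<And>t. t \<in> I \<Longrightarrow> vector_measure borel (\<mu> t)"
    and meas: "\<And>A. A \<in> sets borel \<Longrightarrow> (\<lambda>t. \<mu> t A) \<in> borel_measurable (restrict_space borel I)"
    and A: "A \<in> sets (borel :: (real \<times> 'a) measure)"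
  shows "(\<lambda>t. \<mu> t {x. (t, x) \<in> A}) \<in> borel_measurable (restrict_space borel I)"
proof -
  have sp: "space (restrict_space borel I) = I" by (simp add: space_restrict_space)
  have sec: "{x. (t, x) \<in> B} \<in> sets borel" if B: "B \<in> sets (borel \<Otimes>\<^sub>M borel)" for t :: real and B :: "(real \<times> 'a) set"
    using sets_Pair1[OF B, of t] by (simp add: vimage_def)
  have "A \<in> sigma_sets (space borel \<times> space borel) {a \<times> b |a b. a \<in> sets (borel :: real measure) \<and> b \<in> sets (borel :: 'a measure)}"
    using A unfolding borel_prod[symmetric] sets_pair_measure .
  from Int_stable_pair_measure_generator pair_measure_closed this show ?thesis
  proof (induct rule: sigma_sets_induct_disjoint)
    case (basic A)
    then obtain a b where ab: "A = a \<times> b" "a \<in> sets borel" "b \<in> sets borel" by blast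
    have "(\<lambda>t. indicator a t * \<mu> t b) \<in> borel_measurable (restrict_space borel I)"
      using ab by (intro borel_measurable_times meas measurable_restrict_space1) auto
    then show ?case
      by (rule measurable_cong[THEN iffD1, rotated])
        (auto simp: ab(1) sp indicator_def vector_measure_empty[OF vm])
  next
    case empty
    have "(\<lambda>t. 0 :: real) \<in> borel_measurable (restrict_space borel I)" by simp
    then show ?case
      by (rule measurable_cong[THEN iffD1, rotated]) (simp add: sp vector_measure_empty[OF vm])
  next
    case (compl A)
    then have AM: "A \<in> sets (borel \<Otimes>\<^sub>M borel)" by (simp add: sets_pair_measure)
    have "(\<lambda>t. \<mu> t UNIV - \<mu> t {x. (t, x) \<in> A}) \<in> borel_measurable (restrict_space borel I)"
      by (intro borel_measurable_diff meas compl) simp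
    then show ?case
    proof (rule measurable_cong[THEN iffD1, rotated])
      fix t assume "t \<in> space (restrict_space borel I)"
      then have t: "t \<in> I" by (simp add: sp)
      have "{x. (t, x) \<in> space borel \<times> space borel - A} = UNIV - {x. (t, x) \<in> A}" by auto
      then show "\<mu> t UNIV - \<mu> t {x. (t, x) \<in> A} = \<mu> t {x. (t, x) \<in> space borel \<times> space borel - A}"
        using vector_measure_Diff[OF vm[OF t] sec[OF AM] _ subset_UNIV] by simp
    qed
  next
    case (union A)
    then have AM: "A i \<in> sets (borel \<Otimes>\<^sub>M borel)" for i by (auto simp: sets_pair_measure)
    have "(\<lambda>t. \<Sum>i. \<mu> t {x. (t, x) \<in> A i}) \<in> borel_measurable (restrict_space borel I)"
      by (intro borel_measurable_suminf union)
    then show ?case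
    proof (rule measurable_cong[THEN iffD1, rotated])
      fix t assume "t \<in> space (restrict_space borel I)"
      then have t: "t \<in> I" by (simp add: sp)
      have "(\<lambda>i. \<mu> t {x. (t, x) \<in> A i}) sums \<mu> t (\<Union>i. {x. (t, x) \<in> A i})"
      proof (rule vector_measure_sums[OF vm[OF t]])
        show "range (\<lambda>i. {x. (t, x) \<in> A i}) \<subseteq> sets borel" using sec[OF AM] by auto
        show "disjoint_family (\<lambda>i. {x. (t, x) \<in> A i})" using union unfolding disjoint_family_on_def by blast
      qed
      moreover have "(\<Union>i. {x. (t, x) \<in> A i}) = {x. (t, x) \<in> (\<Union>i. A i)}" by auto
      ultimately show "(\<Sum>i. \<mu> t {x. (t, x) \<in> A i}) = \<mu> t {x. (t, x) \<in> \<Union> (range A)}"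
        by (simp add: sums_iff)
    qed
  qed
qed

lemma section_sets:
  "A \<in> sets (borel :: (real \<times> 'a::second_countable_topology) measure) \<Longrightarrow> {x. (t, x) \<in> A} \<in> sets borel"
  using sets_Pair1[of A borel borel t] by (simp add: vimage_def borel_prod)

lemma restrict_borel_sets:
  "I \<in> sets borel \<Longrightarrow> A \<in> sets (restrict_space (borel :: (real \<times> 'a::second_countable_topology) measure) (I \<times> UNIV)) \<Longrightarrow> A \<in> sets borel"
proof -
  assume I: "I \<in> sets borel" and A: "A \<in> sets (restrict_space (borel :: (real \<times> 'a) measure) (I \<times> UNIV))"
  have "I \<times> (UNIV :: 'a set) \<in> sets (borel \<Otimes>\<^sub>M borel)" using I by (intro pair_measureI) auto
  then have "I \<times> (UNIV :: 'a set) \<in> sets borel" unfolding borel_prod .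
  then show "A \<in> sets borel" using A by (auto simp: sets_restrict_space)
qed

text \<open>Countable additivity in space-time follows by dominated convergence in \<open>t\<close>.
  Since \<open>h\<close> may fail to be measurable, it cannot serve as the majorant itself and
  another one has to be built.\<close>

lemma time_integral_vector_measure:
  fixes \<mu> :: "real \<Rightarrow> 'a::second_countable_topology set \<Rightarrow> real"
  assumes I: "I \<in> sets borel" and vm: "\<And>t. t \<in> I \<Longrightarrow> vector_measure borel (\<mu> t)"
    and meas: "\<And>A. A \<in> sets borel \<Longrightarrow> (\<lambda>t. \<mu> t A) \<in> borel_measurable (restrict_space borel I)"
    and bnd: "\<And>t A. t \<in> I \<Longrightarrow> A \<in> sets borel \<Longrightarrow> ennreal \<bar>\<mu> t A\<bar> \<le> h t"
    and h: "(\<integral>\<^sup>+t\<in>I. h t \<partial>lborel) < \<infinity>"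
  shows "vector_measure (restrict_space borel (I \<times> UNIV)) (time_integral I \<mu>)"
    and "\<And>A. A \<in> sets borel \<Longrightarrow> set_integrable lborel I (\<lambda>t. \<mu> t {x. (t, x) \<in> A})"
proof -
  show int: "set_integrable lborel I (\<lambda>t. \<mu> t {x. (t, x) \<in> A})" if "A \<in> sets borel" for A
    using measurable_section_family[OF I vm meas that] bnd section_sets[OF that]
    by (intro set_integrable_dominated[OF I _ h, of _ 1]) auto
  show "vector_measure (restrict_space borel (I \<times> UNIV)) (time_integral I \<mu>)"
    unfolding vector_measure_def
  proof (intro conjI allI impI)
    show "time_integral I \<mu> {} = 0"
    proof -
      have "time_integral I \<mu> {} = (LINT t:I|lborel. 0)"
        unfolding time_integral_def using I by (intro set_lebesgue_integral_cong) (auto simp: vector_measure_empty[OF vm])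
      then show ?thesis by (simp add: set_lebesgue_integral_def)
    qed
  next
    fix A :: "nat \<Rightarrow> (real \<times> 'a) set"
    assume A: "range A \<subseteq> sets (restrict_space borel (I \<times> UNIV))" "disjoint_family A"
    have AM: "A i \<in> sets borel" for i using A(1) restrict_borel_sets[OF I] by blast
    define U where "U n = (\<Union>i<n. A i)" for n
    have UM: "U n \<in> sets borel" for n using AM by (auto simp: U_def)
    have SM: "(\<Union>i. A i) \<in> sets borel" using AM by auto
    have s: "(\<lambda>i. \<mu> t {x. (t, x) \<in> A i}) sums \<mu> t {x. (t, x) \<in> (\<Union>i. A i)}" if t: "t \<in> I" for t
    proof -
      have "(\<lambda>i. \<mu> t {x. (t, x) \<in> A i}) sums \<mu> t (\<Union>i. {x. (t, x) \<in> A i})"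
      proof (rule vector_measure_sums[OF vm[OF t]])
        show "range (\<lambda>i. {x. (t, x) \<in> A i}) \<subseteq> sets borel" using section_sets[OF AM] by auto
        show "disjoint_family (\<lambda>i. {x. (t, x) \<in> A i})" using A(2) unfolding disjoint_family_on_def by blast
      qed
      moreover have "(\<Union>i. {x. (t, x) \<in> A i}) = {x. (t, x) \<in> (\<Union>i. A i)}" by auto
      ultimately show ?thesis by simp
    qed
    have fin: "\<mu> t {x. (t, x) \<in> U n} = (\<Sum>i<n. \<mu> t {x. (t, x) \<in> A i})" if t: "t \<in> I" for t n
    proof (induction n)
      case 0 then show ?case by (simp add: U_def vector_measure_empty[OF vm[OF t]])
    next
      case (Suc n)
      have e: "{x. (t, x) \<in> U (Suc n)} = {x. (t, x) \<in> U n} \<union> {x. (t, x) \<in> A n}" by (auto simp: U_def lessThan_Suc)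
      have d: "A i \<inter> A n = {}" if "i < n" for i
        by (rule disjoint_family_onD[OF A(2)]) (use that in auto)
      then have "{x. (t, x) \<in> U n} \<inter> {x. (t, x) \<in> A n} = {}" by (fastforce simp: U_def)
      then show ?case
        unfolding e using vector_measure_Un[OF vm[OF t] section_sets[OF UM] section_sets[OF AM]] Suc by simp
    qed
    define g where "g n t = indicator I t * \<mu> t {x. (t, x) \<in> U n}" for n t
    have gm [measurable]: "g n \<in> borel_measurable borel" for n
      using measurable_section_family[OF I vm meas UM] I
      by (simp add: borel_measurable_restrict_space_iff mult.commute g_def[abs_def])
    \<comment> \<open>The supremum of the partial sums is measurable, finite because the sums
      converge at each \<open>t\<close>, and lies below \<open>h\<close>: a legitimate
      majorant.\<close>
    define S where "S t = (SUP n. ennreal \<bar>g n t\<bar>)" for t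
    have Sm [measurable]: "S \<in> borel_measurable borel" unfolding S_def[abs_def] by measurable
    have Sfin: "S t < \<infinity>" for t
    proof (cases "t \<in> I")
      case True
      have "(\<lambda>n. \<mu> t {x. (t, x) \<in> U n}) \<longlonglongrightarrow> \<mu> t {x. (t, x) \<in> (\<Union>i. A i)}"
        unfolding fin[OF True] using s[OF True] by (simp add: sums_def)
      then have "Bseq (\<lambda>n. \<mu> t {x. (t, x) \<in> U n})" by (intro convergent_imp_Bseq convergentI)
      then obtain K where "\<And>n. norm (\<mu> t {x. (t, x) \<in> U n}) \<le> K" by (auto simp: Bseq_def)
      then have "S t \<le> ennreal K" unfolding S_def g_def using True by (intro SUP_least ennreal_leI) simp
      then show ?thesis by (rule le_less_trans) simp
    qed (simp add: S_def g_def)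
    have Sint: "integrable lborel (\<lambda>t. enn2real (S t))"
    proof (rule integrableI_bounded)
      have "(\<integral>\<^sup>+t. ennreal (norm (enn2real (S t))) \<partial>lborel) \<le> (\<integral>\<^sup>+t\<in>I. h t \<partial>lborel)"
      proof (rule nn_integral_mono)
        fix t
        have "S t \<le> h t * indicator I t"
          unfolding S_def g_def using bnd section_sets[OF UM] by (intro SUP_least) (auto simp: indicator_def)
        then show "ennreal (norm (enn2real (S t))) \<le> h t * indicator I t" using Sfin[of t] by simp
      qed
      then show "(\<integral>\<^sup>+t. ennreal (norm (enn2real (S t))) \<partial>lborel) < \<infinity>" using h by (rule le_less_trans)
    qed measurable
    have "(\<lambda>n. LINT t|lborel. g n t) \<longlonglongrightarrow> (LINT t|lborel. indicator I t * \<mu> t {x. (t, x) \<in> (\<Union>i. A i)})"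
    proof (rule integral_dominated_convergence[where w="\<lambda>t. enn2real (S t)"])
      show "(\<lambda>t. indicator I t * \<mu> t {x. (t, x) \<in> (\<Union>i. A i)}) \<in> borel_measurable lborel"
        using measurable_section_family[OF I vm meas SM] I
        by (simp add: borel_measurable_restrict_space_iff mult.commute)
      show "AE t in lborel. (\<lambda>n. g n t) \<longlonglongrightarrow> indicator I t * \<mu> t {x. (t, x) \<in> (\<Union>i. A i)}"
      proof (rule AE_I2)
        fix t
        show "(\<lambda>n. g n t) \<longlonglongrightarrow> indicator I t * \<mu> t {x. (t, x) \<in> (\<Union>i. A i)}"
        proof (cases "t \<in> I")
          case True
          then show ?thesis using s[OF True] unfolding g_def sums_def by (simp add: fin[OF True])
        qed (simp add: g_def)
      qed
      show "AE t in lborel. norm (g n t) \<le> enn2real (S t)" for n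
      proof (rule AE_I2)
        fix t
        have "ennreal \<bar>g n t\<bar> \<le> S t" unfolding S_def by (rule SUP_upper) simp
        then have "ennreal \<bar>g n t\<bar> \<le> ennreal (enn2real (S t))" using Sfin[of t] by simp
        then show "norm (g n t) \<le> enn2real (S t)" by (simp add: ennreal_le_iff)
      qed
    qed (use Sint in auto)
    moreover have "(LINT t|lborel. g n t) = (\<Sum>i<n. time_integral I \<mu> (A i))" for n
    proof -
      have "(LINT t|lborel. g n t) = (LINT t|lborel. (\<Sum>i<n. indicator I t * \<mu> t {x. (t, x) \<in> A i}))"
        by (intro Bochner_Integration.integral_cong) (auto simp: g_def fin indicator_def)
      also have "\<dots> = (\<Sum>i<n. LINT t|lborel. indicator I t * \<mu> t {x. (t, x) \<in> A i})"
        using int[OF AM] by (intro Bochner_Integration.integral_sum) (simp add: set_integrable_def)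
      finally show ?thesis by (simp add: time_integral_def set_lebesgue_integral_def)
    qed
    ultimately show "(\<lambda>i. time_integral I \<mu> (A i)) sums time_integral I \<mu> (\<Union>i. A i)"
      by (simp add: sums_def time_integral_def set_lebesgue_integral_def)
  qed
qed

text \<open>The Jordan parts are obtained separately for each \<open>t\<close>, with no control on
  how they vary. Instead the integrand is replaced by simple functions whose level sets are the same
  for all \<open>t\<close>, which turns the signed integral into a limit of combinations of the
  measurable functions \<open>\<mu> t (C n i)\<close>.\<close>

lemma signed_integral_family:
  fixes \<mu> :: "real \<Rightarrow> 'a::topological_space set \<Rightarrow> real"
  assumes I: "I \<in> sets borel" and vm: "\<And>t. t \<in> I \<Longrightarrow> vector_measure borel (\<mu> t)"
    and meas: "\<And>A. A \<in> sets borel \<Longrightarrow> (\<lambda>t. \<mu> t A) \<in> borel_measurable (restrict_space borel I)"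
    and f: "f \<in> borel_measurable borel" "\<And>x. \<bar>f x\<bar> \<le> B"
  shows "(\<lambda>t. signed_integral borel (\<mu> t) f) \<in> borel_measurable (restrict_space borel I)"
proof -
  have sp: "space (restrict_space borel I) = I" by (simp add: space_restrict_space)
  define d where "d n = inverse (real (Suc n))" for n
  have d: "d n > 0" for n by (simp add: d_def)
  define good where "good J C n \<longleftrightarrow> finite J \<and> (\<forall>i. C i \<in> sets borel) \<and> (\<forall>Q. finite_measure Q \<longrightarrow> sets Q = sets borel \<longrightarrow>
      \<bar>(LINT x|Q. f x) - (\<Sum>i\<in>J. d n * of_int i * measure Q (C i))\<bar> \<le> d n * measure Q UNIV)"
    for J :: "int set" and C :: "int \<Rightarrow> 'a set" and n
  have "\<forall>n. \<exists>JC. good (fst JC) (snd JC) n"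
  proof
    fix n
    obtain J C where "finite J" "\<And>i. C i \<in> sets borel"
      "\<And>Q. finite_measure Q \<Longrightarrow> sets Q = sets borel \<Longrightarrow>
      \<bar>(LINT x|Q. f x) - (\<Sum>i\<in>J. d n * of_int i * measure Q (C i))\<bar> \<le> d n * measure Q (space borel)"
      by (rule bounded_simple_approx[OF f d]) (rule that)
    then have "good J C n" unfolding good_def by simp
    then show "\<exists>JC. good (fst JC) (snd JC) n" by (intro exI[of _ "(J, C)"]) simp
  qed
  from choice[OF this] obtain JC where JC: "\<And>n. good (fst (JC n)) (snd (JC n)) n" by blast
  define J where "J n = fst (JC n)" for n
  define C where "C n = snd (JC n)" for n
  have g: "good (J n) (C n) n" for n using JC by (simp add: J_def C_def)
  have C: "C n i \<in> sets borel" for n i using g[of n] by (simp add: good_def)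
  define s where "s n t = (\<Sum>i\<in>J n. d n * of_int i * \<mu> t (C n i))" for n t
  have sm: "s n \<in> borel_measurable (restrict_space borel I)" for n
    unfolding s_def[abs_def] by (intro borel_measurable_sum borel_measurable_times meas C) auto
  show ?thesis
  proof (rule borel_measurable_LIMSEQ_real[OF _ sm])
    fix t assume "t \<in> space (restrict_space borel I)"
    then have t: "t \<in> I" by (simp add: sp)
    obtain P N where PN: "finite_measure P" "finite_measure N" "sets P = sets borel" "sets N = sets borel"
      "\<And>A. A \<in> sets borel \<Longrightarrow> \<mu> t A = measure P A - measure N A"
      by (rule Jordan_decomposition_vector_measure[OF vm[OF t]]) (rule that)
    have e: "signed_integral borel (\<mu> t) f = (LINT x|P. f x) - (LINT x|N. f x)"
      by (rule signed_integral_eq[OF PN f(1), of B]) (use f(2) in auto)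
    have b: "\<bar>s n t - signed_integral borel (\<mu> t) f\<bar> \<le> d n * (measure P UNIV + measure N UNIV)" for n
    proof -
      have "s n t = (\<Sum>i\<in>J n. d n * of_int i * measure P (C n i)) - (\<Sum>i\<in>J n. d n * of_int i * measure N (C n i))"
        unfolding s_def by (simp add: PN(5)[OF C] right_diff_distrib sum_subtractf)
      moreover have "\<bar>(LINT x|P. f x) - (\<Sum>i\<in>J n. d n * of_int i * measure P (C n i))\<bar> \<le> d n * measure P UNIV"
        "\<bar>(LINT x|N. f x) - (\<Sum>i\<in>J n. d n * of_int i * measure N (C n i))\<bar> \<le> d n * measure N UNIV"
        using g[of n] PN unfolding good_def by blast+
      ultimately show ?thesis unfolding e distrib_left by linarith
    qed
    have l: "(\<lambda>n. d n * (measure P UNIV + measure N UNIV)) \<longlonglongrightarrow> 0 * (measure P UNIV + measure N UNIV)"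
      unfolding d_def by (intro tendsto_mult tendsto_const LIMSEQ_inverse_real_of_nat)
    have "(\<lambda>n. s n t - signed_integral borel (\<mu> t) f) \<longlonglongrightarrow> 0"
      by (rule Lim_null_comparison[OF always_eventually l[simplified mult_zero_left]]) (simp add: b)
    then show "(\<lambda>n. s n t) \<longlonglongrightarrow> signed_integral borel (\<mu> t) f" by (rule LIM_zero_cancel)
  qed
qed

lemma signed_integral_bound:
  fixes \<mu> :: "'a::topological_space set \<Rightarrow> real"
  assumes vm: "vector_measure borel \<mu>" and f: "f \<in> borel_measurable borel" "\<And>x. \<bar>f x\<bar> \<le> B"
  shows "ennreal \<bar>signed_integral borel \<mu> f\<bar> \<le> ennreal B * tv_norm borel \<mu>"
proof -
  obtain P N where PN: "finite_measure P" "finite_measure N" "sets P = sets borel" "sets N = sets borel"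
      "\<And>A. A \<in> sets borel \<Longrightarrow> \<mu> A = measure P A - measure N A"
    and tv: "ennreal (measure P (space borel) + measure N (space borel)) \<le> tv_norm borel \<mu>"
    by (rule Jordan_decomposition_vector_measure[OF vm]) (rule that)
  have B: "0 \<le> B" using f(2)[of undefined] by linarith
  have b: "\<bar>LINT x|Q. f x\<bar> \<le> B * measure Q UNIV" if Q: "finite_measure Q" "sets Q = sets borel" for Q
  proof -
    interpret Q: finite_measure Q by fact
    have sQ: "space Q = UNIV" using sets_eq_imp_space_eq[OF Q(2)] by simp
    have i: "integrable Q f" using f Q by (intro integrable_bounded[of _ _ B]) (auto simp: measurable_cong_sets[OF Q(2) refl])
    have "\<bar>LINT x|Q. f x\<bar> \<le> (LINT x|Q. \<bar>f x\<bar>)" by (rule integral_abs_bound)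
    also have "\<dots> \<le> (LINT x|Q. B)" using i f by (intro integral_mono) auto
    finally show ?thesis by (simp add: sQ mult.commute)
  qed
  have e: "signed_integral borel \<mu> f = (LINT x|P. f x) - (LINT x|N. f x)"
    by (rule signed_integral_eq[OF PN f(1), of B]) (use f(2) in auto)
  have "\<bar>signed_integral borel \<mu> f\<bar> \<le> B * (measure P UNIV + measure N UNIV)"
    unfolding e distrib_left using b[OF PN(1,3)] b[OF PN(2,4)] by linarith
  then have "ennreal \<bar>signed_integral borel \<mu> f\<bar> \<le> ennreal B * ennreal (measure P UNIV + measure N UNIV)"
    using B by (subst ennreal_mult[symmetric]) (auto intro!: ennreal_leI add_nonneg_nonneg)
  also have "\<dots> \<le> ennreal B * tv_norm borel \<mu>" using tv by (intro mult_left_mono) auto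
  finally show ?thesis .
qed

section \<open>Fenchel and Jensen inequalities\<close>

lemma phase_measurable:
  fixes F :: "torus \<Rightarrow> bool \<Rightarrow> 'b::topological_space"
  assumes "\<And>b. (\<lambda>z. F z b) \<in> borel_measurable borel"
  shows "(\<lambda>q :: phase. F (fst q) (snd q)) \<in> borel_measurable borel"
proof -
  have f: "(fst :: phase \<Rightarrow> torus) \<in> borel_measurable borel"
    by (rule borel_measurable_continuous_onI) (rule continuous_on_fst[OF continuous_on_id])
  have "{q :: phase. snd q} = UNIV \<times> {True}" by auto
  moreover have "open ((UNIV :: torus set) \<times> {True})" by (intro open_Times open_UNIV discrete_topology_class.open_discrete)
  ultimately have s: "{q \<in> space (borel :: phase measure). snd q} \<in> sets borel" by simp
  have "(\<lambda>q :: phase. if snd q then F (fst q) True else F (fst q) False) \<in> borel_measurable borel"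
    by (rule measurable_If[OF measurable_compose[OF f assms] measurable_compose[OF f assms] s])
  moreover have "(\<lambda>q :: phase. if snd q then F (fst q) True else F (fst q) False) = (\<lambda>q. F (fst q) (snd q))"
    by (auto simp: fun_eq_iff)
  ultimately show ?thesis by simp
qed

lemma phase_continuous:
  fixes F :: "torus \<Rightarrow> bool \<Rightarrow> 'b::topological_space"
  assumes "\<And>b. continuous_on UNIV (\<lambda>z. F z b)"
  shows "continuous_on UNIV (\<lambda>q :: phase. F (fst q) (snd q))"
proof -
  have e: "UNIV = (\<Union>b. (UNIV :: torus set) \<times> {b :: bool})" by auto
  have "continuous_on (\<Union>b. (UNIV :: torus set) \<times> {b :: bool}) (\<lambda>q. F (fst q) (snd q))"
  proof (rule continuous_on_open_UN)
    fix b :: bool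
    show "open ((UNIV :: torus set) \<times> {b})" by (intro open_Times open_UNIV discrete_topology_class.open_discrete)
    have "continuous_on ((UNIV :: torus set) \<times> {b}) (\<lambda>q. F (fst q) b)"
      by (rule continuous_on_compose2[OF assms continuous_on_fst[OF continuous_on_id]]) simp
    then show "continuous_on ((UNIV :: torus set) \<times> {b}) (\<lambda>q. F (fst q) (snd q))"
      by (rule continuous_on_cong[THEN iffD1, rotated 2]) auto
  qed
  then show ?thesis unfolding e .
qed

text \<open>Second countability of both factors, for the discrete \<open>bool\<close> by the
  instance at the beginning, identifies the Borel sets of the product with the product
  sigma-algebra.\<close>

lemma sets_ref_measure: "sets ref_measure = sets borel"
proof -
  have "A \<in> sets borel" for A :: "bool set" by (rule borel_open) (rule discrete_topology_class.open_discrete)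
  then have "sets (uniform_count_measure (UNIV :: bool set)) = sets borel"
    by (auto simp: sets_uniform_count_measure)
  then have "sets ref_measure = sets (borel \<Otimes>\<^sub>M borel :: phase measure)"
    unfolding ref_measure_def by (intro sets_pair_measure_cong) simp_all
  then show ?thesis unfolding borel_prod .
qed

lemma prob_space_ref_measure: "prob_space ref_measure"
proof -
  interpret U: prob_space "uniform_count_measure (UNIV :: bool set)"
    by (rule prob_space_uniform_count_measure) auto
  interpret pair_prob_space torus_lebesgue "uniform_count_measure (UNIV :: bool set)" ..
  show ?thesis unfolding ref_measure_def by (rule prob_space_axioms)
qed

lemma integral_ref_measure:
  fixes g :: "phase \<Rightarrow> real"
  assumes g: "g \<in> borel_measurable borel" "\<And>q. \<bar>g q\<bar> \<le> B"
  shows "(LINT q|ref_measure. g q) = (\<Sum>b\<in>UNIV. LINT z|torus_lebesgue. g (z, b)) / 2"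
proof -
  interpret U: prob_space "uniform_count_measure (UNIV :: bool set)"
    by (rule prob_space_uniform_count_measure) auto
  interpret pair_prob_space torus_lebesgue "uniform_count_measure (UNIV :: bool set)" ..
  have i: "integrable ref_measure g"
    using g prob_space.finite_measure[OF prob_space_ref_measure]
    by (intro integrable_bounded[of _ _ B]) (auto simp: measurable_cong_sets[OF sets_ref_measure refl])
  have it: "integrable torus_lebesgue (\<lambda>z. g (z, b))" for b
  proof (rule integrable_bounded[of _ _ B])
    have "(\<lambda>z. (z, b)) \<in> measurable borel (borel :: phase measure)"
      by (intro borel_measurable_continuous_onI continuous_intros)
    then have "(\<lambda>z. g (z, b)) \<in> borel_measurable borel" by (rule measurable_compose[OF _ g(1)])
    then show "(\<lambda>z. g (z, b)) \<in> borel_measurable torus_lebesgue" by simp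
  qed (use g torus.finite_measure_axioms in auto)
  have "(LINT q|ref_measure. g q) = (LINT z|torus_lebesgue. LINT b|uniform_count_measure UNIV. g (z, b))"
    using i unfolding ref_measure_def by (rule integral_fst'[symmetric])
  also have "\<dots> = (LINT z|torus_lebesgue. (\<Sum>b\<in>UNIV. g (z, b)) / 2)"
    by (simp add: integral_uniform_count_measure)
  also have "\<dots> = (\<Sum>b\<in>UNIV. LINT z|torus_lebesgue. g (z, b)) / 2"
    using it by (simp add: UNIV_bool)
  finally show ?thesis .
qed

lemma ennreal_integral_le_nn_integral:
  fixes g :: "'a \<Rightarrow> real"
  assumes "integrable M g"
  shows "ennreal (LINT x|M. g x) \<le> (\<integral>\<^sup>+x. ennreal (g x) \<partial>M)"
proof -
  have i: "integrable M (\<lambda>x. max 0 (g x))" using assms by simp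
  have "ennreal (LINT x|M. g x) \<le> ennreal (LINT x|M. max 0 (g x))"
    using assms i by (intro ennreal_leI integral_mono) auto
  also have "\<dots> = (\<integral>\<^sup>+x. ennreal (max 0 (g x)) \<partial>M)"
    by (rule nn_integral_eq_integral[OF i, symmetric]) simp
  also have "\<dots> = (\<integral>\<^sup>+x. ennreal (g x) \<partial>M)"
    by (intro nn_integral_cong) (simp add: max_def ennreal_neg)
  finally show ?thesis .
qed

text \<open>Legendre duality of \<open>a * ln a - a + 1\<close> and \<open>exp u - 1\<close>, read
  off from the tangent inequality for exp at \<open>u - ln a\<close>. For \<open>a = 0\<close> both
  sides are explicit because \<open>0 * ln 0 = 0\<close>.\<close>

lemma Young_entropy:
  fixes a u :: real
  assumes "0 \<le> a"
  shows "a * u - (exp u - 1) \<le> a * ln a - a + 1"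
proof (cases "a = 0")
  case False
  then have a: "a > 0" using assms by simp
  have "1 + (u - ln a) \<le> exp (u - ln a)" by (rule exp_ge_add_one_self)
  then have "a * (1 + (u - ln a)) \<le> a * exp (u - ln a)" using a by (intro mult_left_mono) auto
  also have "a * exp (u - ln a) = exp u" using a by (simp add: exp_diff)
  finally show ?thesis by (simp add: algebra_simps)
qed simp

text \<open>Since the entropy is infinite when there is no density, this holds without any hypothesis on
  \<open>\<mu>\<close>. In particular the Lagrangian need not be known to be measurable in time.\<close>

theorem Ent_Fenchel:
  fixes \<phi> :: "'a \<Rightarrow> real"
  assumes fin: "finite_measure \<nu>" and sets: "sets \<nu> = sets M"
    and \<phi>: "\<phi> \<in> borel_measurable M" "\<And>x. \<bar>\<phi> x\<bar> \<le> B"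
  shows "ennreal (signed_integral M \<mu> \<phi> - (LINT x|\<nu>. exp (\<phi> x) - 1)) \<le> Ent \<mu> \<nu>"
proof (cases "\<exists>f. is_density \<mu> \<nu> f \<and> (\<forall>x. 0 \<le> f x)")
  case False
  have "Ent \<mu> \<nu> = \<infinity>" unfolding Ent_def by (rule if_not_P[OF False])
  then show ?thesis by simp
next
  case True
  define f where "f = (SOME f. is_density \<mu> \<nu> f \<and> (\<forall>x. 0 \<le> f x))"
  have f: "is_density \<mu> \<nu> f" "\<And>x. 0 \<le> f x"
    using someI_ex[OF True] unfolding f_def[symmetric] by blast+
  have Ent: "Ent \<mu> \<nu> = (\<integral>\<^sup>+x. ennreal (f x * ln (f x) - f x + 1) \<partial>\<nu>)"
    using True unfolding Ent_def f_def by (simp add: Let_def)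
  interpret finite_measure \<nu> by fact
  have fi: "integrable \<nu> f" and fd: "\<And>A. A \<in> sets \<nu> \<Longrightarrow> \<mu> A = (LINT x:A|\<nu>. f x)"
    using f(1) by (auto simp: is_density_def)
  have fm [measurable]: "f \<in> borel_measurable \<nu>" using fi by simp
  have \<phi>m [measurable]: "\<phi> \<in> borel_measurable \<nu>" using \<phi>(1) by (simp add: measurable_cong_sets[OF sets refl])
  define P where "P = density \<nu> (\<lambda>x. ennreal (f x))"
  have fP: "finite_measure P"
  proof (rule finite_measureI)
    have "emeasure P (space P) = (\<integral>\<^sup>+x. ennreal (f x) \<partial>\<nu>)"
      unfolding P_def by (simp add: emeasure_density cong: nn_integral_cong)
    also have "\<dots> = ennreal (LINT x|\<nu>. f x)" using fi f(2) by (intro nn_integral_eq_integral) auto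
    finally show "emeasure P (space P) \<noteq> \<infinity>" by simp
  qed
  have mP: "measure P A = (LINT x:A|\<nu>. f x)" if A: "A \<in> sets \<nu>" for A
  proof -
    have "emeasure P A = (\<integral>\<^sup>+x. ennreal (indicator A x * f x) \<partial>\<nu>)"
      using A unfolding P_def by (simp add: emeasure_density) (intro nn_integral_cong, simp add: indicator_def)
    also have "\<dots> = ennreal (LINT x|\<nu>. indicator A x * f x)"
    proof (rule nn_integral_eq_integral)
      show "integrable \<nu> (\<lambda>x. indicator A x * f x)"
        using integrable_real_mult_indicator[OF A fi] by (simp add: mult.commute)
    qed (use f(2) in simp)
    finally show ?thesis
      using f(2) by (simp add: measure_def set_lebesgue_integral_def integral_nonneg_AE)
  qed
  \<comment> \<open>The density is nonnegative, so the negative part can be taken to be the zero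
    measure.\<close>
  have "signed_integral M \<mu> \<phi> = (LINT x|P. \<phi> x) - (LINT x|null_measure M. \<phi> x)"
  proof (rule signed_integral_eq[OF fP])
    show "finite_measure (null_measure M)" by (rule finite_measureI) simp
    show "sets P = sets M" "sets (null_measure M) = sets M" using sets by (simp_all add: P_def)
    show "\<mu> A = measure P A - measure (null_measure M) A" if "A \<in> sets M" for A
      using fd[of A] mP[of A] that sets by simp
  qed (use \<phi> in auto)
  also have "\<dots> = (LINT x|\<nu>. f x * \<phi> x)"
    unfolding P_def using f(2) by (simp add: integral_real_density)
  finally have s: "signed_integral M \<mu> \<phi> = (LINT x|\<nu>. f x * \<phi> x)" .
  have i1: "integrable \<nu> (\<lambda>x. f x * \<phi> x)"
  proof (rule Bochner_Integration.integrable_bound[where f="\<lambda>x. B * f x"])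
    show "AE x in \<nu>. norm (f x * \<phi> x) \<le> norm (B * f x)"
    proof (rule AE_I2)
      fix x
      have "f x * \<bar>\<phi> x\<bar> \<le> f x * \<bar>B\<bar>" using f(2)[of x] \<phi>(2)[of x] by (intro mult_left_mono) auto
      then show "norm (f x * \<phi> x) \<le> norm (B * f x)" using f(2)[of x] by (simp add: abs_mult mult.commute)
    qed
  qed (use fi in auto)
  have i2: "integrable \<nu> (\<lambda>x. exp (\<phi> x) - 1)"
  proof (rule integrable_bounded[OF fin, of _ "exp B + 1"])
    fix x
    have "exp (\<phi> x) \<le> exp B" using \<phi>(2)[of x] by simp
    moreover have "0 < exp (\<phi> x)" by simp
    ultimately show "\<bar>exp (\<phi> x) - 1\<bar> \<le> exp B + 1" unfolding abs_le_iff by linarith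
  qed measurable
  have "ennreal (signed_integral M \<mu> \<phi> - (LINT x|\<nu>. exp (\<phi> x) - 1)) = ennreal (LINT x|\<nu>. f x * \<phi> x - (exp (\<phi> x) - 1))"
    unfolding s by (simp only: Bochner_Integration.integral_diff[OF i1 i2])
  also have "\<dots> \<le> (\<integral>\<^sup>+x. ennreal (f x * \<phi> x - (exp (\<phi> x) - 1)) \<partial>\<nu>)"
    by (rule ennreal_integral_le_nn_integral[OF Bochner_Integration.integrable_diff[OF i1 i2]])
  also have "\<dots> \<le> (\<integral>\<^sup>+x. ennreal (f x * ln (f x) - f x + 1) \<partial>\<nu>)"
    using f(2) by (intro nn_integral_mono ennreal_leI Young_entropy)
  finally show ?thesis unfolding Ent .
qed

lemma signed_integral_measure:
  assumes "finite_measure P" "sets P = sets M" "\<phi> \<in> borel_measurable M" "\<And>x. \<bar>\<phi> x\<bar> \<le> B"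
  shows "signed_integral M (measure P) \<phi> = (LINT x|P. \<phi> x)"
proof -
  have "signed_integral M (measure P) \<phi> = (LINT x|P. \<phi> x) - (LINT x|null_measure M. \<phi> x)"
    by (rule signed_integral_eq[where B=B]) (use assms in \<open>auto intro!: finite_measureI\<close>)
  then show ?thesis by simp
qed

lemma signed_integral_sum:
  fixes \<mu> :: "'a::topological_space set \<Rightarrow> real"
  assumes vm: "vector_measure borel \<mu>" and I: "finite I"
    and f: "\<And>i. i \<in> I \<Longrightarrow> f i \<in> borel_measurable borel" "\<And>i x. i \<in> I \<Longrightarrow> \<bar>f i x\<bar> \<le> B"
  shows "(\<Sum>i\<in>I. a i * signed_integral borel \<mu> (f i)) = signed_integral borel \<mu> (\<lambda>x. \<Sum>i\<in>I. a i * f i x)"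
proof -
  obtain P N where PN: "finite_measure P" "finite_measure N" "sets P = sets borel" "sets N = sets borel"
      "\<And>A. A \<in> sets borel \<Longrightarrow> \<mu> A = measure P A - measure N A"
    by (rule Jordan_decomposition_vector_measure[OF vm]) (rule that)
  have i: "integrable Q (f i)" if "finite_measure Q" "sets Q = sets borel" "i \<in> I" for Q i
    using f that by (intro integrable_bounded[of _ _ B]) (auto simp: measurable_cong_sets[OF that(2) refl])
  have e: "signed_integral borel \<mu> (f i) = (LINT x|P. f i x) - (LINT x|N. f i x)" if "i \<in> I" for i
    by (rule signed_integral_eq[OF PN, of _ B]) (use f that in auto)
  have "\<bar>\<Sum>i\<in>I. a i * f i x\<bar> \<le> (\<Sum>i\<in>I. \<bar>a i\<bar> * B)" for x
    by (rule order_trans[OF sum_abs]) (intro sum_mono, simp add: abs_mult mult_left_mono f(2))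
  then have "signed_integral borel \<mu> (\<lambda>x. \<Sum>i\<in>I. a i * f i x) = (LINT x|P. (\<Sum>i\<in>I. a i * f i x)) - (LINT x|N. (\<Sum>i\<in>I. a i * f i x))"
    by (intro signed_integral_eq[OF PN, of _ "\<Sum>i\<in>I. \<bar>a i\<bar> * B"] borel_measurable_sum borel_measurable_times f) auto
  also have "\<dots> = (\<Sum>i\<in>I. a i * (LINT x|P. f i x)) - (\<Sum>i\<in>I. a i * (LINT x|N. f i x))"
    using i[OF PN(1,3)] i[OF PN(2,4)] by simp
  also have "\<dots> = (\<Sum>i\<in>I. a i * signed_integral borel \<mu> (f i))"
    by (simp add: e right_diff_distrib sum_subtractf)
  finally show ?thesis by simp
qed

lemma integral_scale_measure:
  fixes g :: "'a \<Rightarrow> real"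
  assumes "g \<in> borel_measurable M" "0 \<le> c"
  shows "(LINT x|scale_measure (ennreal c) M. g x) = c * (LINT x|M. g x)"
proof -
  have "scale_measure (ennreal c) M = density M (\<lambda>x. ennreal c)"
    by (rule measure_eqI) (auto simp: emeasure_density nn_integral_cmult_indicator)
  then show ?thesis using assms by (simp add: integral_real_density)
qed

text \<open>The kernel is a probability density in \<open>w\<close>, so Jensen's inequality follows
  by integrating the tangent of exp at the mean \<open>m\<close>.\<close>

lemma tker_Jensen:
  fixes g :: "torus \<Rightarrow> real"
  assumes g: "g \<in> borel_measurable borel" "\<And>z. \<bar>g z\<bar> \<le> B"
  shows "exp (LINT w|torus_lebesgue. tker n w z * g w) \<le> (LINT w|torus_lebesgue. tker n w z * exp (g w))"
proof -
  define m where "m = (LINT w|torus_lebesgue. tker n w z * g w)"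
  obtain K where K: "\<And>w. \<bar>tker n w z\<bar> \<le> K" using bounded_continuous_torus[OF continuous_tker] by blast
  have K0: "0 \<le> K" using K[of undefined] by linarith
  have B0: "0 \<le> B" using g(2)[of undefined] by linarith
  have ik: "integrable torus_lebesgue (\<lambda>w. tker n w z)" by (rule torus_integrable_continuous[OF continuous_tker])
  have i1: "integrable torus_lebesgue (\<lambda>w. tker n w z * g w)"
  proof (rule integrable_bounded[OF torus.finite_measure_axioms, of _ "K * B"])
    show "\<bar>tker n w z * g w\<bar> \<le> K * B" for w
      unfolding abs_mult using K g(2) K0 by (intro mult_mono) auto
  qed (use g in simp)
  have i2: "integrable torus_lebesgue (\<lambda>w. tker n w z * exp (g w))"
  proof (rule integrable_bounded[OF torus.finite_measure_axioms, of _ "K * exp B"])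
    show "\<bar>tker n w z * exp (g w)\<bar> \<le> K * exp B" for w
      unfolding abs_mult using K g(2)[of w] K0 by (intro mult_mono) auto
  qed (use g in simp)
  have "exp m = exp m * (1 - m) * (LINT w|torus_lebesgue. tker n w z) + exp m * (LINT w|torus_lebesgue. tker n w z * g w)"
    unfolding integral_tker m_def[symmetric] by (simp add: algebra_simps)
  also have "\<dots> = (LINT w|torus_lebesgue. exp m * (1 - m) * tker n w z + exp m * (tker n w z * g w))"
    using ik i1 by simp
  also have "\<dots> \<le> (LINT w|torus_lebesgue. tker n w z * exp (g w))"
  proof (rule integral_mono)
    fix w
    have "1 + (g w - m) \<le> exp (g w - m)" by (rule exp_ge_add_one_self)
    then have "exp m * (1 + (g w - m)) \<le> exp m * exp (g w - m)" by (intro mult_left_mono) auto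
    also have "\<dots> = exp (g w)" by (simp add: mult_exp_exp)
    finally have "tker n w z * (exp m * (1 + (g w - m))) \<le> tker n w z * exp (g w)"
      by (intro mult_left_mono tker_nonneg)
    then show "exp m * (1 - m) * tker n w z + exp m * (tker n w z * g w) \<le> tker n w z * exp (g w)"
      by (simp add: algebra_simps)
  qed (use ik i1 i2 in auto)
  finally show ?thesis by (simp add: m_def)
qed

lemma continuous_on_integral_bounded:
  fixes F :: "real \<Rightarrow> 'a \<Rightarrow> real"
  assumes fin: "finite_measure M" and c: "\<And>x. x \<in> space M \<Longrightarrow> continuous_on I (\<lambda>t. F t x)"
    and m: "\<And>t. t \<in> I \<Longrightarrow> F t \<in> borel_measurable M" and B: "\<And>t x. t \<in> I \<Longrightarrow> x \<in> space M \<Longrightarrow> \<bar>F t x\<bar> \<le> B"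
  shows "continuous_on I (\<lambda>t. LINT x|M. F t x)"
  unfolding continuous_on_sequentially
proof (intro allI ballI impI)
  fix u :: "nat \<Rightarrow> real" and a assume a: "a \<in> I" and u: "(\<forall>n. u n \<in> I) \<and> u \<longlonglongrightarrow> a"
  interpret finite_measure M by fact
  have "(\<lambda>n. LINT x|M. F (u n) x) \<longlonglongrightarrow> (LINT x|M. F a x)"
  proof (rule integral_dominated_convergence[where w="\<lambda>_. B"])
    show "AE x in M. (\<lambda>n. F (u n) x) \<longlonglongrightarrow> F a x"
    proof (rule AE_I2)
      fix x assume "x \<in> space M"
      from c[OF this] show "(\<lambda>n. F (u n) x) \<longlonglongrightarrow> F a x"
        using a u unfolding continuous_on_sequentially o_def by blast
    qed
    show "AE x in M. norm (F (u n) x) \<le> B" for n using B u by (intro AE_I2) auto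
  qed (use a u m in auto)
  then show "((\<lambda>t. LINT x|M. F t x) \<circ> u) \<longlonglongrightarrow> (LINT x|M. F a x)" by (simp add: o_def)
qed

lemma set_integrable_sum:
  fixes f :: "'i \<Rightarrow> 'a \<Rightarrow> real"
  assumes "\<And>i. i \<in> I \<Longrightarrow> set_integrable M A (f i)"
  shows "set_integrable M A (\<lambda>x. \<Sum>i\<in>I. f i x)"
  using assms unfolding set_integrable_def scaleR_sum_right by (rule Bochner_Integration.integrable_sum)

lemma set_integral_sum:
  fixes f :: "'i \<Rightarrow> 'a \<Rightarrow> real"
  assumes "\<And>i. i \<in> I \<Longrightarrow> set_integrable M A (f i)"
  shows "(LINT x:A|M. (\<Sum>i\<in>I. f i x)) = (\<Sum>i\<in>I. LINT x:A|M. f i x)"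
  using assms unfolding set_integrable_def set_lebesgue_integral_def scaleR_sum_right
  by (rule Bochner_Integration.integral_sum)

text \<open>An integrated form of the chain rule: the increments of \<open>E\<close> are only estimated with the
  coefficients \<open>l\<close> frozen at the right end point.\<close>

lemma increments_le_integral:
  fixes E :: "real \<Rightarrow> real" and l g :: "'i \<Rightarrow> real \<Rightarrow> real"
  assumes I: "finite I" and l: "\<And>i. i \<in> I \<Longrightarrow> continuous_on {0..T} (l i)"
    and g: "\<And>i. i \<in> I \<Longrightarrow> set_integrable lborel {0<..<T} (g i)"
    and E: "\<And>s t. 0 \<le> s \<Longrightarrow> s \<le> t \<Longrightarrow> t \<le> T \<Longrightarrow> E t - E s \<le> (\<Sum>i\<in>I. l i t * (LINT r:{s<..<t}|lborel. g i r))"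
    and st: "0 \<le> s" "s \<le> t" "t \<le> T"
  shows "set_integrable lborel {s<..<t} (\<lambda>r. \<Sum>i\<in>I. l i r * g i r)"
    and "E t - E s \<le> (LINT r:{s<..<t}|lborel. (\<Sum>i\<in>I. l i r * g i r))"
proof -
  have sub: "set_integrable lborel {a<..<b} (g i)" if "i \<in> I" "0 \<le> a" "b \<le> T" for i a b
    by (rule set_integrable_subset[OF g[OF that(1)]]) (use that in auto)
  have lg: "set_integrable lborel {a<..<b} (\<lambda>r. l i r * g i r)" if i: "i \<in> I" and ab: "0 \<le> a" "b \<le> T" for i a b
  proof -
    have "compact (l i ` {0..T})" by (intro compact_continuous_image l i compact_Icc)
    then have "bounded (l i ` {0..T})" by (rule compact_imp_bounded)
    then obtain K where "\<forall>x\<in>l i ` {0..T}. norm x \<le> K" unfolding bounded_iff by blast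
    then have K: "\<bar>l i r\<bar> \<le> K" if "r \<in> {0..T}" for r using that by simp
    have "(\<lambda>r. indicator {a<..<b} r *\<^sub>R l i r) \<in> borel_measurable borel"
      by (rule borel_measurable_continuous_on_indicator) (use ab in \<open>auto intro: continuous_on_subset[OF l[OF i]]\<close>)
    then have m: "(\<lambda>r. indicator {a<..<b} r * l i r) \<in> borel_measurable borel" by simp
    have gi: "integrable lborel (\<lambda>r. indicator {a<..<b} r * g i r)" using sub[OF i ab] by (simp add: set_integrable_def)
    have "integrable lborel (\<lambda>r. indicator {a<..<b} r * (l i r * g i r))"
    proof (rule Bochner_Integration.integrable_bound[where f="\<lambda>r. K * (indicator {a<..<b} r * g i r)"])
      have "(\<lambda>r. (indicator {a<..<b} r * l i r) * (indicator {a<..<b} r * g i r)) \<in> borel_measurable lborel"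
        by (rule borel_measurable_times) (use m gi in \<open>simp_all del: borel_measurable_times\<close>)
      moreover have "(\<lambda>r. (indicator {a<..<b} r * l i r) * (indicator {a<..<b} r * g i r)) = (\<lambda>r. indicator {a<..<b} r * (l i r * g i r))"
        by (auto simp: indicator_def fun_eq_iff)
      ultimately show "(\<lambda>r. indicator {a<..<b} r * (l i r * g i r)) \<in> borel_measurable lborel" by simp
      show "AE r in lborel. norm (indicator {a<..<b} r * (l i r * g i r)) \<le> norm (K * (indicator {a<..<b} r * g i r))"
      proof (rule AE_I2)
        fix r
        show "norm (indicator {a<..<b} r * (l i r * g i r)) \<le> norm (K * (indicator {a<..<b} r * g i r))"
        proof (cases "r \<in> {a<..<b}")
          case True
          then have "\<bar>l i r\<bar> \<le> \<bar>K\<bar>" using K[of r] ab by auto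
          then have "\<bar>l i r\<bar> * \<bar>g i r\<bar> \<le> \<bar>K\<bar> * \<bar>g i r\<bar>" by (rule mult_right_mono) simp
          then show ?thesis using True by (simp add: abs_mult)
        qed simp
      qed
    qed (use gi in simp)
    then show ?thesis by (simp add: set_integrable_def)
  qed
  have H: "set_integrable lborel {a<..<b} (\<lambda>r. \<Sum>i\<in>I. l i r * g i r)" if "0 \<le> a" "b \<le> T" for a b
    using lg[OF _ that] by (intro set_integrable_sum) auto
  show "set_integrable lborel {s<..<t} (\<lambda>r. \<Sum>i\<in>I. l i r * g i r)" by (rule H[OF st(1,3)])
  define h where "h r = (\<Sum>i\<in>I. l i r * g i r)" for r
  define \<gamma> where "\<gamma> r = (\<Sum>i\<in>I. \<bar>g i r\<bar>)" for r
  have G\<gamma>: "set_integrable lborel {a<..<b} \<gamma>" if "0 \<le> a" "b \<le> T" for a b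
    unfolding \<gamma>_def using sub[OF _ that] by (intro set_integrable_sum set_integrable_abs) auto
  have "E t - E s - (LINT r:{s<..<t}|lborel. h r) \<le> e * (LINT r:{s<..<t}|lborel. \<gamma> r)" if e: "e > 0" for e
  proof -
    \<comment> \<open>A modulus of uniform continuity common to the finitely many
      coefficients.\<close>
    have "\<exists>d>0. \<forall>i\<in>I. \<forall>a\<in>{0..T}. \<forall>b\<in>{0..T}. \<bar>a - b\<bar> < d \<longrightarrow> \<bar>l i a - l i b\<bar> < e"
      using I l
    proof (induction I)
      case empty then show ?case by (intro exI[of _ 1]) simp
    next
      case (insert i J)
      then obtain d1 where d1: "d1 > 0" "\<forall>i\<in>J. \<forall>a\<in>{0..T}. \<forall>b\<in>{0..T}. \<bar>a - b\<bar> < d1 \<longrightarrow> \<bar>l i a - l i b\<bar> < e" by auto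
      have "uniformly_continuous_on {0..T} (l i)"
        using insert by (intro compact_uniformly_continuous) auto
      then obtain d2 where d2: "d2 > 0" "\<forall>a\<in>{0..T}. \<forall>b\<in>{0..T}. \<bar>b - a\<bar> < d2 \<longrightarrow> \<bar>l i b - l i a\<bar> < e"
        using e unfolding uniformly_continuous_on_def dist_real_def by blast
      show ?case using d1 d2 by (intro exI[of _ "min d1 d2"]) auto
    qed
    then obtain d where d: "d > 0" and ld: "\<And>i a b. i \<in> I \<Longrightarrow> a \<in> {0..T} \<Longrightarrow> b \<in> {0..T} \<Longrightarrow> \<bar>a - b\<bar> < d \<Longrightarrow> \<bar>l i a - l i b\<bar> < e"
      by blast
    \<comment> \<open>The defect with an error term added: on steps shorter than \<open>d\<close>,
      freezing the coefficients costs at most the integral of \<open>e * \<gamma>\<close>, so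
      \<open>\<Psi>\<close> does not increase. Finitely many such steps lead from \<open>s\<close>
      to \<open>t\<close>.\<close>
    define \<Psi> where "\<Psi> x = E x - (LINT r:{s<..<x}|lborel. h r) - e * (LINT r:{s<..<x}|lborel. \<gamma> r)" for x
    have split: "(LINT r:{s<..<b}|lborel. u r) = (LINT r:{s<..<a}|lborel. u r) + (LINT r:{a<..<b}|lborel. u r)"
      if ab: "s \<le> a" "a \<le> b" "b \<le> t" and u: "\<And>a b. 0 \<le> a \<Longrightarrow> b \<le> T \<Longrightarrow> set_integrable lborel {a<..<b} u" for a b and u :: "real \<Rightarrow> real"
    proof -
      have i: "integrable lborel (\<lambda>r. indicator {s<..<b} r * u r)" "integrable lborel (\<lambda>r. indicator {s<..<a} r * u r)"
        "integrable lborel (\<lambda>r. indicator {a<..<b} r * u r)"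
        using u[of s b] u[of s a] u[of a b] st ab by (auto simp: set_integrable_def)
      have "(LINT r|lborel. indicator {s<..<b} r * u r) = (LINT r|lborel. indicator {s<..<a} r * u r + indicator {a<..<b} r * u r)"
      proof (rule integral_cong_AE)
        show "AE r in lborel. indicator {s<..<b} r * u r = indicator {s<..<a} r * u r + indicator {a<..<b} r * u r"
          using AE_lborel_singleton[of a] by eventually_elim (use ab in \<open>auto simp: indicator_def\<close>)
      qed (use i in auto)
      then show ?thesis using i by (simp add: set_lebesgue_integral_def)
    qed
    have small: "\<Psi> b \<le> \<Psi> a" if ab: "s \<le> a" "a \<le> b" "b \<le> t" "b - a < d" for a b
    proof -
      have a0: "0 \<le> a" "b \<le> T" using ab st by auto
      have "E b - E a \<le> (\<Sum>i\<in>I. l i b * (LINT r:{a<..<b}|lborel. g i r))" using ab st by (intro E) auto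
      also have "\<dots> = (LINT r:{a<..<b}|lborel. (\<Sum>i\<in>I. l i b * g i r))"
        using sub[OF _ a0] by (subst set_integral_sum) auto
      also have "\<dots> \<le> (LINT r:{a<..<b}|lborel. h r + e * \<gamma> r)"
      proof (rule set_integral_mono)
        show "set_integrable lborel {a<..<b} (\<lambda>r. \<Sum>i\<in>I. l i b * g i r)"
          using sub[OF _ a0] by (intro set_integrable_sum) auto
        show "set_integrable lborel {a<..<b} (\<lambda>r. h r + e * \<gamma> r)"
          using H[OF a0] G\<gamma>[OF a0] unfolding h_def by (intro set_integral_add(1)) auto
        fix r assume r: "r \<in> {a<..<b}"
        have "l i b * g i r \<le> l i r * g i r + e * \<bar>g i r\<bar>" if "i \<in> I" for i
        proof -
          have "\<bar>l i b - l i r\<bar> < e" using r ab st that by (intro ld) auto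
          then have "\<bar>l i b - l i r\<bar> * \<bar>g i r\<bar> \<le> e * \<bar>g i r\<bar>" by (intro mult_right_mono) auto
          then have "(l i b - l i r) * g i r \<le> e * \<bar>g i r\<bar>"
            using abs_ge_self[of "(l i b - l i r) * g i r"] unfolding abs_mult by (rule order_trans[rotated])
          then show ?thesis by (simp add: algebra_simps)
        qed
        then have "(\<Sum>i\<in>I. l i b * g i r) \<le> (\<Sum>i\<in>I. l i r * g i r + e * \<bar>g i r\<bar>)" by (rule sum_mono)
        then show "(\<Sum>i\<in>I. l i b * g i r) \<le> h r + e * \<gamma> r"
          by (simp add: h_def \<gamma>_def sum.distrib sum_distrib_left)
      qed
      also have "\<dots> = (LINT r:{a<..<b}|lborel. h r) + e * (LINT r:{a<..<b}|lborel. \<gamma> r)"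
        using H[OF a0] G\<gamma>[OF a0] unfolding h_def by (subst set_integral_add(2)) auto
      finally have le: "E b - E a \<le> (LINT r:{a<..<b}|lborel. h r) + e * (LINT r:{a<..<b}|lborel. \<gamma> r)" .
      have s1: "(LINT r:{s<..<b}|lborel. h r) = (LINT r:{s<..<a}|lborel. h r) + (LINT r:{a<..<b}|lborel. h r)"
        by (rule split[OF ab(1-3)]) (unfold h_def, rule H)
      have s2: "(LINT r:{s<..<b}|lborel. \<gamma> r) = (LINT r:{s<..<a}|lborel. \<gamma> r) + (LINT r:{a<..<b}|lborel. \<gamma> r)"
        by (rule split[OF ab(1-3)]) (rule G\<gamma>)
      show ?thesis using le unfolding \<Psi>_def s1 s2 distrib_left by linarith
    qed
    obtain m :: nat where m: "(t - s) / d < real m" using reals_Archimedean2 by blast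
    \<comment> \<open>The successor keeps the number of steps positive also when
      \<open>m = 0\<close>.\<close>
    define N where "N = Suc m"
    have N: "(t - s) / real N < d"
    proof -
      have "t - s < real m * d" using m d by (simp add: divide_less_eq)
      also have "\<dots> \<le> real N * d" using d by (simp add: N_def)
      finally show ?thesis by (simp add: divide_less_eq N_def mult.commute)
    qed
    define x where "x i = s + real i * ((t - s) / real N)" for i
    have step0: "0 \<le> (t - s) / real N" using st by simp
    have xN: "x N = t" by (simp add: x_def N_def)
    have xi: "s \<le> x i" "x i \<le> x (Suc i)" for i
    proof -
      have "0 \<le> real i * ((t - s) / real N)" using step0 by (intro mult_nonneg_nonneg) auto
      moreover have "real i * ((t - s) / real N) \<le> real (Suc i) * ((t - s) / real N)"
        using step0 by (intro mult_right_mono) auto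
      ultimately show "s \<le> x i" "x i \<le> x (Suc i)" unfolding x_def by linarith+
    qed
    have xt: "x i \<le> t" if "i \<le> N" for i
    proof -
      have "real i * ((t - s) / real N) \<le> real N * ((t - s) / real N)" using that step0 by (intro mult_right_mono) auto
      then show ?thesis by (simp add: x_def N_def)
    qed
    have "\<Psi> (x i) \<le> \<Psi> s" if "i \<le> N" for i
      using that
    proof (induction i)
      case 0 then show ?case by (simp add: x_def)
    next
      case (Suc i)
      have "x (Suc i) - x i = (t - s) / real N" unfolding x_def of_nat_Suc distrib_right by linarith
      then have "\<Psi> (x (Suc i)) \<le> \<Psi> (x i)" using N xi xt Suc.prems by (intro small) auto
      then show ?case using Suc by simp
    qed
    from this[of N] have "\<Psi> t \<le> \<Psi> s" by (simp add: xN)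
    then show ?thesis by (simp add: \<Psi>_def set_lebesgue_integral_def)
  qed
  moreover have "0 \<le> (LINT r:{s<..<t}|lborel. \<gamma> r)"
    unfolding set_lebesgue_integral_def \<gamma>_def by (intro Bochner_Integration.integral_nonneg) (simp add: sum_nonneg)
  ultimately have "E t - E s - (LINT r:{s<..<t}|lborel. h r) \<le> 0"
  proof -
    define c where "c = (LINT r:{s<..<t}|lborel. \<gamma> r)"
    assume *: "\<And>e. 0 < e \<Longrightarrow> E t - E s - (LINT r:{s<..<t}|lborel. h r) \<le> e * (LINT r:{s<..<t}|lborel. \<gamma> r)"
      and c0: "0 \<le> (LINT r:{s<..<t}|lborel. \<gamma> r)"
    show ?thesis
    proof (rule field_le_epsilon)
      fix e :: real assume "e > 0"
      \<comment> \<open>Division by \<open>c + 1\<close> rather than \<open>c\<close>, which may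
        vanish.\<close>
      then have "E t - E s - (LINT r:{s<..<t}|lborel. h r) \<le> e / (c + 1) * c"
        using *[of "e / (c + 1)"] c0 by (simp add: c_def[symmetric])
      also have "\<dots> \<le> e" using \<open>e > 0\<close> c0 by (simp add: c_def[symmetric] divide_le_eq mult_left_mono)
      finally show "E t - E s - (LINT r:{s<..<t}|lborel. h r) \<le> 0 + e" by simp
    qed
  qed
  then show "E t - E s \<le> (LINT r:{s<..<t}|lborel. (\<Sum>i\<in>I. l i r * g i r))" by (simp add: h_def)
qed

section \<open>The entropy estimate\<close>

text \<open>Test functions charging one velocity. With the discrete topology on velocities they are
  continuous and belong to \<open>C10\<close>, so the continuity equation yields one scalar equation
  for each moment.\<close>

definition vbas :: "nat \<times> nat \<Rightarrow> bool \<Rightarrow> phase \<Rightarrow> real"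
  where "vbas p b q = (if snd q = b then tmon p (fst q) else 0)"

definition dvbas :: "nat \<times> nat \<Rightarrow> bool \<Rightarrow> phase \<Rightarrow> real"
  where "dvbas p b q = (if snd q = b then dtmon p (fst q) else 0)"

lemma continuous_vbas: "continuous_on UNIV (vbas p b)" and continuous_dvbas: "continuous_on UNIV (dvbas p b)"
proof -
  have "continuous_on UNIV (\<lambda>z. if b' = b then g z else 0)" if "continuous_on UNIV g" for b' and g :: "torus \<Rightarrow> real"
    using that by (cases "b' = b") simp_all
  from phase_continuous[of "\<lambda>z b'. if b' = b then tmon p z else 0", OF this[OF continuous_tmon]]
    phase_continuous[of "\<lambda>z b'. if b' = b then dtmon p z else 0", OF this[OF continuous_dtmon]]
  show "continuous_on UNIV (vbas p b)" "continuous_on UNIV (dvbas p b)"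
    unfolding vbas_def[abs_def] dvbas_def[abs_def] .
qed

lemma measurable_vbas [measurable]: "vbas p b \<in> borel_measurable borel"
  and measurable_dvbas [measurable]: "dvbas p b \<in> borel_measurable borel"
  by (simp_all add: borel_measurable_continuous_onI continuous_vbas continuous_dvbas)

lemma vbas_bound: "\<bar>vbas p b q\<bar> \<le> 1"
  by (simp add: vbas_def tmon_bound)

lemma dvbas_bounded: obtains B where "0 < B" "\<And>b q. \<bar>dvbas p b q\<bar> \<le> B"
proof -
  obtain B where "0 < B" "\<And>z. \<bar>dtmon p z\<bar> \<le> B" using bounded_continuous_torus[OF continuous_dtmon] by blast
  then show ?thesis by (intro that[of B]) (auto simp: dvbas_def less_imp_le)
qed

lemma torus_deriv_C10:
  assumes F: "\<And>b. torus_deriv (F b) (G b)" and G: "\<And>b. continuous_on UNIV (G b)"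
  shows "(\<lambda>q. F (snd q) (fst q)) \<in> C10" "dx (\<lambda>q. F (snd q) (fst q)) = (\<lambda>q. G (snd q) (fst q))"
proof -
  have d: "((\<lambda>y. F b (to_torus y)) has_real_derivative G b (to_torus y)) (at y)" for b y
    using F[of b] by (simp add: torus_deriv_def)
  have c: "continuous_on UNIV (\<lambda>y. G b (to_torus y))" for b
    using G[of b] by (simp add: continuous_on_torus_iff)
  have "\<exists>D. (\<forall>x\<in>UNIV. ((\<lambda>y. F b (to_torus y)) has_vector_derivative D x) (at x)) \<and> continuous_on UNIV D" for b
    using d[of b] c[of b] by (intro exI[of _ "\<lambda>y. G b (to_torus y)"]) (simp add: has_real_derivative_iff_has_vector_derivative)
  then show "(\<lambda>q. F (snd q) (fst q)) \<in> C10" by (simp add: C10_def C1_differentiable_on_def)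
  show "dx (\<lambda>q. F (snd q) (fst q)) = (\<lambda>q. G (snd q) (fst q))"
  proof
    fix q
    show "dx (\<lambda>q. F (snd q) (fst q)) q = G (snd q) (fst q)"
      using DERIV_imp_deriv[OF d[of "snd q" "rep_torus (fst q)"]]
      by (cases q) (simp add: dx_def)
  qed
qed

lemma vbas_C10: "vbas p b \<in> C10" "dx (vbas p b) = dvbas p b"
proof -
  have 1: "torus_deriv (\<lambda>z. if b' = b then tmon p z else 0) (\<lambda>z. if b' = b then dtmon p z else 0)" for b'
    using torus_deriv_tmon[of p] by (simp add: torus_deriv_def)
  have 2: "continuous_on UNIV (\<lambda>z. if b' = b then dtmon p z else 0)" for b'
    using continuous_dtmon[of p] by (cases "b' = b") simp_all
  show "vbas p b \<in> C10" "dx (vbas p b) = dvbas p b"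
    using torus_deriv_C10[where F="\<lambda>b' z. if b' = b then tmon p z else 0" and G="\<lambda>b' z. if b' = b then dtmon p z else 0", OF 1 2]
    unfolding vbas_def[abs_def] dvbas_def[abs_def] by simp_all
qed

lemma measurable_flip: "flip \<in> measurable borel borel"
proof -
  have "(\<lambda>q :: phase. (fst q, \<not> snd q)) \<in> borel_measurable borel"
    by (rule phase_measurable[where F="\<lambda>z b. (z, \<not> b)"])
      (intro borel_measurable_continuous_onI continuous_intros)
  then show ?thesis by (simp add: flip_def case_prod_beta')
qed

section \<open>A single curve of finite action at fixed V\<close>

locale ce_curve =
  fixes \<alpha> T V C :: real and \<sigma> :: "real \<Rightarrow> phase measure" and j :: "real \<Rightarrow> phase set \<Rightarrow> real \<times> real"
  assumes \<alpha>: "0 < \<alpha>" and T: "0 < T" and V: "1 \<le> V" and C: "0 < C"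
    and CE: "CE T \<sigma> j"
    and ent0: "Ent (measure (\<sigma> 0)) ref_measure \<le> ennreal C"
    and act: "(\<integral>\<^sup>+r\<in>{0<..<T}. lagrangian \<alpha> V (\<sigma> r) (j r) \<partial>lborel) \<le> ennreal C"
begin

text \<open>The intensity of the reference jumps in \<open>lagrangian\<close>.\<close>

definition k :: real where "k = V\<^sup>2 / (2 * \<alpha>)"
definition \<delta> :: real where "\<delta> = 1 / V\<^sup>2"

lemma k_pos: "0 < k" using V \<alpha> by (simp add: k_def)
lemma \<delta>_pos: "0 < \<delta>" using V by (simp add: \<delta>_def)
lemma \<delta>_le_1: "\<delta> \<le> 1" using V by (simp add: \<delta>_def divide_le_eq)
lemma \<delta>_k: "2 * \<delta> * k = 1 / \<alpha>" using V \<alpha> by (simp add: \<delta>_def k_def)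

lemma narrow_curve: "narrow_curve T \<sigma>"
  using CE unfolding CE_def by (elim conjE)

lemma prob: "t \<in> {0..T} \<Longrightarrow> prob_space (\<sigma> t)" and sets_\<sigma>: "t \<in> {0..T} \<Longrightarrow> sets (\<sigma> t) = sets borel"
  using narrow_curve unfolding narrow_curve_def by simp_all

lemma narrow:
  fixes \<phi> :: "phase \<Rightarrow> real"
  shows "continuous_on UNIV \<phi> \<Longrightarrow> bounded (range \<phi>) \<Longrightarrow> continuous_on {0..T} (\<lambda>t. LINT q|\<sigma> t. \<phi> q)"
  by (rule narrow_curve[unfolded narrow_curve_def, THEN conjunct2, rule_format])

lemma fin: "t \<in> {0..T} \<Longrightarrow> finite_measure (\<sigma> t)"
  using prob by (simp add: prob_space.finite_measure)

lemma space_\<sigma>: "t \<in> {0..T} \<Longrightarrow> space (\<sigma> t) = UNIV"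
  using sets_eq_imp_space_eq[OF sets_\<sigma>] by simp

lemma meas_\<sigma>: "t \<in> {0..T} \<Longrightarrow> f \<in> borel_measurable borel \<Longrightarrow> f \<in> borel_measurable (\<sigma> t)"
  by (simp add: measurable_cong_sets[OF sets_\<sigma> refl])

lemma int_\<sigma>:
  fixes f :: "phase \<Rightarrow> real"
  assumes "t \<in> {0..T}" "f \<in> borel_measurable borel" "\<And>q. \<bar>f q\<bar> \<le> B"
  shows "integrable (\<sigma> t) f"
  by (rule integrable_bounded[OF fin[OF assms(1)] meas_\<sigma>[OF assms(1,2)], of B]) (rule assms(3))

lemma fam: "integrable_family {0<..<T} j"
  using CE unfolding CE_def by (elim conjE)

lemmas CE_eq = CE[unfolded CE_def, THEN conjunct2, THEN conjunct2, rule_format]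

lemma vm_j: "r \<in> {0<..<T} \<Longrightarrow> vector_measure borel (j r)"
  and meas_j: "A \<in> sets borel \<Longrightarrow> (\<lambda>r. j r A) \<in> borel_measurable (restrict_space borel {0<..<T})"
  and tv_j: "(\<integral>\<^sup>+r\<in>{0<..<T}. tv_norm borel (j r) \<partial>lborel) < \<infinity>"
  using fam unfolding integrable_family_def by simp_all

lemma vm_flux: 
  assumes "r \<in> {0<..<T}"
  shows "vector_measure borel (flux1 (j r))" "vector_measure borel (flux2 (j r))"
  using vector_measure_bounded_linear[OF bounded_linear_fst vm_j[OF assms]]
    vector_measure_bounded_linear[OF bounded_linear_snd vm_j[OF assms]]
  unfolding flux1_def[abs_def] flux2_def[abs_def] by simp_all

lemma meas_flux:
  assumes "A \<in> sets borel"
  shows "(\<lambda>r. flux1 (j r) A) \<in> borel_measurable (restrict_space borel {0<..<T})"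
    "(\<lambda>r. flux2 (j r) A) \<in> borel_measurable (restrict_space borel {0<..<T})"
proof -
  have "(fst :: real \<times> real \<Rightarrow> real) \<in> borel_measurable borel" "(snd :: real \<times> real \<Rightarrow> real) \<in> borel_measurable borel"
    by (intro borel_measurable_continuous_onI continuous_intros)+
  then show "(\<lambda>r. flux1 (j r) A) \<in> borel_measurable (restrict_space borel {0<..<T})"
    "(\<lambda>r. flux2 (j r) A) \<in> borel_measurable (restrict_space borel {0<..<T})"
    unfolding flux1_def flux2_def using measurable_compose[OF meas_j[OF assms]] by blast+
qed

lemma tv_flux: "tv_norm borel (flux1 (j r)) \<le> tv_norm borel (j r)" "tv_norm borel (flux2 (j r)) \<le> tv_norm borel (j r)"
proof -
  have "norm (fst x) \<le> norm x" "norm (snd x) \<le> norm x" for x :: "real \<times> real"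
    by (cases x; simp add: norm_Pair real_le_rsqrt)+
  then show "tv_norm borel (flux1 (j r)) \<le> tv_norm borel (j r)" "tv_norm borel (flux2 (j r)) \<le> tv_norm borel (j r)"
    unfolding flux1_def flux2_def by (intro tv_norm_mono; simp)+
qed

lemma flux_integrable:
  assumes f: "f \<in> borel_measurable borel" "\<And>q. \<bar>f q\<bar> \<le> B"
  shows "set_integrable lborel {0<..<T} (\<lambda>r. signed_integral borel (flux1 (j r)) f)"
    "set_integrable lborel {0<..<T} (\<lambda>r. signed_integral borel (flux2 (j r)) f)"
proof -
  have I: "{0<..<T} \<in> sets borel" by simp
  show "set_integrable lborel {0<..<T} (\<lambda>r. signed_integral borel (flux1 (j r)) f)"
    by (rule set_integrable_dominated[OF I signed_integral_family[OF I vm_flux(1) meas_flux(1) f] tv_j, of B])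
      (auto intro!: order_trans[OF signed_integral_bound[OF vm_flux(1) f]] mult_left_mono tv_flux)
  show "set_integrable lborel {0<..<T} (\<lambda>r. signed_integral borel (flux2 (j r)) f)"
    by (rule set_integrable_dominated[OF I signed_integral_family[OF I vm_flux(2) meas_flux(2) f] tv_j, of B])
      (auto intro!: order_trans[OF signed_integral_bound[OF vm_flux(2) f]] mult_left_mono tv_flux)
qed

text \<open>Where the Lagrangian is finite, the first flux is \<open>V * vel\<close> times
  \<open>\<sigma> r\<close>; separating the velocities writes it as the difference of the measures
  \<open>P True\<close> and \<open>P False\<close>, to which \<open>signed_integral_eq\<close>
  applies.\<close>

lemma flux1_signed_integral:
  assumes r: "r \<in> {0<..<T}" and L: "lagrangian \<alpha> V (\<sigma> r) (j r) \<noteq> \<infinity>"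
    and f: "f \<in> borel_measurable borel" "\<And>q. \<bar>f q\<bar> \<le> B"
  shows "signed_integral borel (flux1 (j r)) f = V * (LINT q|\<sigma> r. vel (snd q) * f q)"
proof -
  have r': "r \<in> {0..T}" using r by simp
  have eq: "flux1 (j r) A = V * (LINT q:A|\<sigma> r. vel (snd q))" if "A \<in> sets borel" for A
    using L that unfolding lagrangian_def by (metis (no_types, lifting))
  have sm [measurable]: "(\<lambda>q :: phase. if snd q = b then V else 0) \<in> borel_measurable borel" for b
    by (rule phase_measurable[where F="\<lambda>z b'. if b' = b then V else 0"]) simp
  define P where "P b = density (\<sigma> r) (\<lambda>q. ennreal (if snd q = b then V else 0))" for b
  have iV: "integrable (\<sigma> r) (\<lambda>q. g q * (if snd q = b then V else 0))" if "g \<in> borel_measurable borel" "\<And>q. \<bar>g q\<bar> \<le> K" for g K b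
  proof (rule int_\<sigma>[OF r', of _ "K * V"])
    show "\<bar>g q * (if snd q = b then V else 0)\<bar> \<le> K * V" for q
      using that(2)[of q] V by (auto simp: abs_mult mult_right_mono)
  qed (use that in simp)
  have iP: "(LINT q|P b. g q) = (LINT q|\<sigma> r. g q * (if snd q = b then V else 0))" if "g \<in> borel_measurable borel" for g b
    unfolding P_def using V meas_\<sigma>[OF r' that] meas_\<sigma>[OF r' sm] by (subst integral_real_density) (auto simp: mult.commute)
  have sP: "sets (P b) = sets borel" for b by (simp add: P_def sets_\<sigma>[OF r'])
  have fP: "finite_measure (P b)" for b
  proof (rule finite_measureI)
    have "emeasure (P b) (space (P b)) = (\<integral>\<^sup>+q. ennreal (if snd q = b then V else 0) \<partial>\<sigma> r)"
      unfolding P_def using meas_\<sigma>[OF r' sm] by (simp add: emeasure_density cong: nn_integral_cong)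
    also have "\<dots> = ennreal (LINT q|\<sigma> r. (if snd q = b then V else 0))"
      using iV[of "\<lambda>_. 1" 1 b] V by (intro nn_integral_eq_integral) auto
    finally show "emeasure (P b) (space (P b)) \<noteq> \<infinity>" by simp
  qed
  have mP: "measure (P b) A = (LINT q|\<sigma> r. indicator A q * (if snd q = b then V else 0))" if "A \<in> sets borel" for A b
  proof -
    have "measure (P b) A = (LINT q|P b. indicator A q)"
      using that sets_eq_imp_space_eq[OF sP[of b]] by (simp add: Int_absorb2)
    then show ?thesis using that by (subst (asm) iP) auto
  qed
  have vel: "vel (snd q) * x * V = x * (if snd q = True then V else 0) - x * (if snd q = False then V else 0)" for q :: phase and x
    by (simp add: vel_def)
  have "signed_integral borel (flux1 (j r)) f = (LINT q|P True. f q) - (LINT q|P False. f q)"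
  proof (rule signed_integral_eq[OF fP fP sP sP _ f])
    fix A :: "phase set" assume A: "A \<in> sets borel"
    have "flux1 (j r) A = (LINT q|\<sigma> r. vel (snd q) * indicator A q * V)"
      unfolding eq[OF A] by (simp add: set_lebesgue_integral_def mult.commute)
    also have "\<dots> = measure (P True) A - measure (P False) A"
      unfolding vel mP[OF A] using A by (intro Bochner_Integration.integral_diff iV[of _ 1]) (auto simp: indicator_def)
    finally show "flux1 (j r) A = measure (P True) A - measure (P False) A" .
  qed
  also have "\<dots> = (LINT q|\<sigma> r. vel (snd q) * f q * V)"
    unfolding vel iP[OF f(1)] by (intro Bochner_Integration.integral_diff[symmetric] iV[of _ B] f)
  finally show ?thesis by (simp add: mult.commute)
qed

text \<open>The relation for the first flux holds wherever the Lagrangian is finite, but that set of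
  times is not known to be measurable. The set \<open>N\<close> where the tested relation fails is
  measurable, by narrow continuity on one side and \<open>signed_integral_family\<close> on the
  other, and on it the Lagrangian is infinite; finite action makes it a null set.\<close>

lemma AE_flux1:
  assumes f: "continuous_on UNIV f" "\<And>q. \<bar>f q\<bar> \<le> B"
  shows "AE r in lborel. r \<in> {0<..<T} \<longrightarrow> signed_integral borel (flux1 (j r)) (\<lambda>q. vel (snd q) * f q) = V * (LINT q|\<sigma> r. f q)"
proof -
  have fm: "f \<in> borel_measurable borel" by (rule borel_measurable_continuous_onI[OF f(1)])
  have vm: "(\<lambda>q :: phase. vel (snd q)) \<in> borel_measurable borel"
    by (rule phase_measurable[where F="\<lambda>z b. vel b"]) simp
  have vf: "(\<lambda>q. vel (snd q) * f q) \<in> borel_measurable borel" using fm vm by simp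
  have vb: "\<bar>vel (snd q) * f q\<bar> \<le> B" for q using f(2)[of q] by (simp add: abs_mult vel_def)
  define F where "F r = signed_integral borel (flux1 (j r)) (\<lambda>q. vel (snd q) * f q)" for r
  define G where "G r = V * (LINT q|\<sigma> r. f q)" for r
  define N where "N = {r\<in>{0<..<T}. F r \<noteq> G r}"
  have I: "{0<..<T} \<in> sets borel" by simp
  have Fm: "F \<in> borel_measurable (restrict_space borel {0<..<T})"
    unfolding F_def[abs_def] by (rule signed_integral_family[OF I vm_flux(1) meas_flux(1) vf vb])
  have "continuous_on {0..T} G"
    unfolding G_def using f by (intro continuous_intros narrow) (auto intro!: boundedI[of _ B])
  then have "continuous_on {0<..<T} G" by (rule continuous_on_subset) auto
  then have Gm: "G \<in> borel_measurable (restrict_space borel {0<..<T})" by (rule borel_measurable_continuous_on_restrict)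
  have "{r \<in> space (restrict_space borel {0<..<T}). F r \<noteq> G r} \<in> sets (restrict_space borel {0<..<T})"
    using Fm Gm by measurable
  moreover have "{r \<in> space (restrict_space borel {0<..<T}). F r \<noteq> G r} = N"
    by (simp add: N_def space_restrict_space)
  ultimately have N: "N \<in> sets borel"
    using sets_restrict_space_iff[of "{0<..<T}" borel N] by simp
  have FG: "F r = G r" if "r \<in> {0<..<T}" "lagrangian \<alpha> V (\<sigma> r) (j r) \<noteq> \<infinity>" for r
  proof -
    have v: "vel (snd q) * (vel (snd q) * f q) = f q" for q by (simp add: vel_def)
    show ?thesis unfolding F_def G_def flux1_signed_integral[OF that vf vb] by (simp only: v)
  qed
  have "(\<integral>\<^sup>+r. \<infinity> * indicator N r \<partial>lborel) \<le> (\<integral>\<^sup>+r\<in>{0<..<T}. lagrangian \<alpha> V (\<sigma> r) (j r) \<partial>lborel)"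
  proof (rule nn_integral_mono)
    fix r
    show "\<infinity> * indicator N r \<le> lagrangian \<alpha> V (\<sigma> r) (j r) * indicator {0<..<T} r"
    proof (cases "r \<in> N")
      case True
      then have "lagrangian \<alpha> V (\<sigma> r) (j r) = \<infinity>" using FG[of r] by (auto simp: N_def)
      then show ?thesis using True by (simp add: N_def)
    qed simp
  qed
  also have "\<dots> < \<infinity>" using act by (rule le_less_trans) simp
  finally have "\<infinity> * emeasure lborel N < \<infinity>" using N by (simp add: nn_integral_cmult_indicator)
  then have "emeasure lborel N = 0" by (metis ennreal_top_mult infinity_ennreal_def less_irrefl)
  then have "N \<in> null_sets lborel" using N by (simp add: null_setsI)
  then have "AE r in lborel. r \<notin> N" by (rule AE_not_in)
  then show ?thesis by eventually_elim (simp add: N_def F_def G_def)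
qed

lemma lagrangian_Fenchel:
  assumes r: "r \<in> {0<..<T}" and \<phi>: "\<phi> \<in> borel_measurable borel" "\<And>q. \<bar>\<phi> q\<bar> \<le> B"
  shows "ennreal (signed_integral borel (flux2 (j r)) \<phi> - k * (LINT q|\<sigma> r. exp (\<phi> q) - 1)) \<le> lagrangian \<alpha> V (\<sigma> r) (j r)"
proof (cases "\<forall>A\<in>sets borel. flux1 (j r) A = V * (LINT p:A|\<sigma> r. vel (snd p))")
  case False
  have "lagrangian \<alpha> V (\<sigma> r) (j r) = \<infinity>" unfolding lagrangian_def by (rule if_not_P[OF False])
  then show ?thesis by simp
next
  case True
  have r': "r \<in> {0..T}" using r by simp
  interpret finite_measure "\<sigma> r" by (rule fin[OF r'])
  define \<nu> where "\<nu> = scale_measure (ennreal k) (\<sigma> r)"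
  have L: "lagrangian \<alpha> V (\<sigma> r) (j r) = Ent (flux2 (j r)) \<nu>"
    unfolding lagrangian_def \<nu>_def k_def by (rule if_P[OF True])
  have f\<nu>: "finite_measure \<nu>"
    by (rule finite_measureI) (simp add: \<nu>_def space_scale_measure ennreal_mult_eq_top_iff)
  have s\<nu>: "sets \<nu> = sets borel" by (simp add: \<nu>_def sets_\<sigma>[OF r'])
  have "(LINT q|\<nu>. exp (\<phi> q) - 1) = k * (LINT q|\<sigma> r. exp (\<phi> q) - 1)"
    unfolding \<nu>_def using k_pos by (intro integral_scale_measure meas_\<sigma>[OF r']) (use \<phi> in auto)
  then show ?thesis using Ent_Fenchel[OF f\<nu> s\<nu> \<phi>, of "flux2 (j r)"] by (simp add: L)
qed

text \<open>The comparison goes through the upper integral of the Lagrangian; negative values of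
  \<open>X\<close> are truncated by \<open>ennreal\<close>, which preserves the inequality.\<close>

lemma integral_le_action:
  fixes X :: "real \<Rightarrow> real"
  assumes X: "set_integrable lborel {s<..<t} X" and st: "0 \<le> s" "t \<le> T"
    and le: "AE r in lborel. r \<in> {0<..<T} \<longrightarrow> ennreal (X r) \<le> lagrangian \<alpha> V (\<sigma> r) (j r)"
  shows "(LINT r:{s<..<t}|lborel. X r) \<le> C"
proof -
  have "ennreal (LINT r:{s<..<t}|lborel. X r) \<le> (\<integral>\<^sup>+r. ennreal (indicator {s<..<t} r * X r) \<partial>lborel)"
    using ennreal_integral_le_nn_integral[OF X[unfolded set_integrable_def]] by (simp add: set_lebesgue_integral_def)
  also have "\<dots> \<le> (\<integral>\<^sup>+r\<in>{0<..<T}. lagrangian \<alpha> V (\<sigma> r) (j r) \<partial>lborel)"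
  proof (rule nn_integral_mono_AE)
    show "AE r in lborel. ennreal (indicator {s<..<t} r * X r) \<le> lagrangian \<alpha> V (\<sigma> r) (j r) * indicator {0<..<T} r"
      using le by eventually_elim (use st in \<open>auto simp: indicator_def\<close>)
  qed
  also have "\<dots> \<le> ennreal C" by (rule act)
  finally show ?thesis using C by simp
qed

end

lemma measure_torus_lebesgue_UNIV [simp]: "measure torus_lebesgue UNIV = 1"
  using torus.prob_space by simp

section \<open>Entropy and dissipation of the mollified curve\<close>

locale ce_reg = ce_curve +
  fixes n :: nat
begin

definition c :: "nat \<times> nat \<Rightarrow> bool \<Rightarrow> real \<Rightarrow> real" where "c p b t = (LINT q|\<sigma> t. vbas p b q)"
text \<open>The slice of \<open>\<sigma> t\<close> at velocity \<open>b\<close>, convolved with the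
  kernel and raised by \<open>\<delta>\<close>, as \<open>f_eq\<close> shows. The moment form makes
  it an affine function of the finitely many \<open>c p b t\<close>.\<close>

definition f :: "bool \<Rightarrow> real \<Rightarrow> torus \<Rightarrow> real"
  where "f b t z = \<delta> + (\<Sum>p\<in>tidx n. tcoef n p * tmon p z * c p b t)"
definition df :: "bool \<Rightarrow> real \<Rightarrow> torus \<Rightarrow> real"
  where "df b t z = (\<Sum>p\<in>tidx n. tcoef n p * dtmon p z * c p b t)"
definition S :: real where "S = (\<Sum>p\<in>tidx n. \<bar>tcoef n p\<bar>)"
text \<open>Up to the factor \<open>tcoef n p\<close>, the derivative of \<open>E\<close> in the
  moment \<open>c p b\<close>; the further term from the derivative of \<open>u * ln u\<close>
  cancels in the balance by conservation of mass.\<close>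

definition \<l> :: "nat \<times> nat \<Rightarrow> bool \<Rightarrow> real \<Rightarrow> real"
  where "\<l> p b t = (LINT z|torus_lebesgue. tmon p z * ln (f b t z))"
definition E :: "real \<Rightarrow> real" where "E t = (\<Sum>b\<in>UNIV. LINT z|torus_lebesgue. f b t z * ln (f b t z))"
definition D :: "real \<Rightarrow> real"
  where "D t = (LINT z|torus_lebesgue. (sqrt (f True t z) - sqrt (f False t z))\<^sup>2)"
text \<open>The mollified logarithm of the density. Mollification is self-adjoint, so this is the
  test function on the phase space that corresponds to \<open>ln f\<close>.\<close>

definition \<Phi> :: "real \<Rightarrow> phase \<Rightarrow> real"
  where "\<Phi> t q = (LINT w|torus_lebesgue. tker n w (fst q) * ln (f (snd q) t w))"

lemma c_bound: assumes t: "t \<in> {0..T}" shows "\<bar>c p b t\<bar> \<le> 1"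
proof -
  interpret prob_space "\<sigma> t" by (rule prob[OF t])
  have "\<bar>c p b t\<bar> \<le> (LINT q|\<sigma> t. \<bar>vbas p b q\<bar>)" unfolding c_def by (rule integral_abs_bound)
  also have "\<dots> \<le> (LINT q|\<sigma> t. 1)"
    using int_\<sigma>[OF t measurable_vbas vbas_bound] vbas_bound by (intro integral_mono) auto
  finally show ?thesis by (simp add: prob_space)
qed

lemma continuous_c: "continuous_on {0..T} (c p b)"
  unfolding c_def[abs_def] by (rule narrow[OF continuous_vbas]) (auto intro!: boundedI[of _ 1] vbas_bound)

lemma vbas_tker: "(\<Sum>p\<in>tidx n. tcoef n p * tmon p z * vbas p b q) = (if snd q = b then tker n z (fst q) else 0)"
  by (simp add: vbas_def tker_expand)

lemma int_vbas: "t \<in> {0..T} \<Longrightarrow> integrable (\<sigma> t) (vbas p b)"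
  by (rule int_\<sigma>[OF _ measurable_vbas vbas_bound])

lemma f_eq:
  assumes t: "t \<in> {0..T}"
  shows "f b t z = \<delta> + (LINT q|\<sigma> t. (if snd q = b then tker n z (fst q) else 0))"
  unfolding f_def c_def vbas_tker[symmetric] using int_vbas[OF t] by simp

lemma f_ge: "t \<in> {0..T} \<Longrightarrow> \<delta> \<le> f b t z"
  unfolding f_eq using tker_nonneg by (simp add: integral_nonneg_AE)

lemma f_pos: "t \<in> {0..T} \<Longrightarrow> 0 < f b t z"
  using f_ge[of t b z] \<delta>_pos by linarith

lemma f_le: assumes t: "t \<in> {0..T}" shows "f b t z \<le> \<delta> + S"
proof -
  have "(\<Sum>p\<in>tidx n. tcoef n p * tmon p z * c p b t) \<le> (\<Sum>p\<in>tidx n. \<bar>tcoef n p\<bar>)"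
  proof (rule sum_mono)
    fix p
    have "\<bar>tmon p z\<bar> * \<bar>c p b t\<bar> \<le> 1" using tmon_bound c_bound[OF t] by (intro mult_le_one) auto
    then have "\<bar>tcoef n p\<bar> * (\<bar>tmon p z\<bar> * \<bar>c p b t\<bar>) \<le> \<bar>tcoef n p\<bar> * 1" by (intro mult_left_mono) auto
    then have "\<bar>tcoef n p * tmon p z * c p b t\<bar> \<le> \<bar>tcoef n p\<bar>" by (simp add: abs_mult mult.assoc)
    then show "tcoef n p * tmon p z * c p b t \<le> \<bar>tcoef n p\<bar>" by linarith
  qed
  then show ?thesis by (simp add: f_def S_def)
qed

lemma continuous_f: "continuous_on UNIV (f b t)"
  unfolding f_def[abs_def] by (intro continuous_intros continuous_tmon)

lemma continuous_df: "continuous_on UNIV (df b t)"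
  unfolding df_def[abs_def] by (intro continuous_intros continuous_dtmon)

lemma continuous_ln_f: "t \<in> {0..T} \<Longrightarrow> continuous_on UNIV (\<lambda>z. ln (f b t z))"
  using f_pos by (intro continuous_on_ln continuous_f) (auto simp: less_imp_neq[THEN not_sym])

lemma continuous_f_time: "continuous_on {0..T} (\<lambda>t. f b t z)"
  unfolding f_def by (intro continuous_intros continuous_c)

lemma measurable_f [measurable]: "f b t \<in> borel_measurable borel"
  by (rule borel_measurable_continuous_onI[OF continuous_f])

text \<open>The added mass keeps the logarithm bounded. The bound depends on \<open>n\<close> and
  \<open>V\<close> and serves integrability and continuity only.\<close>

lemma ln_f_bound: "t \<in> {0..T} \<Longrightarrow> \<bar>ln (f b t z)\<bar> \<le> \<bar>ln \<delta>\<bar> + \<bar>ln (\<delta> + S)\<bar>"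
proof -
  assume t: "t \<in> {0..T}"
  have p: "0 < f b t z" "\<delta> \<le> f b t z" "f b t z \<le> \<delta> + S" using f_pos[OF t] f_ge[OF t] f_le[OF t] by auto
  have "ln \<delta> \<le> ln (f b t z)" using p \<delta>_pos by (subst ln_le_cancel_iff) auto
  moreover have "ln (f b t z) \<le> ln (\<delta> + S)" using p by (subst ln_le_cancel_iff) linarith+
  ultimately show ?thesis by linarith
qed

lemma torus_deriv_f: "torus_deriv (f b t) (df b t)"
  unfolding torus_deriv_def f_def df_def using torus_deriv_tmon unfolding torus_deriv_def
  by (auto intro!: derivative_eq_intros simp: mult_ac)

lemma continuous_\<l>: "continuous_on {0..T} (\<l> p b)"
  unfolding \<l>_def[abs_def]
proof (rule continuous_on_integral_bounded[OF torus.finite_measure_axioms])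
  show "continuous_on {0..T} (\<lambda>t. tmon p z * ln (f b t z))" for z
    using f_pos by (intro continuous_intros continuous_f_time) (auto simp: less_imp_neq[THEN not_sym])
  show "(\<lambda>z. tmon p z * ln (f b t z)) \<in> borel_measurable torus_lebesgue" for t by simp
  show "\<bar>tmon p z * ln (f b t z)\<bar> \<le> 1 * (\<bar>ln \<delta>\<bar> + \<bar>ln (\<delta> + S)\<bar>)" if "t \<in> {0..T}" for t z
    unfolding abs_mult using tmon_bound ln_f_bound[OF that] by (intro mult_mono) auto
qed

lemma continuous_D: "continuous_on {0..T} D"
  unfolding D_def[abs_def]
proof (rule continuous_on_integral_bounded[OF torus.finite_measure_axioms])
  show "continuous_on {0..T} (\<lambda>t. (sqrt (f True t z) - sqrt (f False t z))\<^sup>2)" for z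
    by (intro continuous_intros continuous_f_time)
  show "(\<lambda>z. (sqrt (f True t z) - sqrt (f False t z))\<^sup>2) \<in> borel_measurable torus_lebesgue" for t by simp
  show "\<bar>(sqrt (f True t z) - sqrt (f False t z))\<^sup>2\<bar> \<le> (sqrt (\<delta> + S))\<^sup>2" if "t \<in> {0..T}" for t z
  proof -
    have "0 \<le> sqrt (f b t z)" "sqrt (f b t z) \<le> sqrt (\<delta> + S)" for b
      using f_pos[OF that, of b z] f_le[OF that, of b z] by auto
    from this[of True] this[of False] have "\<bar>sqrt (f True t z) - sqrt (f False t z)\<bar> \<le> sqrt (\<delta> + S)" by linarith
    then show ?thesis by (metis abs_power2 power2_abs power_mono abs_ge_zero)
  qed
qed

lemma D_nonneg: "0 \<le> D t"
  unfolding D_def by (intro Bochner_Integration.integral_nonneg) simp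

text \<open>Self-adjointness of the mollification. As the kernel has finite rank, exchanging the
  integrals amounts to exchanging finite sums.\<close>

lemma dual:
  fixes g :: "torus \<Rightarrow> real"
  assumes t: "t \<in> {0..T}" and g: "g \<in> borel_measurable borel" "\<And>z. \<bar>g z\<bar> \<le> B"
  shows "(LINT z|torus_lebesgue. g z * (f b t z - \<delta>)) = (LINT q|\<sigma> t. (if snd q = b then (LINT z|torus_lebesgue. tker n z (fst q) * g z) else 0))"
proof -
  define I where "I p = (LINT z|torus_lebesgue. tmon p z * g z)" for p
  have i: "integrable torus_lebesgue (\<lambda>z. tmon p z * g z)" for p
  proof (rule integrable_bounded[OF torus.finite_measure_axioms, of _ "1 * B"])
    show "\<bar>tmon p z * g z\<bar> \<le> 1 * B" for z
      unfolding abs_mult using tmon_bound g(2) by (intro mult_mono) auto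
  qed (use g in simp)
  have "(LINT z|torus_lebesgue. g z * (f b t z - \<delta>)) = (LINT z|torus_lebesgue. (\<Sum>p\<in>tidx n. tcoef n p * c p b t * (tmon p z * g z)))"
    unfolding f_def by (simp add: sum_distrib_left mult_ac)
  also have "\<dots> = (\<Sum>p\<in>tidx n. tcoef n p * c p b t * I p)" using i by (simp add: I_def)
  also have "\<dots> = (\<Sum>p\<in>tidx n. tcoef n p * I p * c p b t)" by (simp add: mult_ac)
  also have "\<dots> = (LINT q|\<sigma> t. (\<Sum>p\<in>tidx n. tcoef n p * I p * vbas p b q))" using int_vbas[OF t] by (simp add: c_def)
  also have "(\<lambda>q. \<Sum>p\<in>tidx n. tcoef n p * I p * vbas p b q) = (\<lambda>q. if snd q = b then (LINT z|torus_lebesgue. tker n z (fst q) * g z) else 0)"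
  proof
    fix q :: phase
    have "(LINT z|torus_lebesgue. tker n z (fst q) * g z) = (LINT z|torus_lebesgue. (\<Sum>p\<in>tidx n. tcoef n p * tmon p (fst q) * (tmon p z * g z)))"
      unfolding tker_expand by (simp add: sum_distrib_left sum_distrib_right mult_ac)
    also have "\<dots> = (\<Sum>p\<in>tidx n. tcoef n p * tmon p (fst q) * I p)" using i by (simp add: I_def)
    finally show "(\<Sum>p\<in>tidx n. tcoef n p * I p * vbas p b q) = (if snd q = b then (LINT z|torus_lebesgue. tker n z (fst q) * g z) else 0)"
      by (simp add: vbas_def mult_ac)
  qed
  finally show ?thesis .
qed

lemma if_phase_integrable:
  fixes g :: "bool \<Rightarrow> torus \<Rightarrow> real"
  assumes t: "t \<in> {0..T}" and g: "\<And>b. g b \<in> borel_measurable borel" "\<And>b z. \<bar>g b z\<bar> \<le> B"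
  shows "integrable (\<sigma> t) (\<lambda>q. if snd q = b then g b (fst q) else 0)" "integrable (\<sigma> t) (\<lambda>q. g (snd q) (fst q))"
    and "(LINT q|\<sigma> t. g (snd q) (fst q)) = (\<Sum>b\<in>UNIV. LINT q|\<sigma> t. (if snd q = b then g b (fst q) else 0))"
proof -
  have B: "0 \<le> B" using g(2)[of undefined undefined] by linarith
  show i: "integrable (\<sigma> t) (\<lambda>q. if snd q = b then g b (fst q) else 0)" for b
    by (rule int_\<sigma>[OF t phase_measurable[where F="\<lambda>z b'. if b' = b then g b z else 0"], of B])
      (use g B in auto)
  show "integrable (\<sigma> t) (\<lambda>q. g (snd q) (fst q))"
    by (rule int_\<sigma>[OF t phase_measurable[where F="\<lambda>z b. g b z"], of B]) (use g B in auto)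
  have "(LINT q|\<sigma> t. g (snd q) (fst q)) = (LINT q|\<sigma> t. (\<Sum>b\<in>UNIV. (if snd q = b then g b (fst q) else 0)))"
    by simp
  also have "\<dots> = (\<Sum>b\<in>UNIV. LINT q|\<sigma> t. (if snd q = b then g b (fst q) else 0))"
    by (rule Bochner_Integration.integral_sum) (rule i)
  finally show "(LINT q|\<sigma> t. g (snd q) (fst q)) = (\<Sum>b\<in>UNIV. LINT q|\<sigma> t. (if snd q = b then g b (fst q) else 0))" .
qed

lemma integrable_f: "integrable torus_lebesgue (f b t)"
  by (rule torus_integrable_continuous[OF continuous_f])

text \<open>Each velocity receives the extra mass \<open>\<delta>\<close>. The value is constant in
  time, which removes the linear terms from the entropy balance.\<close>

lemma mass: assumes t: "t \<in> {0..T}" shows "(\<Sum>b\<in>UNIV. LINT z|torus_lebesgue. f b t z) = 1 + 2 * \<delta>"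
proof -
  interpret prob_space "\<sigma> t" by (rule prob[OF t])
  have "(LINT z|torus_lebesgue. f b t z) = \<delta> + (LINT z|torus_lebesgue. 1 * (f b t z - \<delta>))" for b
    using integrable_f by (simp add: torus.prob_space)
  also have "\<dots> b = \<delta> + (LINT q|\<sigma> t. (if snd q = b then 1 else 0))" for b
    by (subst dual[OF t, of "\<lambda>_. 1" 1]) (simp_all add: integral_tker cong: if_cong)
  finally have "(\<Sum>b\<in>UNIV. LINT z|torus_lebesgue. f b t z) = (\<Sum>b\<in>UNIV. \<delta> + (LINT q|\<sigma> t. (if snd q = b then 1 else 0)))" by simp
  also have "\<dots> = 2 * \<delta> + (\<Sum>b\<in>UNIV. LINT q|\<sigma> t. (if snd q = b then 1 else 0))" by (simp add: sum.distrib)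
  also have "(\<Sum>b\<in>UNIV. LINT q|\<sigma> t. (if snd q = b then 1 else 0)) = (LINT q|\<sigma> t. 1 :: real)"
    by (rule if_phase_integrable(3)[OF t, of "\<lambda>b z. 1" 1, symmetric]) simp_all
  finally show ?thesis by (simp add: prob_space)
qed

text \<open>Exhibits \<open>\<Phi> t\<close> as the combination of the \<open>vbas\<close> with the
  coefficients that occur in \<open>E_increment\<close>, so that the continuity equation can be
  tested with it at frozen time.\<close>

lemma \<Phi>_eq:
  assumes t: "t \<in> {0..T}"
  shows "\<Phi> t q = (\<Sum>(b, p)\<in>UNIV \<times> tidx n. tcoef n p * \<l> p b t * vbas p b q)"
proof -
  have i: "integrable torus_lebesgue (\<lambda>z. tmon p z * ln (f b t z))" for p b
    by (intro torus_integrable_continuous continuous_intros continuous_tmon continuous_ln_f t)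
  have "\<Phi> t q = (LINT w|torus_lebesgue. (\<Sum>p\<in>tidx n. tcoef n p * tmon p (fst q) * (tmon p w * ln (f (snd q) t w))))"
    unfolding \<Phi>_def tker_expand by (simp add: sum_distrib_left sum_distrib_right mult_ac)
  also have "\<dots> = (\<Sum>p\<in>tidx n. tcoef n p * tmon p (fst q) * \<l> p (snd q) t)" using i by (simp add: \<l>_def)
  also have "\<dots> = (\<Sum>p\<in>tidx n. \<Sum>b\<in>UNIV. tcoef n p * \<l> p b t * vbas p b q)"
    by (intro sum.cong refl) (cases "snd q"; simp add: UNIV_bool vbas_def)
  also have "\<dots> = (\<Sum>b\<in>UNIV. \<Sum>p\<in>tidx n. tcoef n p * \<l> p b t * vbas p b q)" by (rule sum.swap)
  finally show ?thesis by (simp add: sum.cartesian_product)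
qed

text \<open>Tangent inequality for the convex function \<open>u * ln u\<close> at the time
  \<open>t\<close>, applied pointwise. The linear remainder cancels only after summation over both
  velocities, since jumps exchange mass between them.\<close>

lemma E_increment:
  assumes s: "s \<in> {0..T}" and t: "t \<in> {0..T}"
  shows "E t - E s \<le> (\<Sum>(b, p)\<in>UNIV \<times> tidx n. tcoef n p * \<l> p b t * (c p b t - c p b s))"
proof -
  have i: "integrable torus_lebesgue (\<lambda>z. f b u z * ln (f b u z))" if "u \<in> {0..T}" for b u
    by (intro torus_integrable_continuous continuous_intros continuous_f continuous_ln_f that)
  have i2: "integrable torus_lebesgue (\<lambda>z. ln (f b t z) * (f b t z - f b s z))" for b
    by (intro torus_integrable_continuous continuous_intros continuous_f continuous_ln_f t)
  have i3: "integrable torus_lebesgue (\<lambda>z. tmon p z * ln (f b t z))" for p b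
    by (intro torus_integrable_continuous continuous_intros continuous_tmon continuous_ln_f t)
  have conv: "u * ln u - w * ln w \<le> ln u * (u - w) + (u - w)" if "0 < u" "0 < w" for u w :: real
  proof -
    have "ln (u / w) \<le> u / w - 1" using that by (intro ln_le_minus_one) simp
    then have "w * ln (u / w) \<le> w * (u / w - 1)" using that by (intro mult_left_mono) auto
    also have "\<dots> = u - w" using that by (simp add: right_diff_distrib)
    finally show ?thesis using that by (simp add: ln_div algebra_simps)
  qed
  have b: "(LINT z|torus_lebesgue. f b t z * ln (f b t z)) - (LINT z|torus_lebesgue. f b s z * ln (f b s z))
      \<le> (\<Sum>p\<in>tidx n. tcoef n p * \<l> p b t * (c p b t - c p b s)) + ((LINT z|torus_lebesgue. f b t z) - (LINT z|torus_lebesgue. f b s z))" for b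
  proof -
    have "(LINT z|torus_lebesgue. f b t z * ln (f b t z)) - (LINT z|torus_lebesgue. f b s z * ln (f b s z))
        = (LINT z|torus_lebesgue. f b t z * ln (f b t z) - f b s z * ln (f b s z))"
      using i[OF s] i[OF t] by simp
    also have "\<dots> \<le> (LINT z|torus_lebesgue. ln (f b t z) * (f b t z - f b s z) + (f b t z - f b s z))"
      using i[OF s] i[OF t] i2 integrable_f conv[OF f_pos[OF t] f_pos[OF s]] by (intro integral_mono) auto
    also have "\<dots> = (LINT z|torus_lebesgue. ln (f b t z) * (f b t z - f b s z)) + ((LINT z|torus_lebesgue. f b t z) - (LINT z|torus_lebesgue. f b s z))"
      using i2 integrable_f by simp
    also have "(\<lambda>z. ln (f b t z) * (f b t z - f b s z)) = (\<lambda>z. \<Sum>p\<in>tidx n. tcoef n p * (c p b t - c p b s) * (tmon p z * ln (f b t z)))"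
    proof
      fix z
      have "f b t z - f b s z = (\<Sum>p\<in>tidx n. tcoef n p * (c p b t - c p b s) * tmon p z)"
        unfolding f_def by (simp add: sum_subtractf[symmetric] algebra_simps)
      then show "ln (f b t z) * (f b t z - f b s z) = (\<Sum>p\<in>tidx n. tcoef n p * (c p b t - c p b s) * (tmon p z * ln (f b t z)))"
        by (simp add: sum_distrib_left mult_ac)
    qed
    also have "(LINT z|torus_lebesgue. (\<Sum>p\<in>tidx n. tcoef n p * (c p b t - c p b s) * (tmon p z * ln (f b t z)))) = (\<Sum>p\<in>tidx n. tcoef n p * (c p b t - c p b s) * \<l> p b t)"
      using i3 by (simp add: \<l>_def)
    finally show ?thesis by (simp add: mult_ac)
  qed
  have "E t - E s = (\<Sum>b\<in>UNIV. (LINT z|torus_lebesgue. f b t z * ln (f b t z)) - (LINT z|torus_lebesgue. f b s z * ln (f b s z)))"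
    by (simp add: E_def sum_subtractf)
  also have "\<dots> \<le> (\<Sum>b\<in>UNIV. (\<Sum>p\<in>tidx n. tcoef n p * \<l> p b t * (c p b t - c p b s)) + ((LINT z|torus_lebesgue. f b t z) - (LINT z|torus_lebesgue. f b s z)))"
    by (rule sum_mono) (rule b)
  also have "\<dots> = (\<Sum>b\<in>UNIV. \<Sum>p\<in>tidx n. tcoef n p * \<l> p b t * (c p b t - c p b s)) + ((\<Sum>b\<in>UNIV. LINT z|torus_lebesgue. f b t z) - (\<Sum>b\<in>UNIV. LINT z|torus_lebesgue. f b s z))"
    by (simp only: sum.distrib sum_subtractf)
  also have "\<dots> = (\<Sum>(b, p)\<in>UNIV \<times> tidx n. tcoef n p * \<l> p b t * (c p b t - c p b s))"
    unfolding mass[OF s] mass[OF t] by (simp add: sum.cartesian_product)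
  finally show ?thesis .
qed

text \<open>The weak time derivative of the moment \<open>c p b\<close>, see
  \<open>c_increment\<close>.\<close>

definition G :: "bool \<times> (nat \<times> nat) \<Rightarrow> real \<Rightarrow> real"
  where "G = (\<lambda>(b, p) r. signed_integral borel (flux1 (j r)) (dvbas p b) +
    signed_integral borel (flux2 (j r)) (\<lambda>q. vbas p b (flip q) - vbas p b q))"

lemma vbas_flip_measurable: "(\<lambda>q. vbas p b (flip q) - vbas p b q) \<in> borel_measurable borel"
  using measurable_compose[OF measurable_flip measurable_vbas] by simp

lemma vbas_flip_bound: "\<bar>vbas p b (flip q) - vbas p b q\<bar> \<le> 2"
  using vbas_bound[of p b q] vbas_bound[of p b "flip q"] by linarith

lemma G_integrable: "set_integrable lborel {0<..<T} (G i)"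
proof -
  obtain b p where i: "i = (b, p)" by (cases i)
  obtain B where B: "\<And>b q. \<bar>dvbas p b q\<bar> \<le> B" by (rule dvbas_bounded[of p]) (rule that)
  show ?thesis unfolding i G_def prod.case
    by (rule set_integral_add(1)[OF flux_integrable(1)[OF measurable_dvbas B]
          flux_integrable(2)[OF vbas_flip_measurable vbas_flip_bound]])
qed

lemma c_increment:
  assumes "0 \<le> s" "s \<le> t" "t \<le> T"
  shows "c p b t - c p b s = (LINT r:{s<..<t}|lborel. G (b, p) r)"
  using CE_eq[OF vbas_C10(1) assms] unfolding c_def vbas_C10(2) G_def by simp

lemma E_le_integral:
  assumes "0 \<le> s" "s \<le> t" "t \<le> T"
  shows "set_integrable lborel {s<..<t} (\<lambda>r. \<Sum>i\<in>UNIV \<times> tidx n. (tcoef n (snd i) * \<l> (snd i) (fst i) r) * G i r)"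
    and "E t - E s \<le> (LINT r:{s<..<t}|lborel. (\<Sum>i\<in>UNIV \<times> tidx n. (tcoef n (snd i) * \<l> (snd i) (fst i) r) * G i r))"
proof -
  have 1: "finite ((UNIV :: bool set) \<times> tidx n)" by simp
  have 2: "continuous_on {0..T} (\<lambda>r. tcoef n (snd i) * \<l> (snd i) (fst i) r)" for i
    by (intro continuous_intros continuous_\<l>)
  have 3: "E t - E s \<le> (\<Sum>i\<in>UNIV \<times> tidx n. (tcoef n (snd i) * \<l> (snd i) (fst i) t) * (LINT r:{s<..<t}|lborel. G i r))"
    if "0 \<le> s" "s \<le> t" "t \<le> T" for s t
    using E_increment[of s t] that c_increment[OF that] by (simp add: case_prod_beta)
  show "set_integrable lborel {s<..<t} (\<lambda>r. \<Sum>i\<in>UNIV \<times> tidx n. (tcoef n (snd i) * \<l> (snd i) (fst i) r) * G i r)"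
    by (rule increments_le_integral(1)[where E=E, OF 1 2 G_integrable 3 assms])
  show "E t - E s \<le> (LINT r:{s<..<t}|lborel. (\<Sum>i\<in>UNIV \<times> tidx n. (tcoef n (snd i) * \<l> (snd i) (fst i) r) * G i r))"
    by (rule increments_le_integral(2)[where E=E, OF 1 2 G_integrable 3 assms])
qed

text \<open>Transport preserves the entropy: the kernel commutes with translations.\<close>

lemma transport_zero:
  assumes t: "t \<in> {0..T}"
  shows "(\<Sum>p\<in>tidx n. tcoef n p * \<l> p b t * (LINT q|\<sigma> t. dvbas p b q)) = 0"
proof -
  define d where "d p = (LINT q|\<sigma> t. dvbas p b q)" for p
  have id: "integrable (\<sigma> t) (dvbas p b)" for p
  proof -
    obtain B where B: "\<And>b q. \<bar>dvbas p b q\<bar> \<le> B" by (rule dvbas_bounded[of p]) (rule that)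
    show ?thesis by (rule int_\<sigma>[OF t measurable_dvbas B])
  qed
  have i3: "integrable torus_lebesgue (\<lambda>z. tmon p z * ln (f b t z))" for p
    by (intro torus_integrable_continuous continuous_intros continuous_tmon continuous_ln_f t)
  \<comment> \<open>Antisymmetry moves the derivative from the test function to the other argument
    of the kernel, hence to \<open>f\<close>.\<close>
  have e: "(\<Sum>p\<in>tidx n. tcoef n p * tmon p z * d p) = - df b t z" for z
  proof -
    have "(\<Sum>p\<in>tidx n. tcoef n p * tmon p z * d p) = (LINT q|\<sigma> t. (\<Sum>p\<in>tidx n. tcoef n p * tmon p z * dvbas p b q))"
      using id by (simp add: d_def)
    also have "(\<lambda>q. \<Sum>p\<in>tidx n. tcoef n p * tmon p z * dvbas p b q) = (\<lambda>q. - (\<Sum>p\<in>tidx n. tcoef n p * dtmon p z * vbas p b q))"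
    proof
      fix q
      show "(\<Sum>p\<in>tidx n. tcoef n p * tmon p z * dvbas p b q) = - (\<Sum>p\<in>tidx n. tcoef n p * dtmon p z * vbas p b q)"
        using tker_deriv_antisym[of n z "fst q"]
        by (cases "snd q = b") (simp_all add: vbas_def dvbas_def)
    qed
    also have "(LINT q|\<sigma> t. - (\<Sum>p\<in>tidx n. tcoef n p * dtmon p z * vbas p b q)) = - df b t z"
      using int_vbas[OF t] by (simp add: df_def c_def)
    finally show ?thesis .
  qed
  have "(\<Sum>p\<in>tidx n. tcoef n p * \<l> p b t * d p) = (LINT z|torus_lebesgue. (\<Sum>p\<in>tidx n. (tcoef n p * d p) * (tmon p z * ln (f b t z))))"
    using i3 by (simp add: \<l>_def mult_ac)
  also have "\<dots> = (LINT z|torus_lebesgue. - (ln (f b t z) * df b t z))"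
  proof (intro Bochner_Integration.integral_cong refl)
    fix z
    have "(\<Sum>p\<in>tidx n. (tcoef n p * d p) * (tmon p z * ln (f b t z))) = ln (f b t z) * (\<Sum>p\<in>tidx n. tcoef n p * tmon p z * d p)"
      by (simp add: sum_distrib_left mult_ac)
    then show "(\<Sum>p\<in>tidx n. (tcoef n p * d p) * (tmon p z * ln (f b t z))) = - (ln (f b t z) * df b t z)"
      unfolding e by simp
  qed
  also have "\<dots> = - (LINT z|torus_lebesgue. ln (f b t z) * df b t z)" by simp
  also have "(LINT z|torus_lebesgue. ln (f b t z) * df b t z) = 0"
  proof (rule integral_torus_deriv_eq_0)
    \<comment> \<open>\<open>ln f\<close> times the derivative of \<open>f\<close> is itself a
      derivative, namely of \<open>f * ln f - f\<close>.\<close>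
    show "torus_deriv (\<lambda>z. f b t z * ln (f b t z) - f b t z) (\<lambda>z. ln (f b t z) * df b t z)"
      unfolding torus_deriv_def
    proof
      fix x
      have d: "((\<lambda>x. f b t (to_torus x)) has_real_derivative df b t (to_torus x)) (at x)"
        using torus_deriv_f by (simp add: torus_deriv_def)
      show "((\<lambda>x. f b t (to_torus x) * ln (f b t (to_torus x)) - f b t (to_torus x)) has_real_derivative ln (f b t (to_torus x)) * df b t (to_torus x)) (at x)"
        using f_pos[OF t, of b "to_torus x"] by (auto intro!: derivative_eq_intros d simp: field_simps)
    qed
    show "continuous_on UNIV (\<lambda>z. ln (f b t z) * df b t z)"
      by (intro continuous_intros continuous_ln_f continuous_df t)
  qed
  finally show ?thesis by (simp add: d_def)
qed

lemma \<Phi>_measurable: assumes t: "t \<in> {0..T}" shows "\<Phi> t \<in> borel_measurable borel"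
  unfolding \<Phi>_eq[OF t, abs_def] by (simp add: case_prod_beta)

lemma \<Phi>_bound:
  assumes t: "t \<in> {0..T}" obtains B where "\<And>q. \<bar>\<Phi> t q\<bar> \<le> B"
proof -
  have "\<bar>\<Phi> t q\<bar> \<le> (\<Sum>i\<in>UNIV \<times> tidx n. \<bar>tcoef n (snd i) * \<l> (snd i) (fst i) t\<bar>)" for q
  proof -
    have "\<bar>\<Phi> t q\<bar> \<le> (\<Sum>i\<in>UNIV \<times> tidx n. \<bar>tcoef n (snd i) * \<l> (snd i) (fst i) t * vbas (snd i) (fst i) q\<bar>)"
      unfolding \<Phi>_eq[OF t] case_prod_beta by (rule sum_abs)
    also have "\<dots> \<le> (\<Sum>i\<in>UNIV \<times> tidx n. \<bar>tcoef n (snd i) * \<l> (snd i) (fst i) t\<bar>)"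
    proof (rule sum_mono)
      fix i
      show "\<bar>tcoef n (snd i) * \<l> (snd i) (fst i) t * vbas (snd i) (fst i) q\<bar> \<le> \<bar>tcoef n (snd i) * \<l> (snd i) (fst i) t\<bar>"
        unfolding abs_mult[of "tcoef n (snd i) * \<l> (snd i) (fst i) t"]
        using mult_left_mono[OF vbas_bound abs_ge_zero, of "tcoef n (snd i) * \<l> (snd i) (fst i) t"] by simp
    qed
    finally show ?thesis .
  qed
  then show ?thesis by (rule that)
qed

text \<open>Jensen's inequality turns the exponential of the mollified logarithm into the geometric mean of
  the two densities.\<close>

lemma exp_\<Phi>_integral:
  assumes t: "t \<in> {0..T}"
  shows "(LINT q|\<sigma> t. exp ((\<Phi> t (flip q) - \<Phi> t q) / 2)) \<le> 1 + 2 * \<delta> - D t"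
proof -
  \<comment> \<open>The square root of the density ratio; its logarithm is the half difference of
    logarithms inside the exponent.\<close>
  define h where "h b w = sqrt (f (\<not> b) t w / f b t w)" for b w
  have ln_h: "ln (h b w) = (ln (f (\<not> b) t w) - ln (f b t w)) / 2" for b w
    unfolding h_def using f_pos[OF t, of b w] f_pos[OF t, of "\<not> b" w] by (simp add: ln_sqrt ln_div)
  have h_pos: "0 < h b w" for b w unfolding h_def using f_pos[OF t] by simp
  have ch: "continuous_on UNIV (h b)" for b
    unfolding h_def[abs_def] using f_pos[OF t] by (intro continuous_intros continuous_f) (auto simp: less_imp_neq[THEN not_sym])
  have mh [measurable]: "h b \<in> borel_measurable borel" for b by (rule borel_measurable_continuous_onI[OF ch])
  obtain Bh where Bh: "\<And>b w. \<bar>h b w\<bar> \<le> Bh"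
  proof -
    obtain B1 B2 where "\<And>w. \<bar>h True w\<bar> \<le> B1" "\<And>w. \<bar>h False w\<bar> \<le> B2"
      using bounded_continuous_torus[OF ch[of True]] bounded_continuous_torus[OF ch[of False]] by metis
    then have "\<bar>h b w\<bar> \<le> max B1 B2" for b w by (cases b) (auto simp: le_max_iff_disj)
    then show thesis by (rule that)
  qed
  define H where "H b x = (LINT w|torus_lebesgue. tker n w x * h b w)" for b x
  have cH: "continuous_on UNIV (H b)" for b
  proof -
    have i: "integrable torus_lebesgue (\<lambda>w. tmon p w * h b w)" for p
      by (intro torus_integrable_continuous continuous_intros continuous_tmon ch)
    have "H b x = (LINT w|torus_lebesgue. (\<Sum>p\<in>tidx n. (tcoef n p * tmon p x) * (tmon p w * h b w)))" for x
      unfolding H_def tker_expand by (simp add: sum_distrib_left sum_distrib_right mult_ac)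
    then have "H b = (\<lambda>x. \<Sum>p\<in>tidx n. (tcoef n p * tmon p x) * (LINT w|torus_lebesgue. tmon p w * h b w))"
      using i by (simp add: fun_eq_iff)
    then show ?thesis by (simp only:) (intro continuous_intros continuous_tmon)
  qed
  obtain BH where BH: "\<And>b w. \<bar>H b w\<bar> \<le> BH"
  proof -
    obtain B1 B2 where "\<And>w. \<bar>H True w\<bar> \<le> B1" "\<And>w. \<bar>H False w\<bar> \<le> B2"
      using bounded_continuous_torus[OF cH[of True]] bounded_continuous_torus[OF cH[of False]] by metis
    then have "\<bar>H b w\<bar> \<le> max B1 B2" for b w by (cases b) (auto simp: le_max_iff_disj)
    then show thesis by (rule that)
  qed
  have mH: "H b \<in> borel_measurable borel" for b by (rule borel_measurable_continuous_onI[OF cH])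
  have le: "exp ((\<Phi> t (flip q) - \<Phi> t q) / 2) \<le> H (snd q) (fst q)" for q
  proof -
    have i: "integrable torus_lebesgue (\<lambda>w. tker n w x * ln (f b t w))" for b x
      by (intro torus_integrable_continuous continuous_intros continuous_tker continuous_ln_f t)
    have "(\<Phi> t (flip q) - \<Phi> t q) / 2 = (LINT w|torus_lebesgue. (tker n w (fst q) * ln (f (\<not> snd q) t w) - tker n w (fst q) * ln (f (snd q) t w)) / 2)"
      unfolding \<Phi>_def using i by (simp add: flip_def case_prod_beta)
    also have "\<dots> = (LINT w|torus_lebesgue. tker n w (fst q) * ln (h (snd q) w))"
      unfolding ln_h by (simp add: right_diff_distrib diff_divide_distrib)
    finally have "exp ((\<Phi> t (flip q) - \<Phi> t q) / 2) = exp (LINT w|torus_lebesgue. tker n w (fst q) * ln (h (snd q) w))" by simp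
    also have "\<dots> \<le> (LINT w|torus_lebesgue. tker n w (fst q) * exp (ln (h (snd q) w)))"
    proof (rule tker_Jensen[of _ "\<bar>ln \<delta>\<bar> + \<bar>ln (\<delta> + S)\<bar>"])
      show "\<bar>ln (h (snd q) w)\<bar> \<le> \<bar>ln \<delta>\<bar> + \<bar>ln (\<delta> + S)\<bar>" for w
        unfolding ln_h using ln_f_bound[OF t, of "\<not> snd q" w] ln_f_bound[OF t, of "snd q" w] by (simp add: abs_le_iff)
    qed measurable
    finally show ?thesis using h_pos by (simp add: H_def)
  qed
  have "(LINT q|\<sigma> t. exp ((\<Phi> t (flip q) - \<Phi> t q) / 2)) \<le> (LINT q|\<sigma> t. H (snd q) (fst q))"
  proof (rule integral_mono)
    show iH: "integrable (\<sigma> t) (\<lambda>q. H (snd q) (fst q))"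
      by (rule if_phase_integrable(2)[OF t mH BH])
    have m: "(\<lambda>q. exp ((\<Phi> t (flip q) - \<Phi> t q) / 2)) \<in> borel_measurable borel"
      using \<Phi>_measurable[OF t] measurable_compose[OF measurable_flip \<Phi>_measurable[OF t]] by simp
    show "integrable (\<sigma> t) (\<lambda>q. exp ((\<Phi> t (flip q) - \<Phi> t q) / 2))"
    proof (rule int_\<sigma>[OF t m, of BH])
      show "\<bar>exp ((\<Phi> t (flip q) - \<Phi> t q) / 2)\<bar> \<le> BH" for q
        using le[of q] BH[of "snd q" "fst q"] by (simp add: abs_le_iff)
    qed
  qed (rule le)
  also have "\<dots> = (\<Sum>b\<in>UNIV. LINT q|\<sigma> t. (if snd q = b then H b (fst q) else 0))"
    by (rule if_phase_integrable(3)[OF t mH BH])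
  also have "\<dots> = (\<Sum>b\<in>UNIV. LINT z|torus_lebesgue. h b z * (f b t z - \<delta>))"
    unfolding H_def by (intro sum.cong refl dual[OF t, where B=Bh, symmetric] Bh) simp
  also have "\<dots> \<le> (\<Sum>b\<in>(UNIV :: bool set). LINT z|torus_lebesgue. sqrt (f True t z) * sqrt (f False t z))"
  proof (intro sum_mono integral_mono)
    fix b z
    show "integrable torus_lebesgue (\<lambda>z. h b z * (f b t z - \<delta>))"
      by (intro torus_integrable_continuous continuous_intros ch continuous_f)
    show "integrable torus_lebesgue (\<lambda>z. sqrt (f True t z) * sqrt (f False t z))"
      by (intro torus_integrable_continuous continuous_intros continuous_f)
    \<comment> \<open>Discarding \<open>\<delta>\<close> is allowed as \<open>h\<close> is positive,
      and \<open>h * f\<close> is the geometric mean of the two densities.\<close>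
    have "h b z * (f b t z - \<delta>) \<le> h b z * f b t z" using h_pos[of b z] \<delta>_pos by (intro mult_left_mono) auto
    also have "\<dots> = sqrt (f (\<not> b) t z) * sqrt (f b t z)"
      unfolding h_def real_sqrt_divide using f_pos[OF t, of b z] real_sqrt_mult_self[of "f b t z"]
      by (simp add: field_simps)
    also have "\<dots> = sqrt (f True t z) * sqrt (f False t z)" by (cases b) (simp_all add: mult.commute)
    finally show "h b z * (f b t z - \<delta>) \<le> sqrt (f True t z) * sqrt (f False t z)" .
  qed
  also have "\<dots> = (LINT z|torus_lebesgue. 2 * (sqrt (f True t z) * sqrt (f False t z)))" by simp
  \<comment> \<open>Twice the geometric mean is the sum minus the squared difference of the square
    roots.\<close>
  also have "(\<lambda>z. 2 * (sqrt (f True t z) * sqrt (f False t z))) = (\<lambda>z. f True t z + f False t z - (sqrt (f True t z) - sqrt (f False t z))\<^sup>2)"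
    using f_pos[OF t] by (auto simp: fun_eq_iff power2_diff less_imp_le)
  also have "(LINT z|torus_lebesgue. f True t z + f False t z - (sqrt (f True t z) - sqrt (f False t z))\<^sup>2)
      = (\<Sum>b\<in>UNIV. LINT z|torus_lebesgue. f b t z) - D t"
  proof -
    have "integrable torus_lebesgue (\<lambda>z. (sqrt (f True t z) - sqrt (f False t z))\<^sup>2)"
      by (intro torus_integrable_continuous continuous_intros continuous_f)
    then show ?thesis unfolding D_def using integrable_f by (simp add: UNIV_bool)
  qed
  finally show ?thesis using mass[OF t] by simp
qed

text \<open>Fenchel with the half difference of \<open>\<Phi> r\<close> under \<open>flip\<close>.
  Its pairing with the second flux is half the entropy production, since transport contributes
  nothing; the dual term is at most \<open>k * (2 * \<delta> - D r)\<close> by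
  \<open>exp_\<Phi>_integral\<close>, which equals \<open>1 / \<alpha> - k * D r\<close>.\<close>

lemma dissipation_le_lagrangian:
  "AE r in lborel. r \<in> {0<..<T} \<longrightarrow>
    ennreal ((\<Sum>i\<in>UNIV \<times> tidx n. (tcoef n (snd i) * \<l> (snd i) (fst i) r) * G i r) / 2 + k * D r - 1 / \<alpha>)
      \<le> lagrangian \<alpha> V (\<sigma> r) (j r)"
proof -
  have "AE r in lborel. \<forall>i\<in>UNIV \<times> tidx n. r \<in> {0<..<T} \<longrightarrow>
    signed_integral borel (flux1 (j r)) (dvbas (snd i) (fst i)) = V * vel (fst i) * (LINT q|\<sigma> r. dvbas (snd i) (fst i) q)"
  \<comment> \<open>Finitely many test functions, hence a single exceptional null set of
    times.\<close>
  proof (rule AE_finite_allI)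
    fix i :: "bool \<times> nat \<times> nat" 
    obtain B where B: "\<And>b q. \<bar>dvbas (snd i) b q\<bar> \<le> B" by (rule dvbas_bounded[of "snd i"]) (rule that)
    have "AE r in lborel. r \<in> {0<..<T} \<longrightarrow> signed_integral borel (flux1 (j r)) (\<lambda>q. vel (snd q) * (vel (fst i) * dvbas (snd i) (fst i) q))
        = V * (LINT q|\<sigma> r. vel (fst i) * dvbas (snd i) (fst i) q)"
    proof (rule AE_flux1)
      show "continuous_on UNIV (\<lambda>q. vel (fst i) * dvbas (snd i) (fst i) q)"
        by (intro continuous_intros continuous_dvbas)
      show "\<bar>vel (fst i) * dvbas (snd i) (fst i) q\<bar> \<le> B" for q using B[of "fst i" q]
        by (cases "fst i") (simp_all add: abs_mult vel_def)
    qed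
    moreover have "(\<lambda>q. vel (snd q) * (vel (fst i) * dvbas (snd i) (fst i) q)) = dvbas (snd i) (fst i)"
      by (auto simp: fun_eq_iff vel_def dvbas_def)
    ultimately show "AE r in lborel. r \<in> {0<..<T} \<longrightarrow>
      signed_integral borel (flux1 (j r)) (dvbas (snd i) (fst i)) = V * vel (fst i) * (LINT q|\<sigma> r. dvbas (snd i) (fst i) q)"
      by (simp add: mult.assoc)
  qed simp
  then show ?thesis
  proof eventually_elim
    case (elim r)
    show ?case
    proof
      assume r: "r \<in> {0<..<T}"
      then have r': "r \<in> {0..T}" by simp
      define a where "a i = tcoef n (snd i) * \<l> (snd i) (fst i) r" for i
      define F2 where "F2 = flux2 (j r)"
      have "(\<Sum>i\<in>UNIV \<times> tidx n. a i * G i r) = (\<Sum>i\<in>UNIV \<times> tidx n. a i * (V * vel (fst i) * (LINT q|\<sigma> r. dvbas (snd i) (fst i) q)))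
          + (\<Sum>i\<in>UNIV \<times> tidx n. a i * signed_integral borel F2 (\<lambda>q. vbas (snd i) (fst i) (flip q) - vbas (snd i) (fst i) q))"
        unfolding sum.distrib[symmetric]
      proof (intro sum.cong refl)
        fix i :: "bool \<times> nat \<times> nat" assume "i \<in> UNIV \<times> tidx n"
        from bspec[OF elim this] r
        have "signed_integral borel (flux1 (j r)) (dvbas (snd i) (fst i)) = V * vel (fst i) * (LINT q|\<sigma> r. dvbas (snd i) (fst i) q)"
          by (rule mp)
        then show "a i * G i r = a i * (V * vel (fst i) * (LINT q|\<sigma> r. dvbas (snd i) (fst i) q))
          + a i * signed_integral borel F2 (\<lambda>q. vbas (snd i) (fst i) (flip q) - vbas (snd i) (fst i) q)"
          by (simp add: G_def F2_def case_prod_beta distrib_left)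
      qed
      also have "(\<Sum>i\<in>UNIV \<times> tidx n. a i * (V * vel (fst i) * (LINT q|\<sigma> r. dvbas (snd i) (fst i) q)))
          = (\<Sum>b\<in>UNIV. V * vel b * (\<Sum>p\<in>tidx n. tcoef n p * \<l> p b r * (LINT q|\<sigma> r. dvbas p b q)))"
        unfolding a_def sum_distrib_left sum.cartesian_product by (intro sum.cong refl) (auto simp: mult_ac)
      \<comment> \<open>Transport vanishes for each velocity separately.\<close>
      also have "\<dots> = 0" unfolding transport_zero[OF r'] by simp
      also have "(\<Sum>i\<in>UNIV \<times> tidx n. a i * signed_integral borel F2 (\<lambda>q. vbas (snd i) (fst i) (flip q) - vbas (snd i) (fst i) q))
          = signed_integral borel F2 (\<lambda>q. \<Sum>i\<in>UNIV \<times> tidx n. a i * (vbas (snd i) (fst i) (flip q) - vbas (snd i) (fst i) q))"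
        unfolding F2_def by (rule signed_integral_sum[OF vm_flux(2)[OF r] _ vbas_flip_measurable vbas_flip_bound]) simp
      also have "(\<lambda>q. \<Sum>i\<in>UNIV \<times> tidx n. a i * (vbas (snd i) (fst i) (flip q) - vbas (snd i) (fst i) q)) = (\<lambda>q. \<Phi> r (flip q) - \<Phi> r q)"
        unfolding \<Phi>_eq[OF r'] a_def by (simp add: case_prod_beta right_diff_distrib sum_subtractf)
      finally have 1: "(\<Sum>i\<in>UNIV \<times> tidx n. a i * G i r) = signed_integral borel F2 (\<lambda>q. \<Phi> r (flip q) - \<Phi> r q)" by simp
      obtain B where B: "\<And>q. \<bar>\<Phi> r q\<bar> \<le> B" using \<Phi>_bound[OF r'] by blast
      have mF: "(\<lambda>q. \<Phi> r (flip q) - \<Phi> r q) \<in> borel_measurable borel"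
        using \<Phi>_measurable[OF r'] measurable_compose[OF measurable_flip \<Phi>_measurable[OF r']] by simp
      have bF: "\<bar>\<Phi> r (flip q) - \<Phi> r q\<bar> \<le> 2 * B" for q using B[of q] B[of "flip q"] by linarith
      have half: "signed_integral borel F2 (\<lambda>q. (\<Phi> r (flip q) - \<Phi> r q) / 2) = signed_integral borel F2 (\<lambda>q. \<Phi> r (flip q) - \<Phi> r q) / 2"
        using signed_integral_sum[OF vm_flux(2)[OF r], of "{()}" "\<lambda>_ q. \<Phi> r (flip q) - \<Phi> r q" "2 * B" "\<lambda>_. 1 / 2"] mF bF
        by (simp add: F2_def)
      interpret prob_space "\<sigma> r" by (rule prob[OF r'])
      have mE: "(\<lambda>q. exp ((\<Phi> r (flip q) - \<Phi> r q) / 2)) \<in> borel_measurable borel" using mF by simp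
      have iE: "integrable (\<sigma> r) (\<lambda>q. exp ((\<Phi> r (flip q) - \<Phi> r q) / 2))"
      proof (rule int_\<sigma>[OF r' mE, of "exp B"])
        show "\<bar>exp ((\<Phi> r (flip q) - \<Phi> r q) / 2)\<bar> \<le> exp B" for q using bF[of q] by (simp add: abs_le_iff)
      qed
      have "(LINT q|\<sigma> r. exp ((\<Phi> r (flip q) - \<Phi> r q) / 2) - 1) = (LINT q|\<sigma> r. exp ((\<Phi> r (flip q) - \<Phi> r q) / 2)) - 1"
        using iE by (simp add: prob_space)
      also have "\<dots> \<le> 2 * \<delta> - D r" using exp_\<Phi>_integral[OF r'] by simp
      finally have "k * (LINT q|\<sigma> r. exp ((\<Phi> r (flip q) - \<Phi> r q) / 2) - 1) \<le> k * (2 * \<delta> - D r)"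
        using k_pos by (intro mult_left_mono) auto
      also have "\<dots> = 1 / \<alpha> - k * D r" using \<delta>_k by (simp add: right_diff_distrib mult_ac)
      finally have "(\<Sum>i\<in>UNIV \<times> tidx n. a i * G i r) / 2 + k * D r - 1 / \<alpha>
          \<le> signed_integral borel F2 (\<lambda>q. (\<Phi> r (flip q) - \<Phi> r q) / 2) - k * (LINT q|\<sigma> r. exp ((\<Phi> r (flip q) - \<Phi> r q) / 2) - 1)"
        unfolding 1 half by linarith
      then have "ennreal ((\<Sum>i\<in>UNIV \<times> tidx n. a i * G i r) / 2 + k * D r - 1 / \<alpha>)
          \<le> ennreal (signed_integral borel F2 (\<lambda>q. (\<Phi> r (flip q) - \<Phi> r q) / 2) - k * (LINT q|\<sigma> r. exp ((\<Phi> r (flip q) - \<Phi> r q) / 2) - 1))"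
        by (rule ennreal_leI)
      also have "\<dots> \<le> lagrangian \<alpha> V (\<sigma> r) (j r)"
        unfolding F2_def
      proof (rule lagrangian_Fenchel[OF r, of _ B])
        show "(\<lambda>q. (\<Phi> r (flip q) - \<Phi> r q) / 2) \<in> borel_measurable borel" using mF by simp
        show "\<bar>(\<Phi> r (flip q) - \<Phi> r q) / 2\<bar> \<le> B" for q using bF[of q] by (simp add: abs_le_iff)
      qed
      finally show "ennreal ((\<Sum>i\<in>UNIV \<times> tidx n. (tcoef n (snd i) * \<l> (snd i) (fst i) r) * G i r) / 2 + k * D r - 1 / \<alpha>)
          \<le> lagrangian \<alpha> V (\<sigma> r) (j r)" unfolding a_def .
    qed
  qed
qed

lemma D_integrable: "0 \<le> s \<Longrightarrow> t \<le> T \<Longrightarrow> set_integrable lborel {s<..<t} D"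
  by (rule set_integrable_subset[OF borel_integrable_atLeastAtMost'[OF continuous_D]]) auto

lemma entropy_dissipation:
  assumes t: "t \<in> {0..T}"
  shows "(E t - E 0) / 2 + k * (LINT r:{0<..<t}|lborel. D r) \<le> C + T / \<alpha>"
proof -
  have t': "0 \<le> t" "t \<le> T" using t by auto
  define h where "h r = (\<Sum>i\<in>UNIV \<times> tidx n. (tcoef n (snd i) * \<l> (snd i) (fst i) r) * G i r)" for r
  have hi: "set_integrable lborel {0<..<t} h" and Eh: "E t - E 0 \<le> (LINT r:{0<..<t}|lborel. h r)"
    unfolding h_def using E_le_integral[of 0 t] t' by auto
  have Di: "set_integrable lborel {0<..<t} D" by (rule D_integrable) (use t' in auto)
  have ci: "set_integrable lborel {0<..<t} (\<lambda>r. 1 / \<alpha>)"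
    unfolding set_integrable_def real_scaleR_def by (intro integrable_mult_left integrable_real_indicator) (use t' in auto)
  have hi2: "set_integrable lborel {0<..<t} (\<lambda>r. h r / 2)" using hi by (simp add: set_integrable_def)
  have Di2: "set_integrable lborel {0<..<t} (\<lambda>r. k * D r)" using Di by simp
  have "(LINT r:{0<..<t}|lborel. h r / 2 + k * D r - 1 / \<alpha>) \<le> C"
    by (rule integral_le_action) (use hi2 Di2 ci t' dissipation_le_lagrangian in \<open>auto simp: h_def\<close>)
  also have "(LINT r:{0<..<t}|lborel. h r / 2 + k * D r - 1 / \<alpha>)
      = (LINT r:{0<..<t}|lborel. h r / 2) + (LINT r:{0<..<t}|lborel. k * D r) - (LINT r:{0<..<t}|lborel. 1 / \<alpha>)"
    using hi2 Di2 ci by (simp add: set_integral_diff set_integral_add)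
  also have "(LINT r:{0<..<t}|lborel. 1 / \<alpha>) = t / \<alpha>" using t' by (simp add: set_lebesgue_integral_def)
  also have "(LINT r:{0<..<t}|lborel. h r / 2) = (LINT r:{0<..<t}|lborel. h r) / 2" by simp
  also have "(LINT r:{0<..<t}|lborel. k * D r) = k * (LINT r:{0<..<t}|lborel. D r)" by simp
  finally have "(LINT r:{0<..<t}|lborel. h r) / 2 + k * (LINT r:{0<..<t}|lborel. D r) \<le> C + t / \<alpha>" by simp
  moreover have "t / \<alpha> \<le> T / \<alpha>" using t' \<alpha> by (simp add: divide_right_mono)
  moreover have "(E t - E 0) / 2 \<le> (LINT r:{0<..<t}|lborel. h r) / 2" using Eh by simp
  ultimately show ?thesis by linarith
qed

text \<open>The mollified logarithm is inserted in the duality formula for \<open>Ent\<close>, so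
  densities of \<open>\<sigma> 0\<close> are never handled. By Jensen its exponential integrates
  against \<open>ref_measure\<close> to at most half the total mass,
  \<open>(1 + 2 * \<delta>) / 2\<close>.\<close>

lemma initial_entropy: "E 0 \<le> C + 2"
proof -
  have t: "0 \<in> {0..T}" using T by simp
  obtain B where B: "\<And>q. \<bar>\<Phi> 0 q\<bar> \<le> B" using \<Phi>_bound[OF t] by blast
  have iln: "integrable torus_lebesgue (\<lambda>z. ln (f b 0 z))" for b
    by (rule torus_integrable_continuous[OF continuous_ln_f[OF t]])
  have i1: "integrable torus_lebesgue (\<lambda>z. ln (f b 0 z) * (f b 0 z - \<delta>))" for b
    by (intro torus_integrable_continuous continuous_intros continuous_f continuous_ln_f t)
  \<comment> \<open>The part \<open>f - \<delta>\<close> is dual to \<open>\<sigma> 0\<close>; the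
    rest is bounded through \<open>ln u \<le> u - 1\<close>.\<close>
  have "E 0 = (\<Sum>b\<in>UNIV. LINT z|torus_lebesgue. ln (f b 0 z) * (f b 0 z - \<delta>) + \<delta> * ln (f b 0 z))"
    unfolding E_def by (simp add: algebra_simps)
  also have "\<dots> = (\<Sum>b\<in>UNIV. LINT z|torus_lebesgue. ln (f b 0 z) * (f b 0 z - \<delta>)) + \<delta> * (\<Sum>b\<in>UNIV. LINT z|torus_lebesgue. ln (f b 0 z))"
    using iln i1 by (simp add: sum.distrib sum_distrib_left)
  also have "(\<Sum>b\<in>UNIV. LINT z|torus_lebesgue. ln (f b 0 z) * (f b 0 z - \<delta>))
      = (\<Sum>b\<in>UNIV. LINT q|\<sigma> 0. (if snd q = b then (LINT z|torus_lebesgue. tker n z (fst q) * ln (f b 0 z)) else 0))"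
    by (intro sum.cong refl dual[OF t, where B="\<bar>ln \<delta>\<bar> + \<bar>ln (\<delta> + S)\<bar>"] ln_f_bound[OF t]) simp
  also have "\<dots> = (\<Sum>b\<in>UNIV. LINT q|\<sigma> 0. (if snd q = b then \<Phi> 0 (fst q, b) else 0))"
    by (simp add: \<Phi>_def cong: if_cong)
  also have "\<dots> = (LINT q|\<sigma> 0. \<Phi> 0 (fst q, snd q))"
  proof (rule if_phase_integrable(3)[OF t, symmetric, of "\<lambda>b z. \<Phi> 0 (z, b)"])
    show "(\<lambda>z. \<Phi> 0 (z, b)) \<in> borel_measurable borel" for b
    proof -
      have "(\<lambda>z. (z, b)) \<in> measurable borel (borel :: phase measure)"
        by (intro borel_measurable_continuous_onI continuous_intros)
      then show ?thesis by (rule measurable_compose[OF _ \<Phi>_measurable[OF t]])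
    qed
  qed (rule B)
  also have "\<dots> \<le> C + 1 / 2 + \<delta> - 1"
  proof -
    have "ennreal (signed_integral borel (measure (\<sigma> 0)) (\<Phi> 0) - (LINT q|ref_measure. exp (\<Phi> 0 q) - 1)) \<le> ennreal C"
      using Ent_Fenchel[OF prob_space.finite_measure[OF prob_space_ref_measure] sets_ref_measure \<Phi>_measurable[OF t] B, of "measure (\<sigma> 0)"] ent0
      by (rule order_trans)
    then have 1: "(LINT q|\<sigma> 0. \<Phi> 0 q) \<le> C + (LINT q|ref_measure. exp (\<Phi> 0 q) - 1)"
      using C signed_integral_measure[OF fin[OF t] sets_\<sigma>[OF t] \<Phi>_measurable[OF t] B] by (simp add: ennreal_le_iff)
    interpret R: prob_space ref_measure by (rule prob_space_ref_measure)
    have mexp: "(\<lambda>q. exp (\<Phi> 0 q)) \<in> borel_measurable borel" using \<Phi>_measurable[OF t] by simp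
    have bexp: "\<bar>exp (\<Phi> 0 q)\<bar> \<le> exp B" for q using B[of q] by (simp add: abs_le_iff)
    have iexp: "integrable ref_measure (\<lambda>q. exp (\<Phi> 0 q))"
      by (rule integrable_bounded[OF R.finite_measure_axioms, of _ "exp B"])
        (use mexp bexp in \<open>auto simp: measurable_cong_sets[OF sets_ref_measure refl]\<close>)
    have "(LINT q|ref_measure. exp (\<Phi> 0 q) - 1) = (LINT q|ref_measure. exp (\<Phi> 0 q)) - 1"
      using iexp by (simp add: R.prob_space)
    also have "(LINT q|ref_measure. exp (\<Phi> 0 q)) = (\<Sum>b\<in>UNIV. LINT z|torus_lebesgue. exp (\<Phi> 0 (z, b))) / 2"
      by (rule integral_ref_measure[OF mexp bexp])
    also have "(\<Sum>b\<in>UNIV. LINT z|torus_lebesgue. exp (\<Phi> 0 (z, b))) \<le> (\<Sum>b\<in>UNIV. LINT z|torus_lebesgue. f b 0 z)"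
    proof (rule sum_mono)
      fix b :: bool
      define I where "I p = (LINT w|torus_lebesgue. tmon p w * f b 0 w)" for p
      have iI: "integrable torus_lebesgue (\<lambda>w. tmon p w * f b 0 w)" for p
        by (intro torus_integrable_continuous continuous_intros continuous_tmon continuous_f)
      have it: "integrable torus_lebesgue (tmon p)" for p by (rule torus_integrable_continuous[OF continuous_tmon])
      have K: "(LINT w|torus_lebesgue. tker n w z * f b 0 w) = (\<Sum>p\<in>tidx n. tcoef n p * I p * tmon p z)" for z
      proof -
        have "(LINT w|torus_lebesgue. tker n w z * f b 0 w) = (LINT w|torus_lebesgue. (\<Sum>p\<in>tidx n. (tcoef n p * tmon p z) * (tmon p w * f b 0 w)))"
          unfolding tker_expand by (simp add: sum_distrib_left sum_distrib_right mult_ac)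
        also have "\<dots> = (\<Sum>p\<in>tidx n. (tcoef n p * tmon p z) * I p)" using iI by (simp add: I_def)
        finally show ?thesis by (simp add: mult_ac)
      qed
      have "(LINT z|torus_lebesgue. exp (\<Phi> 0 (z, b))) \<le> (LINT z|torus_lebesgue. (\<Sum>p\<in>tidx n. tcoef n p * I p * tmon p z))"
      proof (rule integral_mono)
        have "(\<lambda>z. (z, b)) \<in> measurable borel (borel :: phase measure)"
          by (intro borel_measurable_continuous_onI continuous_intros)
        then have "(\<lambda>z. exp (\<Phi> 0 (z, b))) \<in> borel_measurable borel" by (rule measurable_compose[OF _ mexp])
        then show "integrable torus_lebesgue (\<lambda>z. exp (\<Phi> 0 (z, b)))"
          by (intro integrable_bounded[OF torus.finite_measure_axioms, of _ "exp B"]) (use bexp in auto)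
        show "integrable torus_lebesgue (\<lambda>z. (\<Sum>p\<in>tidx n. tcoef n p * I p * tmon p z))" using it by simp
        fix z
        have "exp (\<Phi> 0 (z, b)) \<le> (LINT w|torus_lebesgue. tker n w z * exp (ln (f b 0 w)))"
          unfolding \<Phi>_def fst_conv snd_conv by (rule tker_Jensen[OF _ ln_f_bound[OF t]]) simp
        also have "\<dots> = (\<Sum>p\<in>tidx n. tcoef n p * I p * tmon p z)" using f_pos[OF t] K by simp
        finally show "exp (\<Phi> 0 (z, b)) \<le> (\<Sum>p\<in>tidx n. tcoef n p * I p * tmon p z)" .
      qed
      also have "\<dots> = (\<Sum>p\<in>tidx n. tcoef n p * I p * (LINT z|torus_lebesgue. tmon p z))" using it by simp
      also have "\<dots> = (\<Sum>p\<in>tidx n. tcoef n p * (LINT z|torus_lebesgue. tmon p z) * I p)" by (simp add: mult_ac)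
      also have "\<dots> = (LINT w|torus_lebesgue. (\<Sum>p\<in>tidx n. tcoef n p * (LINT z|torus_lebesgue. tmon p z) * (tmon p w * f b 0 w)))"
        using iI by (simp add: I_def)
      \<comment> \<open>The expansion is symmetric in its two arguments, so the kernel integrates to
        1 in either.\<close>
      also have "\<dots> = (LINT w|torus_lebesgue. f b 0 w)"
      proof (intro Bochner_Integration.integral_cong refl)
        fix w
        have "(\<Sum>p\<in>tidx n. tcoef n p * (LINT z|torus_lebesgue. tmon p z) * tmon p w) = (LINT z|torus_lebesgue. tker n z w)"
          unfolding tker_expand using it by simp
        then have "(\<Sum>p\<in>tidx n. tcoef n p * (LINT z|torus_lebesgue. tmon p z) * tmon p w) = 1" by (simp add: integral_tker)
        then have "f b 0 w * (\<Sum>p\<in>tidx n. tcoef n p * (LINT z|torus_lebesgue. tmon p z) * tmon p w) = f b 0 w" by simp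
        then show "(\<Sum>p\<in>tidx n. tcoef n p * (LINT z|torus_lebesgue. tmon p z) * (tmon p w * f b 0 w)) = f b 0 w"
          by (simp add: sum_distrib_left mult_ac)
      qed
      finally show "(LINT z|torus_lebesgue. exp (\<Phi> 0 (z, b))) \<le> (LINT z|torus_lebesgue. f b 0 z)" .
    qed
    finally have "(LINT q|ref_measure. exp (\<Phi> 0 q) - 1) \<le> (1 + 2 * \<delta>) / 2 - 1" unfolding mass[OF t] by simp
    then show ?thesis using 1 by simp
  qed
  also have "(\<Sum>b\<in>UNIV. LINT z|torus_lebesgue. ln (f b 0 z)) \<le> (\<Sum>b\<in>UNIV. (LINT z|torus_lebesgue. f b 0 z) - 1)"
  proof (rule sum_mono)
    fix b :: bool
    have "(LINT z|torus_lebesgue. ln (f b 0 z)) \<le> (LINT z|torus_lebesgue. f b 0 z - 1)"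
      using iln integrable_f f_pos[OF t] by (intro integral_mono ln_le_minus_one) auto
    then show "(LINT z|torus_lebesgue. ln (f b 0 z)) \<le> (LINT z|torus_lebesgue. f b 0 z) - 1"
      using integrable_f by (simp add: torus.prob_space)
  qed
  also have "(\<Sum>b\<in>UNIV. (LINT z|torus_lebesgue. f b 0 z) - 1) = 2 * \<delta> - 1"
    unfolding sum_subtractf mass[OF t] by simp
  finally have "E 0 \<le> C + 1 / 2 + \<delta> - 1 + \<delta> * (2 * \<delta> - 1)" using \<delta>_pos by (simp add: mult_left_mono)
  moreover have "\<delta> * (2 * \<delta> - 1) \<le> \<delta> * 1" using \<delta>_pos \<delta>_le_1 by (intro mult_left_mono) auto
  ultimately show ?thesis using \<delta>_le_1 by (simp add: field_simps)
qed

text \<open>From \<open>u * ln u \<ge> u - 1\<close>: the reference mass of the two velocities is 2,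
  the mass of the mollified curve \<open>1 + 2 * \<delta>\<close>.\<close>

lemma entropy_lower: assumes t: "t \<in> {0..T}" shows "- 1 \<le> E t"
proof -
  have i: "integrable torus_lebesgue (\<lambda>z. f b t z * ln (f b t z))" for b
    by (intro torus_integrable_continuous continuous_intros continuous_f continuous_ln_f t)
  have "(LINT z|torus_lebesgue. f b t z) - 1 \<le> (LINT z|torus_lebesgue. f b t z * ln (f b t z))" for b
  proof -
    have "(LINT z|torus_lebesgue. f b t z - 1) \<le> (LINT z|torus_lebesgue. f b t z * ln (f b t z))"
    proof (rule integral_mono)
      fix z
      have "0 \<le> f b t z * ln (f b t z) - f b t z + 1"
        using Young_entropy[of "f b t z" 0] f_pos[OF t, of b z] by simp
      then show "f b t z - 1 \<le> f b t z * ln (f b t z)" by linarith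
    qed (use i integrable_f in auto)
    then show ?thesis using integrable_f by (simp add: torus.prob_space)
  qed
  then have "(\<Sum>b\<in>UNIV. (LINT z|torus_lebesgue. f b t z) - 1) \<le> E t" unfolding E_def by (rule sum_mono)
  moreover have "(\<Sum>b\<in>UNIV. (LINT z|torus_lebesgue. f b t z) - 1) = 2 * \<delta> - 1"
    unfolding sum_subtractf mass[OF t] by simp
  ultimately show ?thesis using \<delta>_pos by linarith
qed

theorem entropy_bound:
  assumes t: "t \<in> {0..T}"
  shows "E t \<le> 3 * C + 2 + 2 * T / \<alpha>"
proof -
  have "0 \<le> k * (LINT r:{0<..<t}|lborel. D r)"
    using k_pos D_nonneg unfolding set_lebesgue_integral_def
    by (intro mult_nonneg_nonneg Bochner_Integration.integral_nonneg) auto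
  moreover have "e \<le> 3 * C + 2 + 2 * a" if "(e - e0) / 2 + x \<le> C + a" "e0 \<le> C + 2" "0 \<le> x" for e e0 x a :: real
    using that by (simp add: field_simps)
  ultimately have "E t \<le> 3 * C + 2 + 2 * (T / \<alpha>)" using entropy_dissipation[OF t] initial_entropy by blast
  then show ?thesis by simp
qed

text \<open>At the final time the lower bound on \<open>E\<close> converts the balance into a bound
  on the dissipation. With the factor \<open>k\<close> on the left it is uniform in \<open>V\<close>
  and in \<open>n\<close>.\<close>

theorem dissipation_bound: "k * (LINT r:{0<..<T}|lborel. D r) \<le> 2 * C + 2 + T / \<alpha>"
proof -
  have t: "T \<in> {0..T}" using T by simp
  have "x \<le> 2 * C + 2 + a" if "(e - e0) / 2 + x \<le> C + a" "e0 \<le> C + 2" "- 1 \<le> e" for e e0 x a :: real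
    using that C by (simp add: field_simps)
  then show ?thesis using entropy_dissipation[OF t] initial_entropy entropy_lower[OF t] by blast
qed

end

section \<open>Uniform estimates\<close>

lemma tker_conv_bound:
  assumes \<psi>: "continuous_on UNIV \<psi>" "\<And>z. \<bar>\<psi> z\<bar> \<le> B"
  shows "\<bar>LINT z|torus_lebesgue. tker n z w * \<psi> z\<bar> \<le> B"
proof -
  have i: "integrable torus_lebesgue (\<lambda>z. tker n z w * \<psi> z)" "integrable torus_lebesgue (\<lambda>z. tker n z w)"
    by (intro torus_integrable_continuous continuous_intros continuous_tker \<psi>)+
  have "\<bar>LINT z|torus_lebesgue. tker n z w * \<psi> z\<bar> \<le> (LINT z|torus_lebesgue. \<bar>tker n z w * \<psi> z\<bar>)"
    by (rule integral_abs_bound)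
  also have "\<dots> \<le> (LINT z|torus_lebesgue. tker n z w * B)"
  proof (rule integral_mono[OF integrable_abs[OF i(1)]])
    show "integrable torus_lebesgue (\<lambda>z. tker n z w * B)" using i(2) by simp
    show "\<bar>tker n z w * \<psi> z\<bar> \<le> tker n z w * B" for z
      using mult_left_mono[OF \<psi>(2) tker_nonneg] tker_nonneg[of n z w] by (simp add: abs_mult)
  qed
  also have "\<dots> = B" using i by (simp add: integral_tker)
  finally show ?thesis .
qed

lemma continuous_tker_conv:
  assumes \<psi>: "continuous_on UNIV \<psi>"
  shows "continuous_on UNIV (\<lambda>w. LINT z|torus_lebesgue. tker n z w * \<psi> z)"
proof -
  have i: "integrable torus_lebesgue (\<lambda>z. tmon p z * \<psi> z)" for p
    by (intro torus_integrable_continuous continuous_intros continuous_tmon \<psi>)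
  have "(LINT z|torus_lebesgue. tker n z w * \<psi> z) = (LINT z|torus_lebesgue. (\<Sum>p\<in>tidx n. (tcoef n p * tmon p w) * (tmon p z * \<psi> z)))" for w
    unfolding tker_expand by (simp add: sum_distrib_left sum_distrib_right mult_ac)
  also have "\<dots> w = (\<Sum>p\<in>tidx n. (tcoef n p * tmon p w) * (LINT z|torus_lebesgue. tmon p z * \<psi> z))" for w using i by simp
  finally show ?thesis by (simp only:) (intro continuous_intros continuous_tmon)
qed

text \<open>Realizes the sum of two measures as a measure, so that approximation in its L1 norm is
  approximation in both.\<close>

lemma integral_Un_finite_measures:
  assumes P: "finite_measure P" "sets P = sets M" and N: "finite_measure N" "sets N = sets M"
  obtains Q where "finite_measure Q" "sets Q = sets M"
    "\<And>f B. f \<in> borel_measurable M \<Longrightarrow> (\<And>x. \<bar>f x :: real\<bar> \<le> B) \<Longrightarrow> (LINT x|Q. f x) = (LINT x|P. f x) + (LINT x|N. f x)"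
proof -
  obtain Q where Q: "finite_measure Q" "sets Q = sets M" "\<And>A. A \<in> sets M \<Longrightarrow> measure Q A = measure P A + measure N A"
    by (rule nonneg_vector_measure_obtain[OF vector_measure_add[OF vector_measure_measure[OF P] vector_measure_measure[OF N]]])
      (use that in auto)
  show ?thesis
  proof (rule that[OF Q(1,2)])
    fix f :: "'a \<Rightarrow> real" and B assume f: "f \<in> borel_measurable M" "\<And>x. \<bar>f x\<bar> \<le> B"
    have "signed_integral M (measure P) f = (LINT x|Q. f x) - (LINT x|N. f x)"
      by (rule signed_integral_eq[OF Q(1) N(1) Q(2) N(2) _ f(1), of _ B]) (use f Q in auto)
    then show "(LINT x|Q. f x) = (LINT x|P. f x) + (LINT x|N. f x)"
      using signed_integral_measure[OF P f] by simp
  qed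
qed

text \<open>Density of continuous functions via \<open>L1_approx\<close>: the open sets generate,
  and their indicators are limits of truncated multiples of the functions from
  \<open>open_torus_eq_positive_set\<close>.\<close>

lemma torus_L1_approx:
  fixes M :: "torus measure"
  assumes M: "finite_measure M" "sets M = sets borel" and A: "A \<in> sets borel" and e: "0 < e"
  shows "\<exists>\<psi>. continuous_on UNIV \<psi> \<and> (\<forall>z. 0 \<le> \<psi> z \<and> \<psi> z \<le> (1::real)) \<and> (LINT z|M. \<bar>indicator A z - \<psi> z\<bar>) < e"
proof -
  define F where "F = {\<psi> :: torus \<Rightarrow> real. continuous_on UNIV \<psi> \<and> (\<forall>z. 0 \<le> \<psi> z \<and> \<psi> z \<le> 1)}"
  have sp: "space M = UNIV" using sets_eq_imp_space_eq[OF M(2)] by simp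
  have Fm: "f \<in> borel_measurable M" if "f \<in> F" for f
    using that borel_measurable_continuous_onI[of f] by (simp add: F_def measurable_cong_sets[OF M(2) refl])
  have "\<exists>f\<in>F. (LINT x|M. \<bar>indicator A x - f x\<bar>) < e"
  proof (rule L1_approx[OF M(1), of "{U. open U}"])
    show "sets M = sigma_sets (space M) {U. open U}" by (simp add: M(2) sp sets_borel)
    show "f \<in> borel_measurable M" "0 \<le> f x \<and> f x \<le> 1" if "f \<in> F" for f x
      using Fm[OF that] that by (auto simp: F_def)
    show "(\<lambda>x. 0) \<in> F" by (simp add: F_def)
    show "\<exists>g\<in>F. \<forall>x\<in>space M. g x = 1 - f x" if "f \<in> F" for f
      using that by (intro bexI[of _ "\<lambda>x. 1 - f x"]) (auto simp: F_def intro!: continuous_intros)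
    show "(\<lambda>x. max (f x) (g x)) \<in> F" if "f \<in> F" "g \<in> F" for f g
      using that by (auto simp: F_def le_max_iff_disj intro!: continuous_on_max)
    fix U :: "torus set" and e :: real assume "U \<in> {U. open U}" and e: "e > 0"
    then have U: "open U" by simp
    obtain \<phi> :: "torus \<Rightarrow> real" where \<phi>: "continuous_on UNIV \<phi>" "\<And>z. 0 \<le> \<phi> z" "U = {z. 0 < \<phi> z}"
      using open_torus_eq_positive_set[OF U] by blast
    define g where "g n z = min 1 (real n * \<phi> z)" for n :: nat and z
    have gF: "g n \<in> F" for n
      using \<phi> unfolding F_def g_def[abs_def] by (auto intro!: continuous_intros continuous_on_min)
    have "(\<lambda>n. LINT z|M. \<bar>indicator U z - g n z\<bar>) \<longlonglongrightarrow> (LINT z|M. 0)"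
    proof (rule integral_dominated_convergence[where w="\<lambda>_. 1"])
      show "AE z in M. (\<lambda>n. \<bar>indicator U z - g n z\<bar>) \<longlonglongrightarrow> 0"
      proof (rule AE_I2)
        fix z
        show "(\<lambda>n. \<bar>indicator U z - g n z\<bar>) \<longlonglongrightarrow> 0"
        proof (cases "z \<in> U")
          case True
          then have p: "0 < \<phi> z" using \<phi> by simp
          obtain N :: nat where N: "1 / \<phi> z < real N" using reals_Archimedean2 by blast
          have "\<bar>indicator U z - g n z\<bar> = 0" if "n \<ge> N" for n
          proof -
            have "1 / \<phi> z < real n" using N that by linarith
            then have "1 < real n * \<phi> z" using p by (simp add: divide_less_eq)
            then show ?thesis using True by (simp add: g_def)
          qed
          then have "eventually (\<lambda>n. \<bar>indicator U z - g n z\<bar> = 0) sequentially"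
            unfolding eventually_sequentially by blast
          then show ?thesis by (rule tendsto_eventually)
        next
          case False
          then have "\<phi> z = 0" using \<phi>(2)[of z] \<phi>(3) by auto
          then show ?thesis using False by (simp add: g_def)
        qed
      qed
      show "AE z in M. norm \<bar>indicator U z - g n z\<bar> \<le> 1" for n
        using gF[of n] by (intro AE_I2) (auto simp: F_def indicator_def)
      show "(\<lambda>z. \<bar>indicator U z - g n z\<bar>) \<in> borel_measurable M" for n
        using Fm[OF gF] U by (intro borel_measurable_abs borel_measurable_diff borel_measurable_indicator) (auto simp: M(2))
      show "integrable M (\<lambda>_. 1 :: real)" by (rule finite_measure.integrable_const[OF M(1)])
    qed simp
    then have lim: "(\<lambda>n. LINT z|M. \<bar>indicator U z - g n z\<bar>) \<longlonglongrightarrow> 0" by simp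
    from LIMSEQ_D[OF lim e] obtain n where "norm ((LINT z|M. \<bar>indicator U z - g n z\<bar>) - 0) < e" by blast
    then show "\<exists>f\<in>F. (LINT x|M. \<bar>indicator U x - f x\<bar>) < e" using gF[of n] by (intro bexI[of _ "g n"]) auto
  qed (use A e M in \<open>auto simp: sp\<close>)
  then show ?thesis by (auto simp: F_def)
qed

context ce_curve
begin

text \<open>\<open>K1\<close> bounds \<open>E t + 2\<close>, where the 2 makes the integrands
  \<open>u * ln u + 1\<close> of both velocities nonnegative; \<open>K2\<close> is the dissipation
  bound. Both are free of \<open>V\<close>.\<close>

definition K1 :: real where "K1 = 3 * C + 4 + 2 * T / \<alpha>"
definition K2 :: real where "K2 = 2 * C + 2 + T / \<alpha>"

lemma K1_pos: "0 < K1" and K2_pos: "0 < K2"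
  using \<alpha> T C by (simp_all add: K1_def K2_def add_pos_nonneg)

text \<open>Mollified test functions converge uniformly and \<open>\<sigma> t\<close> has mass 1.
  The weight \<open>h\<close> is 1 for the position and the velocity for the momentum.\<close>

lemma tker_conv_tendsto:
  assumes t: "t \<in> {0..T}" and h: "h \<in> borel_measurable borel" "\<And>q. \<bar>h q\<bar> \<le> 1" and \<psi>: "continuous_on UNIV \<psi>"
  shows "(\<lambda>n. LINT q|\<sigma> t. h q * (LINT z|torus_lebesgue. tker n z (fst q) * \<psi> z)) \<longlonglongrightarrow> (LINT q|\<sigma> t. h q * \<psi> (fst q))"
proof (rule LIMSEQ_I)
  fix e :: real assume e: "e > 0"
  interpret prob_space "\<sigma> t" by (rule prob[OF t])
  obtain B where B: "0 < B" "\<And>z. \<bar>\<psi> z\<bar> \<le> B" using bounded_continuous_torus[OF \<psi>] by blast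
  have i: "integrable (\<sigma> t) (\<lambda>q. h q * g (fst q))" if "continuous_on UNIV g" "\<And>z. \<bar>g z\<bar> \<le> B" for g
  proof (rule int_\<sigma>[OF t, of _ "1 * B"])
    have "(\<lambda>q :: phase. g (fst q)) \<in> borel_measurable borel"
      by (rule phase_measurable[where F="\<lambda>z b. g z"]) (rule borel_measurable_continuous_onI[OF that(1)])
    then show "(\<lambda>q. h q * g (fst q)) \<in> borel_measurable borel" using h(1) by simp
    show "\<bar>h q * g (fst q)\<bar> \<le> 1 * B" for q unfolding abs_mult using h(2) that(2) by (intro mult_mono) auto
  qed
  have e2: "e / 2 > 0" using e by simp
  obtain N where N: "\<And>n w. n \<ge> N \<Longrightarrow> \<bar>(LINT z|torus_lebesgue. tker n z w * \<psi> z) - \<psi> w\<bar> \<le> e / 2"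
    using tker_uniform_approximation[OF \<psi> e2] by blast
  have "norm ((LINT q|\<sigma> t. h q * (LINT z|torus_lebesgue. tker n z (fst q) * \<psi> z)) - (LINT q|\<sigma> t. h q * \<psi> (fst q))) < e" if n: "n \<ge> N" for n
  proof -
    have i1: "integrable (\<sigma> t) (\<lambda>q. h q * (LINT z|torus_lebesgue. tker n z (fst q) * \<psi> z))"
      by (rule i[OF continuous_tker_conv[OF \<psi>] tker_conv_bound[OF \<psi> B(2)]])
    have i2: "integrable (\<sigma> t) (\<lambda>q. h q * \<psi> (fst q))" by (rule i[OF \<psi> B(2)])
    have "(LINT q|\<sigma> t. h q * (LINT z|torus_lebesgue. tker n z (fst q) * \<psi> z)) - (LINT q|\<sigma> t. h q * \<psi> (fst q))
        = (LINT q|\<sigma> t. h q * (LINT z|torus_lebesgue. tker n z (fst q) * \<psi> z) - h q * \<psi> (fst q))"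
      by (rule Bochner_Integration.integral_diff[OF i1 i2, symmetric])
    also have "\<bar>\<dots>\<bar> \<le> (LINT q|\<sigma> t. \<bar>h q * (LINT z|torus_lebesgue. tker n z (fst q) * \<psi> z) - h q * \<psi> (fst q)\<bar>)"
      by (rule integral_abs_bound)
    also have "\<dots> \<le> (LINT q|\<sigma> t. e / 2)"
    proof (rule integral_mono)
      show "integrable (\<sigma> t) (\<lambda>q. \<bar>h q * (LINT z|torus_lebesgue. tker n z (fst q) * \<psi> z) - h q * \<psi> (fst q)\<bar>)"
        by (rule integrable_abs[OF Bochner_Integration.integrable_diff[OF i1 i2]])
      fix q
      have "\<bar>h q\<bar> * \<bar>(LINT z|torus_lebesgue. tker n z (fst q) * \<psi> z) - \<psi> (fst q)\<bar> \<le> 1 * (e / 2)"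
        using h(2) N[OF n] by (intro mult_mono) auto
      then show "\<bar>h q * (LINT z|torus_lebesgue. tker n z (fst q) * \<psi> z) - h q * \<psi> (fst q)\<bar> \<le> e / 2"
        by (simp add: right_diff_distrib[symmetric] abs_mult)
    qed simp
    also have "\<dots> = e / 2" by (simp add: prob_space)
    finally show ?thesis using e by simp
  qed
  then show "\<exists>no. \<forall>n\<ge>no. norm ((LINT q|\<sigma> t. h q * (LINT z|torus_lebesgue. tker n z (fst q) * \<psi> z)) - (LINT q|\<sigma> t. h q * \<psi> (fst q))) < e"
    by blast
qed

end

section \<open>Estimates for mollified test functions\<close>

context ce_reg
begin

text \<open>Superlinear growth gives equi-integrability: where the density is at most
  \<open>M\<close> that bound is used, elsewhere \<open>u \<le> (u * ln u + 1) / ln M\<close>. The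
  factor 2 counts the velocities.\<close>

lemma position_estimate_mollified:
  assumes t: "t \<in> {0..T}" and \<psi>: "continuous_on UNIV \<psi>" "\<And>z. 0 \<le> \<psi> z" "\<And>z. \<psi> z \<le> 1" and M: "1 < M"
  shows "(LINT q|\<sigma> t. (LINT z|torus_lebesgue. tker n z (fst q) * \<psi> z)) \<le> 2 * M * (LINT z|torus_lebesgue. \<psi> z) + K1 / ln M"
proof -
  have b: "\<bar>\<psi> z\<bar> \<le> 1" for z using \<psi> by (simp add: abs_le_iff order_trans[OF _ \<psi>(2)])
  have m\<psi>: "\<psi> \<in> borel_measurable borel" by (rule borel_measurable_continuous_onI[OF \<psi>(1)])
  have lM: "0 < ln M" using M by simp
  have "(LINT q|\<sigma> t. (LINT z|torus_lebesgue. tker n z (fst q) * \<psi> z)) = (\<Sum>b\<in>UNIV. LINT q|\<sigma> t. (if snd q = b then (LINT z|torus_lebesgue. tker n z (fst q) * \<psi> z) else 0))"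
    by (rule if_phase_integrable(3)[OF t, of "\<lambda>b w. LINT z|torus_lebesgue. tker n z w * \<psi> z" 1])
      (auto intro!: borel_measurable_continuous_onI continuous_tker_conv tker_conv_bound \<psi> b)
  also have "\<dots> = (\<Sum>b\<in>UNIV. LINT z|torus_lebesgue. \<psi> z * (f b t z - \<delta>))"
    using dual[OF t m\<psi> b] by simp
  also have "\<dots> \<le> (\<Sum>b\<in>(UNIV :: bool set). LINT z|torus_lebesgue. M * \<psi> z + (f b t z * ln (f b t z) + 1) / ln M)"
  proof (intro sum_mono integral_mono)
    fix b z
    show "integrable torus_lebesgue (\<lambda>z. \<psi> z * (f b t z - \<delta>))"
      "integrable torus_lebesgue (\<lambda>z. M * \<psi> z + (f b t z * ln (f b t z) + 1) / ln M)"
      using lM by (intro torus_integrable_continuous continuous_intros \<psi> continuous_f continuous_ln_f t; simp)+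
    define u where "u = f b t z"
    have u: "0 < u" unfolding u_def by (rule f_pos[OF t])
    have y: "0 \<le> u * ln u + 1" using Young_entropy[of u 0] u by simp
    have "\<psi> z * (u - \<delta>) \<le> \<psi> z * u" using \<psi>(2) \<delta>_pos by (intro mult_left_mono) auto
    also have "\<psi> z * u \<le> M * \<psi> z + (u * ln u + 1) / ln M"
    proof (cases "u \<le> M")
      case True
      then have "\<psi> z * u \<le> \<psi> z * M" using \<psi>(2) by (intro mult_left_mono) auto
      moreover have "0 \<le> (u * ln u + 1) / ln M" using y lM by simp
      ultimately show ?thesis by (simp add: mult.commute)
    next
      case False
      have "\<psi> z * u \<le> 1 * u" using \<psi>(3) u by (intro mult_right_mono) auto
      moreover have "u * ln M \<le> u * ln u" using False u M by (intro mult_left_mono) auto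
      then have "u \<le> (u * ln u + 1) / ln M" using lM by (simp add: le_divide_eq)
      moreover have "0 \<le> M * \<psi> z" using M \<psi>(2) by simp
      ultimately show ?thesis by linarith
    qed
    finally show "\<psi> z * (f b t z - \<delta>) \<le> M * \<psi> z + (f b t z * ln (f b t z) + 1) / ln M" unfolding u_def .
  qed
  also have "\<dots> = (\<Sum>b\<in>(UNIV :: bool set). M * (LINT z|torus_lebesgue. \<psi> z) + ((LINT z|torus_lebesgue. f b t z * ln (f b t z)) + 1) / ln M)"
  proof (intro sum.cong refl)
    fix b
    have i: "integrable torus_lebesgue \<psi>" "integrable torus_lebesgue (\<lambda>z. f b t z * ln (f b t z))"
      by (intro torus_integrable_continuous continuous_intros \<psi> continuous_f continuous_ln_f t)+
    have "(LINT z|torus_lebesgue. M * \<psi> z + (f b t z * ln (f b t z) + 1) / ln M) = (LINT z|torus_lebesgue. M * \<psi> z) + (LINT z|torus_lebesgue. (f b t z * ln (f b t z) + 1) / ln M)"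
      using i by (intro Bochner_Integration.integral_add) auto
    then show "(LINT z|torus_lebesgue. M * \<psi> z + (f b t z * ln (f b t z) + 1) / ln M) = M * (LINT z|torus_lebesgue. \<psi> z) + ((LINT z|torus_lebesgue. f b t z * ln (f b t z)) + 1) / ln M"
      using i by simp
  qed
  also have "\<dots> = 2 * M * (LINT z|torus_lebesgue. \<psi> z) + (E t + 2) / ln M"
    unfolding E_def by (simp add: UNIV_bool add_divide_distrib)
  also have "(E t + 2) / ln M \<le> K1 / ln M"
    using entropy_bound[OF t] lM by (intro divide_right_mono) (auto simp: K1_def)
  finally show ?thesis by simp
qed

text \<open>Factor \<open>A - B\<close> into the difference and the sum of square roots and apply
  Young's inequality with weight \<open>\<theta>\<close>. The free weight later trades dissipation
  against mass.\<close>

lemma momentum_estimate_mollified: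
  assumes t: "t \<in> {0..T}" and \<psi>: "continuous_on UNIV \<psi>" "\<And>z. \<bar>\<psi> z\<bar> \<le> 1" and \<theta>: "0 < \<theta>"
  shows "V * \<bar>LINT q|\<sigma> t. vel (snd q) * (LINT z|torus_lebesgue. tker n z (fst q) * \<psi> z)\<bar>
    \<le> \<theta> * \<alpha> * (k * D t) + (2 * \<delta> * (LINT z|torus_lebesgue. (\<psi> z)\<^sup>2) + (LINT q|\<sigma> t. (LINT z|torus_lebesgue. tker n z (fst q) * (\<psi> z)\<^sup>2))) / \<theta>"
proof -
  have m\<psi>: "\<psi> \<in> borel_measurable borel" by (rule borel_measurable_continuous_onI[OF \<psi>(1)])
  have c2: "continuous_on UNIV (\<lambda>z. (\<psi> z)\<^sup>2)" by (intro continuous_intros \<psi>)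
  have b2: "\<bar>(\<psi> z)\<^sup>2\<bar> \<le> 1" for z using \<psi>(2)[of z] by (simp add: abs_square_le_1)
  define A where "A z = f True t z" for z
  define B where "B z = f False t z" for z
  have pos: "0 < A z" "0 < B z" for z unfolding A_def B_def by (rule f_pos[OF t])+
  have cAB: "continuous_on UNIV A" "continuous_on UNIV B" unfolding A_def[abs_def] B_def[abs_def] by (rule continuous_f)+
  have "(LINT q|\<sigma> t. vel (snd q) * (LINT z|torus_lebesgue. tker n z (fst q) * \<psi> z))
      = (\<Sum>b\<in>UNIV. LINT q|\<sigma> t. (if snd q = b then vel b * (LINT z|torus_lebesgue. tker n z (fst q) * \<psi> z) else 0))"
    by (rule if_phase_integrable(3)[OF t, of "\<lambda>b w. vel b * (LINT z|torus_lebesgue. tker n z w * \<psi> z)" 1])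
      (auto intro!: borel_measurable_continuous_onI continuous_intros continuous_tker_conv tker_conv_bound \<psi> simp: abs_mult vel_def)
  also have "\<dots> = (\<Sum>b\<in>UNIV. LINT q|\<sigma> t. vel b * (if snd q = b then (LINT z|torus_lebesgue. tker n z (fst q) * \<psi> z) else 0))"
    by (intro sum.cong refl Bochner_Integration.integral_cong) auto
  also have "\<dots> = (\<Sum>b\<in>UNIV. vel b * (LINT z|torus_lebesgue. \<psi> z * (f b t z - \<delta>)))"
    using dual[OF t m\<psi> \<psi>(2)] by simp
  also have "\<dots> = (LINT z|torus_lebesgue. \<psi> z * (A z - \<delta>)) - (LINT z|torus_lebesgue. \<psi> z * (B z - \<delta>))"
    by (simp add: UNIV_bool vel_def A_def B_def)
  also have "\<dots> = (LINT z|torus_lebesgue. \<psi> z * (A z - \<delta>) - \<psi> z * (B z - \<delta>))"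
    by (intro Bochner_Integration.integral_diff[symmetric] torus_integrable_continuous continuous_intros \<psi> cAB)
  also have "\<dots> = (LINT z|torus_lebesgue. \<psi> z * (A z - B z))" by (simp add: algebra_simps)
  finally have X: "(LINT q|\<sigma> t. vel (snd q) * (LINT z|torus_lebesgue. tker n z (fst q) * \<psi> z)) = (LINT z|torus_lebesgue. \<psi> z * (A z - B z))" .
  have iD: "integrable torus_lebesgue (\<lambda>z. (sqrt (A z) - sqrt (B z))\<^sup>2)"
    by (intro torus_integrable_continuous continuous_intros cAB)
  have iY: "integrable torus_lebesgue (\<lambda>z. (\<psi> z)\<^sup>2 * (A z + B z))"
    by (intro torus_integrable_continuous continuous_intros cAB \<psi>)
  have "V * \<bar>LINT z|torus_lebesgue. \<psi> z * (A z - B z)\<bar> \<le> V * (LINT z|torus_lebesgue. \<bar>\<psi> z * (A z - B z)\<bar>)"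
    using V by (intro mult_left_mono integral_abs_bound) auto
  also have "\<dots> = (LINT z|torus_lebesgue. V * \<bar>\<psi> z * (A z - B z)\<bar>)" by simp
  also have "\<dots> \<le> (LINT z|torus_lebesgue. \<theta> * \<alpha> * k * (sqrt (A z) - sqrt (B z))\<^sup>2 + (1 / \<theta>) * ((\<psi> z)\<^sup>2 * (A z + B z)))"
  proof (rule integral_mono)
    show "integrable torus_lebesgue (\<lambda>z. V * \<bar>\<psi> z * (A z - B z)\<bar>)"
      by (intro torus_integrable_continuous continuous_intros cAB \<psi>)
    show "integrable torus_lebesgue (\<lambda>z. \<theta> * \<alpha> * k * (sqrt (A z) - sqrt (B z))\<^sup>2 + (1 / \<theta>) * ((\<psi> z)\<^sup>2 * (A z + B z)))"
      by (intro torus_integrable_continuous continuous_intros cAB \<psi>)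
    fix z
    define x y p where "x = sqrt (A z)" and "y = sqrt (B z)" and "p = \<bar>\<psi> z\<bar>"
    have xy: "A z = x\<^sup>2" "B z = y\<^sup>2" "0 < x" "0 < y" using pos[of z] by (simp_all add: x_def y_def)
    have "A z - B z = (x - y) * (x + y)" unfolding xy by (simp add: power2_eq_square algebra_simps)
    then have 1: "\<bar>\<psi> z * (A z - B z)\<bar> = p * (\<bar>x - y\<bar> * (x + y))" using xy by (simp add: abs_mult p_def)
    \<comment> \<open>Completing the square with \<open>V\<close> attached to the difference of the
      roots: half of V squared equals \<open>\<alpha> * k\<close>, the rate that multiplies the
      dissipation.\<close>
    have "0 \<le> (\<theta> * V * \<bar>x - y\<bar> - p * (x + y))\<^sup>2" by simp
    also have "\<dots> = \<theta>\<^sup>2 * V\<^sup>2 * \<bar>x - y\<bar>\<^sup>2 + p\<^sup>2 * (x + y)\<^sup>2 - 2 * \<theta> * (V * (p * (\<bar>x - y\<bar> * (x + y))))"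
      by (simp add: power2_diff power_mult_distrib mult_ac)
    also have "p\<^sup>2 * (x + y)\<^sup>2 \<le> p\<^sup>2 * (2 * (x\<^sup>2 + y\<^sup>2))"
    proof (rule mult_left_mono)
      have "0 \<le> (x - y)\<^sup>2" by simp
      then show "(x + y)\<^sup>2 \<le> 2 * (x\<^sup>2 + y\<^sup>2)" by (simp add: power2_diff power2_sum)
    qed simp
    finally have "2 * \<theta> * (V * (p * (\<bar>x - y\<bar> * (x + y)))) \<le> \<theta>\<^sup>2 * V\<^sup>2 * (x - y)\<^sup>2 + 2 * (p\<^sup>2 * (x\<^sup>2 + y\<^sup>2))"
      by (simp add: algebra_simps)
    then have "V * (p * (\<bar>x - y\<bar> * (x + y))) \<le> (\<theta>\<^sup>2 * V\<^sup>2 * (x - y)\<^sup>2 + 2 * (p\<^sup>2 * (x\<^sup>2 + y\<^sup>2))) / (2 * \<theta>)"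
      using \<theta> by (simp add: le_divide_eq mult_ac)
    also have "\<dots> = \<theta> * (V\<^sup>2 / 2) * (x - y)\<^sup>2 + (1 / \<theta>) * (p\<^sup>2 * (x\<^sup>2 + y\<^sup>2))"
      using \<theta> by (simp add: field_simps power2_eq_square)
    also have "V\<^sup>2 / 2 = \<alpha> * k" using \<alpha> by (simp add: k_def)
    finally have F: "V * (p * (\<bar>x - y\<bar> * (x + y))) \<le> \<theta> * (\<alpha> * k) * (x - y)\<^sup>2 + (1 / \<theta>) * (p\<^sup>2 * (x\<^sup>2 + y\<^sup>2))" .
    have G: "\<theta> * \<alpha> * k * (sqrt (A z) - sqrt (B z))\<^sup>2 = \<theta> * (\<alpha> * k) * (x - y)\<^sup>2" by (simp add: x_def y_def mult.assoc)
    have e: "(\<psi> z)\<^sup>2 * (A z + B z) = p\<^sup>2 * (x\<^sup>2 + y\<^sup>2)" unfolding xy by (simp add: p_def)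
    show "V * \<bar>\<psi> z * (A z - B z)\<bar> \<le> \<theta> * \<alpha> * k * (sqrt (A z) - sqrt (B z))\<^sup>2 + (1 / \<theta>) * ((\<psi> z)\<^sup>2 * (A z + B z))"
      unfolding 1 G e by (rule F)
  qed
  also have "\<dots> = \<theta> * \<alpha> * k * (LINT z|torus_lebesgue. (sqrt (A z) - sqrt (B z))\<^sup>2) + (1 / \<theta>) * (LINT z|torus_lebesgue. (\<psi> z)\<^sup>2 * (A z + B z))"
    using iD iY by simp
  also have "(LINT z|torus_lebesgue. (sqrt (A z) - sqrt (B z))\<^sup>2) = D t" by (simp add: D_def A_def B_def)
  also have "(LINT z|torus_lebesgue. (\<psi> z)\<^sup>2 * (A z + B z)) = 2 * \<delta> * (LINT z|torus_lebesgue. (\<psi> z)\<^sup>2) + (LINT q|\<sigma> t. (LINT z|torus_lebesgue. tker n z (fst q) * (\<psi> z)\<^sup>2))"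
  proof -
    have i2: "integrable torus_lebesgue (\<lambda>z. (\<psi> z)\<^sup>2)" "integrable torus_lebesgue (\<lambda>z. (\<psi> z)\<^sup>2 * (f b t z - \<delta>))" for b
      by (intro torus_integrable_continuous continuous_intros c2 continuous_f)+
    have "(LINT z|torus_lebesgue. (\<psi> z)\<^sup>2 * (A z + B z)) = (LINT z|torus_lebesgue. 2 * \<delta> * (\<psi> z)\<^sup>2 + ((\<psi> z)\<^sup>2 * (f True t z - \<delta>) + (\<psi> z)\<^sup>2 * (f False t z - \<delta>)))"
      by (intro Bochner_Integration.integral_cong) (simp_all add: A_def B_def algebra_simps)
    also have "\<dots> = 2 * \<delta> * (LINT z|torus_lebesgue. (\<psi> z)\<^sup>2) + (\<Sum>b\<in>UNIV. LINT z|torus_lebesgue. (\<psi> z)\<^sup>2 * (f b t z - \<delta>))"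
      using i2 by (simp add: UNIV_bool)
    also have "(\<Sum>b\<in>UNIV. LINT z|torus_lebesgue. (\<psi> z)\<^sup>2 * (f b t z - \<delta>)) = (\<Sum>b\<in>UNIV. LINT q|\<sigma> t. (if snd q = b then (LINT z|torus_lebesgue. tker n z (fst q) * (\<psi> z)\<^sup>2) else 0))"
      using dual[OF t borel_measurable_continuous_onI[OF c2] b2] by simp
    also have "\<dots> = (LINT q|\<sigma> t. (LINT z|torus_lebesgue. tker n z (fst q) * (\<psi> z)\<^sup>2))"
      by (rule if_phase_integrable(3)[OF t, of "\<lambda>b w. LINT z|torus_lebesgue. tker n z w * (\<psi> z)\<^sup>2" 1, symmetric])
        (auto intro!: borel_measurable_continuous_onI continuous_tker_conv tker_conv_bound c2 b2)
    finally show ?thesis .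
  qed
  finally show ?thesis unfolding X by (simp add: mult.assoc)
qed

end

lemma phase_slice_sets: "B \<in> sets borel \<Longrightarrow> B \<times> {b} \<in> sets (borel :: phase measure)"
proof -
  assume B: "B \<in> sets borel"
  have "{b} \<in> sets borel" by (rule borel_open) (rule discrete_topology_class.open_discrete)
  then have "B \<times> {b} \<in> sets (borel \<Otimes>\<^sub>M borel)" using B by (rule pair_measureI[rotated])
  then show ?thesis unfolding borel_prod .
qed

lemma vector_measure_slice:
  assumes vm: "vector_measure (borel :: phase measure) \<mu>"
  shows "vector_measure borel (\<lambda>B. \<mu> (B \<times> {b}))"
  unfolding vector_measure_def
proof (intro conjI allI impI)
  show "\<mu> ({} \<times> {b}) = 0" using vector_measure_empty[OF vm] by simp
next
  fix A :: "nat \<Rightarrow> torus set" assume A: "range A \<subseteq> sets borel" "disjoint_family A"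
  have "(\<lambda>i. \<mu> (A i \<times> {b})) sums \<mu> (\<Union>i. A i \<times> {b})"
  proof (rule vector_measure_sums[OF vm])
    show "range (\<lambda>i. A i \<times> {b}) \<subseteq> sets borel" using A(1) by (auto intro: phase_slice_sets)
    show "disjoint_family (\<lambda>i. A i \<times> {b})" using A(2) unfolding disjoint_family_on_def by blast
  qed
  moreover have "(\<Union>i. A i \<times> {b}) = (\<Union>i. A i) \<times> {b}" by auto
  ultimately show "(\<lambda>i. \<mu> (A i \<times> {b})) sums \<mu> ((\<Union>i. A i) \<times> {b})" by simp
qed

text \<open>For negative \<open>u = - x\<close> this is the chain
  \<open>exp (- x) \<le> 1 / (1 + x) \<le> 1 - x + x^2\<close>, the last step because the product of
  the outer factors is \<open>1 + x^3\<close>.\<close>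

lemma exp_quadratic_bound:
  fixes u :: real
  assumes "\<bar>u\<bar> \<le> 1"
  shows "exp u - 1 \<le> u + u\<^sup>2"
proof (cases "0 \<le> u")
  case True
  then show ?thesis using exp_bound[of u] assms by simp
next
  case False
  define x where "x = - u"
  have x: "0 < x" "x \<le> 1" using False assms by (auto simp: x_def)
  have "1 \<le> (1 - x + x\<^sup>2) * (1 + x)"
  proof -
    have "(1 - x + x\<^sup>2) * (1 + x) = 1 + x ^ 3" by (simp add: power2_eq_square power3_eq_cube algebra_simps)
    then show ?thesis using x by simp
  qed
  also have "\<dots> \<le> (1 - x + x\<^sup>2) * exp x"
    using x by (intro mult_left_mono exp_ge_add_one_self) (auto intro: add_nonneg_nonneg)
  finally have "exp (- x) \<le> 1 - x + x\<^sup>2" by (simp add: exp_minus inverse_eq_divide divide_le_eq)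
  then show ?thesis by (simp add: x_def)
qed

section \<open>Passing to the limit in the mollification\<close>

context ce_curve
begin

lemma reg: "ce_reg \<alpha> T V C \<sigma> j" by unfold_locales

abbreviation \<rho> :: "real \<Rightarrow> torus measure" where "\<rho> t \<equiv> position_marginal (\<sigma> t)"

lemma fst_measurable: "t \<in> {0..T} \<Longrightarrow> fst \<in> measurable (\<sigma> t) borel"
proof -
  assume t: "t \<in> {0..T}"
  have "(fst :: phase \<Rightarrow> torus) \<in> borel_measurable borel"
    by (rule borel_measurable_continuous_onI) (rule continuous_on_fst[OF continuous_on_id])
  then show ?thesis by (simp add: measurable_cong_sets[OF sets_\<sigma>[OF t] refl])
qed

lemma prob_\<rho>: "t \<in> {0..T} \<Longrightarrow> prob_space (\<rho> t)"
  unfolding position_marginal_def by (rule prob_space.prob_space_distr[OF prob fst_measurable])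

lemma sets_\<rho> [simp]: "sets (\<rho> t) = sets borel" and space_\<rho> [simp]: "space (\<rho> t) = UNIV"
  by (simp_all add: position_marginal_def)

lemma integral_\<rho>:
  fixes g :: "torus \<Rightarrow> real"
  shows "t \<in> {0..T} \<Longrightarrow> g \<in> borel_measurable borel \<Longrightarrow> (LINT z|\<rho> t. g z) = (LINT q|\<sigma> t. g (fst q))"
  unfolding position_marginal_def by (rule integral_distr[OF fst_measurable])

lemma measure_\<rho>: "t \<in> {0..T} \<Longrightarrow> B \<in> sets borel \<Longrightarrow> measure (\<rho> t) B = measure (\<sigma> t) (B \<times> UNIV)"
proof -
  assume t: "t \<in> {0..T}" and B: "B \<in> sets borel"
  have "measure (\<rho> t) B = measure (\<sigma> t) (fst -` B \<inter> space (\<sigma> t))"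
    unfolding position_marginal_def by (rule measure_distr[OF fst_measurable[OF t] B])
  also have "fst -` B \<inter> space (\<sigma> t) = B \<times> UNIV" by (auto simp: space_\<sigma>[OF t])
  finally show ?thesis .
qed

lemma integrable_fst_continuous:
  assumes t: "t \<in> {0..T}" and g: "g \<in> borel_measurable borel" "\<And>z. \<bar>g z :: real\<bar> \<le> B"
  shows "integrable (\<sigma> t) (\<lambda>q. g (fst q))" "integrable (\<sigma> t) (\<lambda>q. vel (snd q) * g (fst q))"
  using ce_reg.if_phase_integrable(2)[OF reg t, of "\<lambda>b. g" B] g
    ce_reg.if_phase_integrable(2)[OF reg t, of "\<lambda>b z. vel b * g z" B] by (auto simp: abs_mult vel_def)

lemma position_estimate:
  assumes t: "t \<in> {0..T}" and \<psi>: "continuous_on UNIV \<psi>" "\<And>z. 0 \<le> \<psi> z" "\<And>z. \<psi> z \<le> 1" and M: "1 < M"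
  shows "(LINT z|\<rho> t. \<psi> z) \<le> 2 * M * (LINT z|torus_lebesgue. \<psi> z) + K1 / ln M"
proof -
  have "(\<lambda>n. LINT q|\<sigma> t. 1 * (LINT z|torus_lebesgue. tker n z (fst q) * \<psi> z)) \<longlonglongrightarrow> (LINT q|\<sigma> t. 1 * \<psi> (fst q))"
    by (rule tker_conv_tendsto[OF t _ _ \<psi>(1)]) auto
  then have "(\<lambda>n. LINT q|\<sigma> t. (LINT z|torus_lebesgue. tker n z (fst q) * \<psi> z)) \<longlonglongrightarrow> (LINT q|\<sigma> t. \<psi> (fst q))" by simp
  then have "(LINT q|\<sigma> t. \<psi> (fst q)) \<le> 2 * M * (LINT z|torus_lebesgue. \<psi> z) + K1 / ln M"
    by (rule LIMSEQ_le_const2) (use ce_reg.position_estimate_mollified[OF reg t \<psi> M] in blast)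
  then show ?thesis using integral_\<rho>[OF t borel_measurable_continuous_onI[OF \<psi>(1)]] by simp
qed

text \<open>The curve and the reference measure occur in the same estimate, so a single
  \<open>\<psi>\<close> must be close to the indicator for both; it is found in L1 of their
  sum.\<close>

lemma approximation_both:
  assumes t: "t \<in> {0..T}" and A: "A \<in> sets borel" and e: "0 < e"
  obtains \<psi> where "continuous_on UNIV \<psi>" "\<And>z. 0 \<le> \<psi> z" "\<And>z. \<psi> z \<le> (1::real)"
    "(LINT z|\<rho> t. \<bar>indicator A z - \<psi> z\<bar>) < e" "(LINT z|torus_lebesgue. \<bar>indicator A z - \<psi> z\<bar>) < e"
proof -
  obtain Q where Q: "finite_measure Q" "sets Q = sets borel"
    "\<And>f B. f \<in> borel_measurable borel \<Longrightarrow> (\<And>x. \<bar>f x :: real\<bar> \<le> B) \<Longrightarrow> (LINT x|Q. f x) = (LINT x|\<rho> t. f x) + (LINT x|torus_lebesgue. f x)"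
  proof (rule integral_Un_finite_measures[OF prob_space.finite_measure[OF prob_\<rho>[OF t]] sets_\<rho> torus.finite_measure_axioms sets_torus_lebesgue])
    fix Q :: "torus measure"
    assume Q: "finite_measure Q" "sets Q = sets borel"
      and int: "\<And>f B. f \<in> borel_measurable borel \<Longrightarrow> (\<And>x. \<bar>f x :: real\<bar> \<le> B) \<Longrightarrow> (LINT x|Q. f x) = (LINT x|\<rho> t. f x) + (LINT x|torus_lebesgue. f x)"
    show thesis by (rule that[OF Q int])
  qed
  obtain \<psi> where \<psi>: "continuous_on UNIV \<psi>" "\<And>z. 0 \<le> \<psi> z \<and> \<psi> z \<le> (1::real)" "(LINT z|Q. \<bar>indicator A z - \<psi> z\<bar>) < e"
    using torus_L1_approx[OF Q(1,2) A e] by blast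
  have m: "(\<lambda>z. \<bar>indicator A z - \<psi> z\<bar>) \<in> borel_measurable borel"
    using A borel_measurable_continuous_onI[OF \<psi>(1)] by simp
  have b: "\<bar>\<bar>indicator A z - \<psi> z\<bar>\<bar> \<le> 1" for z using \<psi>(2)[of z] by (auto simp: indicator_def)
  have "0 \<le> (LINT z|\<rho> t. \<bar>indicator A z - \<psi> z\<bar>)" "0 \<le> (LINT z|torus_lebesgue. \<bar>indicator A z - \<psi> z\<bar>)"
    by (intro Bochner_Integration.integral_nonneg; simp)+
  then have "(LINT z|\<rho> t. \<bar>indicator A z - \<psi> z\<bar>) < e" "(LINT z|torus_lebesgue. \<bar>indicator A z - \<psi> z\<bar>) < e"
    using \<psi>(3) unfolding Q(3)[OF m b] by linarith+
  then show ?thesis using \<psi>(1,2) by (intro that[of \<psi>]) auto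
qed

lemma L1_close:
  fixes A :: "torus set"
  assumes Q: "finite_measure Q" "sets Q = sets borel" and A: "A \<in> sets borel"
    and \<psi>: "continuous_on UNIV \<psi>" "\<And>z. 0 \<le> \<psi> z" "\<And>z. \<psi> z \<le> (1::real)"
    and e: "(LINT z|Q. \<bar>indicator A z - \<psi> z\<bar>) < e"
  shows "(LINT z|Q. \<psi> z) \<le> measure Q A + e" "measure Q A \<le> (LINT z|Q. \<psi> z) + e" "(LINT z|Q. (\<psi> z)\<^sup>2) \<le> measure Q A + e"
proof -
  have sp: "space Q = UNIV" using sets_eq_imp_space_eq[OF Q(2)] by simp
  have m\<psi>: "\<psi> \<in> borel_measurable Q" using borel_measurable_continuous_onI[OF \<psi>(1)] by (simp add: measurable_cong_sets[OF Q(2) refl])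
  have AQ: "A \<in> sets Q" using A Q by simp
  have i\<psi>: "integrable Q \<psi>" using \<psi> m\<psi> by (intro integrable_bounded[OF Q(1), of _ 1]) (auto simp: abs_le_iff order_trans[OF _ \<psi>(2)])
  have iA: "integrable Q (indicator A :: torus \<Rightarrow> real)"
    using AQ by (intro integrable_bounded[OF Q(1), of _ 1]) (auto simp: indicator_def)
  have i2: "integrable Q (\<lambda>z. (\<psi> z)\<^sup>2)"
    using \<psi> m\<psi> by (intro integrable_bounded[OF Q(1), of _ 1]) (auto simp: power_le_one)
  have id: "integrable Q (\<lambda>z. \<bar>indicator A z - \<psi> z\<bar>)" using iA i\<psi> by simp
  have mA: "(LINT z|Q. indicator A z) = measure Q A" using AQ by (simp add: sp)
  have "(LINT z|Q. \<psi> z) \<le> (LINT z|Q. indicator A z + \<bar>indicator A z - \<psi> z\<bar>)"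
    using iA id i\<psi> by (intro integral_mono) auto
  also have "\<dots> = measure Q A + (LINT z|Q. \<bar>indicator A z - \<psi> z\<bar>)" using iA id by (simp add: sp)
  finally show 1: "(LINT z|Q. \<psi> z) \<le> measure Q A + e" using e by linarith
  have "(LINT z|Q. indicator A z) \<le> (LINT z|Q. \<psi> z + \<bar>indicator A z - \<psi> z\<bar>)"
    using iA id i\<psi> by (intro integral_mono) auto
  also have "\<dots> = (LINT z|Q. \<psi> z) + (LINT z|Q. \<bar>indicator A z - \<psi> z\<bar>)" using i\<psi> id by simp
  finally show "measure Q A \<le> (LINT z|Q. \<psi> z) + e" using e unfolding mA by linarith
  have "(LINT z|Q. (\<psi> z)\<^sup>2) \<le> (LINT z|Q. \<psi> z)"
    using i2 i\<psi> \<psi> by (intro integral_mono) (auto simp: power2_eq_square mult_left_le)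
  then show "(LINT z|Q. (\<psi> z)\<^sup>2) \<le> measure Q A + e" using 1 by linarith
qed

lemma position_set_estimate:
  assumes t: "t \<in> {0..T}" and A: "A \<in> sets borel" and M: "1 < M"
  shows "measure (\<rho> t) A \<le> 2 * M * measure torus_lebesgue A + K1 / ln M"
proof (rule field_le_epsilon)
  fix e :: real assume e: "0 < e"
  \<comment> \<open>The approximation error enters with total weight
    \<open>1 + 2 * M\<close>.\<close>
  define e' where "e' = e / (1 + 2 * M)"
  have e': "0 < e'" using e M by (simp add: e'_def)
  obtain \<psi> where \<psi>: "continuous_on UNIV \<psi>" "\<And>z. 0 \<le> \<psi> z" "\<And>z. \<psi> z \<le> (1::real)"
    "(LINT z|\<rho> t. \<bar>indicator A z - \<psi> z\<bar>) < e'" "(LINT z|torus_lebesgue. \<bar>indicator A z - \<psi> z\<bar>) < e'"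
    by (rule approximation_both[OF t A e']) (rule that)
  have "measure (\<rho> t) A \<le> (LINT z|\<rho> t. \<psi> z) + e'"
    by (rule L1_close(2)[OF prob_space.finite_measure[OF prob_\<rho>[OF t]] sets_\<rho> A \<psi>(1-4)])
  also have "(LINT z|\<rho> t. \<psi> z) \<le> 2 * M * (LINT z|torus_lebesgue. \<psi> z) + K1 / ln M"
    by (rule position_estimate[OF t \<psi>(1-3) M])
  also have "2 * M * (LINT z|torus_lebesgue. \<psi> z) \<le> 2 * M * (measure torus_lebesgue A + e')"
    using M by (intro mult_left_mono L1_close(1)[OF torus.finite_measure_axioms sets_torus_lebesgue A \<psi>(1-3,5)]) auto
  also have "2 * M * (measure torus_lebesgue A + e') + K1 / ln M + e' = 2 * M * measure torus_lebesgue A + K1 / ln M + (1 + 2 * M) * e'"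
    by (simp add: algebra_simps)
  also have "(1 + 2 * M) * e' = e" using M by (simp add: e'_def)
  finally show "measure (\<rho> t) A \<le> 2 * M * measure torus_lebesgue A + K1 / ln M + e" by simp
qed

lemma momentum_eq:
  assumes t: "t \<in> {0..T}" and A: "A \<in> sets borel"
  shows "momentum V (\<sigma> t) A = V * (LINT q|\<sigma> t. vel (snd q) * indicator A (fst q))"
proof -
  have "(LINT q|\<sigma> t. vel (snd q) * indicator A (fst q)) = (\<Sum>b\<in>UNIV. LINT q|\<sigma> t. (if snd q = b then vel b * indicator A (fst q) else 0))"
    by (rule ce_reg.if_phase_integrable(3)[OF reg t, of "\<lambda>b z. vel b * indicator A z" 1]) (use A in \<open>auto simp: vel_def indicator_def\<close>)
  also have "\<dots> = (\<Sum>b\<in>UNIV. LINT q|\<sigma> t. vel b * indicator (A \<times> {b}) q)"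
    by (intro sum.cong refl Bochner_Integration.integral_cong) (auto simp: indicator_def split: prod.splits)
  also have "\<dots> = (\<Sum>b\<in>UNIV. vel b * measure (\<sigma> t) (A \<times> {b}))"
    by (simp add: space_\<sigma>[OF t])
  finally show ?thesis by (simp add: momentum_def)
qed

text \<open>The dissipation rate \<open>d\<close> is a limit inferior, as the mollification is removed, of the rates
  \<open>k D\<close>; it does not depend on the test function.\<close>

lemma momentum_estimate:
  obtains d :: "real \<Rightarrow> real" where "\<And>t. 0 \<le> d t" "integrable lborel d" "(LINT t|lborel. d t) \<le> K2"
    "AE t in lborel. t \<in> {0<..<T} \<longrightarrow> (\<forall>\<psi> \<theta>. continuous_on UNIV \<psi> \<longrightarrow> (\<forall>z. \<bar>\<psi> z\<bar> \<le> 1) \<longrightarrow> 0 < \<theta> \<longrightarrow>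
      V * \<bar>LINT q|\<sigma> t. vel (snd q) * \<psi> (fst q)\<bar>
        \<le> \<theta> * \<alpha> * d t + (2 * \<delta> * (LINT z|torus_lebesgue. (\<psi> z)\<^sup>2) + (LINT z|\<rho> t. (\<psi> z)\<^sup>2)) / \<theta>)"
proof -
  define Dn where "Dn n = ce_reg.D V \<sigma> n" for n
  define En where "En n t = ennreal (indicator {0<..<T} t * (k * Dn n t))" for n t
  define Di where "Di t = liminf (\<lambda>n. En n t)" for t
  have Dn0: "0 \<le> Dn n t" for n t unfolding Dn_def by (rule ce_reg.D_nonneg[OF reg])
  have Dint: "integrable lborel (\<lambda>t. indicator {0<..<T} t * (k * Dn n t))" for n
  proof -
    have "set_integrable lborel {0<..<T} (Dn n)"
      unfolding Dn_def by (rule ce_reg.D_integrable[OF reg]) (use T in auto)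
    then have "integrable lborel (\<lambda>t. k * (indicator {0<..<T} t * Dn n t))" by (simp add: set_integrable_def)
    then show ?thesis by (simp add: mult_ac)
  qed
  have Em [measurable]: "En n \<in> borel_measurable borel" for n
    using borel_measurable_integrable[OF Dint[of n]] unfolding En_def[abs_def] by simp
  have Enint: "(\<integral>\<^sup>+t. En n t \<partial>lborel) \<le> ennreal K2" for n
  proof -
    have "(\<integral>\<^sup>+t. En n t \<partial>lborel) = ennreal (LINT t|lborel. indicator {0<..<T} t * (k * Dn n t))"
      unfolding En_def using Dn0 k_pos by (intro nn_integral_eq_integral Dint) auto
    also have "(LINT t|lborel. indicator {0<..<T} t * (k * Dn n t)) = k * (LINT t:{0<..<T}|lborel. Dn n t)"
      by (simp add: set_lebesgue_integral_def mult.left_commute)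
    also have "ennreal \<dots> \<le> ennreal K2"
      unfolding Dn_def K2_def by (intro ennreal_leI ce_reg.dissipation_bound[OF reg])
    finally show ?thesis .
  qed
  have Dim [measurable]: "Di \<in> borel_measurable borel" unfolding Di_def[abs_def] by measurable
  have Diint: "(\<integral>\<^sup>+t. Di t \<partial>lborel) \<le> ennreal K2"
  proof -
    have "(\<integral>\<^sup>+t. Di t \<partial>lborel) \<le> liminf (\<lambda>n. \<integral>\<^sup>+t. En n t \<partial>lborel)"
      unfolding Di_def by (rule nn_integral_liminf) simp
    also have "\<dots> \<le> limsup (\<lambda>n. \<integral>\<^sup>+t. En n t \<partial>lborel)" by (rule Liminf_le_Limsup) simp
    also have "\<dots> \<le> ennreal K2" by (rule Limsup_bounded) (simp add: Enint)
    finally show ?thesis .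
  qed
  \<comment> \<open>Where \<open>Di\<close> is infinite, a null set, \<open>d\<close> takes the
    value 0; elsewhere it is the true limit inferior, whose integral is bounded by \<open>K2\<close>
    through Fatou's lemma.\<close>
  define d where "d t = enn2real (Di t)" for t
  have AEfin: "AE t in lborel. Di t \<noteq> \<infinity>"
    by (rule nn_integral_PInf_AE) (use Diint in \<open>auto simp: top_unique\<close>)
  have dle: "ennreal (d t) \<le> Di t" for t by (cases "Di t") (simp_all add: d_def)
  have dnn: "(\<integral>\<^sup>+t. ennreal (d t) \<partial>lborel) \<le> ennreal K2"
    by (rule order_trans[OF nn_integral_mono Diint]) (rule dle)
  have dm: "d \<in> borel_measurable lborel" unfolding d_def[abs_def] by measurable
  have dint: "integrable lborel d"
  proof (rule integrableI_nonneg)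
    show "(\<integral>\<^sup>+t. ennreal (d t) \<partial>lborel) < \<infinity>" by (rule le_less_trans[OF dnn]) simp
    show "AE t in lborel. 0 \<le> d t" by (simp add: d_def)
  qed (rule dm)
  show ?thesis
  proof (rule that[of d])
    show "0 \<le> d t" for t by (simp add: d_def)
    show "integrable lborel d" by (rule dint)
    have "ennreal (LINT t|lborel. d t) = (\<integral>\<^sup>+t. ennreal (d t) \<partial>lborel)"
      by (rule nn_integral_eq_integral[OF dint, symmetric]) (simp add: d_def)
    then show "(LINT t|lborel. d t) \<le> K2" using dnn K2_pos by (metis ennreal_le_iff less_imp_le)
    show "AE t in lborel. t \<in> {0<..<T} \<longrightarrow> (\<forall>\<psi> \<theta>. continuous_on UNIV \<psi> \<longrightarrow> (\<forall>z. \<bar>\<psi> z\<bar> \<le> 1) \<longrightarrow> 0 < \<theta> \<longrightarrow>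
      V * \<bar>LINT q|\<sigma> t. vel (snd q) * \<psi> (fst q)\<bar>
        \<le> \<theta> * \<alpha> * d t + (2 * \<delta> * (LINT z|torus_lebesgue. (\<psi> z)\<^sup>2) + (LINT z|\<rho> t. (\<psi> z)\<^sup>2)) / \<theta>)"
      using AEfin
    proof eventually_elim
      case (elim t)
      show ?case
      proof (intro impI allI)
        fix \<psi> :: "torus \<Rightarrow> real" and \<theta> :: real
        assume t: "t \<in> {0<..<T}" and c: "continuous_on UNIV \<psi>" and b: "\<forall>z. \<bar>\<psi> z\<bar> \<le> 1" and \<theta>: "0 < \<theta>"
        have t': "t \<in> {0..T}" using t by simp
        have c2: "continuous_on UNIV (\<lambda>z. (\<psi> z)\<^sup>2)" by (intro continuous_intros c)
        define Xn where "Xn n = V * \<bar>LINT q|\<sigma> t. vel (snd q) * (LINT z|torus_lebesgue. tker n z (fst q) * \<psi> z)\<bar>" for n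
        define X where "X = V * \<bar>LINT q|\<sigma> t. vel (snd q) * \<psi> (fst q)\<bar>"
        define Bn where "Bn n = (2 * \<delta> * (LINT z|torus_lebesgue. (\<psi> z)\<^sup>2) + (LINT q|\<sigma> t. (LINT z|torus_lebesgue. tker n z (fst q) * (\<psi> z)\<^sup>2))) / \<theta>" for n
        define B where "B = (2 * \<delta> * (LINT z|torus_lebesgue. (\<psi> z)\<^sup>2) + (LINT z|\<rho> t. (\<psi> z)\<^sup>2)) / \<theta>"
        have vm: "(\<lambda>q :: phase. vel (snd q)) \<in> borel_measurable borel"
          by (rule phase_measurable[where F="\<lambda>z b. vel b"]) simp
        have lX: "Xn \<longlonglongrightarrow> X"
          unfolding Xn_def X_def by (intro tendsto_intros tker_conv_tendsto[OF t' vm _ c]) (simp add: vel_def)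
        have "(\<lambda>n. LINT q|\<sigma> t. 1 * (LINT z|torus_lebesgue. tker n z (fst q) * (\<psi> z)\<^sup>2)) \<longlonglongrightarrow> (LINT q|\<sigma> t. 1 * (\<psi> (fst q))\<^sup>2)"
          by (rule tker_conv_tendsto[OF t' _ _ c2]) auto
        then have "(\<lambda>n. LINT q|\<sigma> t. (LINT z|torus_lebesgue. tker n z (fst q) * (\<psi> z)\<^sup>2)) \<longlonglongrightarrow> (LINT z|\<rho> t. (\<psi> z)\<^sup>2)"
          unfolding integral_\<rho>[OF t' borel_measurable_continuous_onI[OF c2]] by simp
        then have lB: "Bn \<longlonglongrightarrow> B"
          unfolding Bn_def B_def using \<theta> by (intro tendsto_divide tendsto_add tendsto_const) auto
        have est: "Xn n \<le> \<theta> * \<alpha> * (k * Dn n t) + Bn n" for n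
          unfolding Xn_def Bn_def Dn_def by (rule ce_reg.momentum_estimate_mollified[OF reg t' c _ \<theta>]) (use b in blast)
        have "X - B \<le> \<theta> * \<alpha> * d t"
        \<comment> \<open>\<open>Xn\<close> and \<open>Bn\<close> converge, so up to
          \<open>e\<close> the lower bound on \<open>En n t\<close> eventually holds with a
          constant, and constants pass to the limit inferior.\<close>
        proof (rule field_le_epsilon)
          fix e :: real assume e: "0 < e"
          have "(\<lambda>n. Xn n - Bn n) \<longlonglongrightarrow> X - B" by (intro tendsto_diff lX lB)
          from order_tendstoD(1)[OF this, of "X - B - e"] have ev: "eventually (\<lambda>n. X - B - e < Xn n - Bn n) sequentially"
            using e by simp
          have \<theta>\<alpha>: "0 < \<theta> * \<alpha>" using \<theta> \<alpha> by simp
          have "eventually (\<lambda>n. ennreal ((X - B - e) / (\<theta> * \<alpha>)) \<le> En n t) sequentially"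
            using ev
          proof eventually_elim
            case (elim n)
            then have "X - B - e \<le> (\<theta> * \<alpha>) * (k * Dn n t)" using est[of n] by linarith
            then have "(X - B - e) / (\<theta> * \<alpha>) \<le> k * Dn n t" using \<theta>\<alpha> by (simp add: divide_le_eq mult.commute)
            then show ?case using t by (simp add: En_def ennreal_leI)
          qed
          then have "ennreal ((X - B - e) / (\<theta> * \<alpha>)) \<le> Di t" unfolding Di_def by (rule Liminf_bounded)
          also have "Di t = ennreal (d t)" using elim by (simp add: d_def ennreal_enn2real_if)
          finally have "(X - B - e) / (\<theta> * \<alpha>) \<le> d t" by (simp add: d_def ennreal_le_iff)
          then show "X - B \<le> \<theta> * \<alpha> * d t + e" using \<theta>\<alpha> by (simp add: divide_le_eq mult_ac)
        qed
        then show "V * \<bar>LINT q|\<sigma> t. vel (snd q) * \<psi> (fst q)\<bar>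
          \<le> \<theta> * \<alpha> * d t + (2 * \<delta> * (LINT z|torus_lebesgue. (\<psi> z)\<^sup>2) + (LINT z|\<rho> t. (\<psi> z)\<^sup>2)) / \<theta>"
          unfolding X_def B_def by simp
      qed
    qed
  qed
qed

text \<open>Works at one fixed time with an estimate valid for all continuous \<open>\<psi>\<close>,
  so that \<open>A\<close> may later be a section depending on the time without collecting
  uncountably many null sets.\<close>

lemma momentum_set_estimate:
  assumes t: "t \<in> {0..T}" and A: "A \<in> sets borel" and \<theta>: "0 < \<theta>"
    and est: "\<And>\<psi>. continuous_on UNIV \<psi> \<Longrightarrow> (\<And>z. \<bar>\<psi> z\<bar> \<le> 1) \<Longrightarrow>
      V * \<bar>LINT q|\<sigma> t. vel (snd q) * \<psi> (fst q)\<bar>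
        \<le> \<theta> * \<alpha> * d + (2 * \<delta> * (LINT z|torus_lebesgue. (\<psi> z)\<^sup>2) + (LINT z|\<rho> t. (\<psi> z)\<^sup>2)) / \<theta>"
  shows "\<bar>momentum V (\<sigma> t) A\<bar> \<le> \<theta> * \<alpha> * d + (2 * \<delta> * measure torus_lebesgue A + measure (\<rho> t) A) / \<theta>"
proof (rule field_le_epsilon)
  fix e :: real assume e: "0 < e"
  \<comment> \<open>The total weight with which the approximation error enters.\<close>
  define c where "c = V + (2 * \<delta> + 1) / \<theta>"
  have c: "0 < c" unfolding c_def using V \<theta> \<delta>_pos by (intro add_pos_nonneg) auto
  define e' where "e' = e / c"
  have e': "0 < e'" using e c by (simp add: e'_def)
  obtain \<psi> where \<psi>: "continuous_on UNIV \<psi>" "\<And>z. 0 \<le> \<psi> z" "\<And>z. \<psi> z \<le> (1::real)"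
    "(LINT z|\<rho> t. \<bar>indicator A z - \<psi> z\<bar>) < e'" "(LINT z|torus_lebesgue. \<bar>indicator A z - \<psi> z\<bar>) < e'"
    by (rule approximation_both[OF t A e']) (rule that)
  have b: "\<bar>\<psi> z\<bar> \<le> 1" for z using \<psi>(2)[of z] \<psi>(3)[of z] by simp
  have m\<psi>: "\<psi> \<in> borel_measurable borel" by (rule borel_measurable_continuous_onI[OF \<psi>(1)])
  have mA: "(indicator A :: torus \<Rightarrow> real) \<in> borel_measurable borel" using A by simp
  have i1: "integrable (\<sigma> t) (\<lambda>q. vel (snd q) * \<psi> (fst q))" by (rule integrable_fst_continuous(2)[OF t m\<psi> b])
  have i2: "integrable (\<sigma> t) (\<lambda>q. vel (snd q) * indicator A (fst q))"
    by (rule integrable_fst_continuous(2)[OF t mA, of 1]) (simp add: indicator_def)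
  have md: "(\<lambda>z. \<bar>indicator A z - \<psi> z\<bar>) \<in> borel_measurable borel" using mA m\<psi> by simp
  have i3: "integrable (\<sigma> t) (\<lambda>q. \<bar>indicator A (fst q) - \<psi> (fst q)\<bar>)"
    by (rule integrable_fst_continuous(1)[OF t md, of 1]) (use \<psi> in \<open>auto simp: indicator_def\<close>)
  have "\<bar>(LINT q|\<sigma> t. vel (snd q) * indicator A (fst q)) - (LINT q|\<sigma> t. vel (snd q) * \<psi> (fst q))\<bar>
      = \<bar>LINT q|\<sigma> t. vel (snd q) * indicator A (fst q) - vel (snd q) * \<psi> (fst q)\<bar>"
    using i1 i2 by simp
  also have "\<dots> \<le> (LINT q|\<sigma> t. \<bar>vel (snd q) * indicator A (fst q) - vel (snd q) * \<psi> (fst q)\<bar>)" by (rule integral_abs_bound)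
  also have "\<dots> = (LINT q|\<sigma> t. \<bar>indicator A (fst q) - \<psi> (fst q)\<bar>)"
    by (intro Bochner_Integration.integral_cong refl) (simp add: right_diff_distrib[symmetric] abs_mult vel_def)
  also have "\<dots> = (LINT z|\<rho> t. \<bar>indicator A z - \<psi> z\<bar>)" by (rule integral_\<rho>[OF t md, symmetric])
  finally have "\<bar>LINT q|\<sigma> t. vel (snd q) * indicator A (fst q)\<bar> \<le> \<bar>LINT q|\<sigma> t. vel (snd q) * \<psi> (fst q)\<bar> + e'"
    using \<psi>(4) by linarith
  then have "V * \<bar>LINT q|\<sigma> t. vel (snd q) * indicator A (fst q)\<bar> \<le> V * (\<bar>LINT q|\<sigma> t. vel (snd q) * \<psi> (fst q)\<bar> + e')"
    using V by (intro mult_left_mono) auto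
  then have "\<bar>momentum V (\<sigma> t) A\<bar> \<le> V * \<bar>LINT q|\<sigma> t. vel (snd q) * \<psi> (fst q)\<bar> + V * e'"
    unfolding momentum_eq[OF t A] using V by (simp add: abs_mult distrib_left)
  also have "V * \<bar>LINT q|\<sigma> t. vel (snd q) * \<psi> (fst q)\<bar>
        \<le> \<theta> * \<alpha> * d + (2 * \<delta> * (LINT z|torus_lebesgue. (\<psi> z)\<^sup>2) + (LINT z|\<rho> t. (\<psi> z)\<^sup>2)) / \<theta>"
    by (rule est[OF \<psi>(1) b])
  also have "(2 * \<delta> * (LINT z|torus_lebesgue. (\<psi> z)\<^sup>2) + (LINT z|\<rho> t. (\<psi> z)\<^sup>2)) / \<theta>
      \<le> (2 * \<delta> * (measure torus_lebesgue A + e') + (measure (\<rho> t) A + e')) / \<theta>"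
    using \<theta> \<delta>_pos
    by (intro divide_right_mono add_mono mult_left_mono
        L1_close(3)[OF torus.finite_measure_axioms sets_torus_lebesgue A \<psi>(1-3,5)]
        L1_close(3)[OF prob_space.finite_measure[OF prob_\<rho>[OF t]] sets_\<rho> A \<psi>(1-4)]) auto
  also have "\<theta> * \<alpha> * d + (2 * \<delta> * (measure torus_lebesgue A + e') + (measure (\<rho> t) A + e')) / \<theta> + V * e'
      = \<theta> * \<alpha> * d + (2 * \<delta> * measure torus_lebesgue A + measure (\<rho> t) A) / \<theta> + c * e'"
    unfolding c_def by (simp add: algebra_simps add_divide_distrib)
  also have "c * e' = e" using c by (simp add: e'_def)
  finally show "\<bar>momentum V (\<sigma> t) A\<bar> \<le> \<theta> * \<alpha> * d + (2 * \<delta> * measure torus_lebesgue A + measure (\<rho> t) A) / \<theta> + e" by simp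
qed

text \<open>Narrow continuity makes integrals of continuous functions continuous in
  \<open>t\<close>; indicators of open sets are limits of such functions, and Dynkin's theorem
  reaches all Borel sets. Open sets of the phase space are treated slice by slice in the
  velocity.\<close>

lemma measurable_\<sigma>:
  assumes A: "A \<in> sets borel"
  shows "(\<lambda>t. measure (\<sigma> t) A) \<in> borel_measurable (restrict_space borel {0..T})"
proof -
  have sp: "space (restrict_space borel {0..T}) = {0..T}" by (simp add: space_restrict_space)
  have 1: "Int_stable {U :: phase set. open U}" by (auto simp: Int_stable_def)
  have 2: "{U :: phase set. open U} \<subseteq> Pow UNIV" by simp
  have 3: "A \<in> sigma_sets UNIV {U :: phase set. open U}" using A by (simp add: sets_borel)
  from 1 2 3 show ?thesis
  proof (induct rule: sigma_sets_induct_disjoint)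
    case (basic U)
    then have U: "open U" by simp
    have Ub: "open {z. (z, b) \<in> U}" for b
    proof -
      have "{z. (z, b) \<in> U} = (\<lambda>z. (z, b)) -` U" by auto
      moreover have "open ((\<lambda>z :: torus. (z, b)) -` U)" by (rule open_vimage[OF U]) (intro continuous_intros)
      ultimately show ?thesis by simp
    qed
    have "\<exists>\<phi> :: torus \<Rightarrow> real. continuous_on UNIV \<phi> \<and> (\<forall>z. 0 \<le> \<phi> z) \<and> {z. (z, b) \<in> U} = {z. 0 < \<phi> z}" for b
      by (rule open_torus_eq_positive_set[OF Ub[of b]]) blast
    then obtain \<phi> :: "bool \<Rightarrow> torus \<Rightarrow> real" where \<phi>: "\<And>b. continuous_on UNIV (\<phi> b)" "\<And>b z. 0 \<le> \<phi> b z"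
      "\<And>b. {z. (z, b) \<in> U} = {z. 0 < \<phi> b z}" by metis
    define g where "g m q = min 1 (real m * \<phi> (snd q) (fst q))" for m :: nat and q
    have cg: "continuous_on UNIV (g m)" for m
      unfolding g_def[abs_def] by (intro continuous_on_min continuous_intros phase_continuous[where F="\<lambda>z b. \<phi> b z"] \<phi>)
    have bg: "0 \<le> g m q" "g m q \<le> 1" for m q using \<phi>(2) by (auto simp: g_def)
    have gm: "(\<lambda>t. LINT q|\<sigma> t. g m q) \<in> borel_measurable (restrict_space borel {0..T})" for m
      using bg by (intro borel_measurable_continuous_on_restrict narrow cg) (auto intro!: boundedI[of _ 1] simp: abs_le_iff order_trans[OF _ bg(1)])
    show ?case
    proof (rule borel_measurable_LIMSEQ_real[OF _ gm])
      fix t assume "t \<in> space (restrict_space borel {0..T})"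
      then have t: "t \<in> {0..T}" by (simp add: sp)
      interpret prob_space "\<sigma> t" by (rule prob[OF t])
      have "(\<lambda>m. LINT q|\<sigma> t. g m q) \<longlonglongrightarrow> (LINT q|\<sigma> t. indicator U q)"
      proof (rule integral_dominated_convergence[where w="\<lambda>_. 1"])
        show "AE q in \<sigma> t. (\<lambda>m. g m q) \<longlonglongrightarrow> indicator U q"
        proof (rule AE_I2)
          fix q :: phase
          have iff: "q \<in> U \<longleftrightarrow> 0 < \<phi> (snd q) (fst q)" using \<phi>(3)[of "snd q"] by (cases q) auto
          show "(\<lambda>m. g m q) \<longlonglongrightarrow> indicator U q"
          proof (cases "q \<in> U")
            case True
            then have p: "0 < \<phi> (snd q) (fst q)" using iff by simp
            obtain N :: nat where N: "1 / \<phi> (snd q) (fst q) < real N" using reals_Archimedean2 by blast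
            have "g m q = 1" if "m \<ge> N" for m
            proof -
              have "1 / \<phi> (snd q) (fst q) < real m" using N that by linarith
              then have "1 < real m * \<phi> (snd q) (fst q)" using p by (simp add: divide_less_eq)
              then show ?thesis by (simp add: g_def)
            qed
            then have "eventually (\<lambda>m. g m q = indicator U q) sequentially"
              unfolding eventually_sequentially using True by auto
            then show ?thesis by (rule tendsto_eventually)
          next
            case False
            then have "\<phi> (snd q) (fst q) = 0" using iff \<phi>(2)[of "snd q" "fst q"] by simp
            then show ?thesis using False by (simp add: g_def)
          qed
        qed
        show "AE q in \<sigma> t. norm (g m q) \<le> 1" for m using bg by (intro AE_I2) (simp add: abs_le_iff order_trans[OF _ bg(1)])
        show "g m \<in> borel_measurable (\<sigma> t)" for m by (rule meas_\<sigma>[OF t borel_measurable_continuous_onI[OF cg]])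
        show "indicator U \<in> borel_measurable (\<sigma> t)" using U by (intro borel_measurable_indicator) (simp add: sets_\<sigma>[OF t])
      qed simp
      then show "(\<lambda>m. LINT q|\<sigma> t. g m q) \<longlonglongrightarrow> measure (\<sigma> t) U" by (simp add: space_\<sigma>[OF t])
    qed
  next
    case empty show ?case by simp
  next
    case (compl A)
    then have A: "A \<in> sets borel" by (simp add: sets_borel)
    have "(\<lambda>t. 1 - measure (\<sigma> t) A) \<in> borel_measurable (restrict_space borel {0..T})"
      using compl by (intro borel_measurable_diff) auto
    then show ?case
    proof (rule measurable_cong[THEN iffD1, rotated])
      fix t assume "t \<in> space (restrict_space borel {0..T})"
      then have t: "t \<in> {0..T}" by (simp add: sp)
      show "1 - measure (\<sigma> t) A = measure (\<sigma> t) (UNIV - A)"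
        using prob_space.prob_compl[OF prob[OF t], of A] A by (simp add: space_\<sigma>[OF t] sets_\<sigma>[OF t])
    qed
  next
    case (union A)
    then have A: "A i \<in> sets borel" for i by (auto simp: sets_borel)
    have "(\<lambda>t. \<Sum>i. measure (\<sigma> t) (A i)) \<in> borel_measurable (restrict_space borel {0..T})"
      by (intro borel_measurable_suminf union)
    then show ?case
    proof (rule measurable_cong[THEN iffD1, rotated])
      fix t assume "t \<in> space (restrict_space borel {0..T})"
      then have t: "t \<in> {0..T}" by (simp add: sp)
      show "(\<Sum>i. measure (\<sigma> t) (A i)) = measure (\<sigma> t) (\<Union> (range A))"
        using finite_measure.finite_measure_UNION[OF fin[OF t], of A] A union by (simp add: sums_iff sets_\<sigma>[OF t] image_subset_iff)
    qed
  qed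
qed

lemma vm_\<sigma>: "t \<in> {0..T} \<Longrightarrow> vector_measure borel (measure (\<sigma> t))"
  by (rule vector_measure_measure[OF fin sets_\<sigma>])

lemma vm_momentum: assumes t: "t \<in> {0..T}" shows "vector_measure borel (momentum V (\<sigma> t))"
  unfolding momentum_def[abs_def] UNIV_bool
  by (simp add: vector_measure_cmult vector_measure_add vector_measure_slice vm_\<sigma>[OF t])

lemma measurable_momentum:
  "A \<in> sets borel \<Longrightarrow> (\<lambda>t. momentum V (\<sigma> t) A) \<in> borel_measurable (restrict_space borel {0..T})"
  unfolding momentum_def by (intro borel_measurable_times borel_measurable_sum borel_measurable_const measurable_\<sigma> phase_slice_sets)

text \<open>A bound growing with \<open>V\<close>, for integrability in time; uniformity comes from
  the dissipation in \<open>spacetime_momentum_bound\<close>.\<close>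

lemma momentum_bound: assumes t: "t \<in> {0..T}" and A: "A \<in> sets borel" shows "\<bar>momentum V (\<sigma> t) A\<bar> \<le> V"
proof -
  interpret prob_space "\<sigma> t" by (rule prob[OF t])
  have mA: "(indicator A :: torus \<Rightarrow> real) \<in> borel_measurable borel" using A by simp
  have i: "integrable (\<sigma> t) (\<lambda>q. vel (snd q) * indicator A (fst q))"
    by (rule integrable_fst_continuous(2)[OF t mA, of 1]) (simp add: indicator_def)
  have "\<bar>LINT q|\<sigma> t. vel (snd q) * indicator A (fst q)\<bar> \<le> (LINT q|\<sigma> t. \<bar>vel (snd q) * indicator A (fst q)\<bar>)" by (rule integral_abs_bound)
  also have "\<dots> \<le> (LINT q|\<sigma> t. 1)" using i by (intro integral_mono) (auto simp: vel_def indicator_def)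
  finally have "\<bar>LINT q|\<sigma> t. vel (snd q) * indicator A (fst q)\<bar> \<le> 1" by (simp add: prob_space)
  then have "V * \<bar>LINT q|\<sigma> t. vel (snd q) * indicator A (fst q)\<bar> \<le> V * 1" using V by (intro mult_left_mono) auto
  then show ?thesis unfolding momentum_eq[OF t A] using V by (simp add: abs_mult)
qed

lemma vm_\<rho>: assumes t: "t \<in> {0..T}" shows "vector_measure borel (measure (\<rho> t))"
  by (rule vector_measure_measure[OF prob_space.finite_measure[OF prob_\<rho>[OF t]] sets_\<rho>])

lemma measurable_\<rho>:
  assumes A: "A \<in> sets borel" shows "(\<lambda>t. measure (\<rho> t) A) \<in> borel_measurable (restrict_space borel {0..T})"
proof -
  have "A \<times> UNIV \<in> sets (borel \<Otimes>\<^sub>M borel :: phase measure)" using A by (intro pair_measureI) auto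
  then have "A \<times> UNIV \<in> sets (borel :: phase measure)" unfolding borel_prod .
  from measurable_\<sigma>[OF this] show ?thesis
    by (rule measurable_cong[THEN iffD1, rotated]) (simp add: space_restrict_space measure_\<rho> A)
qed

lemma vm_net_flux: assumes r: "r \<in> {0<..<T}" shows "vector_measure borel (net_flux V (j r))"
proof -
  have "vector_measure borel (\<lambda>B. vel False / V * flux2 (j r) (B \<times> {False}) + vel True / V * flux2 (j r) (B \<times> {True}))"
    by (intro vector_measure_add vector_measure_cmult vector_measure_slice vm_flux(2)[OF r])
  then show ?thesis unfolding net_flux_def[abs_def] UNIV_bool by (simp add: add.commute)
qed

lemma measurable_net_flux:
  "A \<in> sets borel \<Longrightarrow> (\<lambda>r. net_flux V (j r) A) \<in> borel_measurable (restrict_space borel {0<..<T})"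
  unfolding net_flux_def by (intro borel_measurable_times borel_measurable_sum borel_measurable_const meas_flux(2) phase_slice_sets)

text \<open>Provides the majorant in time for the integrability of the flux; the weights
  \<open>1 / V\<close> are at most 1. The estimate that is uniform in \<open>V\<close> is
  \<open>spacetime_flux_bound\<close>.\<close>

lemma net_flux_bound:
  assumes r: "r \<in> {0<..<T}" and A: "A \<in> sets borel"
  shows "ennreal \<bar>net_flux V (j r) A\<bar> \<le> tv_norm borel (j r)"
proof -
  have "\<bar>vel b / V * x\<bar> \<le> \<bar>x\<bar>" for b x
    using V mult_left_mono[OF V abs_ge_zero[of x]] by (simp add: abs_mult vel_def divide_le_eq)
  then have "\<bar>net_flux V (j r) A\<bar> \<le> \<bar>flux2 (j r) (A \<times> {False})\<bar> + \<bar>flux2 (j r) (A \<times> {True})\<bar>"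
    unfolding net_flux_def UNIV_bool
    by (simp add: order_trans[OF abs_triangle_ineq] add_mono)
  then have "ennreal \<bar>net_flux V (j r) A\<bar> \<le> ennreal (norm (flux2 (j r) (A \<times> {False})) + norm (flux2 (j r) (A \<times> {True})))"
    by (intro ennreal_leI) simp
  also have "\<dots> \<le> tv_norm borel (flux2 (j r))"
    by (rule sum_norm_le_tv_norm[where \<mu>="flux2 (j r)" and A="A \<times> {False}" and B="A \<times> {True}", OF vector_measure_empty[OF vm_flux(2)[OF r]] phase_slice_sets[OF A] phase_slice_sets[OF A]]) auto
  also have "\<dots> \<le> tv_norm borel (j r)" by (rule tv_flux)
  finally show ?thesis .
qed

text \<open>Quadratic part of the relative entropy, with a test function of size \<open>s / V\<close>.\<close>

lemma flux_le_lagrangian: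
  assumes r: "r \<in> {0<..<T}" and A: "A \<in> sets borel" and s: "0 < s" "s \<le> V" and \<epsilon>: "\<bar>\<epsilon>\<bar> = 1"
  shows "ennreal (\<epsilon> * s * (net_flux V (j r) A - momentum V (\<sigma> r) A / (2 * \<alpha>)) - s\<^sup>2 / (2 * \<alpha>) * measure (\<rho> r) A)
    \<le> lagrangian \<alpha> V (\<sigma> r) (j r)"
proof -
  have r': "r \<in> {0..T}" using r by simp
  \<comment> \<open>The hypothesis \<open>s \<le> V\<close> keeps this between -1 and 1, where
    \<open>exp_quadratic_bound\<close> holds.\<close>
  define \<phi> where "\<phi> q = \<epsilon> * (s / V) * (vel (snd q) * indicator A (fst q))" for q :: phase
  have V0: "0 < V" using V by simp
  have sV: "0 \<le> s / V" "s / V \<le> 1" using s V0 by auto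
  have \<phi>b: "\<bar>\<phi> q\<bar> \<le> 1" for q
    unfolding \<phi>_def abs_mult \<epsilon> using sV by (auto simp: vel_def indicator_def)
  have \<phi>2: "(\<phi> q)\<^sup>2 = (s / V)\<^sup>2 * indicator A (fst q)" for q
  proof -
    have "\<epsilon>\<^sup>2 = 1" using \<epsilon> by (metis power2_abs one_power2)
    then show ?thesis unfolding \<phi>_def by (simp add: power_mult_distrib power_divide vel_def indicator_def)
  qed
  have mA: "(indicator A :: torus \<Rightarrow> real) \<in> borel_measurable borel" using A by simp
  have \<phi>m: "\<phi> \<in> borel_measurable borel"
    unfolding \<phi>_def[abs_def] by (rule phase_measurable[where F="\<lambda>z b. \<epsilon> * (s / V) * (vel b * indicator A z)"]) (use mA in simp)
  have si: "signed_integral borel (flux2 (j r)) (indicator B) = flux2 (j r) B" if B: "B \<in> sets borel" for B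
  proof -
    obtain P N where PN: "finite_measure P" "finite_measure N" "sets P = sets borel" "sets N = sets borel"
      "\<And>A. A \<in> sets borel \<Longrightarrow> flux2 (j r) A = measure P A - measure N A"
      by (rule Jordan_decomposition_vector_measure[OF vm_flux(2)[OF r]]) (rule that)
    have "signed_integral borel (flux2 (j r)) (indicator B) = (LINT q|P. indicator B q) - (LINT q|N. indicator B q)"
      by (rule signed_integral_eq[OF PN, of _ 1]) (use B in \<open>auto simp: indicator_def\<close>)
    then show ?thesis
      using PN(5)[OF B] sets_eq_imp_space_eq[OF PN(3)] sets_eq_imp_space_eq[OF PN(4)] by simp
  qed
  have "\<phi> = (\<lambda>q. \<Sum>b\<in>UNIV. (\<epsilon> * (s / V) * vel b) * indicator (A \<times> {b}) q)"
  proof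
    fix q :: phase
    obtain z b where "q = (z, b)" by (cases q)
    then show "\<phi> q = (\<Sum>b\<in>UNIV. (\<epsilon> * (s / V) * vel b) * indicator (A \<times> {b}) q)"
      by (cases b) (simp_all add: \<phi>_def UNIV_bool indicator_def)
  qed
  then have "signed_integral borel (flux2 (j r)) \<phi> = (\<Sum>b\<in>UNIV. (\<epsilon> * (s / V) * vel b) * signed_integral borel (flux2 (j r)) (indicator (A \<times> {b})))"
    using signed_integral_sum[OF vm_flux(2)[OF r], of UNIV "\<lambda>b. indicator (A \<times> {b})" 1 "\<lambda>b. \<epsilon> * (s / V) * vel b"] phase_slice_sets[OF A]
    by (simp add: indicator_def)
  also have "\<dots> = \<epsilon> * s * net_flux V (j r) A"
    unfolding net_flux_def by (simp add: si phase_slice_sets[OF A] UNIV_bool distrib_left mult_ac)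
  finally have 1: "signed_integral borel (flux2 (j r)) \<phi> = \<epsilon> * s * net_flux V (j r) A" .
  have iA: "integrable (\<sigma> r) (\<lambda>q. indicator A (fst q) :: real)" "integrable (\<sigma> r) (\<lambda>q. vel (snd q) * indicator A (fst q))"
    by (rule integrable_fst_continuous[OF r' mA, of 1]; simp add: indicator_def)+
  have "(LINT q|\<sigma> r. exp (\<phi> q) - 1) \<le> (LINT q|\<sigma> r. \<epsilon> * (s / V) * (vel (snd q) * indicator A (fst q)) + (s / V)\<^sup>2 * indicator A (fst q))"
  proof (rule integral_mono)
    show "integrable (\<sigma> r) (\<lambda>q. exp (\<phi> q) - 1)"
    proof (rule int_\<sigma>[OF r', of _ "exp 1 + 1"])
      show "(\<lambda>q. exp (\<phi> q) - 1) \<in> borel_measurable borel" using \<phi>m by simp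
      fix q
      have "exp (\<phi> q) \<le> exp 1" using \<phi>b[of q] by simp
      moreover have "0 < exp (\<phi> q)" by simp
      ultimately show "\<bar>exp (\<phi> q) - 1\<bar> \<le> exp 1 + 1" unfolding abs_le_iff by linarith
    qed
    show "integrable (\<sigma> r) (\<lambda>q. \<epsilon> * (s / V) * (vel (snd q) * indicator A (fst q)) + (s / V)\<^sup>2 * indicator A (fst q))"
      using iA by (intro Bochner_Integration.integrable_add integrable_mult_right)
    show "exp (\<phi> q) - 1 \<le> \<epsilon> * (s / V) * (vel (snd q) * indicator A (fst q)) + (s / V)\<^sup>2 * indicator A (fst q)" for q
      using exp_quadratic_bound[OF \<phi>b[of q]] unfolding \<phi>2 by (simp add: \<phi>_def)
  qed
  also have "\<dots> = (LINT q|\<sigma> r. \<epsilon> * (s / V) * (vel (snd q) * indicator A (fst q))) + (LINT q|\<sigma> r. (s / V)\<^sup>2 * indicator A (fst q))"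
    by (intro Bochner_Integration.integral_add integrable_mult_right iA)
  also have "\<dots> = \<epsilon> * (s / V) * (LINT q|\<sigma> r. vel (snd q) * indicator A (fst q)) + (s / V)\<^sup>2 * (LINT q|\<sigma> r. indicator A (fst q))"
    by (simp only: integral_mult_right_zero)
  also have "(LINT q|\<sigma> r. indicator A (fst q)) = measure (\<rho> r) A"
    unfolding integral_\<rho>[OF r' mA, symmetric] by simp
  finally have "k * (LINT q|\<sigma> r. exp (\<phi> q) - 1) \<le> k * (\<epsilon> * (s / V) * (LINT q|\<sigma> r. vel (snd q) * indicator A (fst q)) + (s / V)\<^sup>2 * measure (\<rho> r) A)"
    using k_pos by (intro mult_left_mono) auto
  \<comment> \<open>The linear term reproduces the momentum with its factor \<open>V\<close>; the
    quadratic one is free of \<open>V\<close>.\<close>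
  also have "\<dots> = \<epsilon> * s * (momentum V (\<sigma> r) A / (2 * \<alpha>)) + s\<^sup>2 / (2 * \<alpha>) * measure (\<rho> r) A"
  proof -
    have "k * (\<epsilon> * (s / V) * x) = \<epsilon> * s * (V * x / (2 * \<alpha>))" for x
      unfolding k_def using V0 by (simp add: power2_eq_square)
    moreover have "k * ((s / V)\<^sup>2 * y) = s\<^sup>2 / (2 * \<alpha>) * y" for y
      unfolding k_def using V0 by (simp add: power_divide)
    ultimately show ?thesis unfolding momentum_eq[OF r' A] distrib_left by simp
  qed
  finally have "\<epsilon> * s * (net_flux V (j r) A - momentum V (\<sigma> r) A / (2 * \<alpha>)) - s\<^sup>2 / (2 * \<alpha>) * measure (\<rho> r) A
      \<le> signed_integral borel (flux2 (j r)) \<phi> - k * (LINT q|\<sigma> r. exp (\<phi> q) - 1)"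
    unfolding 1 right_diff_distrib by linarith
  then have "ennreal (\<epsilon> * s * (net_flux V (j r) A - momentum V (\<sigma> r) A / (2 * \<alpha>)) - s\<^sup>2 / (2 * \<alpha>) * measure (\<rho> r) A)
      \<le> ennreal (signed_integral borel (flux2 (j r)) \<phi> - k * (LINT q|\<sigma> r. exp (\<phi> q) - 1))" by (rule ennreal_leI)
  also have "\<dots> \<le> lagrangian \<alpha> V (\<sigma> r) (j r)" by (rule lagrangian_Fenchel[OF r \<phi>m \<phi>b])
  finally show ?thesis .
qed

end

section \<open>Space-time measures\<close>

definition slab :: "real set \<Rightarrow> (real \<times> torus) measure"
  where "slab I = restrict_space (lborel \<Otimes>\<^sub>M torus_lebesgue) (I \<times> UNIV)"

lemma sets_lborel_torus: "sets (lborel \<Otimes>\<^sub>M torus_lebesgue :: (real \<times> torus) measure) = sets borel"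
proof -
  have "sets (lborel \<Otimes>\<^sub>M torus_lebesgue :: (real \<times> torus) measure) = sets (borel \<Otimes>\<^sub>M borel :: (real \<times> torus) measure)"
    by (intro sets_pair_measure_cong) simp_all
  then show ?thesis unfolding borel_prod .
qed

lemma strip_sets: "I \<in> sets borel \<Longrightarrow> I \<times> UNIV \<in> sets (borel :: (real \<times> torus) measure)"
proof -
  assume "I \<in> sets borel"
  then have "I \<times> UNIV \<in> sets (borel \<Otimes>\<^sub>M borel :: (real \<times> torus) measure)" by (intro pair_measureI) auto
  then show ?thesis unfolding borel_prod .
qed

lemma sets_slab: "sets (slab I) = sets (restrict_space borel (I \<times> UNIV))"
  unfolding slab_def by (rule sets_restrict_space_cong[OF sets_lborel_torus])

lemma space_slab: "space (slab I) = I \<times> UNIV"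
  by (simp add: slab_def space_restrict_space space_pair_measure)

lemma sets_slab_iff: "I \<in> sets borel \<Longrightarrow> A \<in> sets (slab I) \<longleftrightarrow> A \<subseteq> I \<times> UNIV \<and> A \<in> sets borel"
  unfolding sets_slab by (subst sets_restrict_space_iff) (auto simp: strip_sets)

text \<open>A countable generator is what \<open>setwise_compactness_signed\<close> asks for; it
  comes from a countable basis of the space-time topology.\<close>

lemma slab_generator:
  assumes I: "I \<in> sets borel"
  obtains G where "countable G" "G \<subseteq> Pow (space (slab I))" "sets (slab I) = sigma_sets (space (slab I)) G"
proof -
  obtain \<B> :: "(real \<times> torus) set set" where \<B>: "countable \<B>" "topological_basis \<B>" using ex_countable_basis by blast
  have b: "sets (borel :: (real \<times> torus) measure) = sigma_sets UNIV \<B>"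
    unfolding borel_eq_countable_basis[OF \<B>] by (rule sets_measure_of) simp
  have "sets (slab I) = (\<inter>) (I \<times> UNIV) ` sigma_sets UNIV \<B>"
    unfolding sets_slab sets_restrict_space b by simp
  also have "\<dots> = sigma_sets (I \<times> UNIV) ((\<inter>) (I \<times> UNIV) ` \<B>)"
    by (rule sigma_sets_Int) (use strip_sets[OF I] in \<open>auto simp: b\<close>)
  finally show ?thesis using \<B>(1) by (intro that[of "(\<inter>) (I \<times> UNIV) ` \<B>"]) (auto simp: space_slab)
qed

lemma emeasure_slab:
  assumes I: "I \<in> sets borel" and A: "A \<in> sets (slab I)"
  shows "emeasure (slab I) A = (\<integral>\<^sup>+t. ennreal (indicator I t * measure torus_lebesgue {z. (t, z) \<in> A}) \<partial>lborel)"
proof -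
  have A': "A \<subseteq> I \<times> UNIV" "A \<in> sets borel" using A sets_slab_iff[OF I] by auto
  have "emeasure (slab I) A = emeasure (lborel \<Otimes>\<^sub>M torus_lebesgue) A"
    unfolding slab_def
  proof (rule emeasure_restrict_space)
    have "I \<times> UNIV \<in> sets (lborel \<Otimes>\<^sub>M torus_lebesgue)" using strip_sets[OF I] unfolding sets_lborel_torus .
    then show "I \<times> UNIV \<inter> space (lborel \<Otimes>\<^sub>M torus_lebesgue) \<in> sets (lborel \<Otimes>\<^sub>M torus_lebesgue)" by (rule sets.Int) (rule sets.top)
  qed (rule A'(1))
  also have "\<dots> = (\<integral>\<^sup>+t. emeasure torus_lebesgue (Pair t -` A) \<partial>lborel)"
    by (rule torus.emeasure_pair_measure_alt) (use A'(2) in \<open>unfold sets_lborel_torus\<close>)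
  also have "\<dots> = (\<integral>\<^sup>+t. ennreal (indicator I t * measure torus_lebesgue {z. (t, z) \<in> A}) \<partial>lborel)"
  proof (rule nn_integral_cong)
    fix t
    have "Pair t -` A = {z. (t, z) \<in> A}" by auto
    moreover have "t \<notin> I \<Longrightarrow> {z. (t, z) \<in> A} = {}" using A' by auto
    ultimately show "emeasure torus_lebesgue (Pair t -` A) = ennreal (indicator I t * measure torus_lebesgue {z. (t, z) \<in> A})"
      by (cases "t \<in> I") (simp_all add: torus.emeasure_eq_measure)
  qed
  finally show ?thesis .
qed

lemma lebesgue_family:
  assumes I: "(I :: real set) \<in> sets borel" "emeasure lborel I < \<infinity>" and A: "A \<in> sets borel"
  shows "set_integrable lborel I (\<lambda>t. measure torus_lebesgue {z. (t, z) \<in> A})"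
proof (rule time_integral_vector_measure(2)[where \<mu>="\<lambda>_. measure torus_lebesgue" and h="\<lambda>_. 1", OF I(1)])
  show "vector_measure borel (measure torus_lebesgue)"
    by (rule vector_measure_measure[OF torus.finite_measure_axioms]) simp
  show "(\<integral>\<^sup>+t\<in>I. 1 \<partial>lborel) < \<infinity>" using I by simp
  show "ennreal \<bar>measure torus_lebesgue B\<bar> \<le> 1" for B
    using torus.prob_le_1[of B] by (simp add: ennreal_le_1)
qed (use A in auto)

lemma measure_slab:
  assumes I: "I \<in> sets borel" "emeasure lborel I < \<infinity>" and A: "A \<in> sets (slab I)"
  shows "measure (slab I) A = (LINT t:I|lborel. measure torus_lebesgue {z. (t, z) \<in> A})"
proof -
  have A': "A \<in> sets borel" using A sets_slab_iff[OF I(1)] by auto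
  have "emeasure (slab I) A = ennreal (LINT t|lborel. indicator I t * measure torus_lebesgue {z. (t, z) \<in> A})"
    unfolding emeasure_slab[OF I(1) A]
    using lebesgue_family[OF I A'] by (intro nn_integral_eq_integral) (auto simp: set_integrable_def)
  then show ?thesis
    by (simp add: measure_def set_lebesgue_integral_def Bochner_Integration.integral_nonneg)
qed

lemma finite_measure_slab:
  assumes I: "I \<in> sets borel" "emeasure lborel I < \<infinity>"
  shows "finite_measure (slab I)"
proof (rule finite_measureI)
  have "emeasure (slab I) (space (slab I)) = (\<integral>\<^sup>+t. ennreal (indicator I t * measure torus_lebesgue {z. (t, z) \<in> space (slab I)}) \<partial>lborel)"
    by (rule emeasure_slab[OF I(1) sets.top])
  also have "\<dots> \<le> (\<integral>\<^sup>+t. indicator I t \<partial>lborel)"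
    by (intro nn_integral_mono) (auto simp: indicator_def ennreal_le_1)
  also have "\<dots> < \<infinity>" using I by simp
  finally show "emeasure (slab I) (space (slab I)) \<noteq> \<infinity>" by simp
qed

text \<open>Only the sigma-algebra enters \<open>signed_integral\<close>, so \<open>slab\<close> and
  \<open>restrict_space borel\<close> may be interchanged although they carry different
  measures.\<close>

lemma signed_integral_cong_sets:
  "sets M = sets N \<Longrightarrow> signed_integral M = signed_integral N"
  using sets_eq_imp_space_eq[of M N]
  by (intro ext) (simp add: signed_integral_def neg_variation_def pos_variation_def)

lemma vector_measure_cong_sets: "sets M = sets N \<Longrightarrow> vector_measure M \<mu> = vector_measure N \<mu>"
  by (simp add: vector_measure_def)

lemma signed_integral_indicator:
  fixes \<mu> :: "'a set \<Rightarrow> real"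
  assumes vm: "vector_measure M \<mu>" and A: "A \<in> sets M"
  shows "signed_integral M \<mu> (indicator A) = \<mu> A"
proof -
  obtain P N where PN: "finite_measure P" "finite_measure N" "sets P = sets M" "sets N = sets M"
    "\<And>A. A \<in> sets M \<Longrightarrow> \<mu> A = measure P A - measure N A"
    by (rule Jordan_decomposition_vector_measure[OF vm]) (rule that)
  have "signed_integral M \<mu> (indicator A) = (LINT x|P. indicator A x) - (LINT x|N. indicator A x)"
    by (rule signed_integral_eq[OF PN, of _ 1]) (use A in \<open>auto simp: indicator_def\<close>)
  moreover have "A \<inter> space P = A" "A \<inter> space N = A"
    using sets.sets_into_space[OF A] sets_eq_imp_space_eq[OF PN(3)] sets_eq_imp_space_eq[OF PN(4)] by auto
  ultimately show ?thesis using PN(5)[OF A] by simp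
qed

section \<open>Space-time measures with a density and their disintegration\<close>

lemma density_vector_measure:
  fixes g :: "'a \<Rightarrow> real"
  assumes g: "integrable L g"
  shows "vector_measure L (\<lambda>A. LINT x|L. indicator A x * g x)"
    and "\<And>\<psi> B. \<psi> \<in> borel_measurable L \<Longrightarrow> (\<And>x. x \<in> space L \<Longrightarrow> \<bar>\<psi> x\<bar> \<le> B) \<Longrightarrow>
      signed_integral L (\<lambda>A. LINT x|L. indicator A x * g x) \<psi> = (LINT x|L. \<psi> x * g x)"
proof -
  define P where "P = density L (\<lambda>x. ennreal (max 0 (g x)))"
  define N where "N = density L (\<lambda>x. ennreal (max 0 (- g x)))"
  have gm [measurable]: "g \<in> borel_measurable L" using g by simp
  have ip: "integrable L (\<lambda>x. max 0 (g x))" "integrable L (\<lambda>x. max 0 (- g x))" using g by auto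
  have fd: "finite_measure (density L (\<lambda>x. ennreal (h x)))" if "integrable L h" "\<And>x. 0 \<le> h x" for h
    using that by (intro finite_measureI)
      (simp add: emeasure_density nn_integral_eq_integral cong: nn_integral_cong)
  have f: "finite_measure P" "finite_measure N" unfolding P_def N_def by (rule fd[OF ip(1)], simp) (rule fd[OF ip(2)], simp)
  have s: "sets P = sets L" "sets N = sets L" by (simp_all add: P_def N_def)
  have ib: "integrable L (\<lambda>x. h x * \<psi> x)" if "integrable L h" "\<psi> \<in> borel_measurable L" "\<And>x. x \<in> space L \<Longrightarrow> \<bar>\<psi> x\<bar> \<le> B" for h \<psi> :: "'a \<Rightarrow> real" and B
  proof (rule Bochner_Integration.integrable_bound[where f="\<lambda>x. B * h x"])
    show "AE x in L. norm (h x * \<psi> x) \<le> norm (B * h x)"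
    proof (rule AE_I2)
      fix x assume "x \<in> space L"
      then have "\<bar>\<psi> x\<bar> \<le> \<bar>B\<bar>" using that(3)[of x] by linarith
      then have "\<bar>\<psi> x\<bar> * \<bar>h x\<bar> \<le> \<bar>B\<bar> * \<bar>h x\<bar>" by (rule mult_right_mono) simp
      then show "norm (h x * \<psi> x) \<le> norm (B * h x)" by (simp add: abs_mult mult.commute)
    qed
  qed (use that in auto)
  have int: "(LINT x|P. \<psi> x) - (LINT x|N. \<psi> x) = (LINT x|L. \<psi> x * g x)"
    if \<psi>: "\<psi> \<in> borel_measurable L" "\<And>x. x \<in> space L \<Longrightarrow> \<bar>\<psi> x\<bar> \<le> B" for \<psi> B
  proof -
    have "(LINT x|P. \<psi> x) = (LINT x|L. max 0 (g x) * \<psi> x)"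
      unfolding P_def by (rule integral_real_density) (use \<psi> in auto)
    moreover have "(LINT x|N. \<psi> x) = (LINT x|L. max 0 (- g x) * \<psi> x)"
      unfolding N_def by (rule integral_real_density) (use \<psi> in auto)
    ultimately have "(LINT x|P. \<psi> x) - (LINT x|N. \<psi> x) = (LINT x|L. max 0 (g x) * \<psi> x) - (LINT x|L. max 0 (- g x) * \<psi> x)"
      by simp
    also have "\<dots> = (LINT x|L. max 0 (g x) * \<psi> x - max 0 (- g x) * \<psi> x)"
      by (rule Bochner_Integration.integral_diff[symmetric]) (rule ib[OF ip(1) \<psi>], assumption, rule ib[OF ip(2) \<psi>], assumption)
    also have "\<dots> = (LINT x|L. \<psi> x * g x)"
      by (intro Bochner_Integration.integral_cong) (auto simp: max_def)
    finally show ?thesis .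
  qed
  have eq: "(LINT x|L. indicator A x * g x) = measure P A - measure N A" if A: "A \<in> sets L" for A
  proof -
    have "(LINT x|P. indicator A x) - (LINT x|N. indicator A x) = (LINT x|L. indicator A x * g x)"
      by (rule int[of _ 1]) (use A in \<open>auto simp: indicator_def\<close>)
    moreover have "A \<inter> space P = A" "A \<inter> space N = A"
      using sets.sets_into_space[OF A] by (auto simp: P_def N_def)
    ultimately show ?thesis by simp
  qed
  have "vector_measure L (\<lambda>A. measure P A + - measure N A)"
    by (intro vector_measure_add vector_measure_minus vector_measure_measure f s)
  then show "vector_measure L (\<lambda>A. LINT x|L. indicator A x * g x)"
    unfolding vector_measure_def by (simp add: eq image_subset_iff)
  show "signed_integral L (\<lambda>A. LINT x|L. indicator A x * g x) \<psi> = (LINT x|L. \<psi> x * g x)"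
    if \<psi>: "\<psi> \<in> borel_measurable L" "\<And>x. x \<in> space L \<Longrightarrow> \<bar>\<psi> x\<bar> \<le> B" for \<psi> B
  proof -
    have "signed_integral L (\<lambda>A. LINT x|L. indicator A x * g x) \<psi> = (LINT x|P. \<psi> x) - (LINT x|N. \<psi> x)"
      by (rule signed_integral_eq[OF f s eq \<psi>])
    then show ?thesis using int[OF \<psi>] by simp
  qed
qed

lemma tv_norm_density_le:
  fixes g :: "'a \<Rightarrow> real"
  assumes g: "integrable L g"
  shows "tv_norm L (\<lambda>A. LINT x|L. indicator A x * g x) \<le> (\<integral>\<^sup>+x. ennreal \<bar>g x\<bar> \<partial>L)"
  unfolding tv_norm_def
proof (rule SUP_least)
  fix P assume P: "P \<in> {P. finite P \<and> P \<subseteq> sets L \<and> disjoint P}"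
  have i: "integrable L (\<lambda>x. indicator A x * \<bar>g x\<bar>)" "integrable L (\<lambda>x. indicator A x * g x)" if "A \<in> P" for A
    using integrable_real_mult_indicator[of A L "\<lambda>x. \<bar>g x\<bar>"] integrable_real_mult_indicator[of A L g] that P g by (auto simp: mult.commute)
  have "(\<Sum>A\<in>P. ennreal (norm (LINT x|L. indicator A x * g x))) = ennreal (\<Sum>A\<in>P. \<bar>LINT x|L. indicator A x * g x\<bar>)" by simp
  also have "\<dots> \<le> ennreal (\<Sum>A\<in>P. LINT x|L. indicator A x * \<bar>g x\<bar>)"
  proof (intro ennreal_leI sum_mono)
    fix A assume A: "A \<in> P"
    have "\<bar>LINT x|L. indicator A x * g x\<bar> \<le> (LINT x|L. \<bar>indicator A x * g x\<bar>)" by (rule integral_abs_bound)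
    then show "\<bar>LINT x|L. indicator A x * g x\<bar> \<le> (LINT x|L. indicator A x * \<bar>g x\<bar>)" by (simp add: abs_mult)
  qed
  also have "(\<Sum>A\<in>P. LINT x|L. indicator A x * \<bar>g x\<bar>) = (LINT x|L. (\<Sum>A\<in>P. indicator A x * \<bar>g x\<bar>))"
    using i by (intro Bochner_Integration.integral_sum[symmetric]) auto
  also have "\<dots> \<le> (LINT x|L. \<bar>g x\<bar>)"
  proof (rule integral_mono)
    show "integrable L (\<lambda>x. \<Sum>A\<in>P. indicator A x * \<bar>g x\<bar>)" using i by auto
    show "integrable L (\<lambda>x. \<bar>g x\<bar>)" using g by simp
    fix x
    have "(\<Sum>A\<in>P. indicator A x) = (indicator (\<Union>P) x :: real)"
    proof -
      have "finite P" "disjoint_family_on (\<lambda>A. A) P" using P by (simp_all add: disjoint_family_on_def disjoint_def)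
      from indicator_UN_disjoint[OF this, of x, where 'c=real] show ?thesis by (simp only: image_ident)
    qed
    then have "(\<Sum>A\<in>P. indicator A x * \<bar>g x\<bar>) = indicator (\<Union>P) x * \<bar>g x\<bar>" by (simp add: sum_distrib_right[symmetric])
    also have "\<dots> \<le> \<bar>g x\<bar>" by (simp add: indicator_def)
    finally show "(\<Sum>A\<in>P. indicator A x * \<bar>g x\<bar>) \<le> \<bar>g x\<bar>" .
  qed
  also have "ennreal (LINT x|L. \<bar>g x\<bar>) = (\<integral>\<^sup>+x. ennreal \<bar>g x\<bar> \<partial>L)"
    using g by (intro nn_integral_eq_integral[symmetric]) auto
  finally show "(\<Sum>A\<in>P. ennreal (norm (LINT x|L. indicator A x * g x))) \<le> (\<integral>\<^sup>+x. ennreal \<bar>g x\<bar> \<partial>L)"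
    by (simp add: ennreal_leI)
qed

text \<open>Since the reference measure is a product, the section of \<open>g\<close> at time
  \<open>t\<close> is the density of \<open>\<mu> t\<close>, and the rest is Fubini's
  theorem.\<close>

theorem slab_disintegration:
  assumes I: "I \<in> sets borel" and g: "integrable (slab I) g"
  shows "\<exists>\<mu> :: real \<Rightarrow> torus set \<Rightarrow> real. integrable_family I \<mu> \<and>
    (\<forall>A\<in>sets (slab I). (LINT x|slab I. indicator A x * g x) = time_integral I \<mu> A)"
proof -
  interpret PS: pair_sigma_finite lborel torus_lebesgue ..
  define L :: "(real \<times> torus) measure" where "L = lborel \<Otimes>\<^sub>M torus_lebesgue"
  have sL: "sets L = sets borel" unfolding L_def by (rule sets_lborel_torus)
  have IL: "(I \<times> UNIV) \<inter> space L \<in> sets L" using sets.Int[OF strip_sets[OF I, folded sL] sets.top] .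
  define g0 where "g0 x = indicator (I \<times> UNIV) x * g x" for x
  have g0i: "integrable L g0"
    using g unfolding slab_def L_def[symmetric] integrable_restrict_space[OF IL] by (simp add: g0_def[abs_def])
  have g0m [measurable]: "g0 \<in> borel_measurable (lborel \<Otimes>\<^sub>M torus_lebesgue)" using g0i by (simp add: L_def)
  \<comment> \<open>The L1 norms of the sections: a measurable majorant of the total
    variation.\<close>
  define W where "W t = (\<integral>\<^sup>+z. ennreal \<bar>g0 (t, z)\<bar> \<partial>torus_lebesgue)" for t
  have Wm [measurable]: "W \<in> borel_measurable lborel" unfolding W_def[abs_def] by measurable
  have gt: "(\<lambda>z. g0 (t, z)) \<in> borel_measurable torus_lebesgue" for t by measurable
  have Wint: "(\<integral>\<^sup>+t. W t \<partial>lborel) < \<infinity>"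
  proof -
    have "(\<integral>\<^sup>+t. W t \<partial>lborel) = (\<integral>\<^sup>+x. ennreal \<bar>g0 x\<bar> \<partial>L)"
      unfolding W_def L_def by (rule torus.nn_integral_fst) measurable
    also have "\<dots> < \<infinity>" using g0i by (simp add: integrable_iff_bounded)
    finally show ?thesis .
  qed
  have AEW: "AE t in lborel. W t \<noteq> \<infinity>" by (rule nn_integral_PInf_AE) (use Wint in auto)
  have good: "integrable torus_lebesgue (\<lambda>z. g0 (t, z))" if "W t < \<infinity>" for t
    using that gt unfolding W_def by (intro integrableI_bounded) auto
  \<comment> \<open>Times with a nonintegrable section form a null set; the value 0 there makes
    \<open>\<mu> t\<close> a vector measure for every \<open>t\<close>.\<close>
  define \<mu> where "\<mu> t B = (if W t < \<infinity> then (LINT z|torus_lebesgue. indicator B z * g0 (t, z)) else 0)" for t B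
  show ?thesis
  proof (intro exI[of _ \<mu>] conjI ballI)
    show "integrable_family I \<mu>"
      unfolding integrable_family_def
    proof (intro conjI ballI)
      fix t assume "t \<in> I"
      show "vector_measure borel (\<mu> t)"
      proof (cases "W t < \<infinity>")
        case True
        have "vector_measure torus_lebesgue (\<lambda>A. LINT z|torus_lebesgue. indicator A z * g0 (t, z))"
          by (rule density_vector_measure(1)[OF good[OF True]])
        then show ?thesis using True unfolding \<mu>_def[abs_def] by (simp add: vector_measure_cong_sets[of torus_lebesgue borel])
      next
        case False
        then show ?thesis unfolding \<mu>_def[abs_def] by (simp add: vector_measure_def)
      qed
    next
      fix B :: "torus set" assume B: "B \<in> sets borel"
      then have "(\<lambda>t. \<mu> t B) \<in> borel_measurable lborel"
        unfolding \<mu>_def by measurable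
      then show "(\<lambda>t. \<mu> t B) \<in> borel_measurable (restrict_space borel I)" by (intro measurable_restrict_space1) simp
    next
      have "(\<integral>\<^sup>+t\<in>I. tv_norm borel (\<mu> t) \<partial>lborel) \<le> (\<integral>\<^sup>+t. W t \<partial>lborel)"
      proof (rule nn_integral_mono)
        fix t
        have "tv_norm borel (\<mu> t) \<le> W t"
        proof (cases "W t < \<infinity>")
          case True
          have "tv_norm borel (\<mu> t) = tv_norm torus_lebesgue (\<lambda>A. LINT z|torus_lebesgue. indicator A z * g0 (t, z))"
            using True unfolding \<mu>_def[abs_def] tv_norm_def by simp
          also have "\<dots> \<le> W t" unfolding W_def by (rule tv_norm_density_le[OF good[OF True]])
          finally show ?thesis .
        next
          case False
          then show ?thesis by (simp add: top_unique not_less)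
        qed
        then show "tv_norm borel (\<mu> t) * indicator I t \<le> W t" by (auto simp: indicator_def)
      qed
      then show "(\<integral>\<^sup>+t\<in>I. tv_norm borel (\<mu> t) \<partial>lborel) < \<infinity>" using Wint by (rule le_less_trans)
    qed
  next
    fix A assume A: "A \<in> sets (slab I)"
    then have A': "A \<subseteq> I \<times> UNIV" "A \<in> sets borel" using sets_slab_iff[OF I] by auto
    have AL: "A \<in> sets (lborel \<Otimes>\<^sub>M torus_lebesgue)" using A'(2) unfolding sets_lborel_torus .
    have i: "integrable L (\<lambda>x. indicator A x * g0 x)"
      using integrable_real_mult_indicator[OF AL[folded L_def] g0i] by (simp add: mult.commute)
    have "(LINT x|slab I. indicator A x * g x) = (LINT x|L. indicator A x * g0 x)"
      unfolding slab_def L_def[symmetric] integral_restrict_space[OF IL] g0_def by (simp add: mult_ac)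
    also have "\<dots> = (LINT t|lborel. LINT z|torus_lebesgue. indicator A (t, z) * g0 (t, z))"
      using i unfolding L_def by (rule PS.integral_fst'[symmetric])
    also have "\<dots> = (LINT t|lborel. indicator I t * \<mu> t {z. (t, z) \<in> A})"
    proof (rule integral_cong_AE)
      have m1: "(\<lambda>t. LINT z|torus_lebesgue. indicator A (t, z) * g0 (t, z)) \<in> borel_measurable lborel"
        using AL by measurable
      then show "(\<lambda>t. LINT z|torus_lebesgue. indicator A (t, z) * g0 (t, z)) \<in> borel_measurable lborel" .
      have e: "indicator I t * \<mu> t {z. (t, z) \<in> A} = indicator I t * (if W t < \<infinity> then (LINT z|torus_lebesgue. indicator A (t, z) * g0 (t, z)) else 0)" for t
      proof -
        have "(indicator {z. (t, z) \<in> A} :: torus \<Rightarrow> real) = (\<lambda>z. indicator A (t, z))" by (auto simp: fun_eq_iff indicator_def)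
        then show ?thesis by (simp add: \<mu>_def)
      qed
      have "(\<lambda>t. indicator I t * (if W t < \<infinity> then (LINT z|torus_lebesgue. indicator A (t, z) * g0 (t, z)) else 0)) \<in> borel_measurable lborel"
        using I m1 by measurable
      then show "(\<lambda>t. indicator I t * \<mu> t {z. (t, z) \<in> A}) \<in> borel_measurable lborel" unfolding e .
      show "AE t in lborel. (LINT z|torus_lebesgue. indicator A (t, z) * g0 (t, z)) = indicator I t * \<mu> t {z. (t, z) \<in> A}"
        using AEW
      proof eventually_elim
        case (elim t)
        have "t \<notin> I \<Longrightarrow> (\<lambda>z. indicator A (t, z) * g0 (t, z)) = (\<lambda>z. 0)" by (simp add: g0_def)
        then show ?case unfolding e using elim by (cases "t \<in> I") (simp_all add: less_top)
      qed
    qed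
    finally show "(LINT x|slab I. indicator A x * g x) = time_integral I \<mu> A"
      by (simp add: time_integral_def set_lebesgue_integral_def)
  qed
qed

section \<open>Equicontinuous sequences\<close>

lemma uniform_limit_of_Cauchy:
  fixes a :: "nat \<Rightarrow> 'a \<Rightarrow> real"
  assumes C: "uniformly_Cauchy_on X a" and l: "\<And>x. x \<in> X \<Longrightarrow> (\<lambda>n. a n x) \<longlonglongrightarrow> l x"
  shows "uniform_limit X a l sequentially"
  unfolding uniform_limit_sequentially_iff
proof (intro allI impI)
  fix e :: real assume e: "0 < e"
  then have "0 < e / 2" by simp
  then obtain N where N: "\<And>x m n. x \<in> X \<Longrightarrow> m \<ge> N \<Longrightarrow> n \<ge> N \<Longrightarrow> dist (a m x) (a n x) < e / 2"
    using C unfolding uniformly_Cauchy_on_def by blast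
  have "dist (a n x) (l x) < e" if "n \<ge> N" "x \<in> X" for n x
  proof -
    have lim: "(\<lambda>m. dist (a n x) (a m x)) \<longlonglongrightarrow> dist (a n x) (l x)" by (intro tendsto_intros l that)
    have "dist (a n x) (l x) \<le> e / 2"
      by (rule LIMSEQ_le_const2[OF lim]) (use N[OF that(2) that(1)] less_imp_le in blast)
    then show ?thesis using e by simp
  qed
  then show "\<exists>N. \<forall>n\<ge>N. \<forall>x\<in>X. dist (a n x) (l x) < e" by blast
qed

text \<open>On a cell of length \<open>h\<close> a function differs from its mean by at most
  \<open>e / 4\<close>, and the finitely many means converge. Unlike with the Arzela-Ascoli theorem,
  the whole sequence is seen to be uniformly Cauchy, with no further extraction.\<close>

lemma Hoelder_uniformly_Cauchy:
  fixes a :: "nat \<Rightarrow> real \<Rightarrow> real"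
  assumes T: "0 < T" and H: "0 \<le> H"
    and cont: "\<And>n. continuous_on {0..T} (a n)"
    and hol: "\<And>n s t. 0 \<le> s \<Longrightarrow> s \<le> t \<Longrightarrow> t \<le> T \<Longrightarrow> \<bar>a n t - a n s\<bar> \<le> H * sqrt (t - s)"
    and avg: "\<And>s t. 0 \<le> s \<Longrightarrow> s \<le> t \<Longrightarrow> t \<le> T \<Longrightarrow> convergent (\<lambda>n. LINT r:{s..t}|lborel. a n r)"
  shows "uniformly_Cauchy_on {0..T} a"
proof (rule uniformly_Cauchy_onI)
  fix e :: real assume e: "0 < e"
  \<comment> \<open>Makes the oscillation over one cell at most \<open>e / 4\<close>;
    \<open>H + 1\<close> is positive even when \<open>H = 0\<close>.\<close>
  obtain m :: nat where m: "T * (4 * (H + 1) / e)\<^sup>2 < real m" using reals_Archimedean2 by blast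
  define M where "M = Suc m"
  define h where "h = T / real M"
  have h: "0 < h" using T by (simp add: h_def M_def)
  have "H * sqrt h \<le> e / 4"
  proof -
    have "T * (4 * (H + 1) / e)\<^sup>2 \<le> real M" using m by (simp add: M_def)
    then have "h * (4 * (H + 1) / e)\<^sup>2 \<le> 1" by (simp add: h_def M_def divide_le_eq)
    then have "sqrt (h * (4 * (H + 1) / e)\<^sup>2) \<le> 1" by simp
    then have "sqrt h * (4 * (H + 1) / e) \<le> 1" using H e by (simp add: real_sqrt_mult)
    then have "(H + 1) * sqrt h \<le> e / 4" using e by (simp add: field_simps)
    moreover have "H * sqrt h \<le> (H + 1) * sqrt h" using h by (intro mult_right_mono) auto
    ultimately show ?thesis by linarith
  qed
  note Hh = this
  define I where "I i = {real i * h..real (Suc i) * h}" for i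
  define A where "A i n = (LINT r:I i|lborel. a n r)" for i n
  have hM: "real M * h = T" by (simp add: h_def M_def)
  have Isub: "0 \<le> real i * h" "real i * h \<le> real (Suc i) * h" "real (Suc i) * h \<le> T" if "i < M" for i
  proof -
    show "0 \<le> real i * h" "real i * h \<le> real (Suc i) * h" using h by (auto intro: mult_right_mono)
    have "real (Suc i) * h \<le> real M * h" using that h by (intro mult_right_mono) auto
    then show "real (Suc i) * h \<le> T" by (simp add: hM)
  qed
  have "\<forall>i<M. \<exists>N. \<forall>n\<ge>N. \<forall>n'\<ge>N. \<bar>A i n - A i n'\<bar> < h * (e / 4)"
  proof (intro allI impI)
    fix i assume "i < M"
    then have "convergent (A i)" unfolding A_def[abs_def] I_def by (intro avg Isub)
    then have "Cauchy (A i)" by (rule convergent_Cauchy)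
    moreover have "0 < h * (e / 4)" using h e by simp
    ultimately show "\<exists>N. \<forall>n\<ge>N. \<forall>n'\<ge>N. \<bar>A i n - A i n'\<bar> < h * (e / 4)"
      unfolding Cauchy_def dist_real_def by blast
  qed
  then obtain Nf where Nf: "\<And>i n n'. i < M \<Longrightarrow> n \<ge> Nf i \<Longrightarrow> n' \<ge> Nf i \<Longrightarrow> \<bar>A i n - A i n'\<bar> < h * (e / 4)" by metis
  define N where "N = (\<Sum>i<M. Nf i)"
  have NfN: "Nf i \<le> N" if "i < M" for i unfolding N_def using that by (intro member_le_sum) auto
  have "dist (a n t) (a n' t) < e" if t: "t \<in> {0..T}" and n: "n \<ge> N" "n' \<ge> N" for t n n'
  proof -
    obtain i where i: "i < M" "t \<in> I i"
    proof -
      \<comment> \<open>The cells are numbered 0 to \<open>m\<close>; the minimum catches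
        \<open>t = T\<close>, for which the floor is \<open>Suc m\<close>.\<close>
      define i where "i = min m (nat \<lfloor>t / h\<rfloor>)"
      have t0: "0 \<le> t / h" using t h by simp
      have f1: "real (nat \<lfloor>t / h\<rfloor>) \<le> t / h" "t / h < real (nat \<lfloor>t / h\<rfloor>) + 1" using t0 by linarith+
      have "real i * h \<le> t"
      proof -
        have "real i \<le> t / h" using f1(1) by (simp add: i_def)
        then show ?thesis using h by (simp add: le_divide_eq)
      qed
      moreover have "t \<le> real (Suc i) * h"
      proof (cases "nat \<lfloor>t / h\<rfloor> \<le> m")
        case True
        then have "t / h \<le> real (Suc i)" using f1(2) by (simp add: i_def)
        then show ?thesis using h by (simp add: divide_le_eq)
      next
        case False
        then have "real (Suc i) * h = T" using hM by (simp add: i_def M_def)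
        then show ?thesis using t by simp
      qed
      ultimately have "t \<in> I i" by (simp add: I_def)
      moreover have "i < M" by (simp add: i_def M_def)
      ultimately show thesis using that by blast
    qed
    have bnd: "\<bar>h * a n t - A i n\<bar> \<le> h * (e / 4)" for n
    proof -
      have ai: "set_integrable lborel (I i) (a n)"
        unfolding I_def by (rule borel_integrable_atLeastAtMost') (rule continuous_on_subset[OF cont], use Isub[OF i(1)] in auto)
      have ci: "set_integrable lborel (I i) (\<lambda>r. c :: real)" for c
        unfolding I_def by (rule borel_integrable_atLeastAtMost') (rule continuous_on_const)
      have lc: "(LINT r:I i|lborel. c) = h * c" for c :: real
        unfolding set_lebesgue_integral_def I_def using Isub[OF i(1)] h by (simp add: algebra_simps)
      have "h * a n t - A i n = (LINT r:I i|lborel. a n t - a n r)"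
        unfolding A_def lc[symmetric] by (rule set_integral_diff(2)[OF ci ai, symmetric])
      also have "\<bar>\<dots>\<bar> \<le> (LINT r:I i|lborel. \<bar>a n t - a n r\<bar>)"
        unfolding set_lebesgue_integral_def
        using integral_abs_bound[of lborel "\<lambda>r. indicator (I i) r *\<^sub>R (a n t - a n r)"] by (simp add: abs_mult)
      also have "\<dots> \<le> (LINT r:I i|lborel. e / 4)"
      proof (rule set_integral_mono)
        show "set_integrable lborel (I i) (\<lambda>r. \<bar>a n t - a n r\<bar>)"
          by (intro set_integrable_abs set_integral_diff(1) ci ai)
        show "set_integrable lborel (I i) (\<lambda>r. e / 4)" by (rule ci)
        fix r assume r: "r \<in> I i"
        have d: "\<bar>t - r\<bar> \<le> h" using r i(2) by (auto simp: I_def abs_le_iff algebra_simps)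
        have rT: "0 \<le> r" "r \<le> T" using r Isub[OF i(1)] by (auto simp: I_def)
        have "\<bar>a n t - a n r\<bar> \<le> H * sqrt \<bar>t - r\<bar>"
        proof (cases "r \<le> t")
          case True
          then show ?thesis using hol[of r t n] rT t by simp
        next
          case False
          then show ?thesis using hol[of t r n] rT t by (simp add: abs_minus_commute)
        qed
        also have "\<dots> \<le> H * sqrt h" using d H by (intro mult_left_mono) auto
        finally show "\<bar>a n t - a n r\<bar> \<le> e / 4" using Hh by linarith
      qed
      finally show ?thesis by (simp add: lc)
    qed
    have "\<bar>A i n - A i n'\<bar> < h * (e / 4)" using Nf[OF i(1)] NfN[OF i(1)] n by (meson order_trans)
    moreover define q where "q = h * (e / 4)"
    ultimately have "\<bar>h * a n t - h * a n' t\<bar> < 4 * q" using bnd[of n] bnd[of n'] by linarith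
    then have "\<bar>h * a n t - h * a n' t\<bar> < h * e" by (simp add: q_def)
    then have "h * \<bar>a n t - a n' t\<bar> < h * e" using h by (simp add: right_diff_distrib[symmetric] abs_mult)
    then show ?thesis using h by (simp add: dist_real_def)
  qed
  then show "\<exists>M. \<forall>x\<in>{0..T}. \<forall>m\<ge>M. \<forall>n\<ge>M. dist (a m x) (a n x) < e" by blast
qed

section \<open>Uniform space-time bounds\<close>

lemma sets_borel_section: "A \<in> sets (borel :: (real \<times> torus) measure) \<Longrightarrow> {z. (t, z) \<in> A} \<in> sets borel"
  by (rule section_sets)

context ce_curve
begin

lemma spacetime_momentum:
  assumes I: "I \<in> sets borel" "I \<subseteq> {0..T}"
  shows "vector_measure (slab I) (time_integral I (\<lambda>t. momentum V (\<sigma> t)))"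
    and "\<And>A. A \<in> sets borel \<Longrightarrow> set_integrable lborel I (\<lambda>t. momentum V (\<sigma> t) {z. (t, z) \<in> A})"
    and "vector_measure (slab I) (time_integral I (\<lambda>t. measure (\<rho> t)))"
    and "\<And>A. A \<in> sets borel \<Longrightarrow> set_integrable lborel I (\<lambda>t. measure (\<rho> t) {z. (t, z) \<in> A})"
proof -
  have fi: "(\<integral>\<^sup>+t\<in>I. ennreal c \<partial>lborel) < \<infinity>" for c
  proof -
    have "(\<integral>\<^sup>+t\<in>I. ennreal c \<partial>lborel) \<le> (\<integral>\<^sup>+t\<in>{0..T}. ennreal c \<partial>lborel)"
      using I(2) by (intro nn_integral_mono) (auto simp: indicator_def)
    also have "\<dots> = ennreal c * ennreal T" using T by (simp add: nn_integral_cmult_indicator)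
    also have "\<dots> < \<infinity>" by (simp add: ennreal_mult_less_top)
    finally show ?thesis .
  qed
  note 1 = time_integral_vector_measure[where \<mu>="\<lambda>t. momentum V (\<sigma> t)" and h="\<lambda>_. ennreal V",
      OF I(1) vm_momentum measurable_restrict_mono[OF measurable_momentum I(2)] ennreal_leI[OF momentum_bound] fi]
  show "vector_measure (slab I) (time_integral I (\<lambda>t. momentum V (\<sigma> t)))"
    unfolding vector_measure_cong_sets[OF sets_slab] by (rule 1(1)) (use I(2) in auto)
  show "set_integrable lborel I (\<lambda>t. momentum V (\<sigma> t) {z. (t, z) \<in> A})" if "A \<in> sets borel" for A
    by (rule 1(2)) (use I(2) that in auto)
  have b: "ennreal \<bar>measure (\<rho> t) A\<bar> \<le> ennreal 1" if "t \<in> {0..T}" for t A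
    using prob_space.prob_le_1[OF prob_\<rho>[OF that], of A] by (intro ennreal_leI) simp
  note 2 = time_integral_vector_measure[where \<mu>="\<lambda>t. measure (\<rho> t)" and h="\<lambda>_. ennreal 1",
      OF I(1) vm_\<rho> measurable_restrict_mono[OF measurable_\<rho> I(2)] b fi]
  show "vector_measure (slab I) (time_integral I (\<lambda>t. measure (\<rho> t)))"
    unfolding vector_measure_cong_sets[OF sets_slab] by (rule 2(1)) (use I(2) in auto)
  show "set_integrable lborel I (\<lambda>t. measure (\<rho> t) {z. (t, z) \<in> A})" if "A \<in> sets borel" for A
    by (rule 2(2)) (use I(2) that in auto)
qed

lemma spacetime_position_bound:
  assumes I: "I \<in> sets borel" "I \<subseteq> {0..T}" and A: "A \<in> sets (slab I)" and M: "1 < M"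
  shows "0 \<le> time_integral I (\<lambda>t. measure (\<rho> t)) A"
    and "time_integral I (\<lambda>t. measure (\<rho> t)) A \<le> 2 * M * measure (slab I) A + T * K1 / ln M"
proof -
  have A': "A \<in> sets borel" using A sets_slab_iff[OF I(1)] by auto
  have fI: "emeasure lborel I < \<infinity>"
    using emeasure_mono[OF I(2), of lborel] T by (simp add: le_less_trans)
  let ?p = "\<lambda>t. indicator I t * measure (\<rho> t) {z. (t, z) \<in> A}"
  let ?a = "\<lambda>t. indicator I t * measure torus_lebesgue {z. (t, z) \<in> A}"
  have ip: "integrable lborel ?p" using spacetime_momentum(4)[OF I A'] by (simp add: set_integrable_def)
  have ia: "integrable lborel ?a" using lebesgue_family[OF I(1) fI A'] by (simp add: set_integrable_def)
  have ic: "integrable lborel (\<lambda>t. indicator {0..T} t * (K1 / ln M))" using T by simp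
  show "0 \<le> time_integral I (\<lambda>t. measure (\<rho> t)) A"
    by (simp add: time_integral_def set_lebesgue_integral_def Bochner_Integration.integral_nonneg)
  have "time_integral I (\<lambda>t. measure (\<rho> t)) A = (LINT t|lborel. ?p t)"
    by (simp add: time_integral_def set_lebesgue_integral_def)
  also have "\<dots> \<le> (LINT t|lborel. 2 * M * ?a t + indicator {0..T} t * (K1 / ln M))"
  proof (rule integral_mono[OF ip])
    show "integrable lborel (\<lambda>t. 2 * M * ?a t + indicator {0..T} t * (K1 / ln M))"
      by (intro Bochner_Integration.integrable_add integrable_mult_right ia ic)
    fix t
    have "0 \<le> K1 / ln M" using K1_pos M by simp
    then show "?p t \<le> 2 * M * ?a t + indicator {0..T} t * (K1 / ln M)"
      using position_set_estimate[OF _ sets_borel_section[OF A'] M, of t t] I(2) by (auto simp: indicator_def)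
  qed
  also have "\<dots> = 2 * M * (LINT t|lborel. ?a t) + (LINT t|lborel. indicator {0..T} t * (K1 / ln M))"
    using ia ic by simp
  also have "(LINT t|lborel. ?a t) = measure (slab I) A"
    unfolding measure_slab[OF I(1) fI A] by (simp add: set_lebesgue_integral_def)
  also have "(LINT t|lborel. indicator {0..T} t * (K1 / ln M)) = T * K1 / ln M" using T by simp
  finally show "time_integral I (\<lambda>t. measure (\<rho> t)) A \<le> 2 * M * measure (slab I) A + T * K1 / ln M" .
qed

text \<open>Integration in time turns the dissipation rate into \<open>K2\<close>. The parameters
  \<open>\<theta>\<close> and \<open>M\<close> remain free; \<open>momentum_equi\<close> chooses
  them before restricting the measure of \<open>A\<close>.\<close>

lemma spacetime_momentum_bound:
  assumes I: "I \<in> sets borel" "I \<subseteq> {0..T}" and A: "A \<in> sets (slab I)" and M: "1 < M" and \<theta>: "0 < \<theta>"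
  shows "\<bar>time_integral I (\<lambda>t. momentum V (\<sigma> t)) A\<bar>
    \<le> \<theta> * \<alpha> * K2 + ((2 + 2 * M) * measure (slab I) A + T * K1 / ln M) / \<theta>"
proof -
  have A': "A \<in> sets borel" using A sets_slab_iff[OF I(1)] by auto
  have fI: "emeasure lborel I < \<infinity>"
    using emeasure_mono[OF I(2), of lborel] T by (simp add: le_less_trans)
  let ?p = "\<lambda>t. indicator I t * measure (\<rho> t) {z. (t, z) \<in> A}"
  let ?a = "\<lambda>t. indicator I t * measure torus_lebesgue {z. (t, z) \<in> A}"
  let ?m = "\<lambda>t. indicator I t * momentum V (\<sigma> t) {z. (t, z) \<in> A}"
  obtain d where d: "\<And>t. 0 \<le> d t" "integrable lborel d" "(LINT t|lborel. d t) \<le> K2"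
    "AE t in lborel. t \<in> {0<..<T} \<longrightarrow> (\<forall>\<psi> \<theta>. continuous_on UNIV \<psi> \<longrightarrow> (\<forall>z. \<bar>\<psi> z\<bar> \<le> 1) \<longrightarrow> 0 < \<theta> \<longrightarrow>
      V * \<bar>LINT q|\<sigma> t. vel (snd q) * \<psi> (fst q)\<bar>
        \<le> \<theta> * \<alpha> * d t + (2 * \<delta> * (LINT z|torus_lebesgue. (\<psi> z)\<^sup>2) + (LINT z|\<rho> t. (\<psi> z)\<^sup>2)) / \<theta>)"
    by (rule momentum_estimate) (rule that)
  have ip: "integrable lborel ?p" using spacetime_momentum(4)[OF I A'] by (simp add: set_integrable_def)
  have im: "integrable lborel ?m" using spacetime_momentum(2)[OF I A'] by (simp add: set_integrable_def)
  have ia: "integrable lborel ?a" using lebesgue_family[OF I(1) fI A'] by (simp add: set_integrable_def)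
  have "\<bar>time_integral I (\<lambda>t. momentum V (\<sigma> t)) A\<bar> = \<bar>LINT t|lborel. ?m t\<bar>"
    by (simp add: time_integral_def set_lebesgue_integral_def)
  also have "\<dots> \<le> (LINT t|lborel. \<bar>?m t\<bar>)" by (rule integral_abs_bound)
  also have "\<dots> \<le> (LINT t|lborel. \<theta> * \<alpha> * d t + (2 / \<theta> * ?a t + 1 / \<theta> * ?p t))"
  proof (rule integral_mono_AE)
    show "integrable lborel (\<lambda>t. \<bar>?m t\<bar>)" using im by (rule integrable_abs)
    show "integrable lborel (\<lambda>t. \<theta> * \<alpha> * d t + (2 / \<theta> * ?a t + 1 / \<theta> * ?p t))"
      by (intro Bochner_Integration.integrable_add integrable_mult_right ia ip d)
    \<comment> \<open>The pointwise estimate holds on the open interval only; the two end points are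
      removed as a null set.\<close>
    have "AE t in lborel. t \<noteq> 0" "AE t in lborel. t \<noteq> T" by (rule AE_lborel_singleton)+
    then show "AE t in lborel. \<bar>?m t\<bar> \<le> \<theta> * \<alpha> * d t + (2 / \<theta> * ?a t + 1 / \<theta> * ?p t)"
      using d(4)
    proof eventually_elim
      case (elim t)
      show ?case
      proof (cases "t \<in> I")
        case False
        then show ?thesis using \<theta> \<alpha> d(1)[of t] by simp
      next
        case True
        then have t: "t \<in> {0..T}" "t \<in> {0<..<T}" using I(2) elim(1,2) by force+
        let ?B = "{z. (t, z) \<in> A}"
        have "\<bar>momentum V (\<sigma> t) ?B\<bar> \<le> \<theta> * \<alpha> * d t + (2 * \<delta> * measure torus_lebesgue ?B + measure (\<rho> t) ?B) / \<theta>"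
          by (rule momentum_set_estimate[OF t(1) sets_borel_section[OF A'] \<theta>]) (use elim(3) t(2) \<theta> in blast)
        also have "\<dots> \<le> \<theta> * \<alpha> * d t + (2 * measure torus_lebesgue ?B + measure (\<rho> t) ?B) / \<theta>"
        proof -
          have "\<delta> * measure torus_lebesgue ?B \<le> measure torus_lebesgue ?B"
            using \<delta>_le_1 by (intro mult_left_le_one_le) (use \<delta>_pos in auto)
          then show ?thesis using \<theta> by (simp add: divide_right_mono)
        qed
        finally show ?thesis using True by (simp add: add_divide_distrib)
      qed
    qed
  qed
  also have "\<dots> = \<theta> * \<alpha> * (LINT t|lborel. d t) + (2 / \<theta> * (LINT t|lborel. ?a t) + 1 / \<theta> * (LINT t|lborel. ?p t))"
    using ia ip d(2) by simp
  also have "(LINT t|lborel. ?a t) = measure (slab I) A"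
    unfolding measure_slab[OF I(1) fI A] by (simp add: set_lebesgue_integral_def)
  also have "(LINT t|lborel. ?p t) = time_integral I (\<lambda>t. measure (\<rho> t)) A"
    by (simp add: time_integral_def set_lebesgue_integral_def)
  also have "\<theta> * \<alpha> * (LINT t|lborel. d t) + (2 / \<theta> * measure (slab I) A + 1 / \<theta> * time_integral I (\<lambda>t. measure (\<rho> t)) A)
    \<le> \<theta> * \<alpha> * K2 + (2 / \<theta> * measure (slab I) A + 1 / \<theta> * (2 * M * measure (slab I) A + T * K1 / ln M))"
    using \<theta> \<alpha> d(3) spacetime_position_bound(2)[OF I A M] by (intro add_mono mult_left_mono order_refl) auto
  also have "\<dots> = \<theta> * \<alpha> * K2 + ((2 + 2 * M) * measure (slab I) A + T * K1 / ln M) / \<theta>"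
    using \<theta> by (simp add: field_simps)
  finally show ?thesis .
qed

lemma spacetime_flux:
  shows "vector_measure (slab {0<..<T}) (time_integral {0<..<T} (\<lambda>t. net_flux V (j t)))"
    and "\<And>A. A \<in> sets borel \<Longrightarrow> set_integrable lborel {0<..<T} (\<lambda>t. net_flux V (j t) {z. (t, z) \<in> A})"
proof -
  have I: "{0<..<T} \<in> sets borel" by simp
  note 1 = time_integral_vector_measure[where \<mu>="\<lambda>t. net_flux V (j t)" and h="\<lambda>t. tv_norm borel (j t)",
      OF I vm_net_flux measurable_net_flux net_flux_bound tv_j]
  show "vector_measure (slab {0<..<T}) (time_integral {0<..<T} (\<lambda>t. net_flux V (j t)))"
    unfolding vector_measure_cong_sets[OF sets_slab] by (rule 1(1))
  show "set_integrable lborel {0<..<T} (\<lambda>t. net_flux V (j t) {z. (t, z) \<in> A})" if "A \<in> sets borel" for A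
    by (rule 1(2)) (use that in auto)
qed

text \<open>Both signs of the test function together bound \<open>s\<close> times the modulus of
  flux minus momentum/(2 \<alpha>); dividing by \<open>s\<close> leaves \<open>C / s\<close>, small
  for large \<open>s\<close>.\<close>

lemma spacetime_flux_bound:
  assumes A: "A \<in> sets (slab {0<..<T})" and s: "0 < s" "s \<le> V"
  shows "\<bar>time_integral {0<..<T} (\<lambda>t. net_flux V (j t)) A\<bar>
    \<le> \<bar>time_integral {0<..<T} (\<lambda>t. momentum V (\<sigma> t)) A\<bar> / (2 * \<alpha>) + C / s
      + s / (2 * \<alpha>) * time_integral {0<..<T} (\<lambda>t. measure (\<rho> t)) A"
proof -
  let ?I = "{0<..<T}"
  have I: "?I \<in> sets borel" "?I \<subseteq> {0..T}" by auto
  have A': "A \<in> sets borel" using A sets_slab_iff[OF I(1)] by auto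
  let ?f = "\<lambda>t. net_flux V (j t) {z. (t, z) \<in> A}"
  let ?m = "\<lambda>t. momentum V (\<sigma> t) {z. (t, z) \<in> A}"
  let ?p = "\<lambda>t. measure (\<rho> t) {z. (t, z) \<in> A}"
  let ?F = "time_integral ?I (\<lambda>t. net_flux V (j t)) A"
  let ?W = "time_integral ?I (\<lambda>t. momentum V (\<sigma> t)) A"
  let ?P = "time_integral ?I (\<lambda>t. measure (\<rho> t)) A"
  note i = spacetime_flux(2)[OF A'] spacetime_momentum(2)[OF I A'] spacetime_momentum(4)[OF I A']
  have "\<epsilon> * s * (?F - ?W / (2 * \<alpha>)) - s\<^sup>2 / (2 * \<alpha>) * ?P \<le> C" if \<epsilon>: "\<bar>\<epsilon>\<bar> = 1" for \<epsilon> :: real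
  proof -
    let ?X = "\<lambda>t. \<epsilon> * s * (?f t - ?m t / (2 * \<alpha>)) - s\<^sup>2 / (2 * \<alpha>) * ?p t"
    have iX1: "set_integrable lborel ?I (\<lambda>t. \<epsilon> * s * (?f t - ?m t / (2 * \<alpha>)))"
      using i by (intro set_integrable_mult_right set_integral_diff(1) set_integrable_divide)
    have iX2: "set_integrable lborel ?I (\<lambda>t. s\<^sup>2 / (2 * \<alpha>) * ?p t)"
      using i by (intro set_integrable_mult_right)
    have im: "set_integrable lborel ?I (\<lambda>t. ?m t / (2 * \<alpha>))" using i(2) by (rule set_integrable_divide)
    have eq: "(LINT t:?I|lborel. ?X t) = \<epsilon> * s * (?F - ?W / (2 * \<alpha>)) - s\<^sup>2 / (2 * \<alpha>) * ?P"
      unfolding time_integral_def set_integral_diff(2)[OF iX1 iX2] set_integral_mult_right set_integral_diff(2)[OF i(1) im] by simp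
    have "(LINT t:?I|lborel. ?X t) \<le> C"
    proof (rule integral_le_action)
      show "set_integrable lborel ?I ?X" using iX1 iX2 by (rule set_integral_diff(1))
      show "AE r in lborel. r \<in> ?I \<longrightarrow> ennreal (?X r) \<le> lagrangian \<alpha> V (\<sigma> r) (j r)"
        by (intro AE_I2 impI) (rule flux_le_lagrangian[OF _ sets_borel_section[OF A'] s \<epsilon>])
    qed auto
    then show ?thesis unfolding eq .
  qed
  note pm = this[of 1] this[of "-1"]
  have b: "s * \<bar>?F - ?W / (2 * \<alpha>)\<bar> \<le> C + s\<^sup>2 / (2 * \<alpha>) * ?P"
  proof -
    let ?D = "s * (?F - ?W / (2 * \<alpha>))"
    have "s * \<bar>?F - ?W / (2 * \<alpha>)\<bar> = \<bar>?D\<bar>" using s by (simp add: abs_mult)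
    then show ?thesis using pm by (simp only: abs_le_iff) simp
  qed
  have "\<bar>?F - ?W / (2 * \<alpha>)\<bar> \<le> (C + s\<^sup>2 / (2 * \<alpha>) * ?P) / s"
    using b s by (simp add: le_divide_eq mult.commute)
  also have "\<dots> = C / s + s / (2 * \<alpha>) * ?P" using s \<alpha> by (simp add: field_simps power2_eq_square)
  finally have c: "\<bar>?F - ?W / (2 * \<alpha>)\<bar> \<le> C / s + s / (2 * \<alpha>) * ?P" .
  have "\<bar>?W / (2 * \<alpha>)\<bar> = \<bar>?W\<bar> / (2 * \<alpha>)" using \<alpha> by simp
  then show ?thesis using c by linarith
qed

text \<open>A test function independent of the velocity does not see the jumps, so only the momentum
  acts. The weight \<open>\<theta> = sqrt (t - s)\<close> balances the dissipation term, of order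
  \<open>\<theta>\<close>, against \<open>(t - s) / \<theta>\<close>, which produces the exponent
  one half; the 3 bounds \<open>2 * \<delta> + 1\<close>.\<close>

lemma position_Hoelder:
  assumes \<phi>: "torus_deriv \<phi> \<phi>'" "continuous_on UNIV \<phi>'" "continuous_on UNIV \<phi>" and B: "0 < B" "\<And>z. \<bar>\<phi>' z\<bar> \<le> B"
    and st: "0 \<le> s" "s \<le> t" "t \<le> T"
  shows "\<bar>(LINT z|\<rho> t. \<phi> z) - (LINT z|\<rho> s. \<phi> z)\<bar> \<le> B * (\<alpha> * K2 + 3) * sqrt (t - s)"
proof (cases "s = t")
  case True
  then show ?thesis by simp
next
  case False
  define \<theta> where "\<theta> = sqrt (t - s)"
  have \<theta>: "0 < \<theta>" using False st by (simp add: \<theta>_def)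
  have \<theta>2: "\<theta> * \<theta> = t - s" using st by (simp add: \<theta>_def)
  have m: "\<phi> \<in> borel_measurable borel" "\<phi>' \<in> borel_measurable borel" by (intro borel_measurable_continuous_onI \<phi>)+
  define F where "F r = signed_integral borel (flux1 (j r)) (\<lambda>q. \<phi>' (fst q))" for r
  have mf: "(\<lambda>q :: phase. \<phi>' (fst q)) \<in> borel_measurable borel"
    by (rule phase_measurable[where F="\<lambda>z b. \<phi>' z"]) (rule m)
  have iF: "set_integrable lborel {s<..<t} F"
    unfolding F_def[abs_def] by (rule set_integrable_subset[OF flux_integrable(1)[OF mf, of B]]) (use B(2) st in auto)
  have e: "(LINT z|\<rho> t. \<phi> z) - (LINT z|\<rho> s. \<phi> z) = (LINT r:{s<..<t}|lborel. F r)"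
  proof -
    note C = torus_deriv_C10[where F="\<lambda>b. \<phi>" and G="\<lambda>b. \<phi>'", OF \<phi>(1,2)]
    have "(\<lambda>p. \<phi> (fst (flip p)) - \<phi> (fst p)) = (\<lambda>p. 0)" by (simp add: flip_def case_prod_beta')
    then show ?thesis
      using CE_eq[OF C(1) st] st by (simp add: integral_\<rho>[OF _ m(1)] C(2) F_def signed_integral_def)
  qed
  obtain d where d: "\<And>t. 0 \<le> d t" "integrable lborel d" "(LINT t|lborel. d t) \<le> K2"
    "AE t in lborel. t \<in> {0<..<T} \<longrightarrow> (\<forall>\<psi> \<theta>. continuous_on UNIV \<psi> \<longrightarrow> (\<forall>z. \<bar>\<psi> z\<bar> \<le> 1) \<longrightarrow> 0 < \<theta> \<longrightarrow>
      V * \<bar>LINT q|\<sigma> t. vel (snd q) * \<psi> (fst q)\<bar>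
        \<le> \<theta> * \<alpha> * d t + (2 * \<delta> * (LINT z|torus_lebesgue. (\<psi> z)\<^sup>2) + (LINT z|\<rho> t. (\<psi> z)\<^sup>2)) / \<theta>)"
    by (rule momentum_estimate) (rule that)
  \<comment> \<open>Normalized to meet the bound 1 on test functions.\<close>
  define \<psi> where "\<psi> z = \<phi>' z / B" for z
  have \<psi>: "continuous_on UNIV \<psi>" "\<bar>\<psi> z\<bar> \<le> 1" for z
    unfolding \<psi>_def[abs_def] using B \<phi>(2) by (auto intro!: continuous_intros simp: divide_le_eq)
  have \<psi>m [measurable]: "\<psi> \<in> borel_measurable borel" by (rule borel_measurable_continuous_onI[OF \<psi>(1)])
  have sq: "(LINT z|Q. (\<psi> z)\<^sup>2) \<le> 1" if Q: "prob_space Q" "sets Q = sets borel" for Q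
  proof -
    have "\<bar>(\<psi> z)\<^sup>2\<bar> \<le> 1" for z using \<psi>(2)[of z] by (simp add: abs_square_le_1)
    moreover from this have "integrable Q (\<lambda>z. (\<psi> z)\<^sup>2)"
      by (intro integrable_bounded[of _ _ 1] prob_space.finite_measure Q) (simp_all add: measurable_cong_sets[OF Q(2) refl])
    ultimately show ?thesis by (intro prob_space.integral_le_const[OF Q(1)]) auto
  qed
  have cv: "continuous_on UNIV (\<lambda>q :: phase. vel (snd q) * \<phi>' (fst q))"
    by (rule phase_continuous[where F="\<lambda>z b. vel b * \<phi>' z"]) (intro continuous_intros \<phi>)
  have "\<bar>vel (snd q) * \<phi>' (fst q)\<bar> \<le> B" for q :: phase using B(2)[of "fst q"] by (simp add: vel_def)
  from AE_flux1[OF cv this]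
  have "AE r in lborel. r \<in> {0<..<T} \<longrightarrow> F r = V * (LINT q|\<sigma> r. vel (snd q) * \<phi>' (fst q))"
  proof (rule AE_mp, intro AE_I2 impI)
    have "(\<lambda>q :: phase. vel (snd q) * (vel (snd q) * \<phi>' (fst q))) = (\<lambda>q. \<phi>' (fst q))" by (auto simp: vel_def)
    then show "F r = V * (LINT q|\<sigma> r. vel (snd q) * \<phi>' (fst q))" if "r \<in> {0<..<T} \<longrightarrow>
        signed_integral borel (flux1 (j r)) (\<lambda>q. vel (snd q) * (vel (snd q) * \<phi>' (fst q))) = V * (LINT q|\<sigma> r. vel (snd q) * \<phi>' (fst q))" "r \<in> {0<..<T}" for r
      using that by (simp add: F_def)
  qed
  then have "AE r in lborel. r \<in> {s<..<t} \<longrightarrow> \<bar>F r\<bar> \<le> B * (\<theta> * \<alpha> * d r + 3 / \<theta>)"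
    using d(4)
  proof eventually_elim
    case (elim r)
    show ?case
    proof
      assume "r \<in> {s<..<t}"
      then have r: "r \<in> {0<..<T}" "r \<in> {0..T}" using st by auto
      have Fr: "F r = B * (V * (LINT q|\<sigma> r. vel (snd q) * \<psi> (fst q)))"
        using elim(1) r(1) B(1) by (simp add: \<psi>_def)
      have "V * \<bar>LINT q|\<sigma> r. vel (snd q) * \<psi> (fst q)\<bar>
        \<le> \<theta> * \<alpha> * d r + (2 * \<delta> * (LINT z|torus_lebesgue. (\<psi> z)\<^sup>2) + (LINT z|\<rho> r. (\<psi> z)\<^sup>2)) / \<theta>"
        using elim(2) r(1) \<psi> \<theta> by blast
      also have "\<dots> \<le> \<theta> * \<alpha> * d r + (2 * 1 * 1 + 1) / \<theta>"
        using \<theta> \<delta>_le_1 \<delta>_pos sq[of torus_lebesgue] sq[OF prob_\<rho>[OF r(2)]] torus.prob_space_axioms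
        by (intro add_mono divide_right_mono mult_mono order_refl) auto
      finally have "B * (V * \<bar>LINT q|\<sigma> r. vel (snd q) * \<psi> (fst q)\<bar>) \<le> B * (\<theta> * \<alpha> * d r + 3 / \<theta>)"
        using B(1) by (intro mult_left_mono) auto
      then show "\<bar>F r\<bar> \<le> B * (\<theta> * \<alpha> * d r + 3 / \<theta>)" unfolding Fr using B(1) V by (simp add: abs_mult)
    qed
  qed
  note bd = this
  have "\<bar>LINT r:{s<..<t}|lborel. F r\<bar> \<le> (LINT r|lborel. \<bar>indicator {s<..<t} r * F r\<bar>)"
    unfolding set_lebesgue_integral_def real_scaleR_def by (rule integral_abs_bound)
  also have "\<dots> \<le> (LINT r|lborel. B * \<theta> * \<alpha> * d r + indicator {s<..<t} r * (B * 3 / \<theta>))"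
  proof (rule integral_mono_AE)
    show "integrable lborel (\<lambda>r. \<bar>indicator {s<..<t} r * F r\<bar>)"
      using iF unfolding set_integrable_def real_scaleR_def by (rule integrable_abs)
    show "integrable lborel (\<lambda>r. B * \<theta> * \<alpha> * d r + indicator {s<..<t} r * (B * 3 / \<theta>))"
      by (intro Bochner_Integration.integrable_add integrable_mult_right integrable_mult_left d(2)) (use st in simp)
    show "AE r in lborel. \<bar>indicator {s<..<t} r * F r\<bar> \<le> B * \<theta> * \<alpha> * d r + indicator {s<..<t} r * (B * 3 / \<theta>)"
      using bd
    proof eventually_elim
      case (elim r)
      have "0 \<le> B * \<theta> * \<alpha> * d r" using B(1) \<theta> \<alpha> d(1)[of r] by simp
      then show ?case using elim by (cases "r \<in> {s<..<t}") (simp_all add: ring_distribs mult.assoc)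
    qed
  qed
  also have "\<dots> = B * \<theta> * \<alpha> * (LINT r|lborel. d r) + (t - s) * (B * 3 / \<theta>)" using d(2) st by simp
  also have "\<dots> \<le> B * \<theta> * \<alpha> * K2 + (t - s) * (B * 3 / \<theta>)"
    using d(3) B(1) \<theta> \<alpha> by (intro add_mono mult_left_mono order_refl) auto
  also have "\<dots> = B * (\<alpha> * K2 + 3) * \<theta>" using \<theta> unfolding \<theta>2[symmetric] by (simp add: field_simps)
  finally show ?thesis unfolding e \<theta>_def .
qed

end

section \<open>Compactness\<close>

lemma convergent_uniform_approx:
  fixes a :: "nat \<Rightarrow> real"
  assumes "\<And>e. 0 < e \<Longrightarrow> \<exists>b. convergent b \<and> (\<forall>n. \<bar>a n - b n\<bar> \<le> e)"
  shows "convergent a"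
proof -
  have "\<exists>N. \<forall>m\<ge>N. \<forall>n\<ge>N. dist (a m) (a n) < e" if e: "0 < e" for e
  proof -
    define q where "q = e / 4"
    have q: "0 < q" "e = 4 * q" using e by (simp_all add: q_def)
    obtain b where b: "convergent b" "\<And>n. \<bar>a n - b n\<bar> \<le> q" using assms[OF q(1)] by blast
    obtain N where N: "\<And>m n. m \<ge> N \<Longrightarrow> n \<ge> N \<Longrightarrow> dist (b m) (b n) < q"
      using convergent_Cauchy[OF b(1)] q(1) unfolding Cauchy_def by blast
    have "dist (a m) (a n) < e" if "m \<ge> N" "n \<ge> N" for m n
      using N[OF that] b(2)[of m] b(2)[of n] q unfolding dist_real_def by linarith
    then show ?thesis by blast
  qed
  then have "Cauchy a" unfolding Cauchy_def by blast
  then show ?thesis by (simp add: Cauchy_convergent_iff)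
qed

lemma uniformly_Cauchy_approx:
  fixes a :: "nat \<Rightarrow> 'a \<Rightarrow> real"
  assumes "\<And>e. 0 < e \<Longrightarrow> \<exists>b. uniformly_Cauchy_on X b \<and> (\<forall>n. \<forall>x\<in>X. \<bar>a n x - b n x\<bar> \<le> e)"
  shows "uniformly_Cauchy_on X a"
proof (rule uniformly_Cauchy_onI)
  fix e :: real assume e: "0 < e"
  define q where "q = e / 4"
  have q: "0 < q" "e = 4 * q" using e by (simp_all add: q_def)
  obtain b where b: "uniformly_Cauchy_on X b" "\<And>n x. x \<in> X \<Longrightarrow> \<bar>a n x - b n x\<bar> \<le> q" using assms[OF q(1)] by blast
  obtain N where N: "\<And>x m n. x \<in> X \<Longrightarrow> m \<ge> N \<Longrightarrow> n \<ge> N \<Longrightarrow> dist (b m x) (b n x) < q"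
    using b(1) q(1) unfolding uniformly_Cauchy_on_def by blast
  have "dist (a m x) (a n x) < e" if "x \<in> X" "m \<ge> N" "n \<ge> N" for x m n
    using N[OF that] b(2)[OF that(1), of m] b(2)[OF that(1), of n] q unfolding dist_real_def by linarith
  then show "\<exists>M. \<forall>x\<in>X. \<forall>m\<ge>M. \<forall>n\<ge>M. dist (a m x) (a n x) < e" by blast
qed

lemma divide_ln_small:
  fixes c e :: real
  assumes "0 \<le> c" "0 < e"
  shows "\<exists>M>1. c / ln M \<le> e"
proof (intro exI conjI)
  have "0 \<le> c / e" using assms by simp
  \<comment> \<open>The summand 1 in the exponent keeps \<open>M\<close> above 1 when
    \<open>c = 0\<close>.\<close>
  then show "1 < exp (c / e + 1)" by simp
  have "c \<le> e * (c / e + 1)" using assms by (simp add: ring_distribs)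
  then show "c / ln (exp (c / e + 1)) \<le> e" using \<open>0 \<le> c / e\<close> by (simp add: divide_le_eq mult.commute)
qed

text \<open>Convergence against all bounded measurable functions towards a density: stronger than
  narrow convergence, inherited by subsequences, and the same for the open and the closed time
  interval.\<close>

definition bounded_weak_limit :: "'a measure \<Rightarrow> (nat \<Rightarrow> 'a set \<Rightarrow> real) \<Rightarrow> ('a \<Rightarrow> real) \<Rightarrow> bool"
  where "bounded_weak_limit L \<mu> g \<longleftrightarrow> (\<forall>\<psi> B. \<psi> \<in> borel_measurable L \<longrightarrow> (\<forall>x\<in>space L. \<bar>\<psi> x\<bar> \<le> B) \<longrightarrow>
    (\<lambda>n. signed_integral L (\<mu> n) \<psi>) \<longlonglongrightarrow> (LINT x|L. \<psi> x * g x))"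

lemma bounded_weak_limitD:
  assumes "bounded_weak_limit L \<mu> g" "\<psi> \<in> borel_measurable L" "\<And>x. x \<in> space L \<Longrightarrow> \<bar>\<psi> x\<bar> \<le> B"
  shows "(\<lambda>n. signed_integral L (\<mu> n) \<psi>) \<longlonglongrightarrow> (LINT x|L. \<psi> x * g x)"
  using assms unfolding bounded_weak_limit_def by blast

lemma bounded_weak_limit_subseq:
  assumes "bounded_weak_limit L \<mu> g" "strict_mono k"
  shows "bounded_weak_limit L (\<lambda>n. \<mu> (k n)) g"
  using assms(1) LIMSEQ_subseq_LIMSEQ[OF _ assms(2)] unfolding bounded_weak_limit_def comp_def by blast

lemma slab_compactness:
  fixes \<nu> :: "nat \<Rightarrow> (real \<times> torus) set \<Rightarrow> real"
  assumes I: "I \<in> sets borel" and fin: "finite_measure (slab I)" and vm: "\<And>n. vector_measure (slab I) (\<nu> n)"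
    and K: "\<exists>K. \<forall>n. \<forall>A\<in>sets (slab I). \<bar>\<nu> n A\<bar> \<le> K"
    and equi: "\<And>e. e > 0 \<Longrightarrow> \<exists>d>0. \<exists>N. \<forall>n\<ge>N. \<forall>A\<in>sets (slab I). measure (slab I) A < d \<longrightarrow> \<bar>\<nu> n A\<bar> \<le> e"
  shows "\<exists>k g. strict_mono k \<and> integrable (slab I) g \<and> bounded_weak_limit (slab I) (\<lambda>n. \<nu> (k n)) g"
proof -
  obtain G where G: "countable G" "G \<subseteq> Pow (space (slab I))" "sets (slab I) = sigma_sets (space (slab I)) G"
    by (rule slab_generator[OF I]) (rule that)
  obtain K where K': "\<And>n A. A \<in> sets (slab I) \<Longrightarrow> \<bar>\<nu> n A\<bar> \<le> K" using K by blast
  show ?thesis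
  proof (rule setwise_compactness_signed[where \<nu>=\<nu>, OF fin G vm K' equi], assumption, assumption)
    fix k and g :: "real \<times> torus \<Rightarrow> real" assume h: "strict_mono k" "integrable (slab I) g" "\<And>\<psi> B. \<psi> \<in> borel_measurable (slab I) \<Longrightarrow>
      (\<And>x. x \<in> space (slab I) \<Longrightarrow> \<bar>\<psi> x\<bar> \<le> B) \<Longrightarrow> (\<lambda>n. signed_integral (slab I) (\<nu> (k n)) \<psi>) \<longlonglongrightarrow> (LINT x|slab I. \<psi> x * g x)"
    then show ?thesis unfolding bounded_weak_limit_def by blast
  qed
qed

section \<open>Sequences of curves with V tending to infinity\<close>

locale ce_sequence =
  fixes \<alpha> T C :: real and V :: "nat \<Rightarrow> real" and \<sigma> :: "nat \<Rightarrow> real \<Rightarrow> phase measure"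
    and j :: "nat \<Rightarrow> real \<Rightarrow> phase set \<Rightarrow> real \<times> real"
  assumes ce: "\<And>n. ce_curve \<alpha> T (V n) C (\<sigma> n) (j n)" and V_lim: "filterlim V at_top sequentially"
begin

abbreviation "K1 \<equiv> ce_curve.K1 \<alpha> T C"
abbreviation "K2 \<equiv> ce_curve.K2 \<alpha> T C"
abbreviation "\<rho> n t \<equiv> position_marginal (\<sigma> n t)"
abbreviation "om I n \<equiv> time_integral I (\<lambda>t. momentum (V n) (\<sigma> n t))"
abbreviation "ps I n \<equiv> time_integral I (\<lambda>t. measure (\<rho> n t))"
abbreviation "fl n \<equiv> time_integral {0<..<T} (\<lambda>t. net_flux (V n) (j n t))"

lemma pos: "0 < \<alpha>" "0 < T" "0 < C" "1 \<le> V n" "0 < K1" "0 < K2"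
  using ce_curve.\<alpha>[OF ce] ce_curve.T[OF ce] ce_curve.C[OF ce] ce_curve.V[OF ce] ce_curve.K1_pos[OF ce] ce_curve.K2_pos[OF ce] by blast+

lemma slab_facts:
  assumes "I \<in> sets borel" "I \<subseteq> {0..T}"
  shows "emeasure lborel I < \<infinity>" "finite_measure (slab I)" "A \<in> sets (slab I) \<Longrightarrow> measure (slab I) A \<le> measure (slab I) (space (slab I))"
proof -
  show e: "emeasure lborel I < \<infinity>"
    using emeasure_mono[OF assms(2), of lborel] pos(2) by (simp add: le_less_trans)
  show f: "finite_measure (slab I)" by (rule finite_measure_slab[OF assms(1) e])
  show "A \<in> sets (slab I) \<Longrightarrow> measure (slab I) A \<le> measure (slab I) (space (slab I))"
    by (rule finite_measure.bounded_measure[OF f])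
qed

lemma position_bounded:
  assumes I: "I \<in> sets borel" "I \<subseteq> {0..T}"
  shows "\<exists>K. \<forall>n. \<forall>A\<in>sets (slab I). \<bar>ps I n A\<bar> \<le> K"
proof (intro exI allI ballI)
  fix n A assume A: "A \<in> sets (slab I)"
  \<comment> \<open>\<open>M = exp 1\<close> makes \<open>ln M = 1\<close>; any fixed value above 1
    would give some bound.\<close>
  have "ps I n A \<le> 2 * exp 1 * measure (slab I) A + T * K1 / ln (exp 1)"
    by (rule ce_curve.spacetime_position_bound(2)[OF ce I A]) simp
  also have "\<dots> \<le> 2 * exp 1 * measure (slab I) (space (slab I)) + T * K1 / ln (exp 1)"
    using slab_facts(3)[OF I A] by simp
  finally show "\<bar>ps I n A\<bar> \<le> 2 * exp 1 * measure (slab I) (space (slab I)) + T * K1 / ln (exp 1)"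
    using ce_curve.spacetime_position_bound(1)[OF ce I A, of "exp 1" n] by simp
qed

lemma momentum_bounded:
  assumes I: "I \<in> sets borel" "I \<subseteq> {0..T}"
  shows "\<exists>K. \<forall>n. \<forall>A\<in>sets (slab I). \<bar>om I n A\<bar> \<le> K"
proof (intro exI allI ballI)
  fix n A assume A: "A \<in> sets (slab I)"
  have "\<bar>om I n A\<bar> \<le> 1 * \<alpha> * K2 + ((2 + 2 * exp 1) * measure (slab I) A + T * K1 / ln (exp 1)) / 1"
    by (rule ce_curve.spacetime_momentum_bound[OF ce I A]) simp_all
  also have "\<dots> \<le> 1 * \<alpha> * K2 + ((2 + 2 * exp 1) * measure (slab I) (space (slab I)) + T * K1 / ln (exp 1)) / 1"
    using slab_facts(3)[OF I A] by (intro add_mono divide_right_mono mult_left_mono order_refl) auto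
  finally show "\<bar>om I n A\<bar> \<le> 1 * \<alpha> * K2 + ((2 + 2 * exp 1) * measure (slab I) (space (slab I)) + T * K1 / ln (exp 1)) / 1" .
qed

text \<open>First \<open>M\<close> makes the entropy term small, then the measure of
  \<open>A\<close> is taken small against \<open>M\<close>; both choices are independent of
  \<open>n\<close>.\<close>

lemma position_equi:
  assumes I: "I \<in> sets borel" "I \<subseteq> {0..T}" and e: "0 < e"
  shows "\<exists>d>0. \<forall>n. \<forall>A\<in>sets (slab I). measure (slab I) A < d \<longrightarrow> \<bar>ps I n A\<bar> \<le> e"
proof -
  have "0 \<le> T * K1" "0 < e / 2" using pos e by (simp_all add: less_imp_le)
  then obtain M where M: "1 < M" "T * K1 / ln M \<le> e / 2" using divide_ln_small by blast
  have "\<bar>ps I n A\<bar> \<le> e" if A: "A \<in> sets (slab I)" and d: "measure (slab I) A < e / (4 * M)" for n A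
  proof -
    have "2 * M * measure (slab I) A \<le> e / 2" using d M by (simp add: less_divide_eq mult_ac)
    then have "ps I n A \<le> e"
      using ce_curve.spacetime_position_bound(2)[OF ce I A M(1), of n] M(2) by linarith
    then show ?thesis using ce_curve.spacetime_position_bound(1)[OF ce I A M(1), of n] by simp
  qed
  moreover have "0 < e / (4 * M)" using e M by simp
  ultimately show ?thesis by blast
qed

text \<open>The parameters are fixed in the order \<open>\<theta>\<close>, \<open>M\<close>,
  \<open>d\<close>: each depends on the earlier ones and on constants free of
  \<open>V\<close>.\<close>

lemma momentum_equi:
  assumes I: "I \<in> sets borel" "I \<subseteq> {0..T}" and e: "0 < e"
  shows "\<exists>d>0. \<forall>n. \<forall>A\<in>sets (slab I). measure (slab I) A < d \<longrightarrow> \<bar>om I n A\<bar> \<le> e"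
proof -
  define q where "q = e / 3"
  have q: "0 < q" "e = q + (q + q)" using e by (simp_all add: q_def)
  define \<theta> where "\<theta> = q / (\<alpha> * K2)"
  have \<theta>: "0 < \<theta>" "\<theta> * \<alpha> * K2 = q" using q(1) pos by (simp_all add: \<theta>_def)
  have "0 \<le> T * K1 / \<theta>" using pos \<theta> by (simp add: less_imp_le)
  then obtain M where M: "1 < M" "T * K1 / \<theta> / ln M \<le> q" using divide_ln_small q(1) by blast
  have "\<bar>om I n A\<bar> \<le> e" if A: "A \<in> sets (slab I)" and d: "measure (slab I) A < q * \<theta> / (2 + 2 * M)" for n A
  proof -
    have "(2 + 2 * M) * measure (slab I) A / \<theta> \<le> q" using d M \<theta>(1) by (simp add: less_divide_eq divide_le_eq mult_ac)
    moreover have "((2 + 2 * M) * measure (slab I) A + T * K1 / ln M) / \<theta> = (2 + 2 * M) * measure (slab I) A / \<theta> + T * K1 / \<theta> / ln M"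
      by (simp add: add_divide_distrib mult.commute)
    ultimately show ?thesis
      using ce_curve.spacetime_momentum_bound[OF ce I A M(1) \<theta>(1), of n] M(2) \<theta>(2) q(2) by linarith
  qed
  moreover have "0 < q * \<theta> / (2 + 2 * M)" using q M \<theta> by simp
  ultimately show ?thesis by blast
qed

lemma flux_bounded: "\<exists>K. \<forall>n. \<forall>A\<in>sets (slab {0<..<T}). \<bar>fl n A\<bar> \<le> K"
proof -
  let ?I = "{0<..<T}"
  have I: "?I \<in> sets borel" "?I \<subseteq> {0..T}" by auto
  obtain K where K: "\<And>n A. A \<in> sets (slab ?I) \<Longrightarrow> \<bar>om ?I n A\<bar> \<le> K" using momentum_bounded[OF I] by blast
  obtain K' where K': "\<And>n A. A \<in> sets (slab ?I) \<Longrightarrow> \<bar>ps ?I n A\<bar> \<le> K'" using position_bounded[OF I] by blast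
  have "\<bar>fl n A\<bar> \<le> K / (2 * \<alpha>) + C / 1 + 1 / (2 * \<alpha>) * K'" if A: "A \<in> sets (slab ?I)" for n A
  proof -
    have "\<bar>fl n A\<bar> \<le> \<bar>om ?I n A\<bar> / (2 * \<alpha>) + C / 1 + 1 / (2 * \<alpha>) * ps ?I n A"
      by (rule ce_curve.spacetime_flux_bound[OF ce A]) (use pos in simp_all)
    also have "\<dots> \<le> K / (2 * \<alpha>) + C / 1 + 1 / (2 * \<alpha>) * K'"
      using K[OF A, of n] abs_le_D1[OF K'[OF A, of n]] pos(1) by (intro add_mono divide_right_mono mult_left_mono order_refl) auto
    finally show ?thesis .
  qed
  then show ?thesis by blast
qed

text \<open>\<open>s\<close> is fixed by \<open>C / s = q\<close> before the position term is made
  small against it. The estimate requires \<open>s \<le> V n\<close>, hence holds on a tail of the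
  sequence.\<close>

lemma flux_equi:
  assumes e: "0 < e"
  shows "\<exists>d>0. \<exists>N. \<forall>n\<ge>N. \<forall>A\<in>sets (slab {0<..<T}). measure (slab {0<..<T}) A < d \<longrightarrow> \<bar>fl n A\<bar> \<le> e"
proof -
  let ?I = "{0<..<T}"
  have I: "?I \<in> sets borel" "?I \<subseteq> {0..T}" by auto
  define q where "q = e / 3"
  have q: "0 < q" "e = q + q + q" using e by (simp_all add: q_def)
  define s where "s = C / q"
  have s: "0 < s" "C / s = q" using q(1) pos(3) by (simp_all add: s_def)
  have "0 < q * (2 * \<alpha>)" "0 < q * (2 * \<alpha>) / s" using q(1) pos s by simp_all
  note q' = this
  obtain d1 where d1: "0 < d1" "\<And>n A. A \<in> sets (slab ?I) \<Longrightarrow> measure (slab ?I) A < d1 \<Longrightarrow> \<bar>om ?I n A\<bar> \<le> q * (2 * \<alpha>)"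
    using momentum_equi[OF I q'(1)] by blast
  obtain d2 where d2: "0 < d2" "\<And>n A. A \<in> sets (slab ?I) \<Longrightarrow> measure (slab ?I) A < d2 \<Longrightarrow> \<bar>ps ?I n A\<bar> \<le> q * (2 * \<alpha>) / s"
    using position_equi[OF I q'(2)] by blast
  note d = d1 d2
  obtain N where N: "\<And>n. n \<ge> N \<Longrightarrow> s \<le> V n"
    using V_lim unfolding filterlim_at_top eventually_sequentially by blast
  have "\<bar>fl n A\<bar> \<le> e" if n: "n \<ge> N" and A: "A \<in> sets (slab ?I)" and m: "measure (slab ?I) A < min d1 d2" for n A
  proof -
    have "\<bar>fl n A\<bar> \<le> \<bar>om ?I n A\<bar> / (2 * \<alpha>) + C / s + s / (2 * \<alpha>) * ps ?I n A"
      by (rule ce_curve.spacetime_flux_bound[OF ce A s(1) N[OF n]])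
    also have "\<dots> \<le> q * (2 * \<alpha>) / (2 * \<alpha>) + q + s / (2 * \<alpha>) * (q * (2 * \<alpha>) / s)"
      unfolding s(2) using d(2)[OF A, of n] abs_le_D1[OF d(4)[OF A, of n]] m pos(1) s(1)
      by (intro add_mono divide_right_mono mult_left_mono order_refl) auto
    also have "\<dots> = e" using pos(1) s(1) q(2) by simp
    finally show ?thesis .
  qed
  moreover have "0 < min d1 d2" using d by simp
  ultimately show ?thesis by blast
qed

lemma momentum_compactness:
  "\<exists>k g. strict_mono k \<and> integrable (slab {0..T}) g \<and> bounded_weak_limit (slab {0..T}) (\<lambda>n. om {0..T} (k n)) g"
proof -
  have I: "{0..T} \<in> sets borel" "{0..T} \<subseteq> {0..T}" by auto
  have equi: "\<exists>d>0. \<exists>N. \<forall>n\<ge>N. \<forall>A\<in>sets (slab {0..T}). measure (slab {0..T}) A < d \<longrightarrow> \<bar>om {0..T} n A\<bar> \<le> e" if "0 < e" for e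
    using momentum_equi[OF I that] by blast
  show ?thesis
    by (rule slab_compactness[OF I(1) slab_facts(2)[OF I] ce_curve.spacetime_momentum(1)[OF ce I] momentum_bounded[OF I] equi])
qed

text \<open>Only convergence on sets is kept: it feeds the time averages, while the limit at each
  time is found in \<open>position_limit\<close>.\<close>

lemma position_compactness:
  "\<exists>k. strict_mono k \<and> (\<forall>A\<in>sets (slab {0..T}). convergent (\<lambda>n. ps {0..T} (k n) A))"
proof -
  have I: "{0..T} \<in> sets borel" "{0..T} \<subseteq> {0..T}" by auto
  have equi: "\<exists>d>0. \<exists>N. \<forall>n\<ge>N. \<forall>A\<in>sets (slab {0..T}). measure (slab {0..T}) A < d \<longrightarrow> \<bar>ps {0..T} n A\<bar> \<le> e" if "0 < e" for e
    using position_equi[OF I that] by blast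
  have vm: "vector_measure (slab {0..T}) (ps {0..T} n)" for n by (rule ce_curve.spacetime_momentum(3)[OF ce I])
  obtain k g where k: "strict_mono k" "bounded_weak_limit (slab {0..T}) (\<lambda>n. ps {0..T} (k n)) g"
    using slab_compactness[where \<nu>="ps {0..T}", OF I(1) slab_facts(2)[OF I] vm position_bounded[OF I] equi] by blast
  have "convergent (\<lambda>n. ps {0..T} (k n) A)" if A: "A \<in> sets (slab {0..T})" for A
  proof -
    have "(\<lambda>n. signed_integral (slab {0..T}) (ps {0..T} (k n)) (indicator A)) \<longlonglongrightarrow> (LINT x|slab {0..T}. indicator A x * g x)"
      by (rule bounded_weak_limitD[OF k(2), of _ 1]) (use A in \<open>auto simp: indicator_def\<close>)
    then show ?thesis
      unfolding signed_integral_indicator[OF vm A] by (rule convergentI)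
  qed
  with k(1) show ?thesis by blast
qed

lemma flux_compactness:
  "\<exists>k g. strict_mono k \<and> integrable (slab {0<..<T}) g \<and> bounded_weak_limit (slab {0<..<T}) (\<lambda>n. fl (k n)) g"
proof -
  have I: "{0<..<T} \<in> sets borel" "{0<..<T} \<subseteq> {0..T}" by auto
  show ?thesis
    by (rule slab_compactness[OF I(1) slab_facts(2)[OF I] ce_curve.spacetime_flux(1)[OF ce] flux_bounded flux_equi])
qed

text \<open>The hypotheses are stable under subsequences, so successive extractions can reuse every
  result of the locale.\<close>

lemma subsequence: "strict_mono k \<Longrightarrow> ce_sequence \<alpha> T C (\<lambda>n. V (k n)) (\<lambda>n. \<sigma> (k n)) (\<lambda>n. j (k n))"
  by (rule ce_sequence.intro[OF ce filterlim_compose[OF V_lim filterlim_subseq]])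

lemma integrable_position:
  fixes \<phi> :: "torus \<Rightarrow> real"
  assumes t: "t \<in> {0..T}" and \<phi>: "\<phi> \<in> borel_measurable borel" "\<And>z. \<bar>\<phi> z\<bar> \<le> B"
  shows "integrable (\<rho> n t) \<phi>"
  by (rule integrable_bounded[of _ _ B])
    (use prob_space.finite_measure[OF ce_curve.prob_\<rho>[OF ce t]] \<phi> in \<open>simp_all add: measurable_cong_sets[OF ce_curve.sets_\<rho>[OF ce] refl]\<close>)

lemma continuous_position:
  fixes \<phi> :: "torus \<Rightarrow> real"
  assumes \<phi>: "continuous_on UNIV \<phi>"
  shows "continuous_on {0..T} (\<lambda>t. LINT z|\<rho> n t. \<phi> z)"
proof -
  have m: "\<phi> \<in> borel_measurable borel" by (rule borel_measurable_continuous_onI[OF \<phi>])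
  obtain B where B: "\<And>z. \<bar>\<phi> z\<bar> \<le> B" using bounded_continuous_torus[OF \<phi>] by blast
  have "continuous_on UNIV (\<lambda>q :: phase. \<phi> (fst q))" by (rule phase_continuous[where F="\<lambda>z b. \<phi> z"]) (rule \<phi>)
  moreover have "bounded (range (\<lambda>q :: phase. \<phi> (fst q)))" using B by (intro boundedI[of _ B]) auto
  ultimately have "continuous_on {0..T} (\<lambda>t. LINT q|\<sigma> n t. \<phi> (fst q))" by (rule ce_curve.narrow[OF ce])
  then show ?thesis by (rule continuous_on_cong[THEN iffD1, rotated 2]) (simp_all add: ce_curve.integral_\<rho>[OF ce _ m])
qed

text \<open>A simple approximation of \<open>\<phi>\<close> with level sets \<open>A i\<close>
  common to all times and all \<open>n\<close> turns the time average into a combination of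
  space-time masses of the boxes \<open>{s..t} \<times> A i\<close>, which converge by
  hypothesis.\<close>

lemma time_average_convergent:
  fixes \<phi> :: "torus \<Rightarrow> real"
  assumes conv: "\<And>A. A \<in> sets (slab {0..T}) \<Longrightarrow> convergent (\<lambda>n. ps {0..T} n A)"
    and \<phi>: "continuous_on UNIV \<phi>" and st: "0 \<le> s" "s \<le> t" "t \<le> T"
  shows "convergent (\<lambda>n. LINT r:{s..t}|lborel. LINT z|\<rho> n r. \<phi> z)"
proof (rule convergent_uniform_approx)
  fix e :: real assume e: "0 < e"
  have m: "\<phi> \<in> borel_measurable borel" by (rule borel_measurable_continuous_onI[OF \<phi>])
  obtain B where B: "\<And>z. \<bar>\<phi> z\<bar> \<le> B" using bounded_continuous_torus[OF \<phi>] by blast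
  \<comment> \<open>An error \<open>d\<close> at each time, integrated over a length of at most
    \<open>T\<close>.\<close>
  define d where "d = e / T"
  have d: "0 < d" "T * d = e" using e pos(2) by (simp_all add: d_def)
  obtain J :: "int set" and A where A: "finite J" "\<And>i. A i \<in> sets borel"
    "\<And>Q. finite_measure Q \<Longrightarrow> sets Q = sets borel \<Longrightarrow>
      \<bar>(LINT x|Q. \<phi> x) - (\<Sum>i\<in>J. d * of_int i * measure Q (A i))\<bar> \<le> d * measure Q (space borel)"
    by (rule bounded_simple_approx[OF m B d(1)]) (rule that)
  let ?I = "{s..t}"
  have AS: "?I \<times> A i \<in> sets (borel :: (real \<times> torus) measure)" for i
  proof -
    have "?I \<times> A i \<in> sets (borel \<Otimes>\<^sub>M borel :: (real \<times> torus) measure)" using A(2) by (intro pair_measureI) auto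
    then show ?thesis unfolding borel_prod .
  qed
  have As: "?I \<times> A i \<in> sets (slab {0..T})" for i
    using AS st by (subst sets_slab_iff) auto
  have I: "{0..T} \<in> sets borel" "{0..T} \<subseteq> {0..T}" by auto
  have sec: "indicator {0..T} r * measure (\<rho> n r) {z. (r, z) \<in> ?I \<times> A i} = indicator ?I r * measure (\<rho> n r) (A i)" for n r i
    using st by (auto simp: indicator_def)
  have im: "set_integrable lborel ?I (\<lambda>r. measure (\<rho> n r) (A i))" for n i
    using ce_curve.spacetime_momentum(4)[OF ce I AS, of n i] unfolding set_integrable_def real_scaleR_def sec .
  have mi: "ps {0..T} n (?I \<times> A i) = (LINT r:?I|lborel. measure (\<rho> n r) (A i))" for n i
    unfolding time_integral_def set_lebesgue_integral_def real_scaleR_def sec ..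
  have "convergent (\<lambda>n. \<Sum>i\<in>J. d * of_int i * ps {0..T} n (?I \<times> A i))"
    by (intro convergent_sum convergent_mult convergent_const conv As)
  moreover have "\<bar>(LINT r:?I|lborel. LINT z|\<rho> n r. \<phi> z) - (\<Sum>i\<in>J. d * of_int i * ps {0..T} n (?I \<times> A i))\<bar> \<le> e" for n
  proof -
    have iA: "set_integrable lborel ?I (\<lambda>r. LINT z|\<rho> n r. \<phi> z)"
      by (rule borel_integrable_atLeastAtMost') (rule continuous_on_subset[OF continuous_position[OF \<phi>]], use st in auto)
    have iS: "set_integrable lborel ?I (\<lambda>r. \<Sum>i\<in>J. d * of_int i * measure (\<rho> n r) (A i))"
      by (intro set_integrable_sum set_integrable_mult_right im)
    have "(\<Sum>i\<in>J. d * of_int i * ps {0..T} n (?I \<times> A i)) = (LINT r:?I|lborel. (\<Sum>i\<in>J. d * of_int i * measure (\<rho> n r) (A i)))"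
      unfolding mi by (subst set_integral_sum) (auto intro!: set_integrable_mult_right im)
    then have "(LINT r:?I|lborel. LINT z|\<rho> n r. \<phi> z) - (\<Sum>i\<in>J. d * of_int i * ps {0..T} n (?I \<times> A i))
        = (LINT r:?I|lborel. (LINT z|\<rho> n r. \<phi> z) - (\<Sum>i\<in>J. d * of_int i * measure (\<rho> n r) (A i)))"
      by (simp only: set_integral_diff(2)[OF iA iS])
    also have "\<bar>\<dots>\<bar> \<le> (LINT r:?I|lborel. \<bar>(LINT z|\<rho> n r. \<phi> z) - (\<Sum>i\<in>J. d * of_int i * measure (\<rho> n r) (A i))\<bar>)"
      unfolding set_lebesgue_integral_def
      using integral_abs_bound[of lborel "\<lambda>r. indicator ?I r *\<^sub>R ((LINT z|\<rho> n r. \<phi> z) - (\<Sum>i\<in>J. d * of_int i * measure (\<rho> n r) (A i)))"]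
      by (simp add: abs_mult)
    also have "\<dots> \<le> (LINT r:?I|lborel. d)"
    proof (rule set_integral_mono)
      show "set_integrable lborel ?I (\<lambda>r. \<bar>(LINT z|\<rho> n r. \<phi> z) - (\<Sum>i\<in>J. d * of_int i * measure (\<rho> n r) (A i))\<bar>)"
        by (intro set_integrable_abs set_integral_diff(1) iA iS)
      show "set_integrable lborel ?I (\<lambda>r. d)"
        by (rule borel_integrable_atLeastAtMost') (rule continuous_on_const)
      fix r assume "r \<in> ?I"
      then have r: "r \<in> {0..T}" using st by auto
      have "\<bar>(LINT z|\<rho> n r. \<phi> z) - (\<Sum>i\<in>J. d * of_int i * measure (\<rho> n r) (A i))\<bar> \<le> d * measure (\<rho> n r) (space borel)"
        by (rule A(3)[OF prob_space.finite_measure[OF ce_curve.prob_\<rho>[OF ce r]] ce_curve.sets_\<rho>[OF ce]])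
      also have "\<dots> = d" using prob_space.prob_space[OF ce_curve.prob_\<rho>[OF ce r, of n]] by (simp add: ce_curve.space_\<rho>[OF ce])
      finally show "\<bar>(LINT z|\<rho> n r. \<phi> z) - (\<Sum>i\<in>J. d * of_int i * measure (\<rho> n r) (A i))\<bar> \<le> d" .
    qed
    also have "\<dots> = (t - s) * d" using st by (simp add: set_lebesgue_integral_def)
    also have "\<dots> \<le> T * d" using st d by (intro mult_right_mono) auto
    finally show ?thesis using d(2) by simp
  qed
  ultimately show "\<exists>b. convergent b \<and> (\<forall>n. \<bar>(LINT r:?I|lborel. LINT z|\<rho> n r. \<phi> z) - b n\<bar> \<le> e)" by blast
qed

text \<open>For differentiable test functions the integrals are equi-Hoelder in time and converge in
  time average, so \<open>Hoelder_uniformly_Cauchy\<close> applies; a continuous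
  \<open>\<phi>\<close> is replaced by a uniformly close trigonometric polynomial.\<close>

lemma position_uniformly_Cauchy:
  fixes \<phi> :: "torus \<Rightarrow> real"
  assumes conv: "\<And>A. A \<in> sets (slab {0..T}) \<Longrightarrow> convergent (\<lambda>n. ps {0..T} n A)"
    and \<phi>: "continuous_on UNIV \<phi>"
  shows "uniformly_Cauchy_on {0..T} (\<lambda>n t. LINT z|\<rho> n t. \<phi> z)"
proof (rule uniformly_Cauchy_approx)
  have smooth: "uniformly_Cauchy_on {0..T} (\<lambda>n t. LINT z|\<rho> n t. \<psi> z)"
    if \<psi>: "torus_deriv \<psi> \<psi>'" "continuous_on UNIV \<psi>'" "continuous_on UNIV \<psi>" for \<psi> \<psi>'
  proof -
    obtain B where B: "0 < B" "\<And>z. \<bar>\<psi>' z\<bar> \<le> B" using bounded_continuous_torus[OF \<psi>(2)] by blast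
    show ?thesis
    proof (rule Hoelder_uniformly_Cauchy[OF pos(2)])
      show "0 \<le> B * (\<alpha> * K2 + 3)" using B pos by (simp add: less_imp_le)
      show "continuous_on {0..T} (\<lambda>t. LINT z|\<rho> n t. \<psi> z)" for n by (rule continuous_position[OF \<psi>(3)])
      show "\<bar>(LINT z|\<rho> n t. \<psi> z) - (LINT z|\<rho> n s. \<psi> z)\<bar> \<le> B * (\<alpha> * K2 + 3) * sqrt (t - s)"
        if "0 \<le> s" "s \<le> t" "t \<le> T" for n s t
        by (rule ce_curve.position_Hoelder[OF ce \<psi> B that])
      show "convergent (\<lambda>n. LINT r:{s..t}|lborel. LINT z|\<rho> n r. \<psi> z)" if "0 \<le> s" "s \<le> t" "t \<le> T" for s t
        by (rule time_average_convergent[OF conv \<psi>(3) that])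
    qed
  qed
  fix e :: real assume e: "0 < e"
  \<comment> \<open>The mollification of \<open>\<phi>\<close> at one fixed order is a combination
    of the \<open>tmon\<close>, hence differentiable.\<close>
  obtain n0 where n0: "\<And>w. \<bar>(LINT z|torus_lebesgue. tker n0 z w * \<phi> z) - \<phi> w\<bar> \<le> e"
    using tker_uniform_approximation[OF \<phi> e] by blast
  define c where "c p = tcoef n0 p * (LINT z|torus_lebesgue. tmon p z * \<phi> z)" for p
  define \<psi> where "\<psi> w = (\<Sum>p\<in>tidx n0. c p * tmon p w)" for w
  define \<psi>' where "\<psi>' w = (\<Sum>p\<in>tidx n0. c p * dtmon p w)" for w
  have "(LINT z|torus_lebesgue. tker n0 z w * \<phi> z) = \<psi> w" for w
  proof -
    have "(LINT z|torus_lebesgue. tker n0 z w * \<phi> z) = (LINT z|torus_lebesgue. (\<Sum>p\<in>tidx n0. tcoef n0 p * tmon p w * (tmon p z * \<phi> z)))"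
      unfolding tker_expand by (simp add: sum_distrib_left sum_distrib_right mult_ac)
    also have "\<dots> = (\<Sum>p\<in>tidx n0. tcoef n0 p * tmon p w * (LINT z|torus_lebesgue. tmon p z * \<phi> z))"
      by (subst Bochner_Integration.integral_sum)
        (auto intro!: integrable_mult_right torus_integrable_continuous continuous_on_mult continuous_tmon \<phi>)
    also have "\<dots> = \<psi> w" unfolding \<psi>_def c_def by (intro sum.cong) (simp_all add: mult_ac)
    finally show ?thesis .
  qed
  with n0 have close: "\<bar>\<phi> w - \<psi> w\<bar> \<le> e" for w by (simp add: abs_minus_commute)
  have td: "torus_deriv \<psi> \<psi>'"
    using torus_deriv_tmon unfolding \<psi>_def[abs_def] \<psi>'_def[abs_def] torus_deriv_def
    by (auto intro!: DERIV_sum DERIV_cmult)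
  have c: "continuous_on UNIV \<psi>'" "continuous_on UNIV \<psi>"
    unfolding \<psi>_def[abs_def] \<psi>'_def[abs_def] by (intro continuous_intros continuous_tmon continuous_dtmon)+
  have "\<bar>(LINT z|\<rho> n t. \<phi> z) - (LINT z|\<rho> n t. \<psi> z)\<bar> \<le> e" if t: "t \<in> {0..T}" for n t
  proof -
    have i: "integrable (\<rho> n t) f" if f: "continuous_on UNIV f" for f :: "torus \<Rightarrow> real"
    proof -
      obtain B where "\<And>z. \<bar>f z\<bar> \<le> B" using bounded_continuous_torus[OF f] by blast
      then show ?thesis by (rule integrable_position[OF t borel_measurable_continuous_onI[OF f]])
    qed
    interpret prob_space "\<rho> n t" by (rule ce_curve.prob_\<rho>[OF ce t])
    have "\<bar>LINT z|\<rho> n t. \<phi> z - \<psi> z\<bar> \<le> (LINT z|\<rho> n t. \<bar>\<phi> z - \<psi> z\<bar>)" by (rule integral_abs_bound)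
    also have "\<dots> \<le> e" by (intro integral_le_const integrable_abs Bochner_Integration.integrable_diff i \<phi> c AE_I2 close)
    finally show ?thesis by (simp add: Bochner_Integration.integral_diff i \<phi> c)
  qed
  then show "\<exists>b. uniformly_Cauchy_on {0..T} b \<and> (\<forall>n. \<forall>t\<in>{0..T}. \<bar>(LINT z|\<rho> n t. \<phi> z) - b n t\<bar> \<le> e)"
    using smooth[OF td c] by (intro exI[of _ "\<lambda>n t. LINT z|\<rho> n t. \<psi> z"]) blast
qed

text \<open>Setwise compactness produces the limit measure at a fixed time together with its
  density, since \<open>position_set_estimate\<close> holds at every time and not just almost every
  one. The subsequence used depends on \<open>t\<close>, but the full sequence of integrals is
  already Cauchy and thus has the same limit.\<close>

lemma position_limit:
  assumes conv: "\<And>A. A \<in> sets (slab {0..T}) \<Longrightarrow> convergent (\<lambda>n. ps {0..T} n A)" and t: "t \<in> {0..T}"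
  shows "\<exists>P. prob_space P \<and> sets P = sets borel \<and> absolutely_continuous torus_lebesgue P \<and>
    (\<forall>\<phi> :: torus \<Rightarrow> real. continuous_on UNIV \<phi> \<longrightarrow> (\<lambda>n. LINT z|\<rho> n t. \<phi> z) \<longlonglongrightarrow> (LINT z|P. \<phi> z))"
proof -
  obtain \<B> :: "torus set set" where \<B>: "countable \<B>" "topological_basis \<B>" using ex_countable_basis by blast
  have G: "sets torus_lebesgue = sigma_sets (space torus_lebesgue) \<B>"
  proof -
    have "sets (borel :: torus measure) = sigma_sets UNIV \<B>"
      unfolding borel_eq_countable_basis[OF \<B>] by (rule sets_measure_of) simp
    then show ?thesis by simp
  qed
  have f: "finite_measure (\<rho> n t)" for n by (rule prob_space.finite_measure[OF ce_curve.prob_\<rho>[OF ce t]])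
  have s: "sets (\<rho> n t) = sets torus_lebesgue" for n by (simp add: ce_curve.sets_\<rho>[OF ce])
  have K: "measure (\<rho> n t) (space torus_lebesgue) \<le> 1" for n
    by (rule prob_space.prob_le_1[OF ce_curve.prob_\<rho>[OF ce t]])
  have equi: "\<exists>d>0. \<exists>N. \<forall>n\<ge>N. \<forall>A\<in>sets torus_lebesgue. measure torus_lebesgue A < d \<longrightarrow> measure (\<rho> n t) A \<le> e" if e: "0 < e" for e
  proof -
    have "0 \<le> K1" "0 < e / 2" using pos e by (simp_all add: less_imp_le)
    then obtain M where M: "1 < M" "K1 / ln M \<le> e / 2" using divide_ln_small by blast
    have "measure (\<rho> n t) A \<le> e" if A: "A \<in> sets torus_lebesgue" and d: "measure torus_lebesgue A < e / (4 * M)" for n A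
    proof -
      have "2 * M * measure torus_lebesgue A \<le> e / 2" using d M by (simp add: less_divide_eq mult_ac)
      then show ?thesis
        using ce_curve.position_set_estimate[OF ce t _ M(1), of A n, OF A[simplified]] M(2) by linarith
    qed
    moreover have "0 < e / (4 * M)" using e M by simp
    ultimately show ?thesis by blast
  qed
  obtain k g where k: "strict_mono k" "integrable torus_lebesgue g" "\<And>x. 0 \<le> g x"
    "\<And>A. A \<in> sets torus_lebesgue \<Longrightarrow> (\<lambda>n. measure (\<rho> (k n) t) A) \<longlonglongrightarrow> measure (density torus_lebesgue (\<lambda>x. ennreal (g x))) A"
    by (rule setwise_compactness_nonneg[where \<nu>="\<lambda>n. \<rho> n t", OF torus.finite_measure_axioms \<B>(1) _ G f s K equi]) (simp, assumption, rule that)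
  define P where "P = density torus_lebesgue (\<lambda>x. ennreal (g x))"
  have sP: "sets P = sets borel" by (simp add: P_def)
  have fP: "finite_measure P"
  proof (rule finite_measureI)
    have "emeasure P (space P) = (\<integral>\<^sup>+x. ennreal (g x) \<partial>torus_lebesgue)"
      unfolding P_def using k(2) by (simp add: emeasure_density cong: nn_integral_cong)
    also have "\<dots> = ennreal (LINT x|torus_lebesgue. g x)" by (rule nn_integral_eq_integral[OF k(2)]) (simp add: k(3))
    finally show "emeasure P (space P) \<noteq> \<infinity>" by simp
  qed
  have "(\<lambda>n. measure (\<rho> (k n) t) UNIV) \<longlonglongrightarrow> measure P UNIV" unfolding P_def by (rule k(4)) simp
  moreover have "measure (\<rho> n t) UNIV = 1" for n
    using prob_space.prob_space[OF ce_curve.prob_\<rho>[OF ce t, of n]] by (simp add: ce_curve.space_\<rho>[OF ce])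
  ultimately have "measure P UNIV = 1" by (simp add: LIMSEQ_const_iff)
  then have "emeasure P (space P) = 1"
    using sets_eq_imp_space_eq[OF sP] by (simp add: finite_measure.emeasure_eq_measure[OF fP])
  then have "prob_space P" by (rule prob_spaceI)
  moreover have "absolutely_continuous torus_lebesgue P"
    unfolding P_def by (rule absolutely_continuousI_density) (use k(2) in simp)
  moreover have "(\<lambda>n. LINT z|\<rho> n t. \<phi> z) \<longlonglongrightarrow> (LINT z|P. \<phi> z)" if \<phi>: "continuous_on UNIV \<phi>" for \<phi> :: "torus \<Rightarrow> real"
  proof -
    obtain B where B: "\<And>z. \<bar>\<phi> z\<bar> \<le> B" using bounded_continuous_torus[OF \<phi>] by blast
    have sub: "(\<lambda>n. LINT z|\<rho> (k n) t. \<phi> z) \<longlonglongrightarrow> (LINT z|P. \<phi> z)"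
    proof (rule setwise_convergence_bounded_integral[OF fP f])
      show "sets (\<rho> (k n) t) = sets P" for n by (simp add: s sP)
      show "(\<lambda>n. measure (\<rho> (k n) t) A) \<longlonglongrightarrow> measure P A" if "A \<in> sets P" for A
        unfolding P_def by (rule k(4)) (use that sP in simp)
      show "\<phi> \<in> borel_measurable P"
        using borel_measurable_continuous_onI[OF \<phi>] by (simp add: measurable_cong_sets[OF sP refl])
      show "\<bar>\<phi> x\<bar> \<le> B" for x by (rule B)
    qed
    have "Cauchy (\<lambda>n. LINT z|\<rho> n t. \<phi> z)"
      using position_uniformly_Cauchy[OF conv \<phi>] t unfolding uniformly_Cauchy_on_def Cauchy_def by blast
    then obtain l where l: "(\<lambda>n. LINT z|\<rho> n t. \<phi> z) \<longlonglongrightarrow> l" using Cauchy_convergent convergent_def by blast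
    have "l = (LINT z|P. \<phi> z)"
      using LIMSEQ_unique[OF LIMSEQ_subseq_LIMSEQ[OF l k(1), unfolded comp_def] sub] .
    then show ?thesis using l by simp
  qed
  ultimately show ?thesis using sP by blast
qed

text \<open>The limits are chosen time by time; narrow continuity of the chosen curve is inherited
  through uniform convergence.\<close>

lemma position_uniform_limit:
  assumes conv: "\<And>A. A \<in> sets (slab {0..T}) \<Longrightarrow> convergent (\<lambda>n. ps {0..T} n A)"
  shows "\<exists>\<rho>'. narrow_curve T \<rho>' \<and> uniform_narrow_conv T \<rho> \<rho>' \<and> (\<forall>t\<in>{0..T}. absolutely_continuous torus_lebesgue (\<rho>' t))"
proof -
  from position_limit[OF conv] obtain \<rho>' where p: "\<And>t. t \<in> {0..T} \<Longrightarrow> prob_space (\<rho>' t) \<and> sets (\<rho>' t) = sets borel \<and>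
      absolutely_continuous torus_lebesgue (\<rho>' t) \<and>
      (\<forall>\<phi> :: torus \<Rightarrow> real. continuous_on UNIV \<phi> \<longrightarrow> (\<lambda>n. LINT z|\<rho> n t. \<phi> z) \<longlonglongrightarrow> (LINT z|\<rho>' t. \<phi> z))"
    using bchoice[of "{0..T}" "\<lambda>t P. prob_space P \<and> sets P = sets borel \<and> absolutely_continuous torus_lebesgue P \<and>
    (\<forall>\<phi> :: torus \<Rightarrow> real. continuous_on UNIV \<phi> \<longrightarrow> (\<lambda>n. LINT z|\<rho> n t. \<phi> z) \<longlonglongrightarrow> (LINT z|P. \<phi> z))"] by meson
  have u: "uniform_limit {0..T} (\<lambda>n t. LINT z|\<rho> n t. \<phi> z) (\<lambda>t. LINT z|\<rho>' t. \<phi> z) sequentially"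
    if \<phi>: "continuous_on UNIV \<phi>" for \<phi> :: "torus \<Rightarrow> real"
  proof (rule uniform_limit_of_Cauchy[OF position_uniformly_Cauchy[OF conv \<phi>]])
    fix t assume "t \<in> {0..T}"
    from p[OF this] \<phi> show "(\<lambda>n. LINT z|\<rho> n t. \<phi> z) \<longlonglongrightarrow> (LINT z|\<rho>' t. \<phi> z)" by blast
  qed
  have "continuous_on {0..T} (\<lambda>t. LINT z|\<rho>' t. \<phi> z)" if \<phi>: "continuous_on UNIV \<phi>" for \<phi> :: "torus \<Rightarrow> real"
    by (rule uniform_limit_theorem[OF _ u[OF \<phi>]]) (simp_all add: continuous_position[OF \<phi>])
  then have "narrow_curve T \<rho>'" unfolding narrow_curve_def using p by simp
  moreover have "uniform_narrow_conv T \<rho> \<rho>'" unfolding uniform_narrow_conv_def using u by simp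
  ultimately show ?thesis using p by blast
qed

end

text \<open>Bounded continuous functions are bounded and measurable, and the density of the limit
  supplies its disintegration.\<close>

lemma signed_narrow_limit:
  assumes I: "I \<in> sets borel" and g: "integrable (slab I) g"
    and lim: "bounded_weak_limit (slab I) \<mu> g"
  shows "\<exists>\<nu> \<nu>t. vector_measure (restrict_space borel (I \<times> UNIV)) \<nu> \<and> signed_narrow_conv (I \<times> UNIV) \<mu> \<nu> \<and>
    integrable_family I \<nu>t \<and> (\<forall>A\<in>sets (restrict_space borel (I \<times> UNIV)). \<nu> A = time_integral I \<nu>t A)"
proof -
  let ?\<nu> = "\<lambda>A. LINT x|slab I. indicator A x * g x"
  obtain \<nu>t :: "real \<Rightarrow> torus set \<Rightarrow> real" where \<nu>t: "integrable_family I \<nu>t" "\<And>A. A \<in> sets (slab I) \<Longrightarrow> ?\<nu> A = time_integral I \<nu>t A"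
    using slab_disintegration[OF I g] by blast
  have "signed_narrow_conv (I \<times> UNIV) \<mu> ?\<nu>"
    unfolding signed_narrow_conv_def
  proof (intro allI impI)
    fix \<phi> :: "real \<times> torus \<Rightarrow> real" assume c: "continuous_on (I \<times> UNIV) \<phi>" and b: "bounded (\<phi> ` (I \<times> UNIV))"
    obtain B where B: "\<And>x. x \<in> I \<times> UNIV \<Longrightarrow> \<bar>\<phi> x\<bar> \<le> B" using b unfolding bounded_iff by auto
    have m: "\<phi> \<in> borel_measurable (slab I)"
      unfolding measurable_cong_sets[OF sets_slab refl] by (rule borel_measurable_continuous_on_restrict[OF c])
    have "signed_integral (slab I) ?\<nu> \<phi> = (LINT x|slab I. \<phi> x * g x)"
      by (rule density_vector_measure(2)[OF g m, of B]) (use B in \<open>simp add: space_slab\<close>)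
    moreover have "(\<lambda>n. signed_integral (slab I) (\<mu> n) \<phi>) \<longlonglongrightarrow> (LINT x|slab I. \<phi> x * g x)"
      by (rule bounded_weak_limitD[OF lim m, of B]) (use B in \<open>simp add: space_slab\<close>)
    ultimately show "(\<lambda>n. signed_integral (restrict_space borel (I \<times> UNIV)) (\<mu> n) \<phi>) \<longlonglongrightarrow> signed_integral (restrict_space borel (I \<times> UNIV)) ?\<nu> \<phi>"
      by (simp add: signed_integral_cong_sets[OF sets_slab])
  qed
  moreover have "vector_measure (restrict_space borel (I \<times> UNIV)) ?\<nu>"
    using density_vector_measure(1)[OF g] unfolding vector_measure_cong_sets[OF sets_slab] .
  ultimately show ?thesis using \<nu>t unfolding sets_slab by blast
qed

theorem proposition4p4:
  fixes \<alpha> T C :: real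
    and \<sigma> :: "real \<Rightarrow> real \<Rightarrow> phase measure"
    and j :: "real \<Rightarrow> real \<Rightarrow> phase set \<Rightarrow> real \<times> real"
  assumes "\<alpha> > 0" and "T > 0" and "C > 0"
    and "\<And>V. V \<ge> 1 \<Longrightarrow> CE T (\<sigma> V) (j V)"
    and "(SUP V\<in>{1..}. Ent (measure (\<sigma> V 0)) ref_measure + action \<alpha> T V (\<sigma> V) (j V)) \<le> ennreal C"
  defines "\<rho> \<equiv> \<lambda>V t. position_marginal (\<sigma> V t)"
    and "\<omega> \<equiv> \<lambda>V. time_integral {0..T} (\<lambda>t. momentum V (\<sigma> V t))"
    and "J \<equiv> \<lambda>V. time_integral {0<..<T} (\<lambda>t. net_flux V (j V t))"
  shows "\<forall>Vs :: nat \<Rightarrow> real. (\<forall>n. Vs n \<ge> 1) \<longrightarrow> filterlim Vs at_top sequentially \<longrightarrow>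
    (\<exists>(k :: nat \<Rightarrow> nat) (\<rho>' :: real \<Rightarrow> torus measure)
      (\<omega>' :: (real \<times> torus) set \<Rightarrow> real) (J' :: (real \<times> torus) set \<Rightarrow> real).
      strict_mono k \<and>
      narrow_curve T \<rho>' \<and>
      uniform_narrow_conv T (\<lambda>n. \<rho> (Vs (k n))) \<rho>' \<and>
      vector_measure (restrict_space borel ({0..T} \<times> UNIV)) \<omega>' \<and>
      signed_narrow_conv ({0..T} \<times> UNIV) (\<lambda>n. \<omega> (Vs (k n))) \<omega>' \<and>
      vector_measure (restrict_space borel ({0<..<T} \<times> UNIV)) J' \<and>
      signed_narrow_conv ({0<..<T} \<times> UNIV) (\<lambda>n. J (Vs (k n))) J' \<and>
      (\<forall>t\<in>{0..T}. absolutely_continuous torus_lebesgue (\<rho>' t)) \<and>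
      (\<exists>\<omega>t :: real \<Rightarrow> torus set \<Rightarrow> real. integrable_family {0..T} \<omega>t \<and>
        (\<forall>A\<in>sets (restrict_space borel ({0..T} \<times> UNIV)). \<omega>' A = time_integral {0..T} \<omega>t A)) \<and>
      (\<exists>Jt :: real \<Rightarrow> torus set \<Rightarrow> real. integrable_family {0<..<T} Jt \<and>
        (\<forall>A\<in>sets (restrict_space borel ({0<..<T} \<times> UNIV)). J' A = time_integral {0<..<T} Jt A)))"
proof (intro allI impI)
  fix Vs :: "nat \<Rightarrow> real" assume Vs: "\<forall>n. 1 \<le> Vs n" "filterlim Vs at_top sequentially"
  \<comment> \<open>Both terms of the bounded sum are nonnegative, so each is at most
    \<open>C\<close>.\<close>
  have curve: "ce_curve \<alpha> T V C (\<sigma> V) (j V)" if V: "1 \<le> V" for V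
  proof
    have "Ent (measure (\<sigma> V 0)) ref_measure + action \<alpha> T V (\<sigma> V) (j V) \<le> ennreal C"
      by (rule order_trans[OF SUP_upper assms(5)]) (use V in simp)
    note b = order_trans[OF add_increasing2[OF zero_le order_refl] this] order_trans[OF add_increasing[OF zero_le order_refl] this]
    then show "Ent (measure (\<sigma> V 0)) ref_measure \<le> ennreal C"
      "(\<integral>\<^sup>+r\<in>{0<..<T}. lagrangian \<alpha> V (\<sigma> V r) (j V r) \<partial>lborel) \<le> ennreal C"
      using assms(4)[OF V] by (simp_all add: action_def)
  qed (use assms V in auto)
  have 0: "ce_sequence \<alpha> T C Vs (\<lambda>n. \<sigma> (Vs n)) (\<lambda>n. j (Vs n))"
    using Vs by (intro ce_sequence.intro curve) auto
  obtain k1 g1 where k1: "strict_mono k1" "integrable (slab {0..T}) g1"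
    "bounded_weak_limit (slab {0..T}) (\<lambda>n. \<omega> (Vs (k1 n))) g1"
    using ce_sequence.momentum_compactness[OF 0] unfolding \<omega>_def by blast
  \<comment> \<open>Each extraction refines the previous one; limits found earlier persist by
    \<open>bounded_weak_limit_subseq\<close>.\<close>
  note 1 = ce_sequence.subsequence[OF 0 k1(1)]
  obtain k2 g2 where k2: "strict_mono k2" "integrable (slab {0<..<T}) g2"
    "bounded_weak_limit (slab {0<..<T}) (\<lambda>n. J (Vs (k1 (k2 n)))) g2"
    using ce_sequence.flux_compactness[OF 1] unfolding J_def by blast
  note 2 = ce_sequence.subsequence[OF 1 k2(1)]
  obtain k3 where k3: "strict_mono k3" "\<And>A. A \<in> sets (slab {0..T}) \<Longrightarrow>
      convergent (\<lambda>n. time_integral {0..T} (\<lambda>t. measure (\<rho> (Vs (k1 (k2 (k3 n)))) t)) A)"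
    using ce_sequence.position_compactness[OF 2] unfolding \<rho>_def by blast
  note 3 = ce_sequence.subsequence[OF 2 k3(1)]
  define k where "k n = k1 (k2 (k3 n))" for n
  have k: "strict_mono k" using k1(1) k2(1) k3(1) by (simp add: k_def strict_mono_def)
  obtain \<rho>' where \<rho>': "narrow_curve T \<rho>'" "uniform_narrow_conv T (\<lambda>n. \<rho> (Vs (k n))) \<rho>'"
    "\<forall>t\<in>{0..T}. absolutely_continuous torus_lebesgue (\<rho>' t)"
    using ce_sequence.position_uniform_limit[OF 3 k3(2)[unfolded \<rho>_def]] unfolding \<rho>_def k_def by blast
  have lim1: "bounded_weak_limit (slab {0..T}) (\<lambda>n. \<omega> (Vs (k n))) g1"
    unfolding k_def using bounded_weak_limit_subseq[OF bounded_weak_limit_subseq[OF k1(3) k2(1)] k3(1)] .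
  have lim2: "bounded_weak_limit (slab {0<..<T}) (\<lambda>n. J (Vs (k n))) g2"
    unfolding k_def using bounded_weak_limit_subseq[OF k2(3) k3(1)] .
  obtain \<omega>' \<omega>t where \<omega>': "vector_measure (restrict_space borel ({0..T} \<times> UNIV)) \<omega>'"
    "signed_narrow_conv ({0..T} \<times> UNIV) (\<lambda>n. \<omega> (Vs (k n))) \<omega>'" "integrable_family {0..T} \<omega>t"
    "\<forall>A\<in>sets (restrict_space borel ({0..T} \<times> UNIV)). \<omega>' A = time_integral {0..T} \<omega>t A"
    using signed_narrow_limit[where \<mu>="\<lambda>n. \<omega> (Vs (k n))", OF _ k1(2) lim1] by auto
  obtain J' Jt where J': "vector_measure (restrict_space borel ({0<..<T} \<times> UNIV)) J'"
    "signed_narrow_conv ({0<..<T} \<times> UNIV) (\<lambda>n. J (Vs (k n))) J'" "integrable_family {0<..<T} Jt"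
    "\<forall>A\<in>sets (restrict_space borel ({0<..<T} \<times> UNIV)). J' A = time_integral {0<..<T} Jt A"
    using signed_narrow_limit[where \<mu>="\<lambda>n. J (Vs (k n))", OF _ k2(2) lim2] by auto
  show "\<exists>(k :: nat \<Rightarrow> nat) (\<rho>' :: real \<Rightarrow> torus measure)
      (\<omega>' :: (real \<times> torus) set \<Rightarrow> real) (J' :: (real \<times> torus) set \<Rightarrow> real).
      strict_mono k \<and>
      narrow_curve T \<rho>' \<and>
      uniform_narrow_conv T (\<lambda>n. \<rho> (Vs (k n))) \<rho>' \<and>
      vector_measure (restrict_space borel ({0..T} \<times> UNIV)) \<omega>' \<and>
      signed_narrow_conv ({0..T} \<times> UNIV) (\<lambda>n. \<omega> (Vs (k n))) \<omega>' \<and>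
      vector_measure (restrict_space borel ({0<..<T} \<times> UNIV)) J' \<and>
      signed_narrow_conv ({0<..<T} \<times> UNIV) (\<lambda>n. J (Vs (k n))) J' \<and>
      (\<forall>t\<in>{0..T}. absolutely_continuous torus_lebesgue (\<rho>' t)) \<and>
      (\<exists>\<omega>t :: real \<Rightarrow> torus set \<Rightarrow> real. integrable_family {0..T} \<omega>t \<and>
        (\<forall>A\<in>sets (restrict_space borel ({0..T} \<times> UNIV)). \<omega>' A = time_integral {0..T} \<omega>t A)) \<and>
      (\<exists>Jt :: real \<Rightarrow> torus set \<Rightarrow> real. integrable_family {0<..<T} Jt \<and>
        (\<forall>A\<in>sets (restrict_space borel ({0<..<T} \<times> UNIV)). J' A = time_integral {0<..<T} Jt A))"
    by (rule exI[of _ k], rule exI[of _ \<rho>'], rule exI[of _ \<omega>'], rule exI[of _ J'],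
        intro conjI k \<rho>' \<omega>' J' exI[of _ \<omega>t] exI[of _ Jt])
qed

end
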